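(* Let $1\le p<\infty$, let $\sigma\in L^\infty(X\times V)$, and let $k\in L^\infty\big(X, L^p(V_v,L^{p/(p-1)}(V_{v'}))\big)$ if $p>1$, and $k\in L^\infty(X\times V\times V)$ if $p=1$, where $X=Z_1\setminus\overline{Z_0}$. Then there exists $\varepsilon>0$ such that for any $(\beta,\gamma)\in L^p(\partial Z_0\times V,d\xi)\times L^p(\mathcal G_-(1,1-\varepsilon),d\xi)$ there exists a solution $u\in W^p(X\times V)$ of the linear Boltzmann transport equation $$v\cdot\nabla_x u(x,v)+\sigma(x,v)u(x,v)=\int_V k(x,v',v)u(x,v')\,dv',\quad (x,v)\in X\times V,$$ with boundary conditions $$u_{|\partial Z_0\times V}=\beta,\qquad u_{|\mathcal G_-(1,1-\varepsilon)}=\gamma .$$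
   Context: $d\ge 1$. $V$ is either a bounded open subset of $\mathbb R^d$ avoiding a neighbourhood of $0$, or a closed codimension-one surface in $\mathbb R^d$ not containing $0$ (e.g. the unit sphere); $dv$ is the canonical measure on $V$. $\rho\in C^2(\mathbb R^d)$ is such that $\mathrm{Hess}\,\rho(x)>0$ (positive definite) for $x\in\mathbb R^d\setminus\{0\}$, $\nabla\rho(0)=0$, $\rho(0)=-1$, and $|\rho(x)|\to\infty$ as $|x|\to\infty$. For $-1<s\le 1$, $Z_s=\{x\in\mathbb R^d : \rho(x)<s\}$, a bounded convex domain. $X=Z_1\setminus\overline{Z_0}$. For a domain $\Omega$ of class $C^1$ with outward unit normal $\nu$, $\Gamma_\pm(\Omega)=\{(x,v)\in\partial\Omega\times V : \pm v\cdot\nu(x)>0\}$, and $d\xi(x,v)=|\nu(x)\cdot v|\,d\mu(x)\,dv$ with $d\mu$ the surface measure on $\partial\Omega$. For $-1<s_1<s_2\le 1$, $$\mathcal G_-(s_2,s_1)=\{(x,v)\in\Gamma_-(Z_{s_2}) : (x+\mathbb R v)\cap Z_{s_1}=\emptyset\}.$$ For $(x,v)\in X\times V$ let $\tau_\pm(x,v)=\inf\{s>0 : x\pm sv\notin X\}$ and $\tau=\tau_-+\tau_+$. $W^p(X\times V)$ is the space of distributions $u$ with $\tau^{-1/p}u\in L^p(X\times V)$ and $\tau^{1-1/p}\,v\cdot\nabla_x u\in L^p(X\times V)$; such functions have traces in $L^p(\partial X\times V,d\xi)$. The space $L^\infty(X,L^p(V_v,L^{p/(p-1)}(V_{v'})))$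 is the set of measurable $k=k(x,v',v)$ with $\operatorname{ess\,sup}_{x\in X}\int_V\big(\int_V|k(x,v',v)|^{p/(p-1)}dv'\big)^{p-1}dv<\infty$. *)

theory Defs
  imports "HOL-Analysis.Analysis" "HOL-Probability.Essential_Supremum"
begin

section \<open>Hypersurfaces, outward normals and surface measure\<close>

definition C1_with_gradient :: "'a::euclidean_space set \<Rightarrow> ('a \<Rightarrow> real) \<Rightarrow> ('a \<Rightarrow> 'a) \<Rightarrow> bool" where
  "C1_with_gradient U g G \<longleftrightarrow> (\<forall>y\<in>U. GDERIV g y :> G y) \<and> continuous_on U G"

text \<open>A closed hypersurface is compact and without boundary; it is presented locally as a regular
  level set of a \<open>C\<^sup>1\<close> function.\<close>

definition closed_hypersurface :: "'a::euclidean_space set \<Rightarrow> bool" where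
  "closed_hypersurface S \<longleftrightarrow> compact S \<and>
     (\<forall>x\<in>S. \<exists>U g G. open U \<and> x \<in> U \<and> C1_with_gradient U g G \<and> G x \<noteq> 0 \<and>
        S \<inter> U = {y\<in>U. g y = 0})"

text \<open>At a boundary point near which \<open>\<Omega>\<close> is the sublevel set \<open>{g < 0}\<close> of a \<open>C\<^sup>1\<close> function with
  nonzero gradient, the outward unit normal is the normalised gradient of \<open>g\<close>; it does not depend
  on the choice of \<open>g\<close>. For \<open>C\<^sup>1\<close> domains every boundary point is of this kind.\<close>

definition outward_normal :: "'a::euclidean_space set \<Rightarrow> 'a \<Rightarrow> 'a" where
  "outward_normal \<Omega> x = (THE n. \<exists>U g G. open U \<and> x \<in> U \<and> C1_with_gradient U g G \<and>
      g x = 0 \<and> G x \<noteq> 0 \<and> \<Omega> \<inter> U = {y\<in>U. g y < 0} \<and> n = G x /\<^sub>R norm (G x))"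

text \<open>Hausdorff measure, normalised so as to agree with Lebesgue measure in dimension \<open>m\<close>.
  Empty pieces of a cover have to count \<open>0\<close> also for \<open>m = 0\<close>, where \<open>0 ^ 0 = 1\<close> in HOL; with this
  convention the case \<open>m = 0\<close> is counting measure. Since \<open>diameter\<close> is only meaningful for bounded
  sets, covers consist of bounded sets.\<close>

definition hausdorff_gauge :: "nat \<Rightarrow> 'a::metric_space set \<Rightarrow> real" where
  "hausdorff_gauge m C = (if C = {} then 0 else unit_ball_vol m * (diameter C / 2) ^ m)"

definition hausdorff_outer :: "nat \<Rightarrow> 'a::metric_space set \<Rightarrow> ennreal" where
  "hausdorff_outer m A =
     (SUP \<delta>\<in>{0<..}. INF C\<in>{C :: nat \<Rightarrow> 'a set. A \<subseteq> (\<Union>i. C i) \<and> (\<forall>i. bounded (C i) \<and> diameter (C i) \<le> \<delta>)}.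
        (\<Sum>i. ennreal (hausdorff_gauge m (C i))))"

definition hausdorff_measure :: "nat \<Rightarrow> 'a::metric_space measure" where
  "hausdorff_measure m = measure_of UNIV (sets borel) (hausdorff_outer m)"

definition surface_measure :: "'a::euclidean_space set \<Rightarrow> 'a measure" where
  "surface_measure S = restrict_space (hausdorff_measure (DIM('a) - 1)) S"

section \<open>Velocities and spatial domains\<close>

definition velocity_space :: "'a::euclidean_space set \<Rightarrow> 'a measure \<Rightarrow> bool" where
  "velocity_space V dv \<longleftrightarrow>
     (bounded V \<and> open V \<and> (\<exists>r>0. V \<inter> ball 0 r = {}) \<and> dv = restrict_space lborel V) \<or>
     (closed_hypersurface V \<and> 0 \<notin> V \<and> dv = surface_measure V)"

definition admissible_weight :: "('a::euclidean_space \<Rightarrow> real) \<Rightarrow> bool" where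
  "admissible_weight \<rho> \<longleftrightarrow>
     (\<exists>G (H :: 'a \<Rightarrow> 'a \<Rightarrow>\<^sub>L 'a).
        (\<forall>x. GDERIV \<rho> x :> G x) \<and>
        (\<forall>x. (G has_derivative blinfun_apply (H x)) (at x)) \<and> continuous_on UNIV H \<and>
        (\<forall>x. x \<noteq> 0 \<longrightarrow> (\<forall>h. h \<noteq> 0 \<longrightarrow> h \<bullet> blinfun_apply (H x) h > 0)) \<and>
        G 0 = 0) \<and>
     \<rho> 0 = -1 \<and> filterlim (\<lambda>x. \<bar>\<rho> x\<bar>) at_top at_infinity"

definition Z :: "('a::euclidean_space \<Rightarrow> real) \<Rightarrow> real \<Rightarrow> 'a set" where
  "Z \<rho> s = {x. \<rho> x < s}"

definition X_dom :: "('a::euclidean_space \<Rightarrow> real) \<Rightarrow> 'a set" where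
  "X_dom \<rho> = Z \<rho> 1 - closure (Z \<rho> 0)"

definition Gamma_minus :: "'a::euclidean_space set \<Rightarrow> 'a set \<Rightarrow> ('a \<times> 'a) set" where
  "Gamma_minus V \<Omega> = {(x, v). x \<in> frontier \<Omega> \<and> v \<in> V \<and> - (v \<bullet> outward_normal \<Omega> x) > 0}"

definition G_minus :: "('a::euclidean_space \<Rightarrow> real) \<Rightarrow> 'a set \<Rightarrow> real \<Rightarrow> real \<Rightarrow> ('a \<times> 'a) set" where
  "G_minus \<rho> V s2 s1 =
     {(x, v) \<in> Gamma_minus V (Z \<rho> s2). {x + t *\<^sub>R v |t. True} \<inter> Z \<rho> s1 = {}}"

definition xi_measure :: "'a::euclidean_space measure \<Rightarrow> 'a set \<Rightarrow> ('a \<times> 'a) measure" where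
  "xi_measure dv \<Omega> = density (surface_measure (frontier \<Omega>) \<Otimes>\<^sub>M dv)
     (\<lambda>(x, v). ennreal \<bar>outward_normal \<Omega> x \<bullet> v\<bar>)"

section \<open>Function spaces\<close>

abbreviation dx :: "'a::euclidean_space set \<Rightarrow> 'a measure" where
  "dx X \<equiv> restrict_space lborel X"

definition in_Lp :: "real \<Rightarrow> 'b measure \<Rightarrow> ('b \<Rightarrow> real) \<Rightarrow> bool" where
  "in_Lp p M f \<longleftrightarrow> f \<in> borel_measurable M \<and> integrable M (\<lambda>z. \<bar>f z\<bar> powr p)"

definition in_Linf :: "'b measure \<Rightarrow> ('b \<Rightarrow> real) \<Rightarrow> bool" where
  "in_Linf M f \<longleftrightarrow> f \<in> borel_measurable M \<and> esssup M (\<lambda>z. ennreal \<bar>f z\<bar>) < \<infinity>"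

text \<open>Real powers of extended nonnegative reals, for exponents \<open>r > 0\<close>.\<close>

definition ennpowr :: "ennreal \<Rightarrow> real \<Rightarrow> ennreal" where
  "ennpowr a r = (if a = \<infinity> then \<infinity> else ennreal (enn2real a powr r))"

definition in_Linf_Lp_Lq ::
  "real \<Rightarrow> 'a::euclidean_space set \<Rightarrow> 'a measure \<Rightarrow> ('a \<Rightarrow> 'a \<Rightarrow> 'a \<Rightarrow> real) \<Rightarrow> bool" where
  "in_Linf_Lp_Lq p X dv k \<longleftrightarrow>
     (\<lambda>(x, v', v). k x v' v) \<in> borel_measurable (dx X \<Otimes>\<^sub>M (dv \<Otimes>\<^sub>M dv)) \<and>
     esssup (dx X) (\<lambda>x. \<integral>\<^sup>+ v. ennpowr (\<integral>\<^sup>+ v'. ennreal (\<bar>k x v' v\<bar> powr (p / (p - 1))) \<partial>dv) (p - 1) \<partial>dv) < \<infinity>"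

definition tau_plus :: "'a::euclidean_space set \<Rightarrow> 'a \<Rightarrow> 'a \<Rightarrow> real" where
  "tau_plus X x v = Inf {s. s > 0 \<and> x + s *\<^sub>R v \<notin> X}"

definition tau_minus :: "'a::euclidean_space set \<Rightarrow> 'a \<Rightarrow> 'a \<Rightarrow> real" where
  "tau_minus X x v = Inf {s. s > 0 \<and> x - s *\<^sub>R v \<notin> X}"

definition tau :: "'a::euclidean_space set \<Rightarrow> 'a \<Rightarrow> 'a \<Rightarrow> real" where
  "tau X x v = tau_minus X x v + tau_plus X x v"

text \<open>Test functions on \<open>X \<times> V\<close> are compactly supported; \<open>\<Phi>\<close> is the gradient of \<open>\<phi>\<close> in the space
  variable. As \<open>v \<bullet> \<nabla>\<^sub>x\<close> differentiates in \<open>x\<close> only, no smoothness in \<open>v\<close> beyond continuity is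
  required, which treats open sets and hypersurfaces \<open>V\<close> alike and, by mollification, gives the
  same weak derivative as smooth test functions.\<close>

definition test_function ::
  "'a::euclidean_space set \<Rightarrow> 'a set \<Rightarrow> ('a \<times> 'a \<Rightarrow> real) \<Rightarrow> ('a \<times> 'a \<Rightarrow> 'a) \<Rightarrow> bool" where
  "test_function X V \<phi> \<Phi> \<longleftrightarrow>
     continuous_on (X \<times> V) \<phi> \<and> continuous_on (X \<times> V) \<Phi> \<and>
     (\<forall>x\<in>X. \<forall>v\<in>V. GDERIV (\<lambda>y. \<phi> (y, v)) x :> \<Phi> (x, v)) \<and>
     (\<exists>K. compact K \<and> K \<subseteq> X \<times> V \<and> (\<forall>z\<in>X \<times> V - K. \<phi> z = 0))"

definition locally_integrable ::
  "'a::euclidean_space set \<Rightarrow> 'a set \<Rightarrow> 'a measure \<Rightarrow> ('a \<times> 'a \<Rightarrow> real) \<Rightarrow> bool" where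
  "locally_integrable X V dv f \<longleftrightarrow> f \<in> borel_measurable (dx X \<Otimes>\<^sub>M dv) \<and>
     (\<forall>K. compact K \<and> K \<subseteq> X \<times> V \<longrightarrow> set_integrable (dx X \<Otimes>\<^sub>M dv) K f)"

text \<open>\<open>w = v \<bullet> \<nabla>\<^sub>x u\<close> in the sense of distributions.\<close>

definition transport_derivative ::
  "'a::euclidean_space set \<Rightarrow> 'a set \<Rightarrow> 'a measure \<Rightarrow> ('a \<times> 'a \<Rightarrow> real) \<Rightarrow> ('a \<times> 'a \<Rightarrow> real) \<Rightarrow> bool" where
  "transport_derivative X V dv u w \<longleftrightarrow>
     locally_integrable X V dv u \<and> locally_integrable X V dv w \<and>
     (\<forall>\<phi> \<Phi>. test_function X V \<phi> \<Phi> \<longrightarrow>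
        (\<integral>z. u z * (snd z \<bullet> \<Phi> z) \<partial>(dx X \<Otimes>\<^sub>M dv)) = - (\<integral>z. w z * \<phi> z \<partial>(dx X \<Otimes>\<^sub>M dv)))"

definition W_space ::
  "real \<Rightarrow> 'a::euclidean_space set \<Rightarrow> 'a set \<Rightarrow> 'a measure \<Rightarrow> ('a \<times> 'a \<Rightarrow> real) set" where
  "W_space p X V dv = {u.
     in_Lp p (dx X \<Otimes>\<^sub>M dv) (\<lambda>(x, v). tau X x v powr (- 1 / p) * u (x, v)) \<and>
     (\<exists>w. transport_derivative X V dv u w \<and>
        in_Lp p (dx X \<Otimes>\<^sub>M dv) (\<lambda>(x, v). tau X x v powr (1 - 1 / p) * w (x, v)))}"

text \<open>Elements of the Sobolev space have representatives that are absolutely continuous along almost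
  every characteristic line \<open>t \<mapsto> (x + t v, v)\<close>, and the trace at a boundary point is the limit along
  the line through it, taken from inside \<open>X\<close> (\<open>t \<down> 0\<close> at incoming, \<open>t \<up> 0\<close> at outgoing points; the
  remaining, grazing, points are null for \<open>\<xi>\<close>). Since any two representatives agree almost
  everywhere on \<open>\<xi>\<close>-almost every line, all representatives for which these limits exist give the
  same trace up to \<open>\<xi>\<close>-null sets. The argument \<open>\<xi>\<close> is the measure \<open>d\<xi>\<close> on the part of the boundary
  under consideration.\<close>

definition has_trace ::
  "'a::euclidean_space set \<Rightarrow> 'a measure \<Rightarrow> ('a \<times> 'a) measure \<Rightarrow> ('a \<times> 'a \<Rightarrow> real) \<Rightarrow> ('a \<times> 'a \<Rightarrow> real) \<Rightarrow> bool" where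
  "has_trace X dv \<xi> u g \<longleftrightarrow>
     (\<exists>u'. (AE z in dx X \<Otimes>\<^sub>M dv. u' z = u z) \<and>
        (AE (x, v) in \<xi>.
           ((\<lambda>t. u' (x + t *\<^sub>R v, v)) \<longlongrightarrow> g (x, v)) (at 0 within {t. x + t *\<^sub>R v \<in> X})))"

definition solves_boltzmann ::
  "'a::euclidean_space set \<Rightarrow> 'a set \<Rightarrow> 'a measure \<Rightarrow> ('a \<times> 'a \<Rightarrow> real) \<Rightarrow> ('a \<Rightarrow> 'a \<Rightarrow> 'a \<Rightarrow> real)
     \<Rightarrow> ('a \<times> 'a \<Rightarrow> real) \<Rightarrow> bool" where
  "solves_boltzmann X V dv \<sigma> k u \<longleftrightarrow>
     (\<exists>w. transport_derivative X V dv u w \<and>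
        (AE (x, v) in dx X \<Otimes>\<^sub>M dv.
           integrable dv (\<lambda>v'. k x v' v * u (x, v')) \<and>
           w (x, v) + \<sigma> (x, v) * u (x, v) = (\<integral>v'. k x v' v * u (x, v') \<partial>dv)))"

end

theory Submission
  imports Defs
begin

text \<open>On a line \<open>x + \<real> v\<close> the weight \<open>\<rho>\<close> is strictly convex, with minimum \<open>m\<close>. If \<open>m < 0\<close>, each of the two
  chords in \<open>X\<close> has an end on \<open>\<partial>Z\<^sub>0\<close>, where \<open>\<beta>\<close> is given; if \<open>m \<ge> 1 - \<epsilon>\<close>, the chord has length
  \<open>O(\<surd>\<epsilon>)\<close> and \<open>\<gamma>\<close> is given at its entry point; on the other lines nothing is given, and \<open>u = 0\<close> is
  imposed at the minimum of \<open>\<rho>\<close>. Integrating from these base points turns the equation into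
  \<open>u = J + A q\<close>, \<open>q = K u - \<sigma> u\<close>, where \<open>K\<close> is the collision operator. Away from the base point \<open>\<rho>\<close>
  increases at least quadratically, except on the short chords. Hence after conjugation with
  \<open>exp (- \<lambda> \<rho>)\<close> the operator \<open>A\<close> has a convolution kernel dominated by
  \<open>exp (- c \<lambda> s\<^sup>2) + exp \<lambda> * 1(|s| \<le> C \<surd>\<epsilon>)\<close>, whose integral is small for \<open>\<lambda>\<close> large and then \<open>\<epsilon>\<close>
  small, and the Neumann series converges.

  The boundary terms compare the Hausdorff measure of a piece of \<open>\<partial>X\<close> with the volume of the tube
  that it sweeps out in direction \<open>v\<close>. In one direction, slab coverings show that
  \<open>\<integral> |J|\<^sup>p / \<tau>\<close> is bounded by the \<open>d\<xi>\<close>-norms of the data; in the other, boundary points whose lines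
  lie in a null set form a null set, which gives the traces.\<close>

section \<open>Hausdorff measure on Borel sets\<close>

text \<open>No sign or smallness is assumed of \<open>\<sigma>\<close> and \<open>k\<close>, so
  contraction must come from transport alone. It does because integration runs uphill: points
  between a base point and \<open>z\<close> have smaller \<open>\<rho>\<close> than
  \<open>z\<close>, and the weight damps what is carried over a positive distance. On lines without
  data the minimum is the only start from which both halves run uphill. Data at the entry of a chord
  force a downhill stretch, which costs up to \<open>exp lam\<close>; shortness of the chord pays
  for it, which is where the restriction of outer data to lines near the outer boundary enters.

  Surface and volume are compared only up to constants, so ball packings and slab coverings replace
  an area formula. Grazing directions are the obstacle: for the norm of the data the constant must
  not depend on the angle, whence dyadic layers in \<open>|n \<bullet> v|\<close>; for null sets it
  may blow up, since it multiplies volume 0.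

  Traces are limits along single lines, so \<open>u\<close> is defined on every line from an
  integral of \<open>q\<close>, and lines on which that integral diverges are followed to the
  boundary and shown negligible there.\<close>

definition hausdorff_pre :: "nat \<Rightarrow> real \<Rightarrow> 'a::metric_space set \<Rightarrow> ennreal" where
  "hausdorff_pre m \<delta> A =
     (INF C\<in>{C :: nat \<Rightarrow> 'a set. A \<subseteq> (\<Union>i. C i) \<and> (\<forall>i. bounded (C i) \<and> diameter (C i) \<le> \<delta>)}.
        (\<Sum>i. ennreal (hausdorff_gauge m (C i))))"

lemma hausdorff_outer_eq: "hausdorff_outer m A = (SUP \<delta>\<in>{0<..}. hausdorff_pre m \<delta> A)"
  by (simp add: hausdorff_outer_def hausdorff_pre_def)

lemma hausdorff_gauge_nonneg: "0 \<le> hausdorff_gauge m C" if "bounded C"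
  using that by (auto simp: hausdorff_gauge_def intro!: mult_nonneg_nonneg zero_le_power diameter_ge_0)

lemma hausdorff_pre_le:
  assumes "A \<subseteq> (\<Union>i. C i)" "\<And>i::nat. bounded (C i)" "\<And>i. diameter (C i) \<le> \<delta>"
  shows "hausdorff_pre m \<delta> A \<le> (\<Sum>i. ennreal (hausdorff_gauge m (C i)))"
  unfolding hausdorff_pre_def using assms by (auto intro!: INF_lower)

lemma hausdorff_preE:
  assumes "hausdorff_pre m \<delta> A < c"
  obtains C :: "nat \<Rightarrow> 'a::metric_space set" where "A \<subseteq> (\<Union>i. C i)" "\<And>i. bounded (C i)" "\<And>i. diameter (C i) \<le> \<delta>"
    "(\<Sum>i. ennreal (hausdorff_gauge m (C i))) < c"
  using assms unfolding hausdorff_pre_def by (auto simp: INF_less_iff)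

lemma hausdorff_pre_empty: "0 < \<delta> \<Longrightarrow> hausdorff_pre m \<delta> {} = 0"
  using hausdorff_pre_le[of "{}" "\<lambda>_. {}" \<delta> m] by (simp add: hausdorff_gauge_def)

lemma hausdorff_pre_mono: "A \<subseteq> B \<Longrightarrow> hausdorff_pre m \<delta> A \<le> hausdorff_pre m \<delta> B"
  unfolding hausdorff_pre_def by (rule INF_superset_mono) auto

lemma hausdorff_pre_antimono: "\<delta> \<le> \<delta>' \<Longrightarrow> hausdorff_pre m \<delta>' A \<le> hausdorff_pre m \<delta> A"
  unfolding hausdorff_pre_def by (rule INF_superset_mono) (auto intro: order_trans)

lemma hausdorff_pre_le_outer: "0 < \<delta> \<Longrightarrow> hausdorff_pre m \<delta> A \<le> hausdorff_outer m A"
  unfolding hausdorff_outer_eq by (auto intro!: SUP_upper)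

lemma hausdorff_outer_leI:
  assumes "\<And>\<delta>. 0 < \<delta> \<Longrightarrow> hausdorff_pre m \<delta> A \<le> c"
  shows "hausdorff_outer m A \<le> c"
  unfolding hausdorff_outer_eq using assms by (auto intro!: SUP_least)

lemma hausdorff_outer_empty: "hausdorff_outer m {} = 0"
  using hausdorff_outer_leI[of m "{}" 0] by (simp add: hausdorff_pre_empty)

lemma hausdorff_outer_mono: "A \<subseteq> B \<Longrightarrow> hausdorff_outer m A \<le> hausdorff_outer m B"
  by (meson hausdorff_outer_leI hausdorff_pre_le_outer hausdorff_pre_mono order_trans)

lemma hausdorff_pre_countably_subadditive:
  fixes A :: "nat \<Rightarrow> 'a::metric_space set"
  assumes "0 < \<delta>"
  shows "hausdorff_pre m \<delta> (\<Union>i. A i) \<le> (\<Sum>i. hausdorff_pre m \<delta> (A i))"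
proof (rule ennreal_le_epsilon)
  fix e :: real
  assume fin: "(\<Sum>i. hausdorff_pre m \<delta> (A i)) < top" and "0 < e"
  have "hausdorff_pre m \<delta> (A i) < top" for i
    using fin ennreal_suminf_lessD by blast
  then have "hausdorff_pre m \<delta> (A i) < hausdorff_pre m \<delta> (A i) + ennreal (e * (1/2) ^ Suc i)" for i
    using \<open>0 < e\<close> by (auto simp: ennreal_add_left_cancel_less less_top[symmetric] ennreal_zero_less_mult_iff
      intro!: ennreal_lessI[of _ 0, simplified])
  then have "\<exists>C. A i \<subseteq> (\<Union>j. C j) \<and> (\<forall>j::nat. bounded (C j) \<and> diameter (C j) \<le> \<delta>) \<and>
     (\<Sum>j. ennreal (hausdorff_gauge m (C j))) < hausdorff_pre m \<delta> (A i) + ennreal (e * (1/2) ^ Suc i)" for i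
    by (metis hausdorff_preE)
  then obtain C where C: "\<And>i. A i \<subseteq> (\<Union>j. C i j)" "\<And>i j::nat. bounded (C i j)" "\<And>i j. diameter (C i j) \<le> \<delta>"
     "\<And>i. (\<Sum>j. ennreal (hausdorff_gauge m (C i j))) < hausdorff_pre m \<delta> (A i) + ennreal (e * (1/2) ^ Suc i)"
    by metis
  \<comment> \<open>The definition asks for covers indexed by \<open>nat\<close>, so the double
    family is enumerated through the pairing function.\<close>
  define D where "D n = (case prod_decode n of (i, j) \<Rightarrow> C i j)" for n
  have "hausdorff_pre m \<delta> (\<Union>i. A i) \<le> (\<Sum>n. ennreal (hausdorff_gauge m (D n)))"
  proof (rule hausdorff_pre_le)
    show "(\<Union>i. A i) \<subseteq> (\<Union>n. D n)"
    proof
      fix x assume "x \<in> (\<Union>i. A i)"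
      then obtain i j where "x \<in> C i j" using C(1) by blast
      then have "x \<in> D (prod_encode (i, j))" by (simp add: D_def)
      then show "x \<in> (\<Union>n. D n)" by blast
    qed
  qed (auto simp: D_def C split: prod.split)
  also have "(\<lambda>n. ennreal (hausdorff_gauge m (D n))) = (\<lambda>(i, j). ennreal (hausdorff_gauge m (C i j))) \<circ> prod_decode"
    by (auto simp: D_def fun_eq_iff split: prod.split)
  also have "(\<Sum>n. ((\<lambda>(i, j). ennreal (hausdorff_gauge m (C i j))) \<circ> prod_decode) n) = (\<Sum>i. \<Sum>j. ennreal (hausdorff_gauge m (C i j)))"
    unfolding comp_def by (rule suminf_ennreal_2dimen[where f="\<lambda>(i, j). ennreal (hausdorff_gauge m (C i j))"]) simp
  also have "\<dots> \<le> (\<Sum>i. hausdorff_pre m \<delta> (A i) + ennreal (e * (1/2) ^ Suc i))"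
    by (intro suminf_le less_imp_le C) auto
  also have "\<dots> = (\<Sum>i. hausdorff_pre m \<delta> (A i)) + (\<Sum>i. ennreal (e * (1/2) ^ Suc i))"
    by (rule suminf_add[symmetric]) auto
  also have "(\<Sum>i. ennreal (e * (1/2) ^ Suc i)) = ennreal e"
    using sums_mult[OF power_half_series, of e] \<open>0 < e\<close>
    by (intro suminf_ennreal_eq) auto
  finally show "hausdorff_pre m \<delta> (\<Union>i. A i) \<le> (\<Sum>i. hausdorff_pre m \<delta> (A i)) + ennreal e" .
qed

lemma hausdorff_outer_countably_subadditive:
  "hausdorff_outer m (\<Union>i. A i) \<le> (\<Sum>i::nat. hausdorff_outer m (A i))"
proof (rule hausdorff_outer_leI)
  fix \<delta> :: real assume "0 < \<delta>"
  then have "hausdorff_pre m \<delta> (\<Union>i. A i) \<le> (\<Sum>i. hausdorff_pre m \<delta> (A i))"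
    by (rule hausdorff_pre_countably_subadditive)
  also have "\<dots> \<le> (\<Sum>i. hausdorff_outer m (A i))"
    using \<open>0 < \<delta>\<close> by (intro suminf_le hausdorff_pre_le_outer) auto
  finally show "hausdorff_pre m \<delta> (\<Union>i. A i) \<le> (\<Sum>i. hausdorff_outer m (A i))" .
qed

lemma outer_measure_space_hausdorff: "outer_measure_space (Pow UNIV) (hausdorff_outer m)"
  unfolding outer_measure_space_def positive_def increasing_def countably_subadditive_def
  by (auto simp: hausdorff_outer_empty hausdorff_outer_mono hausdorff_outer_countably_subadditive)

lemma hausdorff_outer_Un: "hausdorff_outer m (A \<union> B) \<le> hausdorff_outer m A + hausdorff_outer m B"
proof -
  have "A \<union> B \<subseteq> (\<Union>i::nat. if i = 0 then A else if i = 1 then B else {})"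
    by (force intro: exI[of _ "0::nat"] exI[of _ "1::nat"])
  then have "hausdorff_outer m (A \<union> B) \<le> hausdorff_outer m (\<Union>i::nat. if i = 0 then A else if i = 1 then B else {})"
    by (rule hausdorff_outer_mono)
  also have "\<dots> \<le> (\<Sum>i::nat. hausdorff_outer m (if i = 0 then A else if i = 1 then B else {}))"
    by (rule hausdorff_outer_countably_subadditive)
  also have "\<dots> = (\<Sum>i\<in>{0,1::nat}. hausdorff_outer m (if i = 0 then A else if i = 1 then B else {}))"
    by (rule suminf_finite) (auto simp: hausdorff_outer_empty)
  finally show ?thesis by simp
qed

text \<open>A set of diameter below \<open>d\<close> cannot meet both \<open>A\<close> and
  \<open>B\<close>, so every sufficiently fine cover of the union splits into a cover of
  \<open>A\<close> and one of \<open>B\<close>. This is the defining property of a metric outer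
  measure.\<close>

lemma hausdorff_outer_separated:
  assumes "0 < d" and sep: "\<And>a b. a \<in> A \<Longrightarrow> b \<in> B \<Longrightarrow> d \<le> dist a b"
  shows "hausdorff_outer m A + hausdorff_outer m B \<le> hausdorff_outer m (A \<union> B)"
proof -
  have pre: "hausdorff_pre m \<delta> A + hausdorff_pre m \<delta> B \<le> hausdorff_pre m \<delta> (A \<union> B)" if "0 < \<delta>" "\<delta> < d" for \<delta>
    unfolding hausdorff_pre_def[of m \<delta> "A \<union> B"]
  proof (rule INF_greatest, clarify)
    fix C :: "nat \<Rightarrow> 'a set"
    assume C: "A \<union> B \<subseteq> (\<Union>i. C i)" "\<forall>i. bounded (C i) \<and> diameter (C i) \<le> \<delta>"
    \<comment> \<open>Discarded members are replaced by the empty set, whose gauge is 0 in every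
      dimension, including \<open>m = 0\<close>.\<close>
    define CA where "CA i = (if C i \<inter> A = {} then {} else C i)" for i
    define CB where "CB i = (if C i \<inter> B = {} then {} else C i)" for i
    have disj: "CA i = {} \<or> CB i = {}" for i
    proof (rule ccontr)
      assume "\<not> (CA i = {} \<or> CB i = {})"
      then obtain a b where "a \<in> A" "b \<in> B" "a \<in> C i" "b \<in> C i"
        by (auto simp: CA_def CB_def split: if_splits)
      then have "dist a b \<le> \<delta>" using C(2) diameter_bounded_bound[of "C i" a b] by (meson order_trans)
      with sep[OF \<open>a \<in> A\<close> \<open>b \<in> B\<close>] that show False by simp
    qed
    then have g: "ennreal (hausdorff_gauge m (CA i)) + ennreal (hausdorff_gauge m (CB i)) \<le> ennreal (hausdorff_gauge m (C i))" for i
    proof (cases "CA i = {}")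
      case True
      then show ?thesis by (simp add: hausdorff_gauge_def CB_def)
    next
      case False
      then have "CB i = {}" using disj[of i] by simp
      then show ?thesis by (simp add: hausdorff_gauge_def CA_def)
    qed
    have "hausdorff_pre m \<delta> A \<le> (\<Sum>i. ennreal (hausdorff_gauge m (CA i)))"
    proof (rule hausdorff_pre_le)
      show "A \<subseteq> (\<Union>i. CA i)" using C(1) by (force simp: CA_def)
    qed (use C \<open>0 < \<delta>\<close> in \<open>auto simp: CA_def\<close>)
    moreover have "hausdorff_pre m \<delta> B \<le> (\<Sum>i. ennreal (hausdorff_gauge m (CB i)))"
    proof (rule hausdorff_pre_le)
      show "B \<subseteq> (\<Union>i. CB i)" using C(1) by (force simp: CB_def)
    qed (use C \<open>0 < \<delta>\<close> in \<open>auto simp: CB_def\<close>)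
    ultimately have "hausdorff_pre m \<delta> A + hausdorff_pre m \<delta> B
        \<le> (\<Sum>i. ennreal (hausdorff_gauge m (CA i))) + (\<Sum>i. ennreal (hausdorff_gauge m (CB i)))"
      by (rule add_mono)
    also have "\<dots> = (\<Sum>i. ennreal (hausdorff_gauge m (CA i)) + ennreal (hausdorff_gauge m (CB i)))"
      by (rule suminf_add) auto
    also have "\<dots> \<le> (\<Sum>i. ennreal (hausdorff_gauge m (C i)))"
      by (intro suminf_le g) auto
    finally show "hausdorff_pre m \<delta> A + hausdorff_pre m \<delta> B \<le> (\<Sum>i. ennreal (hausdorff_gauge m (C i)))" .
  qed
  have *: "hausdorff_pre m \<delta>1 A + hausdorff_pre m \<delta>2 B \<le> hausdorff_outer m (A \<union> B)" if "0 < \<delta>1" "0 < \<delta>2" for \<delta>1 \<delta>2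
  proof -
    define \<delta> where "\<delta> = min (min \<delta>1 \<delta>2) (d / 2)"
    have \<delta>: "0 < \<delta>" "\<delta> < d" "\<delta> \<le> \<delta>1" "\<delta> \<le> \<delta>2" using that \<open>0 < d\<close> by (auto simp: \<delta>_def)
    have "hausdorff_pre m \<delta>1 A + hausdorff_pre m \<delta>2 B \<le> hausdorff_pre m \<delta> A + hausdorff_pre m \<delta> B"
      using \<delta> by (intro add_mono hausdorff_pre_antimono)
    also note pre[OF \<delta>(1,2)]
    also note hausdorff_pre_le_outer[OF \<delta>(1)]
    finally show ?thesis .
  qed
  have ne: "{0::real<..} \<noteq> {}" using zero_less_one by blast
  have "hausdorff_pre m \<delta> A + hausdorff_outer m B \<le> hausdorff_outer m (A \<union> B)" if "0 < \<delta>" for \<delta>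
    unfolding hausdorff_outer_eq[of m B] add.commute[of "hausdorff_pre m \<delta> A"] ennreal_SUP_add_left[OF ne, symmetric]
    using *[OF that] by (intro SUP_least) (simp add: add.commute[of "hausdorff_pre m _ B"])
  then show ?thesis
    unfolding hausdorff_outer_eq[of m A] ennreal_SUP_add_left[OF ne, symmetric]
    by (intro SUP_least) auto
qed

lemma hausdorff_outer_separated_sum:
  assumes "finite I" and sep: "\<And>i j. i \<in> I \<Longrightarrow> j \<in> I \<Longrightarrow> i \<noteq> j \<Longrightarrow> \<exists>d>0. \<forall>a\<in>R i. \<forall>b\<in>R j. d \<le> dist a b"
  shows "(\<Sum>i\<in>I. hausdorff_outer m (R i)) \<le> hausdorff_outer m (\<Union>i\<in>I. R i)"
  using assms
proof (induction I rule: finite_induct)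
  case (insert i I)
  have "\<forall>j\<in>I. \<exists>d>0. \<forall>a\<in>R i. \<forall>b\<in>R j. d \<le> dist a b"
    using insert by (metis insert_iff)
  then obtain d where d: "\<And>j. j \<in> I \<Longrightarrow> d j > 0" "\<And>j a b. j \<in> I \<Longrightarrow> a \<in> R i \<Longrightarrow> b \<in> R j \<Longrightarrow> d j \<le> dist a b"
    by metis
  define d' where "d' = Min (insert 1 (d ` I))"
  have "0 < d'" using d(1) insert(1) by (auto simp: d'_def)
  have "d' \<le> dist a b" if "a \<in> R i" "b \<in> (\<Union>j\<in>I. R j)" for a b
  proof -
    from that obtain j where j: "j \<in> I" "b \<in> R j" by blast
    have "d' \<le> d j" unfolding d'_def using j insert(1) by (intro Min_le) auto
    with d(2)[OF j(1) that(1) j(2)] show ?thesis by simp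
  qed
  then have sep: "\<And>a b. a \<in> R i \<Longrightarrow> b \<in> (\<Union>j\<in>I. R j) \<Longrightarrow> d' \<le> dist a b" by blast
  have "hausdorff_outer m (R i) + hausdorff_outer m (\<Union>j\<in>I. R j) \<le> hausdorff_outer m (\<Union>j\<in>insert i I. R j)"
    using hausdorff_outer_separated[where m=m and A="R i" and B="\<Union>j\<in>I. R j", OF \<open>0 < d'\<close>] sep by simp
  moreover have "(\<Sum>j\<in>I. hausdorff_outer m (R j)) \<le> hausdorff_outer m (\<Union>j\<in>I. R j)"
    using insert by (metis insert_iff)
  ultimately show ?case using insert(1,2) by (simp) (meson add_left_mono order_trans)
qed (simp add: hausdorff_outer_empty)

text \<open>Caratheodory's criterion for metric outer measures. The part of \<open>A\<close> outside
  \<open>C\<close> is exhausted by the sets \<open>B n\<close> at distance at least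
  \<open>1 / (n + 1)\<close> from \<open>C\<close>, for which additivity is the separated case; what
  is missed is covered by the shells \<open>R i\<close> with \<open>i \<ge> n\<close>, and their
  measures form the tail of a convergent series.\<close>

lemma closed_in_lambda_system:
  fixes C :: "'a::metric_space set"
  assumes "closed C"
  shows "C \<in> lambda_system UNIV (Pow UNIV) (hausdorff_outer m)"
proof -
  have "hausdorff_outer m (C \<inter> A) + hausdorff_outer m (A - C) = hausdorff_outer m A" for A
  proof (cases "C = {} \<or> hausdorff_outer m A = \<infinity>")
    case True
    then show ?thesis
    proof
      assume "hausdorff_outer m A = \<infinity>"
      moreover have "hausdorff_outer m A \<le> hausdorff_outer m (C \<inter> A) + hausdorff_outer m (A - C)"
        using hausdorff_outer_Un[of m "C \<inter> A" "A - C"] by (simp add: Un_Diff_Int Int_commute Un_commute)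
      ultimately show ?thesis by (simp add: top_unique)
    qed (simp add: hausdorff_outer_empty)
  next
    case False
    then have ne: "C \<noteq> {}" and fin: "hausdorff_outer m A < \<infinity>" by (auto simp: less_top)
    define f where "f x = infdist x C" for x
    have lip: "f x - f y \<le> dist x y" for x y
      using infdist_triangle[of x C y] by (simp add: f_def)
    define B where "B n = {x\<in>A. f x \<ge> 1 / real (Suc n)}" for n :: nat
    define R where "R n = B (Suc n) - B n" for n
    have Bmono: "B n \<subseteq> B (Suc n)" for n
    proof -
      have "1 / real (Suc (Suc n)) \<le> 1 / real (Suc n)" by (simp add: field_simps)
      then show ?thesis by (auto simp: B_def intro: order_trans)
    qed
    then have Bmono': "n \<le> k \<Longrightarrow> B n \<subseteq> B k" for n k by (rule lift_Suc_mono_le)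
    have step1: "hausdorff_outer m (C \<inter> A) + hausdorff_outer m (B n) \<le> hausdorff_outer m A" for n
    proof -
      have "hausdorff_outer m (C \<inter> A) + hausdorff_outer m (B n) \<le> hausdorff_outer m ((C \<inter> A) \<union> B n)"
      proof (rule hausdorff_outer_separated)
        fix a b assume "a \<in> C \<inter> A" "b \<in> B n"
        then show "1 / real (Suc n) \<le> dist a b"
          using infdist_le[of a C b] by (auto simp: B_def f_def dist_commute)
      qed simp
      also have "\<dots> \<le> hausdorff_outer m A" by (rule hausdorff_outer_mono) (auto simp: B_def)
      finally show ?thesis .
    qed
    \<comment> \<open>Shells whose indices differ by at least two have positive distance,
      neighbouring shells need not. For this reason the sum over all shells is split below into even
      and odd indices, each of which is bounded by the measure of \<open>A\<close>.\<close>
    have Rsep: "\<exists>d>0. \<forall>a\<in>R i. \<forall>b\<in>R j. d \<le> dist a b" if "Suc (Suc i) \<le> j" for i j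
    proof (intro exI conjI ballI)
      show "0 < 1 / real (Suc (Suc i)) - 1 / real (Suc (Suc (Suc i)))"
        by (simp add: divide_strict_left_mono del: of_nat_Suc)
      fix a b assume "a \<in> R i" "b \<in> R j"
      then have "f a \<ge> 1 / real (Suc (Suc i))" by (auto simp: R_def B_def)
      moreover have "b \<in> A" "b \<notin> B j" using \<open>b \<in> R j\<close> by (auto simp: R_def B_def)
      then have "f b < 1 / real (Suc j)" by (auto simp: B_def)
      moreover have "1 / real (Suc j) \<le> 1 / real (Suc (Suc (Suc i)))" using that by (intro divide_left_mono) auto
      ultimately show "1 / real (Suc (Suc i)) - 1 / real (Suc (Suc (Suc i))) \<le> dist a b" using lip[of a b] by linarith
    qed
    have Rsep': "\<exists>d>0. \<forall>a\<in>R i. \<forall>b\<in>R j. d \<le> dist a b" if "Suc (Suc i) \<le> j \<or> Suc (Suc j) \<le> i" for i j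
      using that Rsep[of i j] Rsep[of j i] by (metis dist_commute)
    have RA: "R i \<subseteq> A" for i by (auto simp: R_def B_def)
    have par: "(\<Sum>i<n. hausdorff_outer m (R (2 * i + p))) \<le> hausdorff_outer m A" for n p
    proof -
      have "(\<Sum>i<n. hausdorff_outer m (R (2 * i + p))) \<le> hausdorff_outer m (\<Union>i<n. R (2 * i + p))"
        by (intro hausdorff_outer_separated_sum Rsep') auto
      also have "\<dots> \<le> hausdorff_outer m A" using RA by (intro hausdorff_outer_mono) auto
      finally show ?thesis .
    qed
    have sumR: "(\<Sum>i. hausdorff_outer m (R i)) \<le> hausdorff_outer m A + hausdorff_outer m A"
    proof (rule suminf_le_const)
      fix n :: nat
      have "(\<Sum>i<n. hausdorff_outer m (R i)) \<le> (\<Sum>i<2*n. hausdorff_outer m (R i))"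
        by (intro sum_mono2) auto
      also have "\<dots> = (\<Sum>i<n. hausdorff_outer m (R (2 * i + 0))) + (\<Sum>i<n. hausdorff_outer m (R (2 * i + 1)))"
        by (induction n) (auto simp: algebra_simps)
      also have "\<dots> \<le> hausdorff_outer m A + hausdorff_outer m A" by (intro add_mono par)
      finally show "(\<Sum>i<n. hausdorff_outer m (R i)) \<le> hausdorff_outer m A + hausdorff_outer m A" .
    qed auto
    then have Rfin: "(\<Sum>i. hausdorff_outer m (R i)) \<noteq> \<infinity>" using fin by (auto simp: top_unique)
    have cover: "A - C \<subseteq> B n \<union> (\<Union>i. R (i + n))" for n
    proof
      fix x assume x: "x \<in> A - C"
      then have "f x > 0" using assms ne by (auto simp: f_def infdist_pos_not_in_closed)
      then obtain k where "1 / real (Suc k) < f x" using nat_approx_posE by metis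
      then have ex: "\<exists>k. x \<in> B k" using x by (auto simp: B_def intro!: exI[of _ k])
      define k where "k = (LEAST k. x \<in> B k)"
      have k: "x \<in> B k" using ex unfolding k_def by (rule LeastI_ex)
      show "x \<in> B n \<union> (\<Union>i. R (i + n))"
      proof (cases "k \<le> n")
        case True then show ?thesis using k Bmono' by blast
      next
        case False
        then have "x \<notin> B (k - 1)" using not_less_Least[of "k - 1" "\<lambda>k. x \<in> B k"] by (auto simp: k_def)
        then have "x \<in> R (k - 1)" using k False by (auto simp: R_def)
        moreover have "k - 1 = (k - 1 - n) + n" using False by simp
        ultimately show ?thesis by (metis UN_I UNIV_I UnI2)
      qed
    qed
    have step2: "hausdorff_outer m (A - C) \<le> hausdorff_outer m (B n) + (\<Sum>i. hausdorff_outer m (R (i + n)))" for n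
    proof -
      have "hausdorff_outer m (A - C) \<le> hausdorff_outer m (B n \<union> (\<Union>i. R (i + n)))"
        using cover by (rule hausdorff_outer_mono)
      also have "\<dots> \<le> hausdorff_outer m (B n) + hausdorff_outer m (\<Union>i. R (i + n))" by (rule hausdorff_outer_Un)
      also have "\<dots> \<le> hausdorff_outer m (B n) + (\<Sum>i. hausdorff_outer m (R (i + n)))"
        by (intro add_left_mono hausdorff_outer_countably_subadditive)
      finally show ?thesis .
    qed
    have lim: "(\<lambda>n. \<Sum>i. hausdorff_outer m (R (i + n))) \<longlonglongrightarrow> 0"
    proof -
      have fi: "hausdorff_outer m (R i) < top" for i
        using Rfin ennreal_suminf_lessD[of "\<lambda>i. hausdorff_outer m (R i)"] by (simp add: less_top)
      define r where "r i = enn2real (hausdorff_outer m (R i))" for i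
      have r: "hausdorff_outer m (R i) = ennreal (r i)" "0 \<le> r i" for i using fi by (auto simp: r_def)
      have sr: "summable r" using Rfin r by (intro summable_suminf_not_top) auto
      have "(\<Sum>i. hausdorff_outer m (R (i + n))) = ennreal (\<Sum>i. r (i + n))" for n
        using r sr by (simp add: suminf_ennreal2 summable_ignore_initial_segment)
      moreover have "(\<lambda>n. \<Sum>i. r (i + n)) \<longlonglongrightarrow> 0" by (rule suminf_exist_split2[OF sr])
      ultimately show ?thesis by (simp flip: ennreal_0)
    qed
    have "hausdorff_outer m (C \<inter> A) + hausdorff_outer m (A - C) \<le> hausdorff_outer m A"
    proof (rule LIMSEQ_le_const)
      show "(\<lambda>n. hausdorff_outer m A + (\<Sum>i. hausdorff_outer m (R (i + n)))) \<longlonglongrightarrow> hausdorff_outer m A"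
        using tendsto_add[OF tendsto_const lim, of "hausdorff_outer m A"] by simp
      have "hausdorff_outer m (C \<inter> A) + hausdorff_outer m (A - C) \<le> hausdorff_outer m A + (\<Sum>i. hausdorff_outer m (R (i + n)))" for n
      proof -
        have "hausdorff_outer m (C \<inter> A) + hausdorff_outer m (A - C) \<le>
          hausdorff_outer m (C \<inter> A) + (hausdorff_outer m (B n) + (\<Sum>i. hausdorff_outer m (R (i + n))))"
          by (intro add_left_mono step2)
        also have "\<dots> \<le> hausdorff_outer m A + (\<Sum>i. hausdorff_outer m (R (i + n)))"
          using add_right_mono[OF step1] by (simp add: add.assoc)
        finally show ?thesis .
      qed
      then show "\<exists>N. \<forall>n\<ge>N. hausdorff_outer m (C \<inter> A) + hausdorff_outer m (A - C) \<le> hausdorff_outer m A + (\<Sum>i. hausdorff_outer m (R (i + n)))"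
        by blast
    qed
    moreover have "hausdorff_outer m A \<le> hausdorff_outer m (C \<inter> A) + hausdorff_outer m (A - C)"
      using hausdorff_outer_Un[of m "C \<inter> A" "A - C"] by (simp add: Un_Diff_Int Int_commute Un_commute)
    ultimately show ?thesis by (rule antisym)
  qed
  then show ?thesis by (simp add: lambda_system_def Diff_eq Int_commute)
qed

text \<open>\<open>measure_of\<close> returns the zero measure unless its last argument is a measure
  on the generated sigma-algebra, so this fact is what gives \<open>hausdorff_measure\<close> its
  intended values.\<close>

lemma measure_space_hausdorff: "measure_space UNIV (sets borel) (hausdorff_outer m :: 'a::metric_space set \<Rightarrow> ennreal)"
proof -
  let ?L = "lambda_system UNIV (Pow UNIV) (hausdorff_outer m :: 'a set \<Rightarrow> ennreal)"
  have L: "measure_space UNIV ?L (hausdorff_outer m)"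
    by (rule sigma_algebra.caratheodory_lemma[OF sigma_algebra_Pow outer_measure_space_hausdorff])
  then have "sigma_algebra UNIV ?L" by (simp add: measure_space_def)
  then have "sigma_sets UNIV {C. closed C} \<subseteq> ?L"
    by (rule sigma_algebra.sigma_sets_subset) (auto intro!: closed_in_lambda_system simp del: Pow_UNIV)
  then have sub: "sets borel \<subseteq> ?L" by (simp add: borel_eq_closed)
  have "countably_additive ?L (hausdorff_outer m)" "positive ?L (hausdorff_outer m)"
    using L by (auto simp: measure_space_def)
  then show ?thesis
    using sub sets.sigma_algebra_axioms[of "borel :: 'a measure"]
    unfolding measure_space_def countably_additive_def positive_def
    by (auto simp: subset_eq simp del: sets.sigma_algebra_axioms)
qed

lemma space_hausdorff_measure [simp]: "space (hausdorff_measure m) = UNIV"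
  by (simp add: hausdorff_measure_def space_measure_of_conv)

lemma sets_hausdorff_measure [simp, measurable_cong]: "sets (hausdorff_measure m) = sets borel"
  unfolding hausdorff_measure_def using sets.sigma_sets_eq[of borel] by (simp add: sets_measure_of_conv)

lemma emeasure_hausdorff_measure:
  "A \<in> sets borel \<Longrightarrow> emeasure (hausdorff_measure m) A = hausdorff_outer m A"
  unfolding hausdorff_measure_def
  using measure_space_hausdorff[of m] sets.sigma_sets_eq[of borel]
  by (intro emeasure_measure_of_sigma) (auto simp: measure_space_def)

section \<open>Hausdorff measure is bounded by the volume of tubes\<close>

definition slab :: "'a::euclidean_space \<Rightarrow> 'a \<Rightarrow> real \<Rightarrow> real \<Rightarrow> 'a set" where
  "slab n a R \<eta> = {w. norm (w - a) \<le> R \<and> \<bar>n \<bullet> (w - a)\<bar> \<le> \<eta>}"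

lemma closed_slab: "closed (slab n a R \<eta>)"
  unfolding slab_def by (intro closed_Collect_conj closed_Collect_le continuous_intros)

lemma slab_measurable [measurable]: "slab n a R \<eta> \<in> sets borel"
  using closed_slab by (rule borel_closed)

lemma emeasure_slab_translate: "emeasure lborel (slab n a R \<eta>) = emeasure lborel (slab n 0 R \<eta>)"
proof -
  have "emeasure lborel (slab n a R \<eta>) = emeasure (distr lborel borel ((+) a)) (slab n a R \<eta>)"
    by (simp add: lborel_distr_plus)
  also have "\<dots> = emeasure lborel ((+) a -` slab n a R \<eta>)"
    by (subst emeasure_distr) auto
  also have "(+) a -` slab n a R \<eta> = slab n 0 R \<eta>"
    by (auto simp: slab_def)
  finally show ?thesis .
qed

text \<open>Disjoint translates of the slab along its thin direction fit into a ball of radius \<open>7 R\<close>.\<close>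

lemma emeasure_slab_le:
  fixes n :: "'a::euclidean_space"
  assumes "norm n = 1" "0 < \<eta>" "\<eta> \<le> R"
  shows "emeasure lborel (slab n a R \<eta>) \<le> ennreal (7 ^ DIM('a) * unit_ball_vol (real DIM('a)) * R ^ (DIM('a) - 1) * \<eta>)"
proof -
  define N where "N = nat \<lceil>R / \<eta>\<rceil>"
  have N: "R / \<eta> \<le> real N" "real N \<le> R / \<eta> + 1"
    using assms by (auto simp: N_def)
  have "R > 0" using assms by simp
  \<comment> \<open>The spacing \<open>3 * \<eta>\<close> exceeds the thickness
    \<open>2 * \<eta>\<close> of a slab. The total shift is at most
    \<open>3 * \<eta> * (R / \<eta> + 1) \<le> 6 * R\<close>, and the slab adds another
    \<open>R\<close>.\<close>
  define c where "c j = a + (3 * \<eta> * real j) *\<^sub>R n" for j :: nat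
  have disj: "disjoint_family_on (\<lambda>j. slab n (c j) R \<eta>) {..<N}"
    unfolding disjoint_family_on_def
  proof (intro ballI impI, rule ccontr)
    fix i j :: nat assume "i \<noteq> j" "slab n (c i) R \<eta> \<inter> slab n (c j) R \<eta> \<noteq> {}"
    then obtain w where "\<bar>n \<bullet> (w - c i)\<bar> \<le> \<eta>" "\<bar>n \<bullet> (w - c j)\<bar> \<le> \<eta>" by (auto simp: slab_def)
    then have "\<bar>n \<bullet> (w - c i) - n \<bullet> (w - c j)\<bar> \<le> 2 * \<eta>" by linarith
    also have "n \<bullet> (w - c i) - n \<bullet> (w - c j) = 3 * \<eta> * (real j - real i)"
      using assms(1) by (simp add: c_def algebra_simps norm_eq_1)
    finally have "3 * \<eta> * \<bar>real j - real i\<bar> \<le> 2 * \<eta>" using \<open>0 < \<eta>\<close> by (simp add: abs_mult)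
    moreover have "1 \<le> \<bar>real j - real i\<bar>" using \<open>i \<noteq> j\<close> by linarith
    then have "3 * \<eta> * 1 \<le> 3 * \<eta> * \<bar>real j - real i\<bar>" using \<open>0 < \<eta>\<close> by (intro mult_left_mono) auto
    ultimately show False using \<open>0 < \<eta>\<close> by simp
  qed
  have "of_nat N * emeasure lborel (slab n a R \<eta>) = (\<Sum>j<N. emeasure lborel (slab n (c j) R \<eta>))"
    using emeasure_slab_translate[of n a] emeasure_slab_translate[of n "c _"] by simp
  also have "\<dots> = emeasure lborel (\<Union>j<N. slab n (c j) R \<eta>)"
    using disj by (intro sum_emeasure) auto
  also have "\<dots> \<le> emeasure lborel (cball a (7 * R))"
  proof (rule emeasure_mono)
    show "(\<Union>j<N. slab n (c j) R \<eta>) \<subseteq> cball a (7 * R)"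
    proof
      fix w assume "w \<in> (\<Union>j<N. slab n (c j) R \<eta>)"
      then obtain j where j: "j < N" "norm (w - c j) \<le> R" by (auto simp: slab_def)
      have "norm (w - a) = norm ((w - c j) + (3 * \<eta> * real j) *\<^sub>R n)" by (simp add: c_def)
      also have "\<dots> \<le> norm (w - c j) + 3 * \<eta> * real j"
        using norm_triangle_ineq[of "w - c j" "(3 * \<eta> * real j) *\<^sub>R n"] assms by simp
      also have "\<dots> \<le> R + 3 * \<eta> * (R / \<eta> + 1)"
        using j N assms by (intro add_mono mult_left_mono) auto
      also have "\<dots> \<le> 7 * R" using assms by (simp add: field_simps)
      finally show "w \<in> cball a (7 * R)" by (simp add: dist_norm norm_minus_commute)
    qed
  qed simp
  also have "\<dots> = ennreal (unit_ball_vol (real DIM('a)) * (7 * R) ^ DIM('a))"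
    using \<open>R > 0\<close> by (simp add: emeasure_cball)
  finally have *: "of_nat N * emeasure lborel (slab n a R \<eta>) \<le> ennreal (unit_ball_vol (real DIM('a)) * (7 * R) ^ DIM('a))" .
  have fin: "emeasure lborel (slab n a R \<eta>) < \<infinity>"
  proof (rule le_less_trans)
    show "emeasure lborel (slab n a R \<eta>) \<le> emeasure lborel (cball a R)"
      by (rule emeasure_mono) (auto simp: slab_def dist_norm norm_minus_commute)
  qed (rule emeasure_lborel_cball_finite)
  then obtain e where e: "emeasure lborel (slab n a R \<eta>) = ennreal e" "0 \<le> e"
    by (cases "emeasure lborel (slab n a R \<eta>)") auto
  have "real N * e \<le> unit_ball_vol (real DIM('a)) * (7 * R) ^ DIM('a)"
  proof -
    have "of_nat N * ennreal e = ennreal (real N * e)"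
      using e(2) by (simp add: ennreal_mult ennreal_of_nat_eq_real_of_nat)
    then show ?thesis using * \<open>R > 0\<close> e by simp
  qed
  then have "R / \<eta> * e \<le> unit_ball_vol (real DIM('a)) * (7 * R) ^ DIM('a)"
    using N(1) e(2) mult_right_mono by (meson order_trans)
  moreover have "(7 * R) ^ DIM('a) = 7 ^ DIM('a) * R ^ (DIM('a) - 1) * R"
    using DIM_positive[where 'a='a] by (simp add: power_mult_distrib power_eq_if[of R])
  ultimately have "R * e \<le> R * (7 ^ DIM('a) * unit_ball_vol (real DIM('a)) * R ^ (DIM('a) - 1) * \<eta>)"
    using \<open>0 < \<eta>\<close> by (simp add: field_simps)
  then show ?thesis using \<open>R > 0\<close> e by (auto intro!: ennreal_leI)
qed

lemma hausdorff_pre_finite_cover: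
  fixes K :: "'a::metric_space set"
  assumes "finite F" "0 < \<delta>" and cov: "K \<subseteq> (\<Union>y\<in>F. cball y \<delta>)"
  shows "hausdorff_pre m (2 * \<delta>) K \<le> of_nat (card F) * ennreal (unit_ball_vol (real m) * \<delta> ^ m)"
proof -
  obtain h where h: "bij_betw h {0..<card F} F" using ex_bij_betw_nat_finite[OF assms(1)] by blast
  define C where "C i = (if i < card F then cball (h i) \<delta> else {})" for i
  have diam: "diameter (cball y \<delta>) \<le> 2 * \<delta>" for y :: 'a
    unfolding diameter_def using \<open>0 < \<delta>\<close>
    by (auto intro!: cSUP_least) (metis dist_commute dist_triangle_le add_mono mult_2)
  have g: "ennreal (hausdorff_gauge m (cball y \<delta>)) \<le> ennreal (unit_ball_vol (real m) * \<delta> ^ m)" for y :: 'a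
    using diam[of y] \<open>0 < \<delta>\<close> unfolding hausdorff_gauge_def
    by (auto intro!: ennreal_leI mult_left_mono power_mono diameter_ge_0 divide_nonneg_nonneg)
  have "hausdorff_pre m (2 * \<delta>) K \<le> (\<Sum>i. ennreal (hausdorff_gauge m (C i)))"
  proof (rule hausdorff_pre_le)
    show "K \<subseteq> (\<Union>i. C i)"
    proof
      fix x assume "x \<in> K"
      then obtain y where "y \<in> F" "x \<in> cball y \<delta>" using cov by blast
      moreover from \<open>y \<in> F\<close> have "y \<in> h ` {0..<card F}" using h by (simp add: bij_betw_def)
      then obtain i where "i < card F" "y = h i" by auto
      ultimately show "x \<in> (\<Union>i. C i)" by (auto simp: C_def intro!: exI[of _ i])
    qed
  qed (use diam \<open>0 < \<delta>\<close> in \<open>auto simp: C_def\<close>)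
  also have "\<dots> = (\<Sum>i<card F. ennreal (hausdorff_gauge m (C i)))"
    by (rule suminf_finite) (auto simp: C_def hausdorff_gauge_def)
  also have "\<dots> \<le> (\<Sum>i<card F. ennreal (unit_ball_vol (real m) * \<delta> ^ m))"
    by (intro sum_mono) (auto simp: C_def g)
  finally show ?thesis by simp
qed

definition tube :: "'a::real_vector set \<Rightarrow> 'a \<Rightarrow> real \<Rightarrow> real \<Rightarrow> 'a set" where
  "tube K v a b = (\<lambda>(y, t). y + t *\<^sub>R v) ` (K \<times> {a..b})"

lemma compact_tube: "compact K \<Longrightarrow> compact (tube K v a b)" for K :: "'a::real_normed_vector set"
  unfolding tube_def case_prod_unfold
  by (intro compact_continuous_image continuous_intros compact_Times compact_Icc)

definition separated_by :: "real \<Rightarrow> 'a::metric_space set \<Rightarrow> bool" where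
  "separated_by \<delta> F \<longleftrightarrow> (\<forall>y\<in>F. \<forall>y'\<in>F. y \<noteq> y' \<longrightarrow> \<delta> \<le> dist y y')"

text \<open>A separated subset of \<open>K\<close> gives disjoint strings of balls inside a neighbourhood of the tube.\<close>

lemma separated_card_le:
  fixes F :: "'a::euclidean_space set"
  assumes "finite F" "F \<subseteq> K" "compact K" "a < b" "v \<noteq> 0" "1 \<le> L" "0 < \<delta>"
    and bil: "\<And>y y' t. y \<in> K \<Longrightarrow> y' \<in> K \<Longrightarrow> norm (y - y') \<le> L * norm (y - y' - t *\<^sub>R v)"
    and sep: "separated_by \<delta> F"
  shows "ennreal (real (card F) * ((b - a) * norm v * L * unit_ball_vol (real DIM('a)) / (2 * L) ^ DIM('a)) * \<delta> ^ (DIM('a) - 1))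
     \<le> emeasure lborel {w. infdist w (tube K v a b) \<le> \<delta>}"
proof -
  \<comment> \<open>Centres over different base points are at least
    \<open>\<delta> / L = 2 * r\<close> apart by the Lipschitz assumption; centres on the same line
    are at least \<open>h * norm v = 2 * r\<close> apart. Hence balls of radius \<open>r\<close> are
    disjoint.\<close>
  define r where "r = \<delta> / (2 * L)"
  have r: "0 < r" "r \<le> \<delta>" using assms by (auto simp: r_def field_simps)
  define h where "h = 2 * r / norm v"
  have h: "0 < h" "h * norm v = 2 * r" using r assms by (auto simp: h_def)
  \<comment> \<open>The indices \<open>0..N\<close> give \<open>N + 1\<close> centres per line,
    which is at least \<open>(b - a) / h\<close>, while the last one still has its time in
    \<open>{a..b}\<close>.\<close>
  define N where "N = nat \<lfloor>(b - a) / h\<rfloor>"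
  have N: "(b - a) / h \<le> real (Suc N)" "real N \<le> (b - a) / h"
    using assms h(1) by (auto simp: N_def) linarith
  define c where "c = (\<lambda>(y, j). y + (a + real j * h) *\<^sub>R v)"
  let ?I = "F \<times> {..N}"
  let ?T = "tube K v a b"
  have cdist: "2 * r \<le> dist (c p) (c q)" if "p \<in> ?I" "q \<in> ?I" "p \<noteq> q" for p q
  proof -
    obtain y j y' j' where pq: "p = (y, j)" "q = (y', j')" by fastforce
    have eq: "c p - c q = y - y' - ((real j' - real j) * h) *\<^sub>R v"
      by (simp add: pq c_def algebra_simps)
    show ?thesis
    proof (cases "y = y'")
      case True
      with that pq have "j \<noteq> j'" by auto
      then have "1 \<le> \<bar>real j' - real j\<bar>" by linarith
      then have "1 * (h * norm v) \<le> \<bar>real j' - real j\<bar> * (h * norm v)"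
        using h by (intro mult_right_mono) (auto simp: r less_imp_le)
      then show ?thesis using eq True h by (simp add: dist_norm abs_mult mult.assoc)
    next
      case False
      then have "\<delta> \<le> L * dist (c p) (c q)"
        using sep bil[of y y' "(real j' - real j) * h"] that pq assms(2) eq
        by (force simp: dist_norm separated_by_def)
      then show ?thesis using \<open>1 \<le> L\<close> by (simp add: r_def field_simps)
    qed
  qed
  have disj: "disjoint_family_on (\<lambda>p. ball (c p) r) ?I"
    unfolding disjoint_family_on_def
  proof (intro ballI impI, rule ccontr)
    fix p q assume pq: "p \<in> ?I" "q \<in> ?I" "p \<noteq> q" "ball (c p) r \<inter> ball (c q) r \<noteq> {}"
    then obtain w where "w \<in> ball (c p) r" "w \<in> ball (c q) r" by blast
    then have "dist (c p) w < r" "dist (c q) w < r" by (simp_all only: mem_ball)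
    then have "dist (c p) (c q) < 2 * r" using dist_triangle2[of "c p" "c q" w] by simp
    with cdist[OF pq(1-3)] show False by simp
  qed
  have "ennreal (real (card F * Suc N) * (unit_ball_vol (real DIM('a)) * r ^ DIM('a))) = (\<Sum>p\<in>?I. emeasure lborel (ball (c p) r))"
    using r by (simp add: emeasure_ball card_cartesian_product ennreal_mult ennreal_of_nat_eq_real_of_nat)
  also have "\<dots> = emeasure lborel (\<Union>p\<in>?I. ball (c p) r)"
    using disj \<open>finite F\<close> by (intro sum_emeasure) auto
  also have "\<dots> \<le> emeasure lborel {w. infdist w ?T \<le> \<delta>}"
  proof (rule emeasure_mono)
    show "(\<Union>p\<in>?I. ball (c p) r) \<subseteq> {w. infdist w ?T \<le> \<delta>}"
    proof
      fix w assume "w \<in> (\<Union>p\<in>?I. ball (c p) r)"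
      then obtain y j where yj: "y \<in> F" "j \<in> {..N}" "w \<in> ball (c (y, j)) r" by blast
      have "real j * h \<le> (b - a) / h * h" using yj(2) N(2) h(1) by (intro mult_right_mono) auto
      then have "a + real j * h \<in> {a..b}" using h(1) by auto
      then have "c (y, j) \<in> ?T" using yj(1) assms(2) unfolding tube_def c_def by force
      then have "infdist w ?T \<le> dist w (c (y, j))" by (rule infdist_le)
      also have "\<dots> \<le> \<delta>" using yj(3) r by (simp add: dist_commute)
      finally show "w \<in> {w. infdist w ?T \<le> \<delta>}" by simp
    qed
  qed (auto intro!: borel_closed closed_Collect_le continuous_intros)
  finally have 1: "ennreal (real (card F * Suc N) * (unit_ball_vol (real DIM('a)) * r ^ DIM('a)))
     \<le> emeasure lborel {w. infdist w ?T \<le> \<delta>}" .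
  have "real (card F) * ((b - a) * norm v * L * unit_ball_vol (real DIM('a)) / (2 * L) ^ DIM('a)) * \<delta> ^ (DIM('a) - 1)
     = real (card F) * ((b - a) / h) * (unit_ball_vol (real DIM('a)) * r ^ DIM('a))"
  proof -
    obtain m where m: "DIM('a) = Suc m" using DIM_positive[where 'a='a] gr0_implies_Suc by blast
    have "(b - a) / h * (unit_ball_vol (real DIM('a)) * r ^ DIM('a)) = (b - a) * norm v / 2 * unit_ball_vol (real DIM('a)) * r ^ m"
      using r \<open>v \<noteq> 0\<close> by (simp add: m h_def)
    also have "r ^ m = \<delta> ^ m / (2 * L) ^ m" by (simp add: r_def power_divide)
    also have "(b - a) * norm v / 2 * unit_ball_vol (real DIM('a)) * (\<delta> ^ m / (2 * L) ^ m)
      = (b - a) * norm v * L * unit_ball_vol (real DIM('a)) / (2 * L) ^ DIM('a) * \<delta> ^ m"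
      using \<open>1 \<le> L\<close> by (simp add: m)
    finally have E: "(b - a) / h * (unit_ball_vol (real DIM('a)) * r ^ DIM('a)) = 
      (b - a) * norm v * L * unit_ball_vol (real DIM('a)) / (2 * L) ^ DIM('a) * \<delta> ^ m" .
    have "real (card F) * ((b - a) * norm v * L * unit_ball_vol (real DIM('a)) / (2 * L) ^ DIM('a)) * \<delta> ^ (DIM('a) - 1)
      = real (card F) * ((b - a) / h * (unit_ball_vol (real DIM('a)) * r ^ DIM('a)))"
      unfolding E by (simp only: m diff_Suc_1 mult.assoc)
    then show ?thesis by (simp only: mult.assoc)
  qed
  also have "\<dots> \<le> real (card F * Suc N) * (unit_ball_vol (real DIM('a)) * r ^ DIM('a))"
    unfolding of_nat_mult by (rule mult_right_mono[OF mult_left_mono[OF N(1)]]) (use r in auto)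
  finally show ?thesis using 1 by (meson ennreal_leI order_trans)
qed

text \<open>A separated set of greatest cardinality is a net, because a point farther than
  \<open>\<delta>\<close> from all its members could be added. The bound \<open>B\<close> guarantees
  that a greatest cardinality exists.\<close>

lemma exists_maximal_separated:
  assumes "0 < \<delta>" and bdd: "\<And>F. finite F \<Longrightarrow> F \<subseteq> K \<Longrightarrow> separated_by \<delta> F \<Longrightarrow> card F < B"
  obtains F where "finite F" "F \<subseteq> K" "separated_by \<delta> F" "K \<subseteq> (\<Union>y\<in>F. cball y \<delta>)"
proof -
  define P where "P F \<longleftrightarrow> finite F \<and> F \<subseteq> K \<and> separated_by \<delta> F" for F
  have "P {}" by (simp add: P_def separated_by_def)
  moreover have "\<forall>F. P F \<longrightarrow> card F < B" using bdd by (auto simp: P_def)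
  ultimately obtain F where F: "P F" "\<And>F'. P F' \<Longrightarrow> card F' \<le> card F"
    using Lattices_Big.ex_has_greatest_nat[of P "{}" card B] by blast
  have "K \<subseteq> (\<Union>y\<in>F. cball y \<delta>)"
  proof (rule ccontr)
    assume "\<not> ?thesis"
    then obtain x where "x \<in> K" "x \<notin> (\<Union>y\<in>F. cball y \<delta>)" by blast
    then have x: "x \<in> K" "\<And>y. y \<in> F \<Longrightarrow> \<delta> < dist y x" by (auto simp: not_le)
    have "x \<notin> F" using x(2)[of x] \<open>0 < \<delta>\<close> by auto
    moreover have "P (insert x F)" using F(1) x by (auto simp: P_def separated_by_def dist_commute less_imp_le)
    then have "card (insert x F) \<le> card F" by (rule F(2))
    ultimately show False using F(1) by (simp add: P_def)
  qed
  then show thesis using that[of F] F(1) by (simp add: P_def)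
qed

text \<open>The cardinality of a maximal separated set bounds the premeasure of \<open>K\<close>
  from above, through the cover by balls, and is itself bounded by the volume of a neighbourhood of
  the tube. These neighbourhoods shrink to the compact tube as \<open>\<delta>\<close> tends to 0.
  The last hypothesis says that projection along \<open>v\<close> has a Lipschitz inverse on
  \<open>K\<close>; the constant obtained depends on \<open>L\<close> and may be large when
  \<open>v\<close> is nearly tangential.\<close>

lemma hausdorff_outer_le_tube:
  fixes K :: "'a::euclidean_space set"
  assumes K: "compact K" and ab: "a < b" "v \<noteq> 0" "1 \<le> L"
    and bil: "\<And>y y' t. y \<in> K \<Longrightarrow> y' \<in> K \<Longrightarrow> norm (y - y') \<le> L * norm (y - y' - t *\<^sub>R v)"
  shows "\<exists>C::real. hausdorff_outer (DIM('a) - 1) K \<le> ennreal C * emeasure lborel (tube K v a b)"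
proof (cases "K = {}")
  case False
  let ?T = "tube K v a b"
  define m where "m = DIM('a) - 1"
  define A where "A = (b - a) * norm v * L * unit_ball_vol (real DIM('a)) / (2 * L) ^ DIM('a)"
  have "A > 0" using ab by (auto simp: A_def)
  define C where "C = unit_ball_vol (real m) / A"
  have "C > 0" using \<open>A > 0\<close> by (simp add: C_def)
  define Nb where "Nb \<delta> = {w. infdist w ?T \<le> \<delta>}" for \<delta>
  have T: "compact ?T" "?T \<noteq> {}" using compact_tube[OF K] False ab by (auto simp: tube_def)
  have Nb_borel: "Nb \<delta> \<in> sets borel" for \<delta>
    unfolding Nb_def by (intro borel_closed closed_Collect_le continuous_intros)
  have Nb_fin: "emeasure lborel (Nb \<delta>) < \<infinity>" for \<delta>
  proof -
    have "bounded (Nb \<delta>)"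
    proof -
      obtain R x where R: "\<And>z. z \<in> ?T \<Longrightarrow> dist x z \<le> R" using compact_imp_bounded[OF T(1)] by (auto simp: bounded_def)
      have "dist x w \<le> R + \<delta>" if "w \<in> Nb \<delta>" for w
      proof -
        obtain z where "z \<in> ?T" "infdist w ?T = dist w z"
          using infdist_attains_inf[of ?T w] T compact_imp_closed by blast
        with that R[of z] dist_triangle2[of x w z] show ?thesis by (auto simp: Nb_def)
      qed
      then show ?thesis unfolding bounded_def by blast
    qed
    then show ?thesis by (rule emeasure_bounded_finite)
  qed
  have main: "hausdorff_pre m (2 * \<delta>) K \<le> ennreal C * emeasure lborel (Nb \<delta>)" if "0 < \<delta>" for \<delta>
  proof -
    obtain e where e: "emeasure lborel (Nb \<delta>) = ennreal e" "0 \<le> e"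
      using Nb_fin[of \<delta>] by (cases "emeasure lborel (Nb \<delta>)") auto
    have card: "real (card F) * A * \<delta> ^ m \<le> e"
      if "finite F" "F \<subseteq> K" "separated_by \<delta> F" for F
      using separated_card_le[OF that(1,2) K ab \<open>0 < \<delta>\<close> bil that(3)] e
      by (simp add: A_def m_def Nb_def)
    have B: "card F < nat \<lceil>e / (A * \<delta> ^ m)\<rceil> + 1"
      if "finite F" "F \<subseteq> K" "separated_by \<delta> F" for F
    proof -
      have "real (card F) \<le> e / (A * \<delta> ^ m)"
        using card[OF that] \<open>A > 0\<close> \<open>0 < \<delta>\<close> by (simp add: field_simps)
      then show ?thesis by linarith
    qed
    obtain F where F: "finite F" "F \<subseteq> K" "separated_by \<delta> F"
      "K \<subseteq> (\<Union>y\<in>F. cball y \<delta>)"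
      by (rule exists_maximal_separated[OF \<open>0 < \<delta>\<close> B])
    have "hausdorff_pre m (2 * \<delta>) K \<le> of_nat (card F) * ennreal (unit_ball_vol (real m) * \<delta> ^ m)"
      using F \<open>0 < \<delta>\<close> by (intro hausdorff_pre_finite_cover)
    also have "\<dots> = ennreal (C * (real (card F) * A * \<delta> ^ m))"
      using \<open>A > 0\<close> \<open>0 < \<delta>\<close> unfolding ennreal_of_nat_eq_real_of_nat
      by (subst ennreal_mult[symmetric]) (auto simp: C_def)
    also have "\<dots> \<le> ennreal (C * e)" using \<open>C > 0\<close> card[OF F(1-3)] by (intro ennreal_leI mult_left_mono) auto
    also have "\<dots> = ennreal C * emeasure lborel (Nb \<delta>)" using \<open>C > 0\<close> e by (simp add: ennreal_mult)
    finally show ?thesis .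
  qed
  have lim: "(\<lambda>n. emeasure lborel (Nb (1 / Suc n))) \<longlonglongrightarrow> emeasure lborel (\<Inter>n. Nb (1 / Suc n))"
  proof (rule Lim_emeasure_decseq)
    show "decseq (\<lambda>n. Nb (1 / Suc n))"
      proof (rule decseq_SucI)
      fix n :: nat
      have "1 / real (Suc (Suc n)) \<le> 1 / real (Suc n)" by (intro divide_left_mono) auto
      then show "Nb (1 / Suc (Suc n)) \<subseteq> Nb (1 / Suc n)" by (auto simp: Nb_def simp del: of_nat_Suc)
    qed
  qed (use Nb_fin Nb_borel in \<open>auto simp: less_top\<close>)
  also have "(\<Inter>n. Nb (1 / Suc n)) = ?T"
  proof
    show "(\<Inter>n. Nb (1 / Suc n)) \<subseteq> ?T"
    proof
      fix w assume w: "w \<in> (\<Inter>n. Nb (1 / Suc n))"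
      have "infdist w ?T = 0"
      proof (rule ccontr)
        assume "infdist w ?T \<noteq> 0"
        then have "0 < infdist w ?T" using infdist_nonneg[of w ?T] by simp
        then obtain n where "1 / Suc n < infdist w ?T" using nat_approx_posE by metis
        moreover have "infdist w ?T \<le> 1 / Suc n" using w by (auto simp: Nb_def)
        ultimately show False by simp
      qed
      then show "w \<in> ?T" using T compact_imp_closed in_closed_iff_infdist_zero by blast
    qed
  qed (auto simp: Nb_def)
  finally have lim: "(\<lambda>n. emeasure lborel (Nb (1 / Suc n))) \<longlonglongrightarrow> emeasure lborel ?T" .
  have "hausdorff_outer m K \<le> ennreal C * emeasure lborel ?T"
  proof (rule hausdorff_outer_leI)
    fix \<delta> :: real assume "0 < \<delta>"
    show "hausdorff_pre m \<delta> K \<le> ennreal C * emeasure lborel ?T"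
    proof (rule LIMSEQ_le_const)
      show "(\<lambda>n. ennreal C * emeasure lborel (Nb (1 / Suc n))) \<longlonglongrightarrow> ennreal C * emeasure lborel ?T"
        by (intro ennreal_tendsto_cmult lim) auto
      obtain N where N: "1 / Suc N < \<delta> / 2" using nat_approx_posE[of "\<delta> / 2"] \<open>0 < \<delta>\<close> by auto
      have "hausdorff_pre m \<delta> K \<le> ennreal C * emeasure lborel (Nb (1 / Suc n))" if "N \<le> n" for n
      proof -
        have "1 / real (Suc n) \<le> 1 / real (Suc N)" using that by (intro divide_left_mono) auto
        then have "2 * (1 / real (Suc n)) \<le> \<delta>" using N by linarith
        then have "hausdorff_pre m \<delta> K \<le> hausdorff_pre m (2 * (1 / real (Suc n))) K" by (rule hausdorff_pre_antimono)
        also have "\<dots> \<le> ennreal C * emeasure lborel (Nb (1 / Suc n))" by (rule main) simp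
        finally show ?thesis .
      qed
      then show "\<exists>N. \<forall>n\<ge>N. hausdorff_pre m \<delta> K \<le> ennreal C * emeasure lborel (Nb (1 / Suc n))" by blast
    qed
  qed
  then show ?thesis unfolding m_def by blast
qed (simp add: hausdorff_outer_empty)

section \<open>Volumes of tubes are bounded by Hausdorff measure\<close>

text \<open>A member of a cover may have diameter 0, whereas the slab estimate requires a positive
  radius. By continuity the radius can be enlarged at an arbitrarily small cost in the
  gauge.\<close>

lemma exists_slightly_larger_radius:
  fixes d e r0 :: real
  assumes "0 < r0" "0 < e"
  obtains r where "d < r" "r < d + r0" "c * (r / 2) ^ m \<le> c * (d / 2) ^ m + e"
proof -
  have "((\<lambda>r. c * (r / 2) ^ m) \<longlongrightarrow> c * (d / 2) ^ m) (at_right d)"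
    by (intro tendsto_intros) auto
  then have "eventually (\<lambda>r. c * (r / 2) ^ m < c * (d / 2) ^ m + e) (at_right d)"
    using assms by (auto intro: order_tendstoD)
  moreover have "eventually (\<lambda>r. d < r) (at_right d)" by (simp add: eventually_at_filter)
  moreover have "eventually (\<lambda>r. r < d + r0) (at_right d)"
    using assms by (intro order_tendstoD(2)[OF tendsto_ident_at]) auto
  ultimately have "eventually (\<lambda>r. d < r \<and> r < d + r0 \<and> c * (r / 2) ^ m < c * (d / 2) ^ m + e) (at_right d)"
    by eventually_elim auto
  then obtain r where "d < r \<and> r < d + r0 \<and> c * (r / 2) ^ m < c * (d / 2) ^ m + e"
    using eventually_happens trivial_limit_at_right_real by blast
  then show thesis using that by (meson less_imp_le)
qed

text \<open>Slabs orthogonal to the normal \<open>n\<close>, rather than balls, are used to cover the tube: this is what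
  produces the factor \<open>\<delta> \<approx> |n \<bullet> v|\<close> that distinguishes \<open>d\<xi>\<close> from \<open>d\<mu> dv\<close>.\<close>

lemma emeasure_flat_tube_le:
  fixes P :: "'a::euclidean_space set"
  assumes n: "norm n = 1" and "0 < r" "0 < \<delta>" "v \<noteq> 0" "r \<le> l * norm v" "M * r * norm v \<le> \<delta>" "0 \<le> M"
    and nv: "\<bar>n \<bullet> v\<bar> \<le> 2 * \<delta>" "\<delta> \<le> \<bar>n \<bullet> v\<bar>"
    and P: "\<And>y. y \<in> P \<Longrightarrow> norm (y - y0) \<le> r" "\<And>y. y \<in> P \<Longrightarrow> \<bar>n \<bullet> (y - y0)\<bar> \<le> M * (norm (y - y0))\<^sup>2"
  shows "\<exists>U\<in>sets borel. tube P v (-l) l \<subseteq> U \<and>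
    emeasure lborel U \<le> ennreal (5 * 21 ^ DIM('a) * unit_ball_vol (real DIM('a)) * l * \<delta> * r ^ (DIM('a) - 1))"
proof -
  define h where "h = r / norm v"
  have h: "0 < h" "h * norm v = r" using assms by (auto simp: h_def)
  have "h \<le> l" using assms h by (simp add: h_def divide_le_eq)
  \<comment> \<open>For \<open>s \<ge> - l\<close> the floor of \<open>s / h\<close> can be as small
    as \<open>- \<lfloor>l / h\<rfloor> - 1\<close>, hence the extra index.\<close>
  define J where "J = {- \<lfloor>l / h\<rfloor> - 1 .. \<lfloor>l / h\<rfloor>}"
  \<comment> \<open>Two contributions to the displacement along \<open>n\<close>: at most
    \<open>r * \<delta> / norm v\<close> from the deviation of \<open>P\<close> from its tangent
    plane, and at most \<open>h * (2 * \<delta>)\<close>, twice that amount, from moving along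
    \<open>v\<close> for a time at most \<open>h\<close>.\<close>
  define \<eta> where "\<eta> = 3 * r * \<delta> / norm v"
  have "\<delta> \<le> norm v" using nv(2) Cauchy_Schwarz_ineq2[of n v] n by simp
  then have \<eta>: "0 < \<eta>" "\<eta> \<le> 3 * r" using assms by (auto simp: \<eta>_def divide_le_eq)
  define U where "U = (\<Union>j\<in>J. slab n (y0 + (of_int j * h) *\<^sub>R v) (3 * r) \<eta>)"
  have "finite J" by (simp add: J_def)
  have cardJ: "real (card J) \<le> 5 * l / h"
  proof -
    have "1 \<le> l / h" using \<open>h \<le> l\<close> h by simp
    then have "1 \<le> \<lfloor>l / h\<rfloor>" by simp
    then have "real (card J) = 2 * of_int \<lfloor>l / h\<rfloor> + 2" by (simp add: J_def)
    also have "\<dots> \<le> 5 * (l / h)" using \<open>1 \<le> l / h\<close> of_int_floor_le[of "l / h"] by linarith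
    finally show ?thesis by simp
  qed
  have "emeasure lborel U \<le> (\<Sum>j\<in>J. emeasure lborel (slab n (y0 + (of_int j * h) *\<^sub>R v) (3 * r) \<eta>))"
    unfolding U_def using \<open>finite J\<close> by (intro emeasure_subadditive_finite) auto
  also have "\<dots> \<le> (\<Sum>j\<in>J. ennreal (7 ^ DIM('a) * unit_ball_vol (real DIM('a)) * (3 * r) ^ (DIM('a) - 1) * \<eta>))"
    using \<eta> n by (intro sum_mono emeasure_slab_le)
  also have "\<dots> = ennreal (real (card J) * (7 ^ DIM('a) * unit_ball_vol (real DIM('a)) * (3 * r) ^ (DIM('a) - 1) * \<eta>))"
    using \<eta> assms by (simp add: ennreal_mult ennreal_of_nat_eq_real_of_nat)
  also have "\<dots> \<le> ennreal (5 * l / h * (7 ^ DIM('a) * unit_ball_vol (real DIM('a)) * (3 * r) ^ (DIM('a) - 1) * \<eta>))"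
    using \<eta> assms cardJ by (intro ennreal_leI mult_right_mono) auto
  also have "5 * l / h * (7 ^ DIM('a) * unit_ball_vol (real DIM('a)) * (3 * r) ^ (DIM('a) - 1) * \<eta>)
     = 5 * 21 ^ DIM('a) * unit_ball_vol (real DIM('a)) * l * \<delta> * r ^ (DIM('a) - 1)"
  proof -
    obtain m where m: "DIM('a) = Suc m" using DIM_positive[where 'a='a] gr0_implies_Suc by blast
    have e1: "5 * l / h * \<eta> = 15 * l * \<delta>" using assms by (simp add: h_def \<eta>_def)
    have e2: "7 ^ DIM('a) * (3 * r) ^ (DIM('a) - 1) * 3 = 21 ^ DIM('a) * r ^ (DIM('a) - 1)"
    proof -
      have "(7::real) ^ Suc m * (3 * r) ^ m * 3 = (7 * 3) ^ Suc m * r ^ m"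
        unfolding power_mult_distrib by simp
      then show ?thesis by (simp add: m)
    qed
    have "5 * l / h * (a * u * x * \<eta>) = (5 * l / h * \<eta>) * (a * x * 3) * u / 3" for a u x
      by simp
    from this[of "7 ^ DIM('a)" "unit_ball_vol (real DIM('a))" "(3 * r) ^ (DIM('a) - 1)", unfolded e1 e2]
    show ?thesis by simp
  qed
  finally have le: "emeasure lborel U \<le> ennreal (5 * 21 ^ DIM('a) * unit_ball_vol (real DIM('a)) * l * \<delta> * r ^ (DIM('a) - 1))" .
  have "tube P v (-l) l \<subseteq> U"
  proof
    fix w assume "w \<in> tube P v (-l) l"
    then obtain y s where w: "w = y + s *\<^sub>R v" "y \<in> P" "-l \<le> s" "s \<le> l" by (auto simp: tube_def)
    define j where "j = \<lfloor>s / h\<rfloor>"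
    define s' where "s' = s - of_int j * h"
    have "of_int j \<le> s / h" "s / h < of_int j + 1" unfolding j_def by linarith+
    then have s': "0 \<le> s'" "s' \<le> h" using h by (auto simp: s'_def field_simps)
    have "- (l / h) \<le> s / h" "s / h \<le> l / h" using w h by (auto simp: divide_right_mono simp flip: divide_minus_left)
    then have "j \<in> J" unfolding J_def j_def by (auto intro: floor_mono) linarith
    moreover have "w \<in> slab n (y0 + (of_int j * h) *\<^sub>R v) (3 * r) \<eta>"
    proof -
      have eq: "w - (y0 + (of_int j * h) *\<^sub>R v) = (y - y0) + s' *\<^sub>R v"
        by (simp add: w s'_def algebra_simps)
      have "norm ((y - y0) + s' *\<^sub>R v) \<le> norm (y - y0) + \<bar>s'\<bar> * norm v"
        by (rule order_trans[OF norm_triangle_ineq]) simp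
      also have "\<dots> \<le> r + h * norm v" using P(1)[OF w(2)] s' by (intro add_mono mult_right_mono) auto
      finally have 1: "norm ((y - y0) + s' *\<^sub>R v) \<le> 3 * r" using h \<open>0 < r\<close> by simp
      have "\<bar>n \<bullet> ((y - y0) + s' *\<^sub>R v)\<bar> \<le> \<bar>n \<bullet> (y - y0)\<bar> + \<bar>s'\<bar> * \<bar>n \<bullet> v\<bar>"
        by (simp add: inner_add_right flip: abs_mult)
      also have "\<dots> \<le> M * (norm (y - y0))\<^sup>2 + h * (2 * \<delta>)"
        using P(2)[OF w(2)] s' nv by (intro add_mono mult_mono) auto
      also have "M * (norm (y - y0))\<^sup>2 \<le> M * r\<^sup>2"
        using P(1)[OF w(2)] \<open>0 \<le> M\<close> by (intro mult_left_mono power_mono) auto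
      also have "M * r\<^sup>2 \<le> r * \<delta> / norm v"
      proof -
        have "(M * r * norm v) * r \<le> \<delta> * r" using assms by (intro mult_right_mono) auto
        then show ?thesis using \<open>v \<noteq> 0\<close> by (simp add: field_simps power2_eq_square)
      qed
      also have "r * \<delta> / norm v + h * (2 * \<delta>) = \<eta>" by (simp add: h_def \<eta>_def field_simps)
      finally show ?thesis using 1 by (simp add: slab_def eq)
    qed
    ultimately show "w \<in> U" by (auto simp: U_def)
  qed
  moreover have "U \<in> sets borel" unfolding U_def using \<open>finite J\<close> by auto
  ultimately show ?thesis using le by blast
qed

text \<open>The factor \<open>2 ^ (DIM('a) - 1)\<close> and the denominator convert
  \<open>r ^ m\<close> into the gauge \<open>\<omega> * (r / 2) ^ m\<close> of a set of diameter
  \<open>r\<close>; the rest is the constant of \<open>emeasure_flat_tube_le\<close>. It depends on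
  the dimension only and not on the angle between surface and direction.\<close>

definition tube_const :: "'a::euclidean_space itself \<Rightarrow> real" where
  "tube_const _ = 5 * 21 ^ DIM('a) * unit_ball_vol (real DIM('a)) * 2 ^ (DIM('a) - 1) / unit_ball_vol (real (DIM('a) - 1))"

lemma tube_const_pos: "0 < tube_const TYPE('a::euclidean_space)"
  by (simp add: tube_const_def)

text \<open>At a scale small compared with \<open>\<delta> / M\<close> the set \<open>A\<close> is
  flat enough for \<open>emeasure_flat_tube_le\<close>, so each member of a fine cover sweeps out a
  volume of at most a constant times \<open>l * \<delta>\<close> times its gauge. Here
  \<open>\<delta>\<close> stands for \<open>|n \<bullet> v|\<close> up to a factor 2, so the
  right-hand side is an upper estimate of the flux of \<open>v\<close> through \<open>A\<close> with
  a universal constant.\<close>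

lemma emeasure_tube_le_hausdorff:
  fixes A :: "'a::euclidean_space set"
  assumes n: "\<And>y. y \<in> A \<Longrightarrow> norm (n y) = 1" and "0 < \<delta>" "0 \<le> M" "v \<noteq> 0" "0 < l"
    and nv: "\<And>y. y \<in> A \<Longrightarrow> \<bar>n y \<bullet> v\<bar> \<le> 2 * \<delta>" "\<And>y. y \<in> A \<Longrightarrow> \<delta> \<le> \<bar>n y \<bullet> v\<bar>"
    and flat: "\<And>y y'. y \<in> A \<Longrightarrow> y' \<in> A \<Longrightarrow> \<bar>n y' \<bullet> (y - y')\<bar> \<le> M * (norm (y - y'))\<^sup>2"
    and E: "E \<subseteq> tube A v (-l) l"
  shows "emeasure lborel E \<le> ennreal (tube_const TYPE('a) * l * \<delta>) * hausdorff_outer (DIM('a) - 1) A"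
proof (cases "hausdorff_outer (DIM('a) - 1) A = \<infinity>")
  case True
  have "0 < tube_const TYPE('a) * l * \<delta>" using assms tube_const_pos[where 'a='a] by simp
  then have "ennreal (tube_const TYPE('a) * l * \<delta>) * hausdorff_outer (DIM('a) - 1) A = \<infinity>"
    unfolding True by (auto simp: ennreal_mult_eq_top_iff)
  then show ?thesis by simp
next
  case False
  define m where "m = DIM('a) - 1"
  define \<omega> where "\<omega> = unit_ball_vol (real m)"
  have "\<omega> > 0" by (simp add: \<omega>_def)
  define Q where "Q = 5 * 21 ^ DIM('a) * unit_ball_vol (real DIM('a)) * l * \<delta>"
  have "Q > 0" using assms by (simp add: Q_def)
  have QC: "tube_const TYPE('a) * l * \<delta> = Q * 2 ^ m / \<omega>" by (simp add: tube_const_def Q_def m_def \<omega>_def)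
  define c where "c = tube_const TYPE('a) * l * \<delta>"
  have "c > 0" using assms tube_const_pos[where 'a='a] by (simp add: c_def)
  have main: "emeasure lborel E \<le> ennreal c * (hausdorff_outer m A + ennreal e + ennreal e)" if "0 < e" for e
  proof -
    \<comment> \<open>Divided by 2 because the radius chosen below may reach \<open>2 * r0\<close>;
      \<open>M + 1\<close> instead of \<open>M\<close> avoids a zero denominator.\<close>
    define r0 where "r0 = min (l * norm v) (\<delta> / ((M + 1) * norm v)) / 2"
    have "0 < r0" using assms by (auto simp: r0_def)
    have "hausdorff_pre m r0 A \<le> hausdorff_outer m A" by (rule hausdorff_pre_le_outer) fact
    also have "hausdorff_outer m A < hausdorff_outer m A + ennreal e"
      using False \<open>0 < e\<close> by (auto simp: m_def ennreal_add_left_cancel_less less_top[symmetric] ennreal_lessI[of _ 0, simplified])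
    finally have "hausdorff_pre m r0 A < hausdorff_outer m A + ennreal e" .
    then obtain C where C: "A \<subseteq> (\<Union>i. C i)" "\<And>i. bounded (C i)" "\<And>i. diameter (C i) \<le> r0"
      "(\<Sum>i. ennreal (hausdorff_gauge m (C i))) < hausdorff_outer m A + ennreal e"
      using hausdorff_preE by metis
    have "\<exists>U\<in>sets borel. tube (C i \<inter> A) v (-l) l \<subseteq> U \<and>
        emeasure lborel U \<le> ennreal c * (ennreal (hausdorff_gauge m (C i)) + ennreal (e * (1/2) ^ Suc i))" for i
    proof (cases "C i \<inter> A = {}")
      case True
      then show ?thesis by (intro bexI[of _ "{}"]) (auto simp: tube_def)
    next
      case False
      then obtain y0 where y0: "y0 \<in> C i" "y0 \<in> A" by blast
      obtain r where r: "diameter (C i) < r" "r < diameter (C i) + r0"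
        "\<omega> * (r / 2) ^ m \<le> \<omega> * (diameter (C i) / 2) ^ m + e * (1/2) ^ Suc i"
        by (rule exists_slightly_larger_radius[OF \<open>0 < r0\<close>, of "e * (1/2) ^ Suc i" "diameter (C i)" \<omega> m]) (use \<open>0 < e\<close> in auto)
      have "0 < r" using r(1) diameter_ge_0[OF C(2), of i] by simp
      have "r \<le> 2 * r0" using r(2) C(3)[of i] by simp
      then have rl: "r \<le> l * norm v" "r \<le> \<delta> / ((M + 1) * norm v)" by (auto simp: r0_def)
      have "M * r * norm v \<le> (M + 1) * r * norm v" using \<open>0 < r\<close> by (intro mult_right_mono) auto
      also have "\<dots> = r * ((M + 1) * norm v)" by simp
      also have "\<dots> \<le> \<delta>" using rl(2) \<open>0 \<le> M\<close> \<open>v \<noteq> 0\<close> by (subst pos_le_divide_eq[symmetric]) auto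
      finally have Mr: "M * r * norm v \<le> \<delta>" .
      have dist: "norm (y - y0) \<le> r" if "y \<in> C i \<inter> A" for y
        using diameter_bounded_bound[OF C(2), of y i y0] that y0 r(1) by (auto simp: dist_norm)
      have "\<exists>U\<in>sets borel. tube (C i \<inter> A) v (-l) l \<subseteq> U \<and> emeasure lborel U \<le> ennreal (Q * r ^ m)"
        unfolding Q_def m_def
        using emeasure_flat_tube_le[OF n[OF y0(2)] \<open>0 < r\<close> \<open>0 < \<delta>\<close> \<open>v \<noteq> 0\<close> rl(1) Mr \<open>0 \<le> M\<close> nv(1)[OF y0(2)] nv(2)[OF y0(2)], of "C i \<inter> A" y0]
          dist flat y0 by blast
      moreover have "ennreal (Q * r ^ m) \<le> ennreal c * (ennreal (hausdorff_gauge m (C i)) + ennreal (e * (1/2) ^ Suc i))"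
      proof -
        have "Q * r ^ m = c * (\<omega> * (r / 2) ^ m)"
          using \<open>\<omega> > 0\<close> by (simp add: c_def QC power_divide)
        also have "\<dots> \<le> c * (\<omega> * (diameter (C i) / 2) ^ m + e * (1/2) ^ Suc i)"
          using r(3) \<open>c > 0\<close> by (intro mult_left_mono) auto
        also have "\<omega> * (diameter (C i) / 2) ^ m = hausdorff_gauge m (C i)"
          using y0 by (auto simp: hausdorff_gauge_def \<omega>_def)
        finally have "ennreal (Q * r ^ m) \<le> ennreal (c * (hausdorff_gauge m (C i) + e * (1/2) ^ Suc i))"
          by (rule ennreal_leI)
        then show ?thesis using \<open>c > 0\<close> \<open>0 < e\<close> hausdorff_gauge_nonneg[OF C(2), of m i]
          by (simp add: ennreal_mult ennreal_plus)
      qed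
      ultimately show ?thesis by (meson order_trans)
    qed
    then obtain U where U: "\<And>i. U i \<in> sets borel" "\<And>i. tube (C i \<inter> A) v (-l) l \<subseteq> U i"
      "\<And>i. emeasure lborel (U i) \<le> ennreal c * (ennreal (hausdorff_gauge m (C i)) + ennreal (e * (1/2) ^ Suc i))"
      by metis
    have "E \<subseteq> (\<Union>i. U i)"
    proof
      fix w assume "w \<in> E"
      then obtain y s where ys: "w = y + s *\<^sub>R v" "y \<in> A" "-l \<le> s" "s \<le> l" using E by (auto simp: tube_def)
      then obtain i where "y \<in> C i" using C(1) by blast
      then have "w \<in> tube (C i \<inter> A) v (-l) l" using ys unfolding tube_def by force
      then show "w \<in> (\<Union>i. U i)" using U(2) by blast
    qed
    then have "emeasure lborel E \<le> emeasure lborel (\<Union>i. U i)" using U(1) by (intro emeasure_mono) auto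
    also have "\<dots> \<le> (\<Sum>i. emeasure lborel (U i))" using U(1) by (intro emeasure_subadditive_countably) auto
    also have "\<dots> \<le> (\<Sum>i. ennreal c * (ennreal (hausdorff_gauge m (C i)) + ennreal (e * (1/2) ^ Suc i)))"
      by (intro suminf_le U(3)) auto
    also have "\<dots> = ennreal c * ((\<Sum>i. ennreal (hausdorff_gauge m (C i))) + (\<Sum>i. ennreal (e * (1/2) ^ Suc i)))"
      by (subst ennreal_suminf_cmult, subst suminf_add[symmetric]) auto
    also have "(\<Sum>i. ennreal (e * (1/2) ^ Suc i)) = ennreal e"
      using sums_mult[OF power_half_series, of e] \<open>0 < e\<close> by (intro suminf_ennreal_eq) auto
    finally show ?thesis using C(4)
      by (meson add_right_mono less_imp_le mult_left_mono order_trans zero_le)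
  qed
  have "emeasure lborel E \<le> ennreal c * hausdorff_outer m A"
  proof (rule ennreal_le_epsilon)
    fix e :: real assume "0 < e"
    define e' where "e' = e / (2 * c)"
    have "0 < e'" using \<open>0 < e\<close> \<open>c > 0\<close> by (simp add: e'_def)
    have "emeasure lborel E \<le> ennreal c * (hausdorff_outer m A + ennreal e' + ennreal e')" by (rule main) fact
    also have "\<dots> = ennreal c * hausdorff_outer m A + ennreal c * (ennreal e' + ennreal e')"
      by (simp add: distrib_left add.assoc)
    also have "ennreal c * (ennreal e' + ennreal e') = ennreal e"
      using \<open>0 < e'\<close> \<open>c > 0\<close> by (simp add: e'_def flip: ennreal_plus ennreal_mult)
    finally show "emeasure lborel E \<le> ennreal c * hausdorff_outer m A + ennreal e" .
  qed
  then show ?thesis by (simp add: c_def m_def)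
qed

text \<open>Near \<open>x0\<close> the difference of two points of the surface is almost orthogonal
  to \<open>G x0\<close>, by the mean value inequality for \<open>g\<close> minus its linear part,
  whereas \<open>v\<close> has a nonzero component along \<open>G x0\<close>. So a multiple of
  \<open>v\<close> can cancel only a fixed fraction of such a difference.\<close>

lemma closed_hypersurface_transversal:
  fixes S :: "'a::euclidean_space set"
  assumes U: "open U" "x0 \<in> U" "C1_with_gradient U g G" and v: "G x0 \<bullet> v \<noteq> 0" and SU: "\<And>y. y \<in> S \<inter> U \<Longrightarrow> g y = 0"
  shows "\<exists>r>0. \<exists>L\<ge>1. \<forall>y\<in>S \<inter> cball x0 r. \<forall>y'\<in>S \<inter> cball x0 r. \<forall>t. norm (y - y') \<le> L * norm (y - y' - t *\<^sub>R v)"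
proof -
  define c where "c = \<bar>G x0 \<bullet> v\<bar>"
  have "c > 0" using v by (simp add: c_def)
  have "v \<noteq> 0" using v by auto
  \<comment> \<open>The factor 1/2 makes the error term \<open>\<omega> * D / c * norm v\<close>
    equal to \<open>D / 2\<close>, which is absorbed into the left-hand side at the end.\<close>
  define \<omega> where "\<omega> = c / (2 * norm v)"
  have "\<omega> > 0" using \<open>c > 0\<close> \<open>v \<noteq> 0\<close> by (simp add: \<omega>_def)
  have "continuous_on U G" using U(3) by (simp add: C1_with_gradient_def)
  then obtain d1 where d1: "d1 > 0" "\<And>y. y \<in> U \<Longrightarrow> dist y x0 < d1 \<Longrightarrow> dist (G y) (G x0) < \<omega>"
    unfolding continuous_on_iff using U(2) \<open>\<omega> > 0\<close> by meson
  obtain d2 where d2: "d2 > 0" "cball x0 d2 \<subseteq> U" using U(1,2) open_contains_cball by blast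
  define r where "r = min (d1 / 2) d2"
  have r: "0 < r" "cball x0 r \<subseteq> U" "\<And>y. y \<in> cball x0 r \<Longrightarrow> norm (G y - G x0) \<le> \<omega>"
    using d1 d2 by (auto simp: r_def dist_commute dist_norm subset_eq less_imp_le)
  have flat: "\<bar>G x0 \<bullet> (y - y')\<bar> \<le> \<omega> * norm (y - y')" if "y \<in> S \<inter> cball x0 r" "y' \<in> S \<inter> cball x0 r" for y y'
  proof -
    have der: "((\<lambda>y. g y - G x0 \<bullet> y) has_derivative (\<lambda>h. G z \<bullet> h - G x0 \<bullet> h)) (at z within cball x0 r)" if "z \<in> cball x0 r" for z
    proof -
      have "GDERIV g z :> G z" using that r(2) U(3) by (auto simp: C1_with_gradient_def)
      then have "(g has_derivative (\<lambda>h. G z \<bullet> h)) (at z within cball x0 r)"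
        unfolding gderiv_def by (auto intro: has_derivative_at_withinI simp: inner_commute)
      then show ?thesis by (intro derivative_eq_intros) (auto intro!: derivative_eq_intros)
    qed
    have "onorm (\<lambda>h. G z \<bullet> h - G x0 \<bullet> h) \<le> \<omega>" if "z \<in> cball x0 r" for z
    proof (rule onorm_le)
      fix h
      have "norm (G z \<bullet> h - G x0 \<bullet> h) \<le> norm (G z - G x0) * norm h"
        using Cauchy_Schwarz_ineq2[of "G z - G x0" h] by (simp add: inner_diff_left)
      also have "\<dots> \<le> \<omega> * norm h" using r(3)[OF that] by (intro mult_right_mono) auto
      finally show "norm (G z \<bullet> h - G x0 \<bullet> h) \<le> \<omega> * norm h" .
    qed
    from differentiable_bound[OF convex_cball der this, of y y'] that
    have "norm ((g y - G x0 \<bullet> y) - (g y' - G x0 \<bullet> y')) \<le> \<omega> * norm (y - y')" by auto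
    moreover have "g y = 0" "g y' = 0" using that SU r(2) by auto
    ultimately show ?thesis by (simp add: inner_diff_right abs_minus_commute)
  qed
  define L where "L = 2 * (1 + norm (G x0) * norm v / c)"
  have "1 \<le> L" using \<open>c > 0\<close> by (auto simp: L_def add_increasing2)
  have "norm (y - y') \<le> L * norm (y - y' - t *\<^sub>R v)" if "y \<in> S \<inter> cball x0 r" "y' \<in> S \<inter> cball x0 r" for y y' t
  proof -
    define D W where "D = norm (y - y')" and "W = norm (y - y' - t *\<^sub>R v)"
    have DW: "D \<le> W + \<bar>t\<bar> * norm v"
      unfolding D_def W_def using norm_triangle_ineq[of "y - y' - t *\<^sub>R v" "t *\<^sub>R v"] by simp
    have "\<bar>t\<bar> * c \<le> norm (G x0) * W + \<omega> * D"
    proof -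
      have "t * (G x0 \<bullet> v) = G x0 \<bullet> (y - y') - G x0 \<bullet> (y - y' - t *\<^sub>R v)" by (simp add: algebra_simps)
      then have "\<bar>t\<bar> * c \<le> \<bar>G x0 \<bullet> (y - y')\<bar> + \<bar>G x0 \<bullet> (y - y' - t *\<^sub>R v)\<bar>"
        unfolding c_def by (simp flip: abs_mult)
      also have "\<dots> \<le> \<omega> * D + norm (G x0) * W"
        unfolding D_def W_def by (intro add_mono flat that Cauchy_Schwarz_ineq2)
      finally show ?thesis by simp
    qed
    then have "\<bar>t\<bar> * norm v \<le> (norm (G x0) * W + \<omega> * D) / c * norm v"
      using \<open>c > 0\<close> by (intro mult_right_mono) (auto simp: field_simps)
    also have "(norm (G x0) * W + \<omega> * D) / c * norm v = norm (G x0) * norm v / c * W + D / 2"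
      using \<open>c > 0\<close> \<open>v \<noteq> 0\<close> by (simp add: \<omega>_def field_simps)
    finally have "\<bar>t\<bar> * norm v \<le> norm (G x0) * norm v / c * W + D / 2" .
    with DW have "D / 2 \<le> W + norm (G x0) * norm v / c * W" by linarith
    then show ?thesis unfolding D_def W_def L_def by (simp add: algebra_simps)
  qed
  then show ?thesis using r(1) \<open>1 \<le> L\<close> by blast
qed

text \<open>A hypersurface is transversal to its own gradient, so near each point its measure is
  bounded by the volume of a bounded tube in that direction; compactness reduces the claim to
  finitely many such pieces. The lemma serves for velocity surfaces and for level sets of
  \<open>\<rho>\<close> alike.\<close>

lemma hausdorff_outer_closed_hypersurface_finite:
  fixes S :: "'a::euclidean_space set"
  assumes "closed_hypersurface S"
  shows "hausdorff_outer (DIM('a) - 1) S < \<infinity>"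
proof -
  have S: "compact S" using assms by (simp add: closed_hypersurface_def)
  have "\<exists>r>0. hausdorff_outer (DIM('a) - 1) (S \<inter> cball x r) < \<infinity>" if "x \<in> S" for x
  proof -
    from assms that obtain U g G where U: "open U" "x \<in> U" "C1_with_gradient U g G" "G x \<noteq> 0" "S \<inter> U = {y\<in>U. g y = 0}"
      unfolding closed_hypersurface_def by metis
    have "G x \<bullet> G x \<noteq> 0" using U(4) by simp
    from closed_hypersurface_transversal[OF U(1-3) this, of S] U(5)
    obtain r L where r: "0 < r" "1 \<le> L"
      "\<And>y y' t. y\<in>S \<inter> cball x r \<Longrightarrow> y'\<in>S \<inter> cball x r \<Longrightarrow> norm (y - y') \<le> L * norm (y - y' - t *\<^sub>R G x)" by blast
    have K: "compact (S \<inter> cball x r)" using S by (simp add: compact_Int)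
    from hausdorff_outer_le_tube[OF K zero_less_one U(4) r(2,3)]
    obtain C :: real where C: "hausdorff_outer (DIM('a) - 1) (S \<inter> cball x r) \<le> ennreal C * emeasure lborel (tube (S \<inter> cball x r) (G x) 0 1)"
      by auto
    also have "\<dots> < \<infinity>"
      using emeasure_bounded_finite[OF compact_imp_bounded[OF compact_tube[OF K]]] by (simp add: ennreal_mult_less_top)
    finally show ?thesis using r(1) by blast
  qed
  then obtain r where r: "\<And>x. x \<in> S \<Longrightarrow> 0 < r x" "\<And>x. x \<in> S \<Longrightarrow> hausdorff_outer (DIM('a) - 1) (S \<inter> cball x (r x)) < \<infinity>"
    by metis
  have "S \<subseteq> (\<Union>x\<in>S. ball x (r x))" using r(1) by fastforce
  from compactE_image[OF S _ this] obtain F where F: "F \<subseteq> S" "finite F" "S \<subseteq> (\<Union>x\<in>F. ball x (r x))" by auto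
  have "hausdorff_outer (DIM('a) - 1) (\<Union>x\<in>F. S \<inter> cball x (r x)) < \<infinity>"
    using F(2,1)
  proof (induction F rule: finite_induct)
    case (insert x F)
    have "hausdorff_outer (DIM('a) - 1) (\<Union>x\<in>insert x F. S \<inter> cball x (r x)) \<le>
      hausdorff_outer (DIM('a) - 1) (S \<inter> cball x (r x)) + hausdorff_outer (DIM('a) - 1) (\<Union>x\<in>F. S \<inter> cball x (r x))"
      using hausdorff_outer_Un by simp
    also have "\<dots> < \<infinity>" using insert r(2) by simp
    finally show ?case .
  qed (simp add: hausdorff_outer_empty)
  moreover have "S \<subseteq> (\<Union>x\<in>F. S \<inter> cball x (r x))" using F(3) by force
  ultimately show ?thesis using hausdorff_outer_mono le_less_trans by blast
qed

section \<open>Powers of extended nonnegative reals\<close>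

lemma ennpowr_zero [simp]: "ennpowr 0 r = 0"
  by (simp add: ennpowr_def)

lemma ennpowr_top [simp]: "ennpowr top r = top"
  by (simp add: ennpowr_def)

lemma ennpowr_ennreal: "0 \<le> x \<Longrightarrow> ennpowr (ennreal x) r = ennreal (x powr r)"
  by (simp add: ennpowr_def)

lemma ennpowr_one [simp]: "ennpowr a 1 = a"
  by (cases a) (auto simp: ennpowr_ennreal)

lemma ennpowr_mono: "a \<le> b \<Longrightarrow> 0 \<le> r \<Longrightarrow> ennpowr a r \<le> ennpowr b r"
  by (cases a; cases b) (auto simp: ennpowr_ennreal top_unique powr_mono2 intro!: ennreal_leI)

lemma ennpowr_eq_0_iff [simp]: "ennpowr a r = 0 \<longleftrightarrow> a = 0"
  by (cases a) (auto simp: ennpowr_ennreal)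

lemma ennpowr_eq_top_iff [simp]: "ennpowr a r = top \<longleftrightarrow> a = top"
  by (cases a) (auto simp: ennpowr_ennreal)

lemma ennpowr_mult: "ennpowr (a * b) r = ennpowr a r * ennpowr b r"
proof (cases "a = 0 \<or> b = 0")
  case False
  then show ?thesis
    by (cases a; cases b) (auto simp: ennpowr_ennreal powr_mult ennreal_mult_top ennreal_top_mult simp flip: ennreal_mult)
qed auto

lemma measurable_ennpowr [measurable]:
  assumes [measurable]: "f \<in> borel_measurable M"
  shows "(\<lambda>x. ennpowr (f x) r) \<in> borel_measurable M"
  unfolding ennpowr_def by measurable

lemma le_one_plus_ennpowr: "1 \<le> p \<Longrightarrow> a \<le> 1 + ennpowr a p"
proof (cases a)
  case (real x)
  assume "1 \<le> p"
  have "x \<le> 1 + x powr p"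
  proof (cases "x \<le> 1")
    case False
    then have "x powr 1 \<le> x powr p" using \<open>1 \<le> p\<close> by (intro powr_mono) auto
    then show ?thesis using real by simp
  qed (simp add: add_increasing2)
  then show ?thesis using real by (simp add: ennpowr_ennreal flip: ennreal_1 ennreal_plus)
qed simp

lemma ennpowr_add_le:
  assumes "1 \<le> p"
  shows "ennpowr (a + b) p \<le> ennreal (2 powr p) * (ennpowr a p + ennpowr b p)"
proof -
  have "ennpowr (a + b) p \<le> ennpowr (ennreal 2 * max a b) p"
    using assms by (intro ennpowr_mono) (auto simp: mult_2 intro!: add_mono)
  also have "\<dots> = ennreal (2 powr p) * ennpowr (max a b) p"
    by (subst ennpowr_mult) (simp only: ennpowr_ennreal[of 2])
  also have "\<dots> \<le> ennreal (2 powr p) * (ennpowr a p + ennpowr b p)"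
    by (intro mult_left_mono) (auto simp: max_def)
  finally show ?thesis .
qed

text \<open>In the proof of Hoelder's inequality \<open>a\<close> and \<open>b\<close> are the two
  integrals on the right; with this normalisation the integrated bracket equals
  \<open>(1 - 1 / p) + 1 / p = 1\<close>.\<close>

lemma Young_ennreal:
  fixes f g :: ennreal
  assumes "1 < p" "0 < a" "0 < b"
  shows "f * g \<le> ennreal (a powr (1 - 1 / p) * b powr (1 / p)) *
    (ennreal ((1 - 1 / p) / a) * ennpowr f (p / (p - 1)) + ennreal (1 / (p * b)) * ennpowr g p)"
proof (cases "f = 0 \<or> g = 0")
  case False
  have "1 - 1 / p > 0" using assms by simp
  then have pos: "0 < (1 - 1 / p) / a" "0 < 1 / (p * b)" "0 < a powr (1 - 1 / p) * b powr (1 / p)" using assms by auto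
  have top1: "ennreal c * (ennreal d * top + w) = top" "ennreal c * (w + ennreal d * top) = top" if "0 < c" "0 < d" for c d w
    using that by (auto simp: ennreal_mult_top)
  show ?thesis
  proof (cases f)
    case (real x)
    show ?thesis
    proof (cases g)
      case (real y)
      have xy: "0 < x" "0 < y" using False \<open>f = ennreal x\<close> real \<open>0 \<le> x\<close> by (auto simp: less_le)
      have "(x powr (p / (p - 1)) / a) powr (1 - 1 / p) * (y powr p / b) powr (1 / p)
         \<le> (1 - 1 / p) * (x powr (p / (p - 1)) / a) + 1 / p * (y powr p / b)"
        using assms xy by (intro Youngs_inequality_0) auto
      moreover have "(x powr (p / (p - 1))) powr (1 - 1 / p) = x"
      proof -
        have "p / (p - 1) * (1 - 1 / p) = 1" using assms by (simp add: field_simps)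
        then show ?thesis using xy by (simp only: powr_powr powr_one)
      qed
      moreover have "(y powr p) powr (1 / p) = y" using assms xy by (simp add: powr_powr)
      ultimately have "x / a powr (1 - 1 / p) * (y / b powr (1 / p)) \<le> (1 - 1 / p) / a * x powr (p / (p - 1)) + 1 / (p * b) * y powr p"
        using assms xy by (simp add: powr_divide)
      then have "x * y \<le> a powr (1 - 1 / p) * b powr (1 / p) * ((1 - 1 / p) / a * x powr (p / (p - 1)) + 1 / (p * b) * y powr p)"
        using pos by (simp add: pos_divide_le_eq mult.commute)
      then show ?thesis
      proof -
        have "ennreal (x * y) \<le> ennreal (a powr (1 - 1 / p) * b powr (1 / p) * ((1 - 1 / p) / a * x powr (p / (p - 1)) + 1 / (p * b) * y powr p))"
          by (rule ennreal_leI) fact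
        moreover have "ennreal (c * (d * u + e * w)) = ennreal c * (ennreal d * ennreal u + ennreal e * ennreal w)"
          if "0 < c" "0 < d" "0 < e" "0 \<le> u" "0 \<le> w" for c d e u w
          using that by (simp add: ennreal_mult ennreal_plus)
        ultimately show ?thesis
          using pos xy unfolding real \<open>f = ennreal x\<close>
          by (simp only: ennpowr_ennreal ennreal_mult less_imp_le powr_ge_zero)
      qed
    next
      case top
      then show ?thesis by (simp only: ennpowr_top top1(2)[OF pos(3,2)]) simp
    qed
  next
    case top
    then show ?thesis by (simp only: ennpowr_top top1(1)[OF pos(3,1)]) simp
  qed
qed auto

text \<open>Taking the \<open>p\<close>-th power of the usual inequality produces the exponent
  \<open>p - 1\<close> that occurs in the mixed norm of \<open>k\<close>. The cases in which one of
  the integrals is 0 or infinite are separated off because Young's inequality is used with both as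
  divisors.\<close>

lemma Hoelder_ennpowr:
  assumes [measurable]: "f \<in> borel_measurable M" "g \<in> borel_measurable M" and p: "1 < p"
  shows "ennpowr (\<integral>\<^sup>+x. f x * g x \<partial>M) p \<le> ennpowr (\<integral>\<^sup>+x. ennpowr (f x) (p / (p - 1)) \<partial>M) (p - 1) * (\<integral>\<^sup>+x. ennpowr (g x) p \<partial>M)"
    (is "ennpowr ?I p \<le> ennpowr ?A (p - 1) * ?B")
proof (cases "?A = 0 \<or> ?B = 0")
  case True
  then have "AE x in M. f x * g x = 0"
  proof
    assume "?A = 0"
    then have "AE x in M. f x = 0" by (subst (asm) nn_integral_0_iff_AE) auto
    then show ?thesis by auto
  next
    assume "?B = 0"
    then have "AE x in M. g x = 0" by (subst (asm) nn_integral_0_iff_AE) auto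
    then show ?thesis by auto
  qed
  then have "?I = 0" by (subst nn_integral_0_iff_AE) auto
  then show ?thesis by simp
next
  case False
  show ?thesis
  proof (cases "?A = top \<or> ?B = top")
    case True
    then show ?thesis using False by (auto simp: ennreal_mult_top ennreal_top_mult)
  next
    case fin: False
    obtain a where a: "?A = ennreal a" "0 < a" using False fin by (cases "?A") (auto simp: less_le)
    obtain b where b: "?B = ennreal b" "0 < b" using False fin by (cases "?B") (auto simp: less_le)
    define c where "c = a powr (1 - 1 / p) * b powr (1 / p)"
    have c: "0 < c" using a b by (simp add: c_def)
    have q: "0 < 1 - 1 / p" using p by simp
    have "?I \<le> (\<integral>\<^sup>+x. ennreal c * (ennreal ((1 - 1 / p) / a) * ennpowr (f x) (p / (p - 1)) + ennreal (1 / (p * b)) * ennpowr (g x) p) \<partial>M)"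
      unfolding c_def by (intro nn_integral_mono Young_ennreal a b p)
    also have "\<dots> = ennreal c * (ennreal ((1 - 1 / p) / a) * ?A + ennreal (1 / (p * b)) * ?B)"
      by (simp add: nn_integral_cmult nn_integral_add)
    also have "ennreal ((1 - 1 / p) / a) * ?A = ennreal (1 - 1 / p)"
      using a q by (simp add: a(1) flip: ennreal_mult)
    also have "ennreal (1 / (p * b)) * ?B = ennreal (1 / p)"
      using b p by (simp add: b(1) flip: ennreal_mult)
    also have "ennreal (1 - 1 / p) + ennreal (1 / p) = 1"
      using q p by (simp flip: ennreal_plus)
    finally have "ennpowr ?I p \<le> ennpowr (ennreal c) p" using p by (intro ennpowr_mono) auto
    also have "\<dots> = ennreal (a powr (p - 1) * b)"
    proof -
      have "(1 - 1 / p) * p = p - 1" using p by (simp add: field_simps)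
      then show ?thesis using a b p c unfolding c_def
        by (simp add: ennpowr_ennreal powr_mult powr_powr)
    qed
    also have "\<dots> = ennpowr ?A (p - 1) * ?B" using a b by (simp add: ennpowr_ennreal ennreal_mult)
    finally show ?thesis .
  qed
qed

lemma Jensen_ennpowr:
  assumes [measurable]: "g \<in> borel_measurable M" and p: "1 \<le> p" and M: "emeasure M (space M) = ennreal c" "0 \<le> c"
  shows "ennpowr (\<integral>\<^sup>+x. g x \<partial>M) p \<le> ennreal (c powr (p - 1)) * (\<integral>\<^sup>+x. ennpowr (g x) p \<partial>M)"
proof (cases "c = 0")
  case True
  then have "AE x in M. False" using M by (auto intro!: AE_I[of _ _ "space M"])
  then have "(\<integral>\<^sup>+x. g x \<partial>M) = 0" by (subst nn_integral_0_iff_AE) auto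
  then show ?thesis by simp
next
  case False
  show ?thesis
  proof (cases "p = 1")
    case True
    then show ?thesis using False M(2) by simp
  next
    case False
    have "ennpowr (\<integral>\<^sup>+x. 1 * g x \<partial>M) p \<le> ennpowr (\<integral>\<^sup>+x. ennpowr 1 (p / (p - 1)) \<partial>M) (p - 1) * (\<integral>\<^sup>+x. ennpowr (g x) p \<partial>M)"
      using p False by (intro Hoelder_ennpowr) auto
    moreover have "ennpowr 1 r = 1" for r using ennpowr_ennreal[of 1 r] by simp
    ultimately show ?thesis using M by (simp add: ennpowr_ennreal)
  qed
qed

text \<open>Used with the contraction kernel as density, with the indicator of a chord, and with a
  geometric sequence on the natural numbers; the total mass \<open>c\<close> is not normalised to
  1.\<close>

lemma Jensen_density:
  assumes [measurable]: "g \<in> borel_measurable M" "\<kappa> \<in> borel_measurable M" and p: "1 \<le> p"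
    and c: "(\<integral>\<^sup>+x. \<kappa> x \<partial>M) = ennreal c" "0 \<le> c"
  shows "ennpowr (\<integral>\<^sup>+x. \<kappa> x * g x \<partial>M) p \<le> ennreal (c powr (p - 1)) * (\<integral>\<^sup>+x. \<kappa> x * ennpowr (g x) p \<partial>M)"
proof -
  have "emeasure (density M \<kappa>) (space (density M \<kappa>)) = ennreal c"
    using c by (simp add: emeasure_density cong: nn_integral_cong)
  from Jensen_ennpowr[of g "density M \<kappa>", OF _ p this c(2)] show ?thesis
    by (simp add: nn_integral_density)
qed

text \<open>Jensen's inequality for the weights \<open>(1/2) ^ (n + 1)\<close> on the natural
  numbers. It replaces Minkowski's inequality for series at the price of a geometric factor, which
  the contraction rate can absorb.\<close>

lemma ennpowr_suminf_le:
  assumes p: "1 \<le> p"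
  shows "ennpowr (\<Sum>n. G n) p \<le> (\<Sum>n. ennreal (2 powr (real (Suc n) * (p - 1))) * ennpowr (G n) p)"
proof -
  define \<kappa> :: "nat \<Rightarrow> ennreal" where "\<kappa> n = ennreal ((1/2) ^ Suc n)" for n
  define g where "g n = ennreal (2 ^ Suc n) * G n" for n
  have \<kappa>: "(\<integral>\<^sup>+n. \<kappa> n \<partial>count_space UNIV) = ennreal 1"
    unfolding \<kappa>_def nn_integral_count_space_nat using power_half_series by (intro suminf_ennreal_eq) auto
  have \<kappa>g: "\<kappa> n * g n = G n" for n
  proof -
    have "\<kappa> n * ennreal (2 ^ Suc n) = 1" unfolding \<kappa>_def
      by (subst ennreal_mult[symmetric]) (auto simp flip: power_mult_distrib power_Suc)
    then show ?thesis by (simp add: g_def flip: mult.assoc)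
  qed
  have \<kappa>gp: "\<kappa> n * ennpowr (g n) p = ennreal (2 powr (real (Suc n) * (p - 1))) * ennpowr (G n) p" for n
  proof -
    have "(1/2) ^ Suc n * (2 ^ Suc n) powr p = 2 powr (real (Suc n) * (p - 1))"
    proof -
      have "(2::real) ^ Suc n = 2 powr real (Suc n)" by (simp add: powr_realpow[symmetric] del: power_Suc)
      moreover have "(1/2::real) ^ Suc n = 2 powr (- real (Suc n))"
        by (simp add: powr_minus powr_realpow power_one_over inverse_eq_divide del: power_Suc of_nat_Suc)
      ultimately show ?thesis by (simp only: powr_powr powr_add[symmetric]) (simp add: algebra_simps)
    qed
    then have "\<kappa> n * ennreal ((2 ^ Suc n) powr p) = ennreal (2 powr (real (Suc n) * (p - 1)))"
      unfolding \<kappa>_def by (simp only: ennreal_mult[symmetric] powr_ge_zero zero_le_power zero_le_divide_1_iff zero_le_numeral)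
    moreover have "ennpowr (ennreal (2 ^ Suc n)) p = ennreal ((2 ^ Suc n) powr p)"
      by (rule ennpowr_ennreal) simp
    ultimately show ?thesis unfolding g_def ennpowr_mult by (simp add: mult.assoc[symmetric])
  qed
  have "ennpowr (\<integral>\<^sup>+n. \<kappa> n * g n \<partial>count_space UNIV) p \<le> ennreal (1 powr (p - 1)) * (\<integral>\<^sup>+n. \<kappa> n * ennpowr (g n) p \<partial>count_space UNIV)"
    by (rule Jensen_density) (use p \<kappa> in auto)
  then show ?thesis unfolding \<kappa>g \<kappa>gp by (simp add: nn_integral_count_space_nat)
qed

text \<open>All consequences of dominated convergence for a series, derived from the single
  finiteness statement that the majorants provide.\<close>

lemma integral_dominated_series:
  fixes f :: "nat \<Rightarrow> 'b \<Rightarrow> real"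
  assumes [measurable]: "\<And>n. f n \<in> borel_measurable M" and fin: "(\<integral>\<^sup>+x. (\<Sum>n. ennreal \<bar>f n x\<bar>) \<partial>M) < \<infinity>"
  shows "AE x in M. summable (\<lambda>n. \<bar>f n x\<bar>)" "integrable M (\<lambda>x. \<Sum>n. f n x)"
    "(\<lambda>n. \<integral>x. f n x \<partial>M) sums (\<integral>x. (\<Sum>n. f n x) \<partial>M)" "summable (\<lambda>n. \<bar>\<integral>x. f n x \<partial>M\<bar>)"
proof -
  have sum: "(\<Sum>n. \<integral>\<^sup>+x. ennreal \<bar>f n x\<bar> \<partial>M) < \<infinity>"
    using fin by (subst nn_integral_suminf[symmetric]) auto
  then have "(\<integral>\<^sup>+x. ennreal \<bar>f n x\<bar> \<partial>M) < \<infinity>" for n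
    using ennreal_suminf_lessD[of "\<lambda>n. \<integral>\<^sup>+x. ennreal \<bar>f n x\<bar> \<partial>M" top n] by simp
  then have int: "integrable M (f n)" for n by (intro integrableI_bounded) auto
  have "AE x in M. (\<Sum>n. ennreal \<bar>f n x\<bar>) \<noteq> \<infinity>"
    using fin by (intro nn_integral_noteq_infinite) auto
  then show ae: "AE x in M. summable (\<lambda>n. \<bar>f n x\<bar>)"
    by eventually_elim (auto intro: summable_suminf_not_top)
  then have ae': "AE x in M. summable (\<lambda>n. norm (f n x))" by simp
  have "(\<integral>\<^sup>+x. ennreal \<bar>f n x\<bar> \<partial>M) = ennreal (\<integral>x. norm (f n x) \<partial>M)" for n
    using int[of n] by (subst nn_integral_eq_integral) auto
  then have s: "summable (\<lambda>n. \<integral>x. norm (f n x) \<partial>M)"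
    using sum by (intro summable_suminf_not_top) auto
  show "integrable M (\<lambda>x. \<Sum>n. f n x)" by (rule integrable_suminf[OF int ae' s])
  show "(\<lambda>n. \<integral>x. f n x \<partial>M) sums (\<integral>x. (\<Sum>n. f n x) \<partial>M)" by (rule sums_integral[OF int ae' s])
  show "summable (\<lambda>n. \<bar>\<integral>x. f n x \<partial>M\<bar>)"
    by (rule summable_comparison_test[OF _ s]) (auto intro!: exI[of _ 0] order_trans[OF integral_abs_bound])
qed

section \<open>Translation invariance and line segments inside a set\<close>

lemma nn_integral_lborel_shift:
  fixes f :: "'a::euclidean_space \<Rightarrow> ennreal"
  assumes [measurable]: "f \<in> borel_measurable borel"
  shows "(\<integral>\<^sup>+x. f (x + c) \<partial>lborel) = (\<integral>\<^sup>+x. f x \<partial>lborel)"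
proof -
  have "(\<integral>\<^sup>+x. f x \<partial>lborel) = (\<integral>\<^sup>+x. f x \<partial>distr lborel borel ((+) c))" by (simp add: lborel_distr_plus)
  also have "\<dots> = (\<integral>\<^sup>+x. f (x + c) \<partial>lborel)" by (subst nn_integral_distr) (auto simp: add.commute)
  finally show ?thesis by simp
qed

lemma integral_lborel_shift:
  fixes f :: "'a::euclidean_space \<Rightarrow> real"
  assumes [measurable]: "f \<in> borel_measurable borel"
  shows "(\<integral>x. f (x + c) \<partial>lborel) = (\<integral>x. f x \<partial>lborel)"
proof -
  have "(\<integral>x. f x \<partial>lborel) = (\<integral>x. f x \<partial>distr lborel borel ((+) c))" by (simp add: lborel_distr_plus)
  also have "\<dots> = (\<integral>x. f (x + c) \<partial>lborel)" by (subst integral_distr) (auto simp: add.commute)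
  finally show ?thesis by simp
qed

text \<open>A phase point is a pair \<open>z = (x, v)\<close>; times along its line may have either sign.\<close>

definition seg :: "'a::real_vector set \<Rightarrow> 'a \<times> 'a \<Rightarrow> real \<Rightarrow> bool" where
  "seg X z t \<longleftrightarrow> (\<forall>s\<in>{0..1}. fst z + (s * t) *\<^sub>R snd z \<in> X)"

definition flow :: "real \<Rightarrow> 'a::real_vector \<times> 'a \<Rightarrow> 'a \<times> 'a" where
  "flow t z = (fst z + t *\<^sub>R snd z, snd z)"

lemma fst_flow [simp]: "fst (flow t z) = fst z + t *\<^sub>R snd z" and snd_flow [simp]: "snd (flow t z) = snd z"
  by (auto simp: flow_def)

lemma flow_flow [simp]: "flow s (flow t z) = flow (s + t) z"
  by (auto simp: flow_def algebra_simps)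

lemma flow_0 [simp]: "flow 0 z = z"
  by (simp add: flow_def)

text \<open>The parameter range \<open>{0..1}\<close> of the definition suits the compactness
  argument in \<open>open_seg\<close>; the present form, with both signs of \<open>t\<close>
  explicit, is the one for computations.\<close>

lemma seg_iff: "seg X z t \<longleftrightarrow> (\<forall>r. (0 \<le> r \<and> r \<le> t \<or> t \<le> r \<and> r \<le> 0) \<longrightarrow> fst z + r *\<^sub>R snd z \<in> X)"
proof
  assume L: "seg X z t"
  show "\<forall>r. (0 \<le> r \<and> r \<le> t \<or> t \<le> r \<and> r \<le> 0) \<longrightarrow> fst z + r *\<^sub>R snd z \<in> X"
  proof (intro allI impI)
    fix r assume r: "0 \<le> r \<and> r \<le> t \<or> t \<le> r \<and> r \<le> 0"
    show "fst z + r *\<^sub>R snd z \<in> X"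
    proof (cases "t = 0")
      case True
      then have "r = 0" using r by auto
      then show ?thesis using L[unfolded seg_def] by (auto dest: bspec[of _ _ 0])
    next
      case False
      then have "r / t \<in> {0..1}" "r / t * t = r" using r by (auto simp: divide_le_eq zero_le_divide_iff)
      then show ?thesis using L unfolding seg_def by metis
    qed
  qed
next
  assume R: "\<forall>r. (0 \<le> r \<and> r \<le> t \<or> t \<le> r \<and> r \<le> 0) \<longrightarrow> fst z + r *\<^sub>R snd z \<in> X"
  show "seg X z t" unfolding seg_def
  proof
    fix s :: real assume s: "s \<in> {0..1}"
    have "0 \<le> s * t \<and> s * t \<le> t \<or> t \<le> s * t \<and> s * t \<le> 0"
      using s by (cases "0 \<le> t") (auto simp: mult_left_le_one_le mult_nonneg_nonpos intro: mult_right_mono[of s 1 t, simplified] mult_right_mono_neg[of s 1 t, simplified])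
    then show "fst z + (s * t) *\<^sub>R snd z \<in> X" using R by blast
  qed
qed

lemma seg_0 [simp]: "seg X z 0 \<longleftrightarrow> fst z \<in> X"
  by (simp add: seg_def) (meson atLeastAtMost_iff zero_le_one order_refl)

lemma seg_in: "seg X z t \<Longrightarrow> fst z \<in> X" "seg X z t \<Longrightarrow> fst z + t *\<^sub>R snd z \<in> X"
  by (auto simp: seg_iff)

lemma seg_flow_iff: "seg X z t \<Longrightarrow> seg X (flow t z) s \<longleftrightarrow> seg X z (s + t)"
proof -
  assume t: "seg X z t"
  have eq: "fst z + t *\<^sub>R snd z + r *\<^sub>R snd z = fst z + (r + t) *\<^sub>R snd z" for r
    by (simp add: algebra_simps)
  show ?thesis
  proof
    assume s: "seg X (flow t z) s"
    show "seg X z (s + t)" unfolding seg_iff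
    proof (intro allI impI)
      fix r assume r: "0 \<le> r \<and> r \<le> s + t \<or> s + t \<le> r \<and> r \<le> 0"
      show "fst z + r *\<^sub>R snd z \<in> X"
      proof (cases "0 \<le> r \<and> r \<le> t \<or> t \<le> r \<and> r \<le> 0")
        case True then show ?thesis using t by (auto simp: seg_iff)
      next
        case False
        then have "0 \<le> r - t \<and> r - t \<le> s \<or> s \<le> r - t \<and> r - t \<le> 0" using r by linarith
        then have "fst (flow t z) + (r - t) *\<^sub>R snd (flow t z) \<in> X" using s unfolding seg_iff by blast
        then show ?thesis by (simp add: eq)
      qed
    qed
  next
    assume s: "seg X z (s + t)"
    show "seg X (flow t z) s" unfolding seg_iff
    proof (intro allI impI)
      fix r assume r: "0 \<le> r \<and> r \<le> s \<or> s \<le> r \<and> r \<le> 0"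
      have "fst z + (r + t) *\<^sub>R snd z \<in> X"
      proof (cases "0 \<le> r + t \<and> r + t \<le> t \<or> t \<le> r + t \<and> r + t \<le> 0")
        case True then show ?thesis using t unfolding seg_iff by blast
      next
        case False
        then have "0 \<le> r + t \<and> r + t \<le> s + t \<or> s + t \<le> r + t \<and> r + t \<le> 0" using r by linarith
        then show ?thesis using s unfolding seg_iff by blast
      qed
      then show "fst (flow t z) + r *\<^sub>R snd (flow t z) \<in> X" by (simp add: eq)
    qed
  qed
qed

lemma seg_flow_minus_iff: "(fst (flow (-t) z) \<in> X \<and> seg X (flow (-t) z) t) \<longleftrightarrow> seg X z (-t)"
proof
  assume "fst (flow (-t) z) \<in> X \<and> seg X (flow (-t) z) t"
  then have s: "seg X (flow (-t) z) t" by simp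
  from seg_flow_iff[OF s, of "-t"] show "seg X z (-t)" using seg_in(1)[OF s] by simp
next
  assume s: "seg X z (-t)"
  from seg_flow_iff[OF s, of t] seg_in[OF s] show "fst (flow (-t) z) \<in> X \<and> seg X (flow (-t) z) t" by simp
qed

text \<open>The complement is the projection of a closed set along the compact interval
  \<open>{0..1}\<close> and therefore closed. Measurability of everything defined by chords rests on
  this.\<close>

lemma open_seg:
  fixes X :: "'a::euclidean_space set"
  assumes "open X"
  shows "open {p. seg X (fst p) (snd p)}"
proof -
  define C :: "(real \<times> ('a \<times> 'a) \<times> real) set" where
    "C = ({0..1} \<times> UNIV) \<inter> (\<lambda>q. fst (fst (snd q)) + (fst q * snd (snd q)) *\<^sub>R snd (fst (snd q))) -` (- X)"
  have "closed ((\<lambda>q :: real \<times> ('a \<times> 'a) \<times> real. fst (fst (snd q)) + (fst q * snd (snd q)) *\<^sub>R snd (fst (snd q))) -` (- X))"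
    using assms by (intro closed_vimage continuous_intros) auto
  then have "closedin (top_of_set ({0..1} \<times> UNIV)) C"
    unfolding C_def by (rule closedin_closed_Int)
  then have "closed {y. \<exists>x. x \<in> {0..1} \<and> (x, y) \<in> C}"
    using closedin_compact_projection[of "{0..1::real}" UNIV C] by simp
  moreover have "{y. \<exists>x. x \<in> {0..1} \<and> (x, y) \<in> C} = - {p. seg X (fst p) (snd p)}"
    by (force simp: C_def seg_def)
  ultimately show ?thesis by (simp add: open_closed)
qed

section \<open>Chords of a bounded open set\<close>

lemma borel_measurable_fst [measurable (raw)]:
  fixes f :: "'b \<Rightarrow> 'a::second_countable_topology \<times> 'c::second_countable_topology"
  assumes "f \<in> borel_measurable M"
  shows "(\<lambda>x. fst (f x)) \<in> borel_measurable M"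
  by (rule measurable_compose[OF assms[folded borel_prod] measurable_fst])

lemma borel_measurable_snd [measurable (raw)]:
  fixes f :: "'b \<Rightarrow> 'a::second_countable_topology \<times> 'c::second_countable_topology"
  assumes "f \<in> borel_measurable M"
  shows "(\<lambda>x. snd (f x)) \<in> borel_measurable M"
  by (rule measurable_compose[OF assms[folded borel_prod] measurable_snd])

lemma borel_measurable_flow [measurable (raw)]:
  fixes f :: "'b \<Rightarrow> 'a::euclidean_space \<times> 'a"
  assumes [measurable]: "t \<in> borel_measurable M" "f \<in> borel_measurable M"
  shows "(\<lambda>x. flow (t x) (f x)) \<in> borel_measurable M"
  unfolding flow_def by measurable

text \<open>The integral of \<open>oriented_indicator a b s * f s\<close> over \<open>s\<close> is the oriented integral of \<open>f\<close> from \<open>a\<close> to \<open>b\<close>.\<close>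

definition oriented_indicator :: "real \<Rightarrow> real \<Rightarrow> real \<Rightarrow> real" where
  "oriented_indicator a b s = (if s < b then 1 else 0) - (if s < a then 1 else 0)"

lemma oriented_indicator_measurable [measurable (raw)]:
  assumes [measurable]: "f \<in> borel_measurable M" "g \<in> borel_measurable M" "h \<in> borel_measurable M"
  shows "(\<lambda>x. oriented_indicator (f x) (g x) (h x)) \<in> borel_measurable M"
  unfolding oriented_indicator_def by measurable

lemma abs_oriented_indicator_le: "\<bar>oriented_indicator a b s\<bar> \<le> 1"
  by (auto simp: oriented_indicator_def)

lemma oriented_indicator_cases: "oriented_indicator a b s = 0 \<or> oriented_indicator a b s = 1 \<or> oriented_indicator a b s = -1"
  by (auto simp: oriented_indicator_def)

locale transport_domain =
  fixes X V :: "'a::euclidean_space set" and D :: "'a measure"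
  assumes open_X: "open X" and bounded_X: "bounded X"
    and sets_D [measurable_cong, simp]: "sets D = sets borel" and finite_D: "finite_measure D"
    and D_V: "AE v in D. v \<in> V" and V_low: "\<exists>r>0. \<forall>v\<in>V. r \<le> norm v"
begin

sublocale D: finite_measure D by (rule finite_D)
sublocale P: pair_sigma_finite lborel D ..

abbreviation N :: "('a \<times> 'a) measure" where "N \<equiv> lborel \<Otimes>\<^sub>M D"

lemma space_D [simp]: "space D = UNIV"
  using sets_eq_imp_space_eq[OF sets_D] by simp

lemma sets_N [measurable_cong, simp]: "sets N = sets borel"
  unfolding borel_prod[symmetric] by (rule sets_pair_measure_cong[OF sets_lborel sets_D])

lemma space_N [simp]: "space N = UNIV"
  by (simp add: space_pair_measure)

lemma V_nz: "v \<in> V \<Longrightarrow> v \<noteq> 0"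
  using V_low by auto

lemma AE_N_V: "AE z in N. snd z \<in> V"
proof -
  have "AE x in lborel. AE y in D. snd (x, y) \<in> V" using D_V by simp
  obtain B where B: "B \<in> null_sets D" "{v. v \<notin> V} \<subseteq> B"
    using D_V by (auto simp: eventually_ae_filter)
  have "UNIV \<times> B \<in> null_sets N"
  proof (rule null_setsI)
    have "emeasure N (UNIV \<times> B) = emeasure lborel (UNIV :: 'a set) * emeasure D B"
      using B(1) by (intro D.emeasure_pair_measure_Times) auto
    then show "emeasure N (UNIV \<times> B) = 0" using B(1) by (simp add: null_setsD1)
    have "UNIV \<times> B \<in> sets (borel \<Otimes>\<^sub>M borel)" using B(1) by (intro pair_measureI) auto
    then show "UNIV \<times> B \<in> sets N" by (simp add: borel_prod)
  qed
  then show ?thesis by (rule AE_I') (use B(2) in auto)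
qed

lemma X_sets [measurable]: "X \<in> sets borel"
  using open_X by simp

lemma seg_measurable [measurable (raw)]:
  assumes [measurable]: "f \<in> borel_measurable M" "t \<in> borel_measurable M"
  shows "Measurable.pred M (\<lambda>x. seg X (f x) (t x))"
proof -
  have "(\<lambda>x. (f x, t x)) \<in> borel_measurable M" by measurable
  moreover have "{p. seg X (fst p) (snd p)} \<in> sets borel" using open_seg[OF open_X] by simp
  ultimately have "(\<lambda>x. (f x, t x)) -` {p. seg X (fst p) (snd p)} \<inter> space M \<in> sets M" by (rule measurable_sets)
  then show ?thesis by (simp add: pred_def vimage_def Int_def conj_commute)
qed

lemma nn_integral_N: "f \<in> borel_measurable borel \<Longrightarrow> (\<integral>\<^sup>+z. f z \<partial>N) = (\<integral>\<^sup>+x. \<integral>\<^sup>+v. f (x, v) \<partial>D \<partial>lborel)"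
  by (rule D.nn_integral_fst[symmetric]) (simp add: measurable_cong_sets[OF sets_N])

lemma nn_integral_N': "f \<in> borel_measurable borel \<Longrightarrow> (\<integral>\<^sup>+z. f z \<partial>N) = (\<integral>\<^sup>+v. \<integral>\<^sup>+x. f (x, v) \<partial>lborel \<partial>D)"
  by (rule P.nn_integral_snd[symmetric]) (simp add: measurable_cong_sets[OF sets_N])

text \<open>The length of the chord through \<open>z\<close>, written as an integral because this makes it measurable in \<open>z\<close>;
  its real part \<open>T\<close> is \<open>\<tau>\<close>.\<close>

definition L :: "'a \<times> 'a \<Rightarrow> ennreal" where
  "L z = (\<integral>\<^sup>+t. (if seg X z t then 1 else 0) \<partial>lborel)"

lemma L_measurable [measurable]: "L \<in> borel_measurable borel"
  unfolding L_def by measurable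

text \<open>Boundedness of \<open>X\<close> and \<open>v \<noteq> 0\<close> make the sets in the
  definition of the exit times nonempty, so that \<open>Inf\<close> has its meaning; openness of
  \<open>X\<close> makes all the inequalities strict.\<close>

lemma seg_iff_tau:
  assumes "x \<in> X" "v \<noteq> 0"
  shows "0 < tau_plus X x v" "0 < tau_minus X x v" "seg X (x, v) t \<longleftrightarrow> - tau_minus X x v < t \<and> t < tau_plus X x v"
proof -
  obtain R where R: "\<And>y. y \<in> X \<Longrightarrow> norm (y - x) \<le> R"
    using bounded_X unfolding bounded_any_center[of _ x] by (auto simp: dist_norm norm_minus_commute)
  have key: "0 < Inf {s. s > 0 \<and> x + s *\<^sub>R w \<notin> X} \<and>
     (\<forall>t\<ge>0. seg X (x, w) t \<longleftrightarrow> t < Inf {s. s > 0 \<and> x + s *\<^sub>R w \<notin> X})" if "w \<noteq> 0" for w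
  proof -
    define T where "T = {s. s > 0 \<and> x + s *\<^sub>R w \<notin> X}"
    have "(\<bar>R\<bar> + 1) / norm w \<in> T"
    proof -
      have "norm ((x + ((\<bar>R\<bar> + 1) / norm w) *\<^sub>R w) - x) = \<bar>R\<bar> + 1" using that by simp
      then have "x + ((\<bar>R\<bar> + 1) / norm w) *\<^sub>R w \<notin> X" using R[of "x + ((\<bar>R\<bar> + 1) / norm w) *\<^sub>R w"] by auto
      then show ?thesis using that by (simp add: T_def)
    qed
    then have ne: "T \<noteq> {}" by blast
    have bdd: "bdd_below T" by (auto simp: T_def bdd_below_def intro!: exI[of _ 0])
    have iff: "seg X (x, w) t \<longleftrightarrow> t < Inf T" if "0 \<le> t" for t
    proof
      assume s: "seg X (x, w) t"
      have "open ((\<lambda>r. x + r *\<^sub>R w) -` X)" by (intro open_vimage open_X continuous_intros)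
      moreover have "t \<in> (\<lambda>r. x + r *\<^sub>R w) -` X" using seg_in(2)[OF s] by simp
      ultimately obtain d where d: "d > 0" "\<And>r. \<bar>r - t\<bar> < d \<Longrightarrow> x + r *\<^sub>R w \<in> X"
        unfolding open_dist by (auto simp: dist_real_def)
      have "t + d \<le> Inf T"
      proof (rule cInf_greatest[OF ne])
        fix r assume r: "r \<in> T"
        show "t + d \<le> r"
        proof (rule ccontr)
          assume "\<not> t + d \<le> r"
          then have "x + r *\<^sub>R w \<in> X"
            using d(2)[of r] s r by (cases "r \<le> t") (auto simp: seg_iff T_def)
          with r show False by (simp add: T_def)
        qed
      qed
      then show "t < Inf T" using d(1) by simp
    next
      assume t: "t < Inf T"
      have "x + r *\<^sub>R w \<in> X" if "0 \<le> r" "r \<le> t" for r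
      proof (cases "r = 0")
        case False
        have "r \<notin> T" using cInf_lower[OF _ bdd, of r] t that by auto
        with False that show ?thesis by (simp add: T_def)
      qed (use assms in simp)
      then show "seg X (x, w) t" using \<open>0 \<le> t\<close> assms by (auto simp: seg_iff)
    qed
    then show ?thesis using iff[of 0] assms unfolding T_def by auto
  qed
  have neg: "seg X (x, v) t \<longleftrightarrow> seg X (x, - v) (- t)" for t by (simp add: seg_def)
  have eq: "tau_minus X x v = Inf {s. s > 0 \<and> x + s *\<^sub>R (- v) \<notin> X}" by (simp add: tau_minus_def)
  have eq': "tau_plus X x v = Inf {s. s > 0 \<and> x + s *\<^sub>R v \<notin> X}" by (simp add: tau_plus_def)
  show 1: "0 < tau_plus X x v" "0 < tau_minus X x v" using key[of v] key[of "- v"] assms unfolding eq eq' by auto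
  show "seg X (x, v) t \<longleftrightarrow> - tau_minus X x v < t \<and> t < tau_plus X x v"
  proof (cases "0 \<le> t")
    case True
    then show ?thesis using key[of v] assms 1 unfolding eq' by auto
  next
    case False
    then show ?thesis using key[of "- v"] assms neg[of t] 1 unfolding eq by (auto simp: algebra_simps)
  qed
qed

lemma L_eq_tau:
  assumes "x \<in> X" "v \<noteq> 0"
  shows "L (x, v) = ennreal (tau X x v)"
proof -
  have "L (x, v) = (\<integral>\<^sup>+t. indicator {- tau_minus X x v<..<tau_plus X x v} t \<partial>lborel)"
    unfolding L_def using seg_iff_tau(3)[OF assms] by (intro nn_integral_cong) (auto simp: indicator_def)
  also have "\<dots> = ennreal (tau X x v)"
    using seg_iff_tau(1,2)[OF assms] by (simp add: tau_def add.commute)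
  finally show ?thesis .
qed

definition T :: "'a \<times> 'a \<Rightarrow> real" where "T z = enn2real (L z)"

lemma T_measurable [measurable]: "T \<in> borel_measurable borel"
  unfolding T_def by measurable

lemma T_eq: "fst z \<in> X \<Longrightarrow> snd z \<noteq> 0 \<Longrightarrow> T z = tau X (fst z) (snd z)"
  "fst z \<in> X \<Longrightarrow> snd z \<noteq> 0 \<Longrightarrow> 0 < T z"
  "fst z \<in> X \<Longrightarrow> snd z \<noteq> 0 \<Longrightarrow> L z = ennreal (T z)"
  using L_eq_tau[of "fst z" "snd z"] seg_iff_tau(1,2)[of "fst z" "snd z"]
  by (auto simp: T_def tau_def simp del: ennreal_plus)

lemma T_bounded: "\<exists>R>0. \<forall>z. fst z \<in> X \<longrightarrow> snd z \<in> V \<longrightarrow> T z \<le> R"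
proof -
  obtain r where r: "r > 0" "\<And>v. v \<in> V \<Longrightarrow> r \<le> norm v" using V_low by blast
  obtain R where R: "R > 0" "\<And>y. y \<in> X \<Longrightarrow> norm y \<le> R" using bounded_X by (auto simp: bounded_pos)
  have "T z \<le> 4 * R / r" if z: "fst z \<in> X" "snd z \<in> V" for z
  proof -
    obtain x v where xv: "z = (x, v)" "x \<in> X" "v \<in> V" using z by (cases z) auto
    have "seg X z t \<Longrightarrow> t \<in> {- (2 * R / r)..2 * R / r}" for t
    proof -
      assume "seg X z t"
      then have "x + t *\<^sub>R v \<in> X" using seg_in(2) xv by fastforce
      then have "norm ((x + t *\<^sub>R v) - x) \<le> 2 * R" using R(2)[of x] R(2)[of "x + t *\<^sub>R v"] xv norm_triangle_ineq4[of "x + t *\<^sub>R v" x] by linarith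
      then have "\<bar>t\<bar> * norm v \<le> 2 * R" by simp
      moreover have "\<bar>t\<bar> * r \<le> \<bar>t\<bar> * norm v" using r(2)[OF xv(3)] by (intro mult_left_mono) auto
      ultimately have "\<bar>t\<bar> \<le> 2 * R / r" using r(1) by (simp add: pos_le_divide_eq)
      then show ?thesis by auto
    qed
    then have "L z \<le> (\<integral>\<^sup>+t. indicator {- (2 * R / r)..2 * R / r} t \<partial>lborel)"
      unfolding L_def by (intro nn_integral_mono) (auto simp: indicator_def)
    also have "\<dots> = ennreal (4 * R / r)" using R(1) r(1) by simp
    finally show ?thesis unfolding T_def using R(1) r(1) by (simp add: enn2real_leI)
  qed
  then show ?thesis using R(1) r(1) by (intro exI[of _ "4 * R / r"]) auto
qed

lemma seg_shift_integral:
  assumes "seg X z t" and [measurable]: "F \<in> borel_measurable borel"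
  shows "(\<integral>\<^sup>+s. (if seg X (flow t z) s then F (s + t) else 0) \<partial>lborel) = (\<integral>\<^sup>+s. (if seg X z s then F s else (0::ennreal)) \<partial>lborel)"
  using nn_integral_lborel_shift[of "\<lambda>s. if seg X z s then F s else 0" t] by (simp add: seg_flow_iff[OF assms(1)])

lemma L_flow: "seg X z t \<Longrightarrow> L (flow t z) = L z"
  using seg_shift_integral[of z t "\<lambda>_. 1"] by (simp add: L_def)

lemma T_flow: "seg X z t \<Longrightarrow> T (flow t z) = T z"
  by (simp add: T_def L_flow)

text \<open>After Fubini and the substitution that replaces \<open>x + t v\<close> by
  \<open>x\<close>, the inner integral counts the times from which the point is reached, and these
  have total measure \<open>L\<close>. Integrals over chords thus become volume integrals with the
  weight \<open>\<tau>\<close>, which is how the weights of \<open>W_space\<close> are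
  handled.\<close>

lemma seg_swap_slice:
  assumes [measurable]: "H \<in> borel_measurable borel"
  shows "(\<integral>\<^sup>+x. \<integral>\<^sup>+t. (if seg X (x, v) t then H (flow t (x, v)) else 0) \<partial>lborel \<partial>lborel) = (\<integral>\<^sup>+x. L (x, v) * H (x, v) \<partial>lborel)"
proof -
  have "(\<integral>\<^sup>+x. \<integral>\<^sup>+t. (if seg X (x, v) t then H (flow t (x, v)) else 0) \<partial>lborel \<partial>lborel)
    = (\<integral>\<^sup>+t. \<integral>\<^sup>+x. (if seg X (x, v) t then H (flow t (x, v)) else 0) \<partial>lborel \<partial>lborel)"
    by (rule lborel_pair.Fubini') measurable
  also have "\<dots> = (\<integral>\<^sup>+t. \<integral>\<^sup>+x. (if seg X (x, v) (-t) then H (x, v) else 0) \<partial>lborel \<partial>lborel)"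
  proof (rule nn_integral_cong)
    fix t
    have eq: "(if seg X (x, v) t then H (flow t (x, v)) else 0) = (if seg X (x + t *\<^sub>R v, v) (-t) then H (x + t *\<^sub>R v, v) else 0)" for x
      using seg_flow_minus_iff[of t "(x + t *\<^sub>R v, v)" X] seg_in(1)[of X "(x, v)" t] by (auto simp: flow_def)
    show "(\<integral>\<^sup>+x. (if seg X (x, v) t then H (flow t (x, v)) else 0) \<partial>lborel) = (\<integral>\<^sup>+x. (if seg X (x, v) (-t) then H (x, v) else 0) \<partial>lborel)"
      unfolding eq by (rule nn_integral_lborel_shift) measurable
  qed
  also have "\<dots> = (\<integral>\<^sup>+x. \<integral>\<^sup>+t. (if seg X (x, v) (-t) then H (x, v) else 0) \<partial>lborel \<partial>lborel)"
    by (rule lborel_pair.Fubini'[symmetric]) measurable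
  also have "\<dots> = (\<integral>\<^sup>+x. L (x, v) * H (x, v) \<partial>lborel)"
  proof (rule nn_integral_cong)
    fix x
    have "(\<integral>\<^sup>+t. (if seg X (x, v) (-t) then H (x, v) else 0) \<partial>lborel) = (\<integral>\<^sup>+t. (if seg X (x, v) (-t) then 1 else 0) * H (x, v) \<partial>lborel)"
      by (intro nn_integral_cong) auto
    also have "\<dots> = (\<integral>\<^sup>+t. (if seg X (x, v) (-t) then 1 else 0) \<partial>lborel) * H (x, v)"
      by (rule nn_integral_multc) measurable
    also have "(\<integral>\<^sup>+t. (if seg X (x, v) (-t) then 1 else 0) \<partial>lborel) = L (x, v)"
      unfolding L_def by (subst (2) nn_integral_real_affine[where c="-1" and t=0]) auto
    finally show "(\<integral>\<^sup>+t. (if seg X (x, v) (-t) then H (x, v) else 0) \<partial>lborel) = L (x, v) * H (x, v)" .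
  qed
  finally show ?thesis .
qed

lemma seg_swap:
  assumes [measurable]: "H \<in> borel_measurable borel"
  shows "(\<integral>\<^sup>+z. \<integral>\<^sup>+t. (if seg X z t then H (flow t z) else 0) \<partial>lborel \<partial>N) = (\<integral>\<^sup>+z. L z * H z \<partial>N)"
  by (subst (1 2) nn_integral_N') (auto simp: seg_swap_slice)

lemma nn_integral_N_flow:
  assumes [measurable]: "F \<in> borel_measurable borel"
  shows "(\<integral>\<^sup>+z. F (flow s z) \<partial>N) = (\<integral>\<^sup>+z. F z \<partial>N)"
proof -
  have "(\<integral>\<^sup>+x. F (flow s (x, v)) \<partial>lborel) = (\<integral>\<^sup>+x. F (x, v) \<partial>lborel)" for v
    unfolding flow_def using nn_integral_lborel_shift[of "\<lambda>x. F (x, v)" "s *\<^sub>R v"] by simp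
  then show ?thesis by (subst (1 2) nn_integral_N') auto
qed

lemma integral_N_flow:
  fixes F :: "_ \<Rightarrow> real"
  assumes [measurable]: "F \<in> borel_measurable borel"
  shows "integrable N (\<lambda>z. F (flow s z)) \<longleftrightarrow> integrable N F" "(\<integral>z. F (flow s z) \<partial>N) = (\<integral>z. F z \<partial>N)"
proof -
  have d: "distr N borel (flow s) = N"
  proof (rule measure_eqI)
    fix A assume "A \<in> sets (distr N borel (flow s))"
    then have [measurable]: "A \<in> sets borel" by simp
    have "emeasure (distr N borel (flow s)) A = (\<integral>\<^sup>+z. indicator A (flow s z) \<partial>N)"
      by (simp add: nn_integral_distr flip: nn_integral_indicator)
    also have "\<dots> = (\<integral>\<^sup>+z. indicator A z \<partial>N)" by (rule nn_integral_N_flow) measurable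
    also have "\<dots> = emeasure N A" by (rule nn_integral_indicator) (simp only: sets_N \<open>A \<in> sets borel\<close>)
    finally show "emeasure (distr N borel (flow s)) A = emeasure N A" .
  qed (simp only: sets_distr sets_N)
  show "integrable N (\<lambda>z. F (flow s z)) \<longleftrightarrow> integrable N F"
    using integrable_distr_eq[of "flow s" N borel F] by (simp add: d)
  show "(\<integral>z. F (flow s z) \<partial>N) = (\<integral>z. F z \<partial>N)"
    using integral_distr[of "flow s" N borel F] by (simp add: d)
qed

end

section \<open>The Neumann series\<close>

lemma measurable_triple_comp:
  fixes f :: "'b \<Rightarrow> 'a::euclidean_space" and g h :: "'b \<Rightarrow> 'a"
  assumes "(\<lambda>(x, v', v). k x v' v) \<in> borel_measurable borel"
    and [measurable]: "f \<in> borel_measurable M" "g \<in> borel_measurable M" "h \<in> borel_measurable M"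
  shows "(\<lambda>y. k (f y) (g y) (h y) :: real) \<in> borel_measurable M"
  using measurable_compose[of "\<lambda>y. (f y, g y, h y)" M borel "\<lambda>(x, v', v). k x v' v" borel] assms(1)
  by simp

text \<open>Here \<open>z\<close> is transported from the base point at time \<open>b z\<close> of its line, where the solution has the
  value \<open>J z\<close>. The kernel \<open>\<kappa>\<close> bounds the ratio of the weights \<open>e\<close> at a point and at the points between it and
  the base point, and \<open>C\<close> is the \<open>p\<close>-th power of a bound for the collision operator.\<close>

locale transport_problem = transport_domain X V D
  for X V :: "'a::euclidean_space set" and D :: "'a measure" +
  fixes p :: real and b J \<sigma> :: "'a \<times> 'a \<Rightarrow> real" and k :: "'a \<Rightarrow> 'a \<Rightarrow> 'a \<Rightarrow> real"
    and e :: "'a \<Rightarrow> real" and \<kappa> :: "real \<Rightarrow> real" and C c\<kappa> :: real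
  assumes p: "1 \<le> p"
    and b_measurable [measurable]: "b \<in> borel_measurable borel"
    and J_measurable [measurable]: "J \<in> borel_measurable borel"
    and \<sigma>_measurable [measurable]: "\<sigma> \<in> borel_measurable borel"
    and k_measurable: "(\<lambda>(x, v', v). k x v' v) \<in> borel_measurable borel"
    and b_flow: "\<And>z t. snd z \<in> V \<Longrightarrow> seg X z t \<Longrightarrow> b (flow t z) = b z - t"
    and J_flow: "\<And>z t. snd z \<in> V \<Longrightarrow> seg X z t \<Longrightarrow> J (flow t z) = J z"
    and e_measurable [measurable]: "e \<in> borel_measurable borel"
    and e_outside: "\<And>x. x \<notin> X \<Longrightarrow> e x = 0"
    and e_bounds: "\<exists>c1>0. \<exists>c2. \<forall>x\<in>X. c1 \<le> e x \<and> e x \<le> c2"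
    and \<kappa>_measurable [measurable]: "\<kappa> \<in> borel_measurable borel"
    and \<kappa>_nonneg: "\<And>s. 0 \<le> \<kappa> s"
    and \<kappa>_integral: "(\<integral>\<^sup>+s. ennreal (\<kappa> s) \<partial>lborel) = ennreal c\<kappa>" "0 \<le> c\<kappa>"
    and kernel: "\<And>z s. snd z \<in> V \<Longrightarrow> seg X z s \<Longrightarrow> oriented_indicator (b z) 0 s \<noteq> 0 \<Longrightarrow> e (fst z) \<le> \<kappa> s * e (fst z + s *\<^sub>R snd z)"
    and C_nonneg: "0 \<le> C"
    and small: "C * c\<kappa> powr p \<le> 2 powr (- p)"
    and collision: "\<And>F. F \<in> borel_measurable borel \<Longrightarrow> AE x in lborel. x \<in> X \<longrightarrow>
       (\<integral>\<^sup>+v. ennpowr (ennreal \<bar>\<sigma> (x, v)\<bar> * F (x, v) + (\<integral>\<^sup>+v'. ennreal \<bar>k x v' v\<bar> * F (x, v') \<partial>D)) p \<partial>D)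
         \<le> ennreal C * (\<integral>\<^sup>+v. ennpowr (F (x, v)) p \<partial>D)"
    and J_integrable: "(\<integral>\<^sup>+z. (if fst z \<in> X then ennreal (\<bar>J z\<bar> powr p / T z) else 0) \<partial>N) < \<infinity>"
begin

lemmas k_measurable' [measurable (raw)] = measurable_triple_comp[OF k_measurable]

definition collision_majorant :: "('a \<times> 'a \<Rightarrow> ennreal) \<Rightarrow> 'a \<times> 'a \<Rightarrow> ennreal" where
  "collision_majorant F z = ennreal \<bar>\<sigma> z\<bar> * F z + (\<integral>\<^sup>+v'. ennreal \<bar>k (fst z) v' (snd z)\<bar> * F (fst z, v') \<partial>D)"

definition collision_op :: "('a \<times> 'a \<Rightarrow> real) \<Rightarrow> 'a \<times> 'a \<Rightarrow> real" where
  "collision_op f z = (\<integral>v'. k (fst z) v' (snd z) * f (fst z, v') \<partial>D) - \<sigma> z * f z"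

definition transport_majorant :: "('a \<times> 'a \<Rightarrow> ennreal) \<Rightarrow> 'a \<times> 'a \<Rightarrow> ennreal" where
  "transport_majorant F z = (\<integral>\<^sup>+s. (if seg X z s then ennreal \<bar>oriented_indicator (b z) 0 s\<bar> * F (flow s z) else 0) \<partial>lborel)"

definition transport_op :: "('a \<times> 'a \<Rightarrow> real) \<Rightarrow> 'a \<times> 'a \<Rightarrow> real" where
  "transport_op f z = (\<integral>s. (if seg X z s then oriented_indicator (b z) 0 s * f (flow s z) else 0) \<partial>lborel)"

lemma collision_majorant_measurable [measurable (raw)]:
  assumes [measurable]: "F \<in> borel_measurable borel"
  shows "collision_majorant F \<in> borel_measurable borel"
proof -
  have "collision_majorant F = (\<lambda>z. ennreal \<bar>\<sigma> z\<bar> * F z + (\<integral>\<^sup>+v'. ennreal \<bar>k (fst z) v' (snd z)\<bar> * F (fst z, v') \<partial>D))"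
    by (simp add: collision_majorant_def fun_eq_iff)
  also have "\<dots> \<in> borel_measurable borel" by measurable
  finally show ?thesis .
qed

lemma collision_op_measurable [measurable (raw)]:
  assumes [measurable]: "f \<in> borel_measurable borel"
  shows "collision_op f \<in> borel_measurable borel"
proof -
  have "collision_op f = (\<lambda>z. (\<integral>v'. k (fst z) v' (snd z) * f (fst z, v') \<partial>D) - \<sigma> z * f z)"
    by (simp add: collision_op_def fun_eq_iff)
  also have "\<dots> \<in> borel_measurable borel" by measurable
  finally show ?thesis .
qed

lemma transport_majorant_measurable [measurable (raw)]:
  assumes [measurable]: "F \<in> borel_measurable borel"
  shows "transport_majorant F \<in> borel_measurable borel"
proof -
  have "transport_majorant F = (\<lambda>z. \<integral>\<^sup>+s. (if seg X z s then ennreal \<bar>oriented_indicator (b z) 0 s\<bar> * F (flow s z) else 0) \<partial>lborel)"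
    by (simp add: transport_majorant_def fun_eq_iff)
  also have "\<dots> \<in> borel_measurable borel" by measurable
  finally show ?thesis .
qed

lemma transport_op_measurable [measurable (raw)]:
  assumes [measurable]: "f \<in> borel_measurable borel"
  shows "transport_op f \<in> borel_measurable borel"
proof -
  have "transport_op f = (\<lambda>z. \<integral>s. (if seg X z s then oriented_indicator (b z) 0 s * f (flow s z) else 0) \<partial>lborel)"
    by (simp add: transport_op_def fun_eq_iff)
  also have "\<dots> \<in> borel_measurable borel" by measurable
  finally show ?thesis .
qed

lemmas op_measurable' [measurable (raw)] =
  measurable_compose[OF _ collision_majorant_measurable] measurable_compose[OF _ collision_op_measurable]
  measurable_compose[OF _ transport_majorant_measurable] measurable_compose[OF _ transport_op_measurable]

lemma ennreal_abs_integral_le: "ennreal \<bar>\<integral>x. f x \<partial>M\<bar> \<le> (\<integral>\<^sup>+x. ennreal \<bar>f x\<bar> \<partial>M)" for f :: "'b \<Rightarrow> real"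
proof (cases "integrable M f")
  case True
  then show ?thesis using integral_norm_bound_ennreal[of M f] by simp
qed (simp add: not_integrable_integral_eq)

section \<open>Domination by the majorants and weighted norm estimates\<close>

lemma collision_op_le_collision_majorant:
  assumes "\<And>z. ennreal \<bar>f z\<bar> \<le> F z"
  shows "ennreal \<bar>collision_op f z\<bar> \<le> collision_majorant F z"
proof -
  have "ennreal \<bar>collision_op f z\<bar> \<le> ennreal (\<bar>\<sigma> z * f z\<bar> + \<bar>\<integral>v'. k (fst z) v' (snd z) * f (fst z, v') \<partial>D\<bar>)"
    unfolding collision_op_def by (rule ennreal_leI) simp
  also have "\<dots> = ennreal \<bar>\<sigma> z\<bar> * ennreal \<bar>f z\<bar> + ennreal \<bar>\<integral>v'. k (fst z) v' (snd z) * f (fst z, v') \<partial>D\<bar>"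
    by (simp add: abs_mult ennreal_mult)
  also have "\<dots> \<le> ennreal \<bar>\<sigma> z\<bar> * F z + (\<integral>\<^sup>+v'. ennreal \<bar>k (fst z) v' (snd z)\<bar> * F (fst z, v') \<partial>D)"
    by (intro add_mono mult_left_mono assms order_trans[OF ennreal_abs_integral_le] nn_integral_mono)
       (auto simp: abs_mult ennreal_mult intro!: mult_left_mono assms)
  finally show ?thesis by (simp add: collision_majorant_def)
qed

lemma transport_op_le_transport_majorant:
  assumes "\<And>z. ennreal \<bar>f z\<bar> \<le> F z"
  shows "ennreal \<bar>transport_op f z\<bar> \<le> transport_majorant F z"
  unfolding transport_op_def transport_majorant_def
  by (intro order_trans[OF ennreal_abs_integral_le] nn_integral_mono)
     (auto simp: abs_mult ennreal_mult intro!: mult_left_mono assms)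

text \<open>The \<open>p\<close>-th power of a weighted p-norm, without the root; hence the
  contraction factor is \<open>2 powr (- p)\<close>. As \<open>e\<close> vanishes outside
  \<open>X\<close>, integration over the whole space sees only \<open>X\<close>.\<close>

definition weighted_norm :: "('a \<times> 'a \<Rightarrow> ennreal) \<Rightarrow> ennreal" where
  "weighted_norm F = (\<integral>\<^sup>+z. ennpowr (ennreal (e (fst z)) * F z) p \<partial>N)"

lemma e_nonneg: "0 \<le> e x"
  using e_bounds e_outside by (cases "x \<in> X") (auto intro: less_imp_le less_le_trans)

text \<open>Collisions act at a fixed position and the weight depends on the position only, so the
  assumption \<open>collision\<close> applies slice by slice with no loss from the weight.\<close>

lemma weighted_norm_collision_majorant:
  assumes [measurable]: "F \<in> borel_measurable borel"
  shows "weighted_norm (collision_majorant F) \<le> ennreal C * weighted_norm F"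
proof -
  have split: "weighted_norm G = (\<integral>\<^sup>+x. ennpowr (ennreal (e x)) p * (\<integral>\<^sup>+v. ennpowr (G (x, v)) p \<partial>D) \<partial>lborel)"
    if [measurable]: "G \<in> borel_measurable borel" for G
    unfolding weighted_norm_def by (subst nn_integral_N) (auto simp: ennpowr_mult nn_integral_cmult)
  have "weighted_norm (collision_majorant F) = (\<integral>\<^sup>+x. ennpowr (ennreal (e x)) p * (\<integral>\<^sup>+v. ennpowr (collision_majorant F (x, v)) p \<partial>D) \<partial>lborel)"
    by (rule split) measurable
  also have "\<dots> \<le> (\<integral>\<^sup>+x. ennreal C * (ennpowr (ennreal (e x)) p * (\<integral>\<^sup>+v. ennpowr (F (x, v)) p \<partial>D)) \<partial>lborel)"
  proof (rule nn_integral_mono_AE)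
    show "AE x in lborel. ennpowr (ennreal (e x)) p * (\<integral>\<^sup>+v. ennpowr (collision_majorant F (x, v)) p \<partial>D)
        \<le> ennreal C * (ennpowr (ennreal (e x)) p * (\<integral>\<^sup>+v. ennpowr (F (x, v)) p \<partial>D))"
      using collision[OF assms]
    proof eventually_elim
      case (elim x)
      show ?case
      proof (cases "x \<in> X")
        case True
        then show ?thesis using elim unfolding collision_majorant_def
          by (simp add: mult.left_commute[of "ennreal C"] mult_left_mono)
      qed (simp add: e_outside)
    qed
  qed
  also have "\<dots> = ennreal C * weighted_norm F" by (subst split[OF assms], rule nn_integral_cmult) measurable
  finally show ?thesis .
qed

text \<open>Young's inequality for convolution with an integrable kernel, carried out along lines:
  the assumption \<open>kernel\<close> moves the weight under the integral, Jensen's inequality for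
  the density \<open>\<kappa>\<close> costs \<open>c\<kappa> powr (p - 1)\<close>, and invariance of
  \<open>N\<close> under the flow contributes the last factor \<open>c\<kappa>\<close>.\<close>

lemma weighted_norm_transport_majorant:
  assumes [measurable]: "F \<in> borel_measurable borel"
  shows "weighted_norm (transport_majorant F) \<le> ennreal (c\<kappa> powr p) * weighted_norm F"
proof -
  define G where "G z = ennreal (e (fst z)) * F z" for z
  have [measurable]: "G \<in> borel_measurable borel" unfolding G_def by measurable
  have "weighted_norm (transport_majorant F) \<le> (\<integral>\<^sup>+z. ennreal (c\<kappa> powr (p - 1)) * (\<integral>\<^sup>+s. ennreal (\<kappa> s) * ennpowr (G (flow s z)) p \<partial>lborel) \<partial>N)"
    unfolding weighted_norm_def
  proof (rule nn_integral_mono_AE)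
    show "AE z in N. ennpowr (ennreal (e (fst z)) * transport_majorant F z) p
      \<le> ennreal (c\<kappa> powr (p - 1)) * (\<integral>\<^sup>+s. ennreal (\<kappa> s) * ennpowr (G (flow s z)) p \<partial>lborel)"
      using AE_N_V
    proof eventually_elim
      case (elim z)
      have "ennreal (e (fst z)) * transport_majorant F z = (\<integral>\<^sup>+s. ennreal (e (fst z)) * (if seg X z s then ennreal \<bar>oriented_indicator (b z) 0 s\<bar> * F (flow s z) else 0) \<partial>lborel)"
        unfolding transport_majorant_def by (rule nn_integral_cmult[symmetric]) measurable
      also have "\<dots> \<le> (\<integral>\<^sup>+s. ennreal (\<kappa> s) * G (flow s z) \<partial>lborel)"
      proof (rule nn_integral_mono)
        fix s
        show "ennreal (e (fst z)) * (if seg X z s then ennreal \<bar>oriented_indicator (b z) 0 s\<bar> * F (flow s z) else 0) \<le> ennreal (\<kappa> s) * G (flow s z)"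
        proof (cases "seg X z s \<and> oriented_indicator (b z) 0 s \<noteq> 0")
          case True
          then have w: "\<bar>oriented_indicator (b z) 0 s\<bar> = 1" using oriented_indicator_cases[of "b z" 0 s] by auto
          have "ennreal (e (fst z)) \<le> ennreal (\<kappa> s * e (fst z + s *\<^sub>R snd z))"
            using True elim by (intro ennreal_leI kernel) auto
          also have "\<dots> = ennreal (\<kappa> s) * ennreal (e (fst z + s *\<^sub>R snd z))" using \<kappa>_nonneg e_nonneg by (rule ennreal_mult)
          finally show ?thesis using True w by (simp add: G_def mult.assoc[symmetric] mult_right_mono)
        qed auto
      qed
      finally have "ennpowr (ennreal (e (fst z)) * transport_majorant F z) p \<le> ennpowr (\<integral>\<^sup>+s. ennreal (\<kappa> s) * G (flow s z) \<partial>lborel) p"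
        using p by (intro ennpowr_mono) auto
      also have "\<dots> \<le> ennreal (c\<kappa> powr (p - 1)) * (\<integral>\<^sup>+s. ennreal (\<kappa> s) * ennpowr (G (flow s z)) p \<partial>lborel)"
        using p \<kappa>_integral by (intro Jensen_density) auto
      finally show ?case .
    qed
  qed
  also have "\<dots> = ennreal (c\<kappa> powr (p - 1)) * (\<integral>\<^sup>+z. \<integral>\<^sup>+s. ennreal (\<kappa> s) * ennpowr (G (flow s z)) p \<partial>lborel \<partial>N)"
    by (rule nn_integral_cmult) measurable
  also have "(\<integral>\<^sup>+z. \<integral>\<^sup>+s. ennreal (\<kappa> s) * ennpowr (G (flow s z)) p \<partial>lborel \<partial>N) = (\<integral>\<^sup>+s. \<integral>\<^sup>+z. ennreal (\<kappa> s) * ennpowr (G (flow s z)) p \<partial>N \<partial>lborel)"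
  proof -
    interpret N: sigma_finite_measure N ..
    interpret PN: pair_sigma_finite N "lborel :: real measure" ..
    show ?thesis by (rule PN.Fubini'[symmetric]) measurable
  qed
  also have "\<dots> = (\<integral>\<^sup>+s. ennreal (\<kappa> s) * weighted_norm F \<partial>lborel)"
  proof (rule nn_integral_cong)
    fix s
    have "(\<integral>\<^sup>+z. ennreal (\<kappa> s) * ennpowr (G (flow s z)) p \<partial>N) = ennreal (\<kappa> s) * (\<integral>\<^sup>+z. ennpowr (G (flow s z)) p \<partial>N)"
      by (rule nn_integral_cmult) measurable
    also have "(\<integral>\<^sup>+z. ennpowr (G (flow s z)) p \<partial>N) = (\<integral>\<^sup>+z. ennpowr (G z) p \<partial>N)"
      by (rule nn_integral_N_flow) measurable
    finally show "(\<integral>\<^sup>+z. ennreal (\<kappa> s) * ennpowr (G (flow s z)) p \<partial>N) = ennreal (\<kappa> s) * weighted_norm F"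
      by (simp add: weighted_norm_def G_def)
  qed
  also have "\<dots> = ennreal c\<kappa> * weighted_norm F" by (subst nn_integral_multc) (auto simp: \<kappa>_integral)
  also have "ennreal (c\<kappa> powr (p - 1)) * (ennreal c\<kappa> * weighted_norm F) = ennreal (c\<kappa> powr p) * weighted_norm F"
  proof -
    have "c\<kappa> powr (p - 1) * c\<kappa> = c\<kappa> powr p"
      using \<kappa>_integral(2) by (cases "c\<kappa> = 0") (auto simp: powr_mult_base powr_diff)
    then show ?thesis using \<kappa>_integral(2) by (simp add: mult.assoc[symmetric] flip: ennreal_mult)
  qed
  finally show ?thesis .
qed

text \<open>The terms of the Neumann series and majorants for them. The majorants take values in \<open>[0, \<infinity>]\<close>, so
  that all sums and integrals may be interchanged before anything is known to be finite.\<close>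

primrec W :: "nat \<Rightarrow> 'a \<times> 'a \<Rightarrow> ennreal" where
  "W 0 = (\<lambda>z. ennreal \<bar>J z\<bar>)"
| "W (Suc n) = transport_majorant (collision_majorant (W n))"

primrec w :: "nat \<Rightarrow> 'a \<times> 'a \<Rightarrow> real" where
  "w 0 = J"
| "w (Suc n) = transport_op (collision_op (w n))"

lemma W_measurable [measurable]: "W n \<in> borel_measurable borel"
  by (induction n) auto

lemma w_measurable [measurable]: "w n \<in> borel_measurable borel"
  by (induction n) auto

lemma w_le_W: "ennreal \<bar>w n z\<bar> \<le> W n z"
proof (induction n arbitrary: z)
  case (Suc n)
  have "ennreal \<bar>collision_op (w n) z\<bar> \<le> collision_majorant (W n) z" for z by (rule collision_op_le_collision_majorant) (rule Suc)
  then show ?case by (simp only: w.simps W.simps) (rule transport_op_le_transport_majorant)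
qed simp

definition Q :: "'a \<times> 'a \<Rightarrow> ennreal" where "Q z = (\<Sum>n. collision_majorant (W n) z)"
definition q :: "'a \<times> 'a \<Rightarrow> real" where "q z = (\<Sum>n. collision_op (w n) z)"
definition U :: "'a \<times> 'a \<Rightarrow> ennreal" where "U z = (\<Sum>n. W n z)"
text \<open>Defined through \<open>q\<close> and not as the sum of the \<open>w n\<close>: in this
  form \<open>u\<close> obeys the integrated equation on every line, which is what increments and
  traces are computed from. The series represents it wherever \<open>U\<close> is finite.\<close>

definition u :: "'a \<times> 'a \<Rightarrow> real" where "u z = J z + transport_op q z"

lemma Q_measurable [measurable]: "Q \<in> borel_measurable borel"
  unfolding Q_def by measurable
lemma q_measurable [measurable]: "q \<in> borel_measurable borel"
  unfolding q_def by measurable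
lemma U_measurable [measurable]: "U \<in> borel_measurable borel"
  unfolding U_def by measurable
lemma u_measurable [measurable]: "u \<in> borel_measurable borel"
  unfolding u_def by measurable

lemma collision_op_w_le: "ennreal \<bar>collision_op (w n) z\<bar> \<le> collision_majorant (W n) z"
  by (rule collision_op_le_collision_majorant) (rule w_le_W)

lemma ennreal_abs_suminf_le: "ennreal \<bar>\<Sum>n. f n\<bar> \<le> (\<Sum>n. ennreal \<bar>f n\<bar>)" for f :: "nat \<Rightarrow> real"
proof (cases "(\<Sum>n. ennreal \<bar>f n\<bar>) = \<infinity>")
  case False
  then have s: "summable (\<lambda>n. \<bar>f n\<bar>)" by (intro summable_suminf_not_top) auto
  then have "\<bar>\<Sum>n. f n\<bar> \<le> (\<Sum>n. \<bar>f n\<bar>)" by (rule summable_rabs)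
  then show ?thesis using s by (simp add: suminf_ennreal2)
qed simp

lemma q_le_Q: "ennreal \<bar>q z\<bar> \<le> Q z"
  unfolding q_def Q_def by (rule order_trans[OF ennreal_abs_suminf_le]) (intro suminf_le collision_op_w_le, auto)

lemma transport_majorant_Q: "transport_majorant Q z = (\<Sum>n. W (Suc n) z)"
proof -
  have "transport_majorant Q z = (\<integral>\<^sup>+s. (\<Sum>n. (if seg X z s then ennreal \<bar>oriented_indicator (b z) 0 s\<bar> * collision_majorant (W n) (flow s z) else 0)) \<partial>lborel)"
    unfolding transport_majorant_def Q_def by (intro nn_integral_cong) (auto simp: ennreal_suminf_cmult)
  also have "\<dots> = (\<Sum>n. transport_majorant (collision_majorant (W n)) z)"
    unfolding transport_majorant_def by (rule nn_integral_suminf) measurable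
  finally show ?thesis by simp
qed

lemma U_eq: "U z = ennreal \<bar>J z\<bar> + transport_majorant Q z"
  unfolding U_def transport_majorant_Q using suminf_offset[of "\<lambda>n. W n z" 1] by (simp add: add.commute)

lemma collision_majorant_U: "collision_majorant U z = Q z"
proof -
  have "(\<integral>\<^sup>+v'. ennreal \<bar>k (fst z) v' (snd z)\<bar> * U (fst z, v') \<partial>D) = (\<integral>\<^sup>+v'. (\<Sum>n. ennreal \<bar>k (fst z) v' (snd z)\<bar> * W n (fst z, v')) \<partial>D)"
    unfolding U_def by (simp add: ennreal_suminf_cmult)
  also have "\<dots> = (\<Sum>n. \<integral>\<^sup>+v'. ennreal \<bar>k (fst z) v' (snd z)\<bar> * W n (fst z, v') \<partial>D)"
    by (rule nn_integral_suminf) measurable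
  finally show ?thesis unfolding collision_majorant_def Q_def U_def[of z]
    by (subst suminf_add[symmetric]) (auto simp: ennreal_suminf_cmult)
qed

text \<open>By \<open>U_eq\<close>, finiteness of \<open>U z\<close> includes finiteness of the
  transport integral of \<open>Q\<close>, which dominates all terms on the line at once; so
  summation and transport may be interchanged at this particular \<open>z\<close>.\<close>

lemma w_sums_u:
  assumes "U z < \<infinity>"
  shows "(\<lambda>n. w n z) sums u z"
proof -
  define f where "f n s = (if seg X z s then oriented_indicator (b z) 0 s * collision_op (w n) (flow s z) else 0)" for n s
  have [measurable]: "f n \<in> borel_measurable lborel" for n unfolding f_def by measurable
  have bound: "(\<Sum>n. ennreal \<bar>f n s\<bar>) \<le> (if seg X z s then ennreal \<bar>oriented_indicator (b z) 0 s\<bar> * Q (flow s z) else 0)" for s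
    unfolding f_def Q_def
    by (auto simp: abs_mult ennreal_mult intro!: suminf_le mult_left_mono collision_op_w_le simp flip: ennreal_suminf_cmult)
  have "(\<integral>\<^sup>+s. (\<Sum>n. ennreal \<bar>f n s\<bar>) \<partial>lborel) \<le> transport_majorant Q z"
    unfolding transport_majorant_def by (intro nn_integral_mono bound)
  also have "\<dots> < \<infinity>" using assms unfolding U_eq by simp
  finally have fin: "(\<integral>\<^sup>+s. (\<Sum>n. ennreal \<bar>f n s\<bar>) \<partial>lborel) < \<infinity>" .
  note ser = integral_dominated_series[of f lborel, OF _ fin]
  have "(\<lambda>n. \<integral>s. f n s \<partial>lborel) sums (\<integral>s. (\<Sum>n. f n s) \<partial>lborel)" by (rule ser(3)) measurable
  also have "(\<integral>s. (\<Sum>n. f n s) \<partial>lborel) = transport_op q z"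
    unfolding transport_op_def
  proof (rule integral_cong_AE)
    have "AE s in lborel. summable (\<lambda>n. \<bar>f n s\<bar>)" by (rule ser(1)) measurable
    then show "AE s in lborel. (\<Sum>n. f n s) = (if seg X z s then oriented_indicator (b z) 0 s * q (flow s z) else 0)"
    proof eventually_elim
      case (elim s)
      show ?case
      proof (cases "seg X z s \<and> oriented_indicator (b z) 0 s \<noteq> 0")
        case True
        then have "\<bar>f n s\<bar> = \<bar>collision_op (w n) (flow s z)\<bar>" for n using oriented_indicator_cases[of "b z" 0 s] by (auto simp: f_def)
        then have "summable (\<lambda>n. collision_op (w n) (flow s z))" using elim by (simp add: summable_rabs_cancel)
        then show ?thesis using True by (simp add: f_def q_def suminf_mult)
      qed (auto simp: f_def)
    qed
  qed (auto simp: f_def)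
  finally have "(\<lambda>n. w (Suc n) z) sums transport_op q z" by (simp add: transport_op_def f_def)
  then show ?thesis using sums_Suc[of "\<lambda>n. w n z" "transport_op q z"] by (simp add: u_def add.commute)
qed

text \<open>\<open>Q z\<close> is the collision majorant of \<open>U\<close>, so its finiteness
  makes \<open>U\<close> finite for almost every \<open>v'\<close> at which the kernel is nonzero,
  and at \<open>z\<close> itself if \<open>\<sigma> z\<close> is nonzero. Those are the only points
  at which the series must represent \<open>u\<close>.\<close>

lemma boltzmann_at:
  assumes "Q z < \<infinity>"
  shows "integrable D (\<lambda>v'. k (fst z) v' (snd z) * u (fst z, v'))" "q z = collision_op u z"
proof -
  define f where "f n v' = k (fst z) v' (snd z) * w n (fst z, v')" for n v'
  have [measurable]: "f n \<in> borel_measurable D" for n unfolding f_def by measurable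
  have KU: "collision_majorant U z < \<infinity>" using assms by (simp add: collision_majorant_U)
  have bound: "(\<Sum>n. ennreal \<bar>f n v'\<bar>) \<le> ennreal \<bar>k (fst z) v' (snd z)\<bar> * U (fst z, v')" for v'
    unfolding f_def U_def by (auto simp: abs_mult ennreal_mult intro!: suminf_le mult_left_mono w_le_W simp flip: ennreal_suminf_cmult)
  have kU: "(\<integral>\<^sup>+v'. ennreal \<bar>k (fst z) v' (snd z)\<bar> * U (fst z, v') \<partial>D) < \<infinity>" and sU: "ennreal \<bar>\<sigma> z\<bar> * U z < \<infinity>"
    using KU by (auto simp: collision_majorant_def)
  have fin: "(\<integral>\<^sup>+v'. (\<Sum>n. ennreal \<bar>f n v'\<bar>) \<partial>D) < \<infinity>"
    by (rule le_less_trans[OF nn_integral_mono[OF bound] kU])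
  note ser = integral_dominated_series[of f D, OF _ fin]
  have "AE v' in D. ennreal \<bar>k (fst z) v' (snd z)\<bar> * U (fst z, v') \<noteq> \<infinity>"
    using kU by (intro nn_integral_noteq_infinite) auto
  then have ae: "AE v' in D. (\<Sum>n. f n v') = k (fst z) v' (snd z) * u (fst z, v')"
  proof eventually_elim
    case (elim v')
    show ?case
    proof (cases "k (fst z) v' (snd z) = 0")
      case False
      then have "U (fst z, v') < \<infinity>" using elim by (auto simp: ennreal_mult_eq_top_iff less_top)
      from sums_mult[OF w_sums_u[OF this], of "k (fst z) v' (snd z)"] show ?thesis
        unfolding f_def by (rule sums_unique[symmetric])
    qed (simp add: f_def)
  qed
  have "integrable D (\<lambda>v'. \<Sum>n. f n v')" by (rule ser(2)) measurable
  moreover have "integrable D (\<lambda>v'. \<Sum>n. f n v') \<longleftrightarrow> integrable D (\<lambda>v'. k (fst z) v' (snd z) * u (fst z, v'))"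
    by (rule integrable_cong_AE) (use ae in auto)
  ultimately show "integrable D (\<lambda>v'. k (fst z) v' (snd z) * u (fst z, v'))" by blast
  have "(\<lambda>n. \<integral>v'. f n v' \<partial>D) sums (\<integral>v'. (\<Sum>n. f n v') \<partial>D)" by (rule ser(3)) measurable
  also have "(\<integral>v'. (\<Sum>n. f n v') \<partial>D) = (\<integral>v'. k (fst z) v' (snd z) * u (fst z, v') \<partial>D)"
    by (rule integral_cong_AE) (use ae in auto)
  finally have s1: "(\<lambda>n. \<integral>v'. f n v' \<partial>D) sums (\<integral>v'. k (fst z) v' (snd z) * u (fst z, v') \<partial>D)" .
  have s2: "(\<lambda>n. \<sigma> z * w n z) sums (\<sigma> z * u z)"
  proof (cases "\<sigma> z = 0")
    case False
    then have "U z < \<infinity>" using sU by (auto simp: ennreal_mult_less_top)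
    then show ?thesis by (intro sums_mult w_sums_u)
  qed simp
  from sums_diff[OF s1 s2] have "(\<lambda>n. collision_op (w n) z) sums collision_op u z" by (simp add: collision_op_def f_def)
  then show "q z = collision_op u z" unfolding q_def by (rule sums_unique[symmetric])
qed

lemma weighted_norm_J: "weighted_norm (\<lambda>z. ennreal \<bar>J z\<bar>) < \<infinity>"
proof -
  obtain R where R: "R > 0" "\<And>z. fst z \<in> X \<Longrightarrow> snd z \<in> V \<Longrightarrow> T z \<le> R" using T_bounded by blast
  obtain c2 where c2: "\<And>x. x \<in> X \<Longrightarrow> e x \<le> c2" using e_bounds by blast
  have "weighted_norm (\<lambda>z. ennreal \<bar>J z\<bar>) \<le> (\<integral>\<^sup>+z. ennreal (\<bar>c2\<bar> powr p * R) * (if fst z \<in> X then ennreal (\<bar>J z\<bar> powr p / T z) else 0) \<partial>N)"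
    unfolding weighted_norm_def
  proof (rule nn_integral_mono_AE)
    show "AE z in N. ennpowr (ennreal (e (fst z)) * ennreal \<bar>J z\<bar>) p \<le> ennreal (\<bar>c2\<bar> powr p * R) * (if fst z \<in> X then ennreal (\<bar>J z\<bar> powr p / T z) else 0)"
      using AE_N_V
    proof eventually_elim
      case (elim z)
      show ?case
      proof (cases "fst z \<in> X")
        case True
        have T: "0 < T z" "T z \<le> R" using R(2)[OF True elim] T_eq(2)[OF True] V_nz[OF elim] by auto
        have "(e (fst z) * \<bar>J z\<bar>) powr p \<le> (\<bar>c2\<bar> * \<bar>J z\<bar>) powr p"
          using c2[OF True] e_nonneg p by (intro powr_mono2 mult_right_mono) auto
        also have "\<dots> = \<bar>c2\<bar> powr p * (\<bar>J z\<bar> powr p)" by (simp add: powr_mult)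
        also have "\<dots> \<le> \<bar>c2\<bar> powr p * (R * (\<bar>J z\<bar> powr p / T z))"
          using T by (intro mult_left_mono) (auto simp: field_simps mult_right_mono)
        finally have "ennreal ((e (fst z) * \<bar>J z\<bar>) powr p) \<le> ennreal (\<bar>c2\<bar> powr p * R * (\<bar>J z\<bar> powr p / T z))"
          by (intro ennreal_leI) (simp add: mult.assoc)
        moreover have "ennreal (e (fst z)) * ennreal \<bar>J z\<bar> = ennreal (e (fst z) * \<bar>J z\<bar>)"
          using e_nonneg by (simp add: ennreal_mult)
        moreover have "ennreal (\<bar>c2\<bar> powr p * R * (\<bar>J z\<bar> powr p / T z)) = ennreal (\<bar>c2\<bar> powr p * R) * ennreal (\<bar>J z\<bar> powr p / T z)"
          using T R by (intro ennreal_mult) auto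
        ultimately show ?thesis using True e_nonneg[of "fst z"] by (simp add: ennpowr_ennreal)
      qed (simp add: e_outside)
    qed
  qed
  also have "\<dots> = ennreal (\<bar>c2\<bar> powr p * R) * (\<integral>\<^sup>+z. (if fst z \<in> X then ennreal (\<bar>J z\<bar> powr p / T z) else 0) \<partial>N)"
    by (rule nn_integral_cmult) measurable
  also have "\<dots> < \<infinity>" using J_integrable by (simp add: ennreal_mult_less_top)
  finally show ?thesis .
qed

lemma weighted_norm_series: "weighted_norm (collision_majorant (W n)) \<le> ennreal (2 powr (- p)) ^ n * weighted_norm (collision_majorant (W 0))"
proof (induction n)
  case (Suc n)
  have "weighted_norm (collision_majorant (W (Suc n))) \<le> ennreal C * weighted_norm (transport_majorant (collision_majorant (W n)))" by (simp, rule weighted_norm_collision_majorant) measurable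
  also have "\<dots> \<le> ennreal C * (ennreal (c\<kappa> powr p) * weighted_norm (collision_majorant (W n)))"
    by (intro mult_left_mono weighted_norm_transport_majorant) auto
  also have "\<dots> = ennreal (C * c\<kappa> powr p) * weighted_norm (collision_majorant (W n))"
    using C_nonneg by (simp add: ennreal_mult mult.assoc)
  also have "\<dots> \<le> ennreal (2 powr (- p)) * (ennreal (2 powr (- p)) ^ n * weighted_norm (collision_majorant (W 0)))"
    by (intro mult_mono ennreal_leI small Suc) auto
  finally show ?case by (simp add: mult.assoc)
qed simp

text \<open>The factor \<open>2 powr (real (Suc n) * (p - 1))\<close> from
  \<open>ennpowr_suminf_le\<close> and the contraction factor \<open>2 powr (- p * n)\<close>
  multiply to \<open>2 powr p * (1/2) ^ Suc n\<close>. This explains the threshold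
  \<open>2 powr (- p)\<close> in the assumption \<open>small\<close>.\<close>

lemma weighted_norm_Q: "weighted_norm Q < \<infinity>"
proof -
  have "weighted_norm Q \<le> (\<integral>\<^sup>+z. (\<Sum>n. ennreal (2 powr (real (Suc n) * (p - 1))) * ennpowr (ennreal (e (fst z)) * collision_majorant (W n) z) p) \<partial>N)"
    unfolding weighted_norm_def
  proof (rule nn_integral_mono)
    fix z
    have "ennreal (e (fst z)) * Q z = (\<Sum>n. ennreal (e (fst z)) * collision_majorant (W n) z)"
      unfolding Q_def by (simp add: ennreal_suminf_cmult)
    then show "ennpowr (ennreal (e (fst z)) * Q z) p \<le> (\<Sum>n. ennreal (2 powr (real (Suc n) * (p - 1))) * ennpowr (ennreal (e (fst z)) * collision_majorant (W n) z) p)"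
      by (simp only: ennpowr_suminf_le[OF p])
  qed
  also have "\<dots> = (\<Sum>n. ennreal (2 powr (real (Suc n) * (p - 1))) * weighted_norm (collision_majorant (W n)))"
    unfolding weighted_norm_def by (subst nn_integral_suminf) (auto intro!: suminf_cong nn_integral_cmult)
  also have "\<dots> \<le> (\<Sum>n. ennreal (2 powr (real (Suc n) * (p - 1))) * (ennreal (2 powr (- p)) ^ n * weighted_norm (collision_majorant (W 0))))"
    by (intro suminf_le mult_left_mono weighted_norm_series) auto
  also have "\<dots> = (\<Sum>n. ennreal (2 powr p) * weighted_norm (collision_majorant (W 0)) * ennreal ((1/2) ^ Suc n))"
  proof (rule suminf_cong)
    fix n
    have mult4: "a * (b * x) = c * x * d" if "a * b = c * d" for a b c d x :: ennreal
      using that by (metis mult.assoc mult.commute)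
    have "(2::real) powr (real (Suc n) * (p - 1)) * (2 powr (- p)) ^ n = 2 powr p * (1/2) ^ Suc n"
    proof -
      have "(2 powr (- p)) ^ n = 2 powr (- p * real n)" by (simp add: powr_realpow[symmetric] powr_powr)
      moreover have "(1/2::real) ^ Suc n = 2 powr (- real (Suc n))"
        by (simp add: powr_minus powr_realpow power_one_over inverse_eq_divide del: power_Suc of_nat_Suc)
      ultimately show ?thesis by (simp only: powr_add[symmetric]) (simp add: algebra_simps)
    qed
    then have "ennreal (2 powr (real (Suc n) * (p - 1))) * ennreal (2 powr (- p)) ^ n = ennreal (2 powr p) * ennreal ((1/2) ^ Suc n)"
      by (simp only: ennreal_power powr_ge_zero ennreal_mult[symmetric] zero_le_power zero_le_divide_1_iff zero_le_numeral)
    then show "ennreal (2 powr (real (Suc n) * (p - 1))) * (ennreal (2 powr (- p)) ^ n * weighted_norm (collision_majorant (W 0))) = ennreal (2 powr p) * weighted_norm (collision_majorant (W 0)) * ennreal ((1/2) ^ Suc n)"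
      by (rule mult4)
  qed
  also have "\<dots> = ennreal (2 powr p) * weighted_norm (collision_majorant (W 0)) * ennreal 1"
    by (subst ennreal_suminf_cmult, subst suminf_ennreal_eq[OF _ power_half_series]) auto
  also have "\<dots> < \<infinity>"
  proof -
    have "weighted_norm (collision_majorant (W 0)) \<le> ennreal C * weighted_norm (W 0)" by (rule weighted_norm_collision_majorant) measurable
    also have "\<dots> < \<infinity>" using weighted_norm_J by (simp add: ennreal_mult_less_top)
    finally show ?thesis by (simp add: ennreal_mult_less_top)
  qed
  finally show ?thesis .
qed

section \<open>Integrability of the sum of the series, on phase space and along lines\<close>

lemma Q_Lp: "(\<integral>\<^sup>+z. (if fst z \<in> X then ennpowr (Q z) p else 0) \<partial>N) < \<infinity>"
proof -
  obtain c1 where c1: "c1 > 0" "\<And>x. x \<in> X \<Longrightarrow> c1 \<le> e x" using e_bounds by blast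
  have "(\<integral>\<^sup>+z. (if fst z \<in> X then ennpowr (Q z) p else 0) \<partial>N) \<le> (\<integral>\<^sup>+z. ennreal ((1 / c1) powr p) * ennpowr (ennreal (e (fst z)) * Q z) p \<partial>N)"
  proof (rule nn_integral_mono)
    fix z
    show "(if fst z \<in> X then ennpowr (Q z) p else 0) \<le> ennreal ((1 / c1) powr p) * ennpowr (ennreal (e (fst z)) * Q z) p"
    proof (cases "fst z \<in> X")
      case True
      have "1 \<le> (1 / c1 * e (fst z)) powr p" using c1 True p by (intro ge_one_powr_ge_zero) (auto simp: field_simps)
      then have "ennreal 1 \<le> ennreal ((1 / c1) powr p * e (fst z) powr p)" using c1 e_nonneg[of "fst z"] by (intro ennreal_leI) (simp add: powr_mult powr_divide)
      then have "1 * ennpowr (Q z) p \<le> ennreal ((1 / c1) powr p * e (fst z) powr p) * ennpowr (Q z) p" by (intro mult_right_mono) auto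
      then show ?thesis using True e_nonneg[of "fst z"] by (simp add: ennpowr_mult ennpowr_ennreal ennreal_mult mult.assoc)
    qed simp
  qed
  also have "\<dots> = ennreal ((1 / c1) powr p) * weighted_norm Q" unfolding weighted_norm_def by (rule nn_integral_cmult) measurable
  also have "\<dots> < \<infinity>" using weighted_norm_Q by (simp add: ennreal_mult_less_top)
  finally show ?thesis .
qed

text \<open>Jensen's inequality on a chord of length \<open>T\<close> gives the factor
  \<open>T powr (p - 1)\<close>; division by \<open>T\<close> leaves the exponent
  \<open>p - 2\<close>, which may be negative. Exchanging the integrals by \<open>seg_swap\<close>
  restores one power of \<open>T\<close>, and \<open>T powr (p - 1)\<close> is bounded because
  chords have bounded length.\<close>

lemma transport_majorant_Q_tau: "(\<integral>\<^sup>+z. (if fst z \<in> X then ennreal (1 / T z) * ennpowr (transport_majorant Q z) p else 0) \<partial>N) < \<infinity>"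
proof -
  obtain R where R: "R > 0" "\<And>z. fst z \<in> X \<Longrightarrow> snd z \<in> V \<Longrightarrow> T z \<le> R" using T_bounded by blast
  define H where "H z = ennreal (T z powr (p - 2)) * ennpowr (Q z) p" for z
  have [measurable]: "H \<in> borel_measurable borel" unfolding H_def by measurable
  have "(\<integral>\<^sup>+z. (if fst z \<in> X then ennreal (1 / T z) * ennpowr (transport_majorant Q z) p else 0) \<partial>N)
    \<le> (\<integral>\<^sup>+z. \<integral>\<^sup>+s. (if seg X z s then H (flow s z) else 0) \<partial>lborel \<partial>N)"
  proof (rule nn_integral_mono_AE)
    show "AE z in N. (if fst z \<in> X then ennreal (1 / T z) * ennpowr (transport_majorant Q z) p else 0) \<le> (\<integral>\<^sup>+s. (if seg X z s then H (flow s z) else 0) \<partial>lborel)"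
      using AE_N_V
    proof eventually_elim
      case (elim z)
      show ?case
      proof (cases "fst z \<in> X")
        case True
        have T: "0 < T z" "L z = ennreal (T z)" using T_eq(2,3)[OF True V_nz[OF elim]] by auto
        define \<mu> where "\<mu> s = (if seg X z s then 1 else 0 :: ennreal)" for s
        have [measurable]: "\<mu> \<in> borel_measurable borel" unfolding \<mu>_def by measurable
        have "transport_majorant Q z \<le> (\<integral>\<^sup>+s. \<mu> s * Q (flow s z) \<partial>lborel)"
          unfolding transport_majorant_def \<mu>_def
        proof (rule nn_integral_mono)
          fix s
          have "ennreal \<bar>oriented_indicator (b z) 0 s\<bar> * Q (flow s z) \<le> ennreal 1 * Q (flow s z)"
            by (intro mult_right_mono ennreal_leI abs_oriented_indicator_le) auto
          then show "(if seg X z s then ennreal \<bar>oriented_indicator (b z) 0 s\<bar> * Q (flow s z) else 0) \<le> (if seg X z s then 1 else 0) * Q (flow s z)" by auto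
        qed
        then have "ennpowr (transport_majorant Q z) p \<le> ennpowr (\<integral>\<^sup>+s. \<mu> s * Q (flow s z) \<partial>lborel) p" using p by (intro ennpowr_mono) auto
        also have "\<dots> \<le> ennreal (T z powr (p - 1)) * (\<integral>\<^sup>+s. \<mu> s * ennpowr (Q (flow s z)) p \<partial>lborel)"
          using p T by (intro Jensen_density) (auto simp: \<mu>_def L_def)
        finally have "ennreal (1 / T z) * ennpowr (transport_majorant Q z) p \<le> ennreal (1 / T z) * (ennreal (T z powr (p - 1)) * (\<integral>\<^sup>+s. \<mu> s * ennpowr (Q (flow s z)) p \<partial>lborel))"
          by (intro mult_left_mono) auto
        also have "\<dots> = ennreal (T z powr (p - 2)) * (\<integral>\<^sup>+s. \<mu> s * ennpowr (Q (flow s z)) p \<partial>lborel)"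
        proof -
          have "1 / T z * T z powr (p - 1) = T z powr (p - 2)"
            using T(1) by (simp add: powr_diff powr_numeral power2_eq_square)
          then have "ennreal (1 / T z) * ennreal (T z powr (p - 1)) = ennreal (T z powr (p - 2))"
            using T(1) by (subst ennreal_mult[symmetric]) auto
          then show ?thesis by (simp add: mult.assoc[symmetric])
        qed
        also have "\<dots> = (\<integral>\<^sup>+s. ennreal (T z powr (p - 2)) * (\<mu> s * ennpowr (Q (flow s z)) p) \<partial>lborel)"
          by (rule nn_integral_cmult[symmetric]) measurable
        also have "\<dots> = (\<integral>\<^sup>+s. (if seg X z s then H (flow s z) else 0) \<partial>lborel)"
          by (intro nn_integral_cong) (auto simp: \<mu>_def H_def T_flow)
        finally show ?thesis using True by simp
      qed simp
    qed
  qed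
  also have "\<dots> = (\<integral>\<^sup>+z. L z * H z \<partial>N)" by (rule seg_swap) measurable
  also have "\<dots> \<le> (\<integral>\<^sup>+z. ennreal (R powr (p - 1)) * (if fst z \<in> X then ennpowr (Q z) p else 0) \<partial>N)"
  proof (rule nn_integral_mono_AE)
    show "AE z in N. L z * H z \<le> ennreal (R powr (p - 1)) * (if fst z \<in> X then ennpowr (Q z) p else 0)"
      using AE_N_V
    proof eventually_elim
      case (elim z)
      show ?case
      proof (cases "fst z \<in> X")
        case True
        have T: "0 < T z" "L z = ennreal (T z)" "T z \<le> R" using T_eq(2,3)[OF True V_nz[OF elim]] R(2)[OF True elim] by auto
        have "T z * T z powr (p - 2) = T z powr (p - 1)"
          using T(1) by (simp add: powr_diff powr_numeral power2_eq_square)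
        also have "\<dots> \<le> R powr (p - 1)" using T p by (intro powr_mono2) auto
        finally have "ennreal (T z * T z powr (p - 2)) * ennpowr (Q z) p \<le> ennreal (R powr (p - 1)) * ennpowr (Q z) p"
          by (intro mult_right_mono ennreal_leI) auto
        then show ?thesis using True T by (simp add: H_def ennreal_mult mult.assoc)
      next
        case False
        then have "\<And>t. \<not> seg X z t" using seg_in(1) by blast
        then have "L z = 0" by (simp add: L_def)
        then show ?thesis by simp
      qed
    qed
  qed
  also have "\<dots> = ennreal (R powr (p - 1)) * (\<integral>\<^sup>+z. (if fst z \<in> X then ennpowr (Q z) p else 0) \<partial>N)"
    by (rule nn_integral_cmult) measurable
  also have "\<dots> < \<infinity>" using Q_Lp by (simp add: ennreal_mult_less_top)
  finally show ?thesis .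
qed

lemma q_Lp: "(\<integral>\<^sup>+z. (if fst z \<in> X then ennreal (\<bar>q z\<bar> powr p) else 0) \<partial>N) < \<infinity>"
proof (rule le_less_trans[OF nn_integral_mono Q_Lp])
  fix z
  have "ennpowr (ennreal \<bar>q z\<bar>) p \<le> ennpowr (Q z) p" using p q_le_Q by (intro ennpowr_mono) auto
  then show "(if fst z \<in> X then ennreal (\<bar>q z\<bar> powr p) else 0) \<le> (if fst z \<in> X then ennpowr (Q z) p else 0)"
    by (simp add: ennpowr_ennreal)
qed

lemma u_W: "(\<integral>\<^sup>+z. (if fst z \<in> X then ennreal (\<bar>u z\<bar> powr p / T z) else 0) \<partial>N) < \<infinity>"
proof -
  have "(\<integral>\<^sup>+z. (if fst z \<in> X then ennreal (\<bar>u z\<bar> powr p / T z) else 0) \<partial>N) \<le>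
    (\<integral>\<^sup>+z. ennreal (2 powr p) * ((if fst z \<in> X then ennreal (\<bar>J z\<bar> powr p / T z) else 0) + (if fst z \<in> X then ennreal (1 / T z) * ennpowr (transport_majorant Q z) p else 0)) \<partial>N)"
  proof (rule nn_integral_mono_AE)
    show "AE z in N. (if fst z \<in> X then ennreal (\<bar>u z\<bar> powr p / T z) else 0) \<le>
      ennreal (2 powr p) * ((if fst z \<in> X then ennreal (\<bar>J z\<bar> powr p / T z) else 0) + (if fst z \<in> X then ennreal (1 / T z) * ennpowr (transport_majorant Q z) p else 0))"
      using AE_N_V
    proof eventually_elim
      case (elim z)
      show ?case
      proof (cases "fst z \<in> X")
        case True
        have T: "0 < T z" using T_eq(2)[OF True V_nz[OF elim]] by auto
        have "ennreal \<bar>u z\<bar> \<le> ennreal (\<bar>J z\<bar> + \<bar>transport_op q z\<bar>)" unfolding u_def by (rule ennreal_leI) simp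
        also have "\<dots> = ennreal \<bar>J z\<bar> + ennreal \<bar>transport_op q z\<bar>" by simp
        also have "\<dots> \<le> ennreal \<bar>J z\<bar> + transport_majorant Q z" by (intro add_left_mono transport_op_le_transport_majorant q_le_Q)
        finally have "ennpowr (ennreal \<bar>u z\<bar>) p \<le> ennpowr (ennreal \<bar>J z\<bar> + transport_majorant Q z) p" using p by (intro ennpowr_mono) auto
        also have "\<dots> \<le> ennreal (2 powr p) * (ennpowr (ennreal \<bar>J z\<bar>) p + ennpowr (transport_majorant Q z) p)" by (rule ennpowr_add_le[OF p])
        finally have "ennreal (1 / T z) * ennpowr (ennreal \<bar>u z\<bar>) p \<le> ennreal (1 / T z) * (ennreal (2 powr p) * (ennpowr (ennreal \<bar>J z\<bar>) p + ennpowr (transport_majorant Q z) p))"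
          by (intro mult_left_mono) auto
        also have "\<dots> = ennreal (2 powr p) * (ennreal (1 / T z) * ennpowr (ennreal \<bar>J z\<bar>) p + ennreal (1 / T z) * ennpowr (transport_majorant Q z) p)"
          by (simp add: distrib_left mult.left_commute)
        finally show ?thesis using True T
          by (simp add: ennpowr_ennreal flip: ennreal_mult)
      qed simp
    qed
  qed
  also have "\<dots> = ennreal (2 powr p) * ((\<integral>\<^sup>+z. (if fst z \<in> X then ennreal (\<bar>J z\<bar> powr p / T z) else 0) \<partial>N) + (\<integral>\<^sup>+z. (if fst z \<in> X then ennreal (1 / T z) * ennpowr (transport_majorant Q z) p else 0) \<partial>N))"
  proof -
    define A where "A z = (if fst z \<in> X then ennreal (\<bar>J z\<bar> powr p / T z) else 0)" for z
    define B where "B z = (if fst z \<in> X then ennreal (1 / T z) * ennpowr (transport_majorant Q z) p else 0)" for z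
    have [measurable]: "A \<in> borel_measurable borel" "B \<in> borel_measurable borel" unfolding A_def B_def by measurable
    have "(\<integral>\<^sup>+z. ennreal (2 powr p) * (A z + B z) \<partial>N) = ennreal (2 powr p) * (\<integral>\<^sup>+z. A z + B z \<partial>N)"
      by (rule nn_integral_cmult) measurable
    also have "(\<integral>\<^sup>+z. A z + B z \<partial>N) = (\<integral>\<^sup>+z. A z \<partial>N) + (\<integral>\<^sup>+z. B z \<partial>N)"
      by (rule nn_integral_add) measurable
    finally show ?thesis unfolding A_def B_def .
  qed
  also have "\<dots> < \<infinity>" using J_integrable transport_majorant_Q_tau by (simp add: ennreal_mult_less_top)
  finally show ?thesis .
qed

lemma Q_L1: "(\<integral>\<^sup>+z. (if fst z \<in> X then Q z else 0) \<partial>N) < \<infinity>"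
proof -
  have "(\<integral>\<^sup>+z. (if fst z \<in> X then Q z else 0) \<partial>N) \<le> (\<integral>\<^sup>+z. indicator (X \<times> UNIV) z + (if fst z \<in> X then ennpowr (Q z) p else 0) \<partial>N)"
    by (intro nn_integral_mono) (auto simp: indicator_def le_one_plus_ennpowr[OF p])
  also have "\<dots> = (\<integral>\<^sup>+z. indicator (X \<times> UNIV) z \<partial>N) + (\<integral>\<^sup>+z. (if fst z \<in> X then ennpowr (Q z) p else 0) \<partial>N)"
  proof (rule nn_integral_add)
    have "X \<times> (UNIV :: 'a set) \<in> sets borel" using open_X by (intro borel_open open_Times) auto
    then show "indicator (X \<times> UNIV) \<in> borel_measurable N" by simp
  qed measurable
  also have "(\<integral>\<^sup>+z. indicator (X \<times> UNIV) z \<partial>N) = emeasure N (X \<times> UNIV)"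
  proof (rule nn_integral_indicator)
    have "X \<times> (UNIV :: 'a set) \<in> sets borel" using open_X by (intro borel_open open_Times) auto
    then show "X \<times> UNIV \<in> sets N" by (simp only: sets_N)
  qed
  also have "emeasure N (X \<times> UNIV) = emeasure lborel X * emeasure D UNIV"
    using open_X by (intro D.emeasure_pair_measure_Times) auto
  also have "\<dots> + (\<integral>\<^sup>+z. (if fst z \<in> X then ennpowr (Q z) p else 0) \<partial>N) < \<infinity>"
  proof -
    have "emeasure D UNIV < \<infinity>"
      using D.emeasure_finite[of UNIV] by (simp only: less_top[symmetric] infinity_ennreal_def) simp
    then show ?thesis
      using Q_Lp emeasure_bounded_finite[OF bounded_X] by (simp add: ennreal_mult_less_top)
  qed
  finally show ?thesis .
qed

lemma AE_Q_finite: "AE z in N. fst z \<in> X \<longrightarrow> Q z < \<infinity>"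
proof -
  have "AE z in N. (if fst z \<in> X then Q z else 0) \<noteq> \<infinity>"
    using Q_L1 by (intro nn_integral_noteq_infinite) auto
  then show ?thesis by eventually_elim (auto simp: less_top)
qed

lemma AE_boltzmann:
  "AE z in N. fst z \<in> X \<longrightarrow> integrable D (\<lambda>v'. k (fst z) v' (snd z) * u (fst z, v')) \<and>
     q z + \<sigma> z * u z = (\<integral>v'. k (fst z) v' (snd z) * u (fst z, v') \<partial>D)"
  using AE_Q_finite by eventually_elim (auto simp: boltzmann_at collision_op_def)

text \<open>By \<open>seg_swap\<close> the integral over all chords is that of \<open>L * Q\<close>,
  and \<open>L\<close> is bounded on the velocities in question. This is the summability along lines
  from which increments of \<open>u\<close> are computed.\<close>

lemma AE_line: "AE z in N. (\<integral>\<^sup>+s. (if seg X z s then Q (flow s z) else 0) \<partial>lborel) < \<infinity>"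
proof -
  obtain R where R: "R > 0" "\<And>z. fst z \<in> X \<Longrightarrow> snd z \<in> V \<Longrightarrow> T z \<le> R" using T_bounded by blast
  have "(\<integral>\<^sup>+z. \<integral>\<^sup>+s. (if seg X z s then Q (flow s z) else 0) \<partial>lborel \<partial>N) = (\<integral>\<^sup>+z. L z * Q z \<partial>N)"
    by (rule seg_swap) measurable
  also have "\<dots> \<le> (\<integral>\<^sup>+z. ennreal R * (if fst z \<in> X then Q z else 0) \<partial>N)"
  proof (rule nn_integral_mono_AE)
    show "AE z in N. L z * Q z \<le> ennreal R * (if fst z \<in> X then Q z else 0)"
      using AE_N_V
    proof eventually_elim
      case (elim z)
      show ?case
      proof (cases "fst z \<in> X")
        case True
        then show ?thesis using T_eq(3)[OF True V_nz[OF elim]] R(2)[OF True elim] by (auto intro!: mult_right_mono ennreal_leI)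
      next
        case False
        then have "\<And>t. \<not> seg X z t" using seg_in(1) by blast
        then have "L z = 0" by (simp add: L_def)
        then show ?thesis by simp
      qed
    qed
  qed
  also have "\<dots> = ennreal R * (\<integral>\<^sup>+z. (if fst z \<in> X then Q z else 0) \<partial>N)" by (rule nn_integral_cmult) measurable
  also have "\<dots> < \<infinity>" using Q_L1 by (simp add: ennreal_mult_less_top)
  finally have "AE z in N. (\<integral>\<^sup>+s. (if seg X z s then Q (flow s z) else 0) \<partial>lborel) \<noteq> \<infinity>"
    by (intro nn_integral_noteq_infinite) auto
  then show ?thesis by eventually_elim (auto simp: less_top)
qed

text \<open>Base point and prescribed value belong to the line and not to the point on it, so moving
  \<open>z\<close> only changes one end of the interval of integration.\<close>

lemma u_flow:
  assumes "snd z \<in> V" and s: "seg X z t"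
  shows "u (flow t z) = J z + (\<integral>s. (if seg X z s then oriented_indicator (b z) t s * q (flow s z) else 0) \<partial>lborel)"
proof -
  define f where "f s = (if seg X z s then oriented_indicator (b z) t s * q (flow s z) else 0)" for s
  have [measurable]: "f \<in> borel_measurable borel" unfolding f_def by measurable
  have eq: "(if seg X (flow t z) s then oriented_indicator (b z - t) 0 s * q (flow s (flow t z)) else 0) = f (s + t)" for s
    by (auto simp: f_def seg_flow_iff[OF s] oriented_indicator_def)
  have "u (flow t z) = J z + (\<integral>s. f (s + t) \<partial>lborel)"
    unfolding u_def transport_op_def b_flow[OF assms] J_flow[OF assms] eq ..
  also have "(\<integral>s. f (s + t) \<partial>lborel) = (\<integral>s. f s \<partial>lborel)" by (rule integral_lborel_shift) measurable
  finally show ?thesis unfolding f_def .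
qed

end

section \<open>The weak derivative along lines\<close>

text \<open>The compact set of pairs with time 0 has a positive distance from the closed set of
  pairs that are not admissible, so all points of \<open>K\<close> can be moved for a common time in
  both directions.\<close>

lemma (in transport_domain) compact_seg:
  assumes "compact K" "K \<subseteq> X \<times> UNIV"
  shows "\<exists>h0>0. \<forall>z\<in>K. \<forall>t. \<bar>t\<bar> < h0 \<longrightarrow> seg X z t"
proof -
  define S where "S = {p. seg X (fst p) (snd p)}"
  have "compact (K \<times> {0::real})" using assms by (intro compact_Times) auto
  moreover have "closed (- S)" using open_seg[OF open_X] by (simp add: S_def open_closed)
  moreover have "(K \<times> {0::real}) \<inter> (- S) = {}" using assms(2) by (auto simp: S_def)
  ultimately obtain d where d: "d > 0" "\<And>x y. x \<in> K \<times> {0} \<Longrightarrow> y \<in> - S \<Longrightarrow> d \<le> dist x y"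
    using separate_compact_closed by metis
  have "seg X z t" if "z \<in> K" "\<bar>t\<bar> < d" for z t
  proof (rule ccontr)
    assume "\<not> seg X z t"
    then have "d \<le> dist (z, 0) (z, t)" using that by (intro d(2)) (auto simp: S_def)
    then show False using that by (simp add: dist_Pair_Pair dist_real_def)
  qed
  then show ?thesis using d(1) by blast
qed

text \<open>The derivative of \<open>\<phi>\<close> along the flow is the limit of difference
  quotients. Flow invariance of \<open>N\<close> shifts the difference from \<open>\<phi>\<close>
  onto \<open>u\<close>, where \<open>line\<close> expresses it through \<open>q\<close>. Only
  differentiability of \<open>\<phi>\<close> along lines enters, so open sets and surfaces of
  velocities are treated alike.\<close>

lemma (in transport_domain) transport_identity:
  fixes u q \<phi> \<psi> :: "'a \<times> 'a \<Rightarrow> real"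
  assumes [measurable]: "u \<in> borel_measurable borel" "q \<in> borel_measurable borel" "\<phi> \<in> borel_measurable borel" "\<psi> \<in> borel_measurable borel"
    and u_int: "integrable N (\<lambda>z. if fst z \<in> X then u z else 0)"
    and q_int: "integrable N (\<lambda>z. if fst z \<in> X then q z else 0)"
    and K: "compact K" "K \<subseteq> X \<times> UNIV" and supp: "\<And>z. z \<notin> K \<Longrightarrow> \<phi> z = 0"
    and bound: "\<And>z. \<bar>\<phi> z\<bar> \<le> B" "\<And>z. \<bar>\<psi> z\<bar> \<le> B"
    and deriv: "\<And>z t. snd z \<in> V \<Longrightarrow> ((\<lambda>t. \<phi> (flow t z)) has_real_derivative \<psi> (flow t z)) (at t)"
    and line: "AE z in N. fst z \<in> X \<longrightarrow> (\<forall>t. seg X z t \<longrightarrow>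
       u (flow t z) - u z = (\<integral>s. (if seg X z s then oriented_indicator 0 t s * q (flow s z) else 0) \<partial>lborel))"
  shows "(\<integral>z. (if fst z \<in> X then u z else 0) * \<psi> z \<partial>N) = - (\<integral>z. (if fst z \<in> X then q z else 0) * \<phi> z \<partial>N)"
proof -
  define u0 where "u0 z = (if fst z \<in> X then u z else 0)" for z
  define q0 where "q0 z = (if fst z \<in> X then q z else 0)" for z
  have [measurable]: "u0 \<in> borel_measurable borel" "q0 \<in> borel_measurable borel" unfolding u0_def q0_def by measurable
  have ui: "integrable N u0" and qi: "integrable N q0" using u_int q_int by (auto simp: u0_def[abs_def] q0_def[abs_def])
  have B: "0 \<le> B" using bound(1)[of undefined] by simp
  obtain h0 where h0: "h0 > 0" "\<And>z t. z \<in> K \<Longrightarrow> \<bar>t\<bar> < h0 \<Longrightarrow> seg X z t" using compact_seg[OF K] by blast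
  define h where "h = (\<lambda>n. h0 / 2 * inverse (real (Suc n)))"
  have h: "0 < h n" "h n < h0" for n
  proof -
    show "0 < h n" using h0(1) by (simp add: h_def)
    have "h0 / 2 * inverse (real (Suc n)) \<le> h0 / 2 * 1"
      using h0(1) by (intro mult_left_mono) (auto simp: inverse_le_1_iff)
    then show "h n < h0" using h0(1) by (simp add: h_def)
  qed
  have h_lim: "h \<longlonglongrightarrow> 0" 
    using tendsto_mult[OF tendsto_const LIMSEQ_inverse_real_of_nat, of "h0 / 2"] unfolding h_def by (simp only: mult_zero_right)
  have int_bounded: "integrable N (\<lambda>z. f z * g z)" if "integrable N f" "g \<in> borel_measurable borel" "\<And>z. \<bar>g z\<bar> \<le> B" for f g
  proof (rule Bochner_Integration.integrable_bound[where f="\<lambda>z. B * f z"])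
    have "\<bar>f z\<bar> * \<bar>g z\<bar> \<le> \<bar>f z\<bar> * B" for z by (intro mult_left_mono that(3)) auto
    then show "AE z in N. norm (f z * g z) \<le> norm (B * f z)"
      using B by (intro AE_I2) (simp add: abs_mult mult.commute[of B])
  qed (use that borel_measurable_integrable[OF that(1)] in \<open>auto intro!: borel_measurable_times\<close>)
  define I where "I n = (\<integral>z. u0 z * ((\<phi> (flow (h n) z) - \<phi> z) / h n) \<partial>N)" for n
  have lim1: "I \<longlonglongrightarrow> (\<integral>z. u0 z * \<psi> z \<partial>N)"
    unfolding I_def[abs_def]
  proof (rule integral_dominated_convergence[where w="\<lambda>z. B * \<bar>u0 z\<bar>"])
    show "AE z in N. (\<lambda>n. u0 z * ((\<phi> (flow (h n) z) - \<phi> z) / h n)) \<longlonglongrightarrow> u0 z * \<psi> z"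
      using AE_N_V
    proof eventually_elim
      case (elim z)
      have "((\<lambda>t. (\<phi> (flow t z) - \<phi> z) / t) \<longlongrightarrow> \<psi> z) (at 0)"
        using deriv[OF elim, of 0] by (simp add: DERIV_def)
      moreover have "filterlim h (at 0) sequentially"
        using h_lim h(1) by (auto simp: filterlim_at less_imp_neq[THEN not_sym])
      ultimately show ?case by (intro tendsto_mult tendsto_const) (rule filterlim_compose)
    qed
    show "AE z in N. norm (u0 z * ((\<phi> (flow (h n) z) - \<phi> z) / h n)) \<le> B * \<bar>u0 z\<bar>" for n
      using AE_N_V
    proof eventually_elim
      case (elim z)
      obtain t where "0 < t" "t < h n" "\<phi> (flow (h n) z) - \<phi> (flow 0 z) = (h n - 0) * \<psi> (flow t z)"
        using MVT2[OF h(1)[of n], of "\<lambda>t. \<phi> (flow t z)" "\<lambda>t. \<psi> (flow t z)"] deriv[OF elim] by blast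
      then have "(\<phi> (flow (h n) z) - \<phi> z) / h n = \<psi> (flow t z)" using h(1)[of n] by simp
      then show ?case using bound(2)[of "flow t z"] by (simp add: abs_mult mult.commute[of B] mult_left_mono)
    qed
  qed (use ui in auto)
  \<comment> \<open>The substitution \<open>s = - h n * r\<close> turns the increment of
    \<open>u\<close> into an average over \<open>r\<close> in \<open>{0<..1}\<close>. Flow
    invariance then moves the shift from \<open>q0\<close> back to \<open>\<phi>\<close>, where it
    disappears in the limit by continuity.\<close>
  define J where "J n = (\<integral>r. indicator {0<..1} r * (\<integral>z. q0 z * \<phi> (flow (h n * r) z) \<partial>N) \<partial>lborel)" for n
  have IJ: "I n = - J n" for n
  proof -
    have s1: "integrable N (\<lambda>z. u0 z * \<phi> (flow (h n) z))" "integrable N (\<lambda>z. u0 z * \<phi> z)"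
      by (rule int_bounded[OF ui], use bound in auto)+
    have s2: "(\<integral>z. u0 z * \<phi> (flow (h n) z) \<partial>N) = (\<integral>z. u0 (flow (- h n) z) * \<phi> z \<partial>N)"
      "integrable N (\<lambda>z. u0 (flow (- h n) z) * \<phi> z)"
      using integral_N_flow[of "\<lambda>z. u0 (flow (- h n) z) * \<phi> z" "h n"] s1 by simp_all
    have "I n = (\<integral>z. (u0 z * \<phi> (flow (h n) z) - u0 z * \<phi> z) / h n \<partial>N)"
      unfolding I_def by (intro Bochner_Integration.integral_cong) (auto simp: algebra_simps)
    also have "\<dots> = (\<integral>z. (u0 (flow (- h n) z) * \<phi> z - u0 z * \<phi> z) / h n \<partial>N)"
      using s1 s2 by simp
    also have "\<dots> = (\<integral>z. - (\<integral>r. indicator {0<..1} r * (q0 (flow (- (h n * r)) z) * \<phi> z) \<partial>lborel) \<partial>N)"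
    proof (rule integral_cong_AE)
      show "AE z in N. (u0 (flow (- h n) z) * \<phi> z - u0 z * \<phi> z) / h n = - (\<integral>r. indicator {0<..1} r * (q0 (flow (- (h n * r)) z) * \<phi> z) \<partial>lborel)"
        using line
      proof eventually_elim
        case (elim z)
        show ?case
        proof (cases "z \<in> K")
          case True
          then have zX: "fst z \<in> X" using K(2) by auto
          have seg: "seg X z s" if "- h n \<le> s" "s \<le> 0" for s using h0(2)[OF True, of s] that h(2)[of n] by auto
          have "u (flow (- h n) z) - u z = (\<integral>s. (if seg X z s then oriented_indicator 0 (- h n) s * q (flow s z) else 0) \<partial>lborel)"
            using elim zX seg h(1)[of n] by auto
          also have "\<dots> = (\<integral>s. - (indicator {-h n..<0} s * q0 (flow s z)) \<partial>lborel)"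
          proof (rule Bochner_Integration.integral_cong)
            fix s
            show "(if seg X z s then oriented_indicator 0 (- h n) s * q (flow s z) else 0) = - (indicator {-h n..<0} s * q0 (flow s z))"
            proof (cases "- h n \<le> s \<and> s < 0")
              case True
              then show ?thesis using seg[of s] seg_in(2)[OF seg[of s]] by (simp add: oriented_indicator_def q0_def)
            next
              case False
              then have "oriented_indicator 0 (- h n) s = 0" using h(1)[of n] by (auto simp: oriented_indicator_def)
              then show ?thesis using False by (auto simp: indicator_def)
            qed
          qed simp
          also have "\<dots> = - (\<integral>s. indicator {-h n..<0} s * q0 (flow s z) \<partial>lborel)" by simp
          also have "(\<integral>s. indicator {-h n..<0} s * q0 (flow s z) \<partial>lborel) = h n * (\<integral>r. indicator {0<..1} r * q0 (flow (- (h n * r)) z) \<partial>lborel)"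
          proof -
            have "(\<integral>s. indicator {-h n..<0} s * q0 (flow s z) \<partial>lborel) = \<bar>- h n\<bar> *\<^sub>R (\<integral>r. indicator {-h n..<0} (0 + (- h n) * r) * q0 (flow (0 + (- h n) * r) z) \<partial>lborel)"
              using h(1)[of n] by (intro lborel_integral_real_affine) auto
            also have "(\<integral>r. indicator {-h n..<0} (0 + (- h n) * r) * q0 (flow (0 + (- h n) * r) z) \<partial>lborel) = (\<integral>r. indicator {0<..1} r * q0 (flow (- (h n * r)) z) \<partial>lborel)"
              using h(1)[of n] by (intro Bochner_Integration.integral_cong) (auto simp: indicator_def zero_less_mult_iff)
            finally show ?thesis using h(1)[of n] by simp
          qed
          finally have "u0 (flow (- h n) z) - u0 z = - (h n * (\<integral>r. indicator {0<..1} r * q0 (flow (- (h n * r)) z) \<partial>lborel))"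
            using zX seg_in(2)[OF seg[of "- h n"]] h(1)[of n] by (simp add: u0_def)
          then have diff: "u0 (flow (- h n) z) - u0 z = - (h n * (\<integral>r. indicator {0<..1} r * q0 (flow (- (h n * r)) z) \<partial>lborel))" .
          have "(u0 (flow (- h n) z) * \<phi> z - u0 z * \<phi> z) / h n = - ((\<integral>r. indicator {0<..1} r * q0 (flow (- (h n * r)) z) \<partial>lborel) * \<phi> z)"
            unfolding left_diff_distrib[symmetric] diff using h(1)[of n] by simp
          also have "(\<integral>r. indicator {0<..1} r * q0 (flow (- (h n * r)) z) \<partial>lborel) * \<phi> z = (\<integral>r. indicator {0<..1} r * (q0 (flow (- (h n * r)) z) * \<phi> z) \<partial>lborel)"
            by (subst integral_mult_left_zero[symmetric]) (simp add: mult.assoc)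
          finally show ?thesis .
        qed (simp add: supp)
      qed
    qed measurable
    also have "\<dots> = - (\<integral>z. (\<integral>r. indicator {0<..1} r * (q0 (flow (- (h n * r)) z) * \<phi> z) \<partial>lborel) \<partial>N)"
      by simp
    also have "(\<integral>z. (\<integral>r. indicator {0<..1} r * (q0 (flow (- (h n * r)) z) * \<phi> z) \<partial>lborel) \<partial>N)
      = (\<integral>r. (\<integral>z. indicator {0<..1} r * (q0 (flow (- (h n * r)) z) * \<phi> z) \<partial>N) \<partial>lborel)"
    proof -
      interpret N: sigma_finite_measure N ..
      interpret PN: pair_sigma_finite N "lborel :: real measure" ..
      define F where "F = (\<lambda>(z, r). indicator {0<..1::real} r * (q0 (flow (- (h n * r)) z) * \<phi> z))"
      have Fm[measurable]: "F \<in> borel_measurable (N \<Otimes>\<^sub>M lborel)" unfolding F_def by measurable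
      have "(\<integral>\<^sup>+p. ennreal (norm (F p)) \<partial>(N \<Otimes>\<^sub>M lborel)) = (\<integral>\<^sup>+r. \<integral>\<^sup>+z. ennreal (norm (F (z, r))) \<partial>N \<partial>lborel)"
        by (rule PN.nn_integral_snd[symmetric]) measurable
      also have "\<dots> \<le> (\<integral>\<^sup>+r. indicator {0<..1::real} r * (ennreal B * (\<integral>\<^sup>+z. ennreal \<bar>q0 z\<bar> \<partial>N)) \<partial>lborel)"
      proof (rule nn_integral_mono)
        fix r :: real
        have "(\<integral>\<^sup>+z. ennreal (norm (F (z, r))) \<partial>N) \<le> (\<integral>\<^sup>+z. indicator {0<..1} r * (ennreal B * ennreal \<bar>q0 (flow (- (h n * r)) z)\<bar>) \<partial>N)"
          using bound(1) B by (intro nn_integral_mono) (auto simp: F_def abs_mult indicator_def mult.commute[of B] ennreal_mult[symmetric] intro!: ennreal_leI mult_left_mono)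
        also have "\<dots> = indicator {0<..1} r * (ennreal B * (\<integral>\<^sup>+z. ennreal \<bar>q0 (flow (- (h n * r)) z)\<bar> \<partial>N))"
          by (simp add: nn_integral_cmult)
        also have "(\<integral>\<^sup>+z. ennreal \<bar>q0 (flow (- (h n * r)) z)\<bar> \<partial>N) = (\<integral>\<^sup>+z. ennreal \<bar>q0 z\<bar> \<partial>N)"
          by (rule nn_integral_N_flow) measurable
        finally show "(\<integral>\<^sup>+z. ennreal (norm (F (z, r))) \<partial>N) \<le> indicator {0<..1} r * (ennreal B * (\<integral>\<^sup>+z. ennreal \<bar>q0 z\<bar> \<partial>N))" .
      qed
      also have "\<dots> = ennreal B * (\<integral>\<^sup>+z. ennreal \<bar>q0 z\<bar> \<partial>N)"
        by (subst nn_integral_multc) auto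
      also have "\<dots> < \<infinity>" using qi by (simp add: integrable_iff_bounded ennreal_mult_less_top)
      finally have "integrable (N \<Otimes>\<^sub>M lborel) F" by (intro integrableI_bounded) auto
      then show ?thesis using PN.Fubini_integral[of "\<lambda>z r. indicator {0<..1::real} r * (q0 (flow (- (h n * r)) z) * \<phi> z)"]
        unfolding F_def by simp
    qed
    also have "\<dots> = J n" unfolding J_def
    proof (rule Bochner_Integration.integral_cong)
      fix r
      have "(\<integral>z. q0 z * \<phi> (flow (h n * r) z) \<partial>N) = (\<integral>z. q0 (flow (- (h n * r)) z) * \<phi> z \<partial>N)"
        using integral_N_flow(2)[of "\<lambda>z. q0 (flow (- (h n * r)) z) * \<phi> z" "h n * r"] by simp
      then show "(\<integral>z. indicator {0<..1} r * (q0 (flow (- (h n * r)) z) * \<phi> z) \<partial>N) = indicator {0<..1} r * (\<integral>z. q0 z * \<phi> (flow (h n * r) z) \<partial>N)"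
        by simp
    qed simp
    finally show ?thesis .
  qed
  have "J \<longlonglongrightarrow> (\<integral>r. indicator {0<..1::real} r * (\<integral>z. q0 z * \<phi> z \<partial>N) \<partial>lborel)"
    unfolding J_def[abs_def]
  proof (rule integral_dominated_convergence[where w="\<lambda>r. indicator {0<..1} r * (B * (\<integral>z. \<bar>q0 z\<bar> \<partial>N))"])
    show "AE r in lborel. (\<lambda>n. indicator {0<..1} r * (\<integral>z. q0 z * \<phi> (flow (h n * r) z) \<partial>N)) \<longlonglongrightarrow> indicator {0<..1} r * (\<integral>z. q0 z * \<phi> z \<partial>N)"
    proof (rule AE_I2, rule tendsto_mult[OF tendsto_const], rule integral_dominated_convergence[where w="\<lambda>z. B * \<bar>q0 z\<bar>"])
      fix r :: real
      show "AE z in N. (\<lambda>n. q0 z * \<phi> (flow (h n * r) z)) \<longlonglongrightarrow> q0 z * \<phi> z"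
        using AE_N_V
      proof eventually_elim
        case (elim z)
        have "isCont (\<lambda>t. \<phi> (flow t z)) 0" using deriv[OF elim, of 0] by (rule DERIV_isCont)
        moreover have "(\<lambda>n. h n * r) \<longlonglongrightarrow> 0" using tendsto_mult[OF h_lim tendsto_const, of r] by simp
        ultimately have "(\<lambda>n. \<phi> (flow (h n * r) z)) \<longlonglongrightarrow> \<phi> (flow 0 z)" by (rule isCont_tendsto_compose)
        then show ?case by (intro tendsto_mult tendsto_const) simp
      qed
      show "AE z in N. norm (q0 z * \<phi> (flow (h n * r) z)) \<le> B * \<bar>q0 z\<bar>" for n
        using bound(1) by (intro AE_I2) (simp add: abs_mult mult.commute[of B] mult_left_mono)
    qed (use qi in auto)
    show "AE r in lborel. norm (indicator {0<..1} r * (\<integral>z. q0 z * \<phi> (flow (h n * r) z) \<partial>N)) \<le> indicator {0<..1} r * (B * (\<integral>z. \<bar>q0 z\<bar> \<partial>N))" for n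
    proof (rule AE_I2)
      fix r :: real
      have "\<bar>\<integral>z. q0 z * \<phi> (flow (h n * r) z) \<partial>N\<bar> \<le> (\<integral>z. B * \<bar>q0 z\<bar> \<partial>N)"
      proof (rule order_trans[OF integral_abs_bound], rule integral_mono')
        show "integrable N (\<lambda>z. B * \<bar>q0 z\<bar>)" using qi by auto
        show "\<bar>q0 z * \<phi> (flow (h n * r) z)\<bar> \<le> B * \<bar>q0 z\<bar>" for z
          using mult_left_mono[OF bound(1)[of "flow (h n * r) z"] abs_ge_zero[of "q0 z"]] by (simp only: abs_mult mult.commute[of B])
        show "0 \<le> B * \<bar>q0 z\<bar>" for z using B by simp
      qed
      then show "norm (indicator {0<..1} r * (\<integral>z. q0 z * \<phi> (flow (h n * r) z) \<partial>N)) \<le> indicator {0<..1} r * (B * (\<integral>z. \<bar>q0 z\<bar> \<partial>N))"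
        by (auto simp: indicator_def)
    qed
  qed (auto intro!: integrable_mult_left integrable_real_indicator)
  then have "J \<longlonglongrightarrow> (\<integral>z. q0 z * \<phi> z \<partial>N)" by simp
  then have "I \<longlonglongrightarrow> - (\<integral>z. q0 z * \<phi> z \<partial>N)" unfolding IJ by (rule tendsto_minus)
  from LIMSEQ_unique[OF lim1 this] show ?thesis by (simp add: u0_def q0_def)
qed

section \<open>Convex weights\<close>

locale convex_weight =
  fixes \<rho> :: "'a::euclidean_space \<Rightarrow> real" and G :: "'a \<Rightarrow> 'a" and H :: "'a \<Rightarrow> 'a \<Rightarrow>\<^sub>L 'a"
  assumes grad: "\<And>x. GDERIV \<rho> x :> G x"
    and hess: "\<And>x. (G has_derivative blinfun_apply (H x)) (at x)"
    and H_cont: "continuous_on UNIV H"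
    and H_pos: "\<And>x h. x \<noteq> 0 \<Longrightarrow> h \<noteq> 0 \<Longrightarrow> 0 < h \<bullet> blinfun_apply (H x) h"
    and G_0: "G 0 = 0" and \<rho>_0: "\<rho> 0 = -1"
    and \<rho>_lim: "filterlim (\<lambda>x. \<bar>\<rho> x\<bar>) at_top at_infinity"
begin

lemma \<rho>_cont: "continuous_on A \<rho>"
proof (rule continuous_at_imp_continuous_on, rule ballI)
  fix x show "isCont \<rho> x"
    using grad[of x] unfolding gderiv_def by (rule has_derivative_continuous)
qed

lemma G_cont: "continuous_on A G"
  by (rule continuous_at_imp_continuous_on, rule ballI, rule has_derivative_continuous[OF hess])

lemma \<rho>_measurable [measurable]: "\<rho> \<in> borel_measurable borel"
  by (rule borel_measurable_continuous_onI[OF \<rho>_cont])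

lemma G_measurable [measurable]: "G \<in> borel_measurable borel"
  by (rule borel_measurable_continuous_onI[OF G_cont])

lemma line_deriv: "((\<lambda>t. \<rho> (x + t *\<^sub>R v)) has_real_derivative G (x + t *\<^sub>R v) \<bullet> v) (at t)"
proof -
  have "((\<lambda>t. x + t *\<^sub>R v) has_derivative (\<lambda>h. h *\<^sub>R v)) (at t)"
    by (auto intro!: derivative_eq_intros)
  from has_derivative_compose[OF this grad[of "x + t *\<^sub>R v", unfolded gderiv_def]]
  have "((\<lambda>t. \<rho> (x + t *\<^sub>R v)) has_derivative (\<lambda>h. (G (x + t *\<^sub>R v) \<bullet> v) * h)) (at t)"
    by (simp add: inner_commute mult.commute)
  then show ?thesis by (simp add: has_field_derivative_def)
qed

lemma line_deriv2: "((\<lambda>t. G (x + t *\<^sub>R v) \<bullet> v) has_real_derivative v \<bullet> blinfun_apply (H (x + t *\<^sub>R v)) v) (at t)"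
proof -
  have "((\<lambda>t. x + t *\<^sub>R v) has_derivative (\<lambda>h. h *\<^sub>R v)) (at t)"
    by (auto intro!: derivative_eq_intros)
  from has_derivative_compose[OF this hess[of "x + t *\<^sub>R v"]]
  have "((\<lambda>t. G (x + t *\<^sub>R v)) has_derivative (\<lambda>h. blinfun_apply (H (x + t *\<^sub>R v)) (h *\<^sub>R v))) (at t)" .
  then have "((\<lambda>t. G (x + t *\<^sub>R v) \<bullet> v) has_derivative (\<lambda>h. blinfun_apply (H (x + t *\<^sub>R v)) (h *\<^sub>R v) \<bullet> v)) (at t)"
    by (rule has_derivative_inner_left)
  then have "((\<lambda>t. G (x + t *\<^sub>R v) \<bullet> v) has_derivative (\<lambda>h. (v \<bullet> blinfun_apply (H (x + t *\<^sub>R v)) v) * h)) (at t)"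
    by (simp add: inner_commute blinfun.scaleR_right mult.commute)
  then show ?thesis by (simp add: has_field_derivative_def)
qed

lemma slope_less_aux:
  assumes "v \<noteq> 0" "t1 < t2" and nz: "\<And>t. t1 < t \<Longrightarrow> t < t2 \<Longrightarrow> x + t *\<^sub>R v \<noteq> 0"
  shows "G (x + t1 *\<^sub>R v) \<bullet> v < G (x + t2 *\<^sub>R v) \<bullet> v"
proof -
  obtain t where t: "t1 < t" "t < t2"
    "G (x + t2 *\<^sub>R v) \<bullet> v - G (x + t1 *\<^sub>R v) \<bullet> v = (t2 - t1) * (v \<bullet> blinfun_apply (H (x + t *\<^sub>R v)) v)"
    using MVT2[OF assms(2), of "\<lambda>t. G (x + t *\<^sub>R v) \<bullet> v" "\<lambda>t. v \<bullet> blinfun_apply (H (x + t *\<^sub>R v)) v"] line_deriv2 by blast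
  then have "0 < (t2 - t1) * (v \<bullet> blinfun_apply (H (x + t *\<^sub>R v)) v)"
    using H_pos[OF nz[OF t(1,2)] assms(1)] assms(2) by simp
  then show ?thesis using t(3) by simp
qed

text \<open>The Hessian is known to be positive only away from the origin, which a line with
  \<open>v \<noteq> 0\<close> meets at most once; the slope increases strictly on either side of
  that time.\<close>

lemma slope_less:
  assumes "v \<noteq> 0" "t1 < t2"
  shows "G (x + t1 *\<^sub>R v) \<bullet> v < G (x + t2 *\<^sub>R v) \<bullet> v"
proof (cases "\<exists>t. t1 < t \<and> t < t2 \<and> x + t *\<^sub>R v = 0")
  case True
  then obtain t0 where t0: "t1 < t0" "t0 < t2" "x + t0 *\<^sub>R v = 0" by blast
  have nz: "x + t *\<^sub>R v \<noteq> 0" if "t \<noteq> t0" for t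
  proof
    assume "x + t *\<^sub>R v = 0"
    then have "(x + t *\<^sub>R v) - (x + t0 *\<^sub>R v) = 0" using t0(3) by simp
    then have "(t - t0) *\<^sub>R v = 0" by (simp add: scaleR_left_diff_distrib)
    then show False using that assms(1) by simp
  qed
  have "G (x + t1 *\<^sub>R v) \<bullet> v < G (x + t0 *\<^sub>R v) \<bullet> v" by (rule slope_less_aux) (use assms t0 nz in auto)
  also have "\<dots> < G (x + t2 *\<^sub>R v) \<bullet> v" by (rule slope_less_aux) (use assms t0 nz in auto)
  finally show ?thesis .
qed (use slope_less_aux assms in blast)

lemma above_tangent_line:
  assumes "v \<noteq> 0" "t \<noteq> s"
  shows "\<rho> (x + s *\<^sub>R v) + (G (x + s *\<^sub>R v) \<bullet> v) * (t - s) < \<rho> (x + t *\<^sub>R v)"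
proof (cases "s < t")
  case True
  obtain z where z: "s < z" "z < t" "\<rho> (x + t *\<^sub>R v) - \<rho> (x + s *\<^sub>R v) = (t - s) * (G (x + z *\<^sub>R v) \<bullet> v)"
    using MVT2[OF True, of "\<lambda>t. \<rho> (x + t *\<^sub>R v)" "\<lambda>t. G (x + t *\<^sub>R v) \<bullet> v"] line_deriv by blast
  have "(t - s) * (G (x + s *\<^sub>R v) \<bullet> v) < (t - s) * (G (x + z *\<^sub>R v) \<bullet> v)"
    using slope_less[OF assms(1) z(1)] True by (intro mult_strict_left_mono) auto
  then show ?thesis using z(3) by (simp add: mult.commute)
next
  case False
  then have "t < s" using assms by simp
  obtain z where z: "t < z" "z < s" "\<rho> (x + s *\<^sub>R v) - \<rho> (x + t *\<^sub>R v) = (s - t) * (G (x + z *\<^sub>R v) \<bullet> v)"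
    using MVT2[OF \<open>t < s\<close>, of "\<lambda>t. \<rho> (x + t *\<^sub>R v)" "\<lambda>t. G (x + t *\<^sub>R v) \<bullet> v"] line_deriv by blast
  have "(s - t) * (G (x + z *\<^sub>R v) \<bullet> v) < (s - t) * (G (x + s *\<^sub>R v) \<bullet> v)"
    using slope_less[OF assms(1) z(2)] \<open>t < s\<close> by (intro mult_strict_left_mono) auto
  then show ?thesis using z(3) by (simp add: algebra_simps)
qed

lemma \<rho>_gt: "x \<noteq> 0 \<Longrightarrow> -1 < \<rho> x"
  using above_tangent_line[of x 1 0 0] by (simp add: G_0 \<rho>_0)

lemma \<rho>_ge: "-1 \<le> \<rho> x"
  using \<rho>_gt[of x] \<rho>_0 by (cases "x = 0") auto

lemma G_nz: "x \<noteq> 0 \<Longrightarrow> G x \<noteq> 0"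
  using slope_less[of x 0 1 0] by (auto simp: G_0)

text \<open>Growth is assumed of \<open>|\<rho>|\<close> only; the lower bound
  \<open>\<rho>_ge\<close>, a consequence of convexity, excludes that \<open>\<rho>\<close> tends to
  minus infinity.\<close>

lemma sublevel_bounded: "bounded {x. \<rho> x \<le> s}"
proof -
  have "eventually (\<lambda>x. \<bar>s\<bar> + 2 \<le> \<bar>\<rho> x\<bar>) at_infinity"
    using \<rho>_lim by (simp add: filterlim_at_top)
  then obtain R where R: "\<And>x. R \<le> norm x \<Longrightarrow> \<bar>s\<bar> + 2 \<le> \<bar>\<rho> x\<bar>"
    by (auto simp: eventually_at_infinity)
  have "norm x \<le> R" if "\<rho> x \<le> s" for x
  proof (rule ccontr)
    assume "\<not> norm x \<le> R"
    then have "\<bar>s\<bar> + 2 \<le> \<bar>\<rho> x\<bar>" using R[of x] by simp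
    then show False using that \<rho>_ge[of x] by linarith
  qed
  then show ?thesis by (auto simp: bounded_iff)
qed

lemma sublevel_compact: "compact {x. \<rho> x \<le> s}"
  using sublevel_bounded by (auto simp: compact_eq_bounded_closed intro!: closed_Collect_le \<rho>_cont continuous_on_const)

lemma shell_compact: "compact {x. r \<le> \<rho> x \<and> \<rho> x \<le> s}"
proof -
  have "{x. r \<le> \<rho> x \<and> \<rho> x \<le> s} = {x. \<rho> x \<le> s} \<inter> {x. r \<le> \<rho> x}" by auto
  moreover have "closed {x. r \<le> \<rho> x}" by (intro closed_Collect_le \<rho>_cont continuous_on_const)
  ultimately show ?thesis using compact_Int_closed[OF sublevel_compact] by simp
qed

section \<open>Level sets: closure, outward normal and flatness\<close>

lemma level_nz: "\<rho> x = s \<Longrightarrow> -1 < s \<Longrightarrow> x \<noteq> 0"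
  using \<rho>_0 by auto

lemma local_direction:
  assumes "G x \<bullet> v > 0"
  shows "\<exists>d>0. \<forall>t. 0 < t \<and> t < d \<longrightarrow> \<rho> x < \<rho> (x + t *\<^sub>R v) \<and> \<rho> (x - t *\<^sub>R v) < \<rho> x"
proof -
  have d: "((\<lambda>t. \<rho> (x + t *\<^sub>R v)) has_real_derivative G x \<bullet> v) (at 0)"
    using line_deriv[of x v 0] by simp
  obtain d1 where "d1 > 0" "\<And>h. 0 < h \<Longrightarrow> h < d1 \<Longrightarrow> \<rho> x < \<rho> (x + h *\<^sub>R v)"
    using DERIV_pos_inc_right[OF d assms] by auto
  moreover obtain d2 where "d2 > 0" "\<And>h. 0 < h \<Longrightarrow> h < d2 \<Longrightarrow> \<rho> (x - h *\<^sub>R v) < \<rho> x"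
    using DERIV_pos_inc_left[OF d assms] by auto
  ultimately show ?thesis by (intro exI[of _ "min d1 d2"]) auto
qed

text \<open>A point of level \<open>s > -1\<close> is not the origin, so its gradient is nonzero and
  small steps against the gradient enter \<open>Z \<rho> s\<close>.\<close>

lemma closure_Z:
  assumes "-1 < s" shows "closure (Z \<rho> s) = {x. \<rho> x \<le> s}"
proof
  show "closure (Z \<rho> s) \<subseteq> {x. \<rho> x \<le> s}"
    by (rule closure_minimal) (auto simp: Z_def intro!: closed_Collect_le \<rho>_cont continuous_on_const)
  show "{x. \<rho> x \<le> s} \<subseteq> closure (Z \<rho> s)"
  proof
    fix x assume x: "x \<in> {x. \<rho> x \<le> s}"
    show "x \<in> closure (Z \<rho> s)"
    proof (cases "\<rho> x = s")
      case True
      then have "G x \<noteq> 0" using level_nz[OF _ assms] G_nz by blast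
      then have "G x \<bullet> G x > 0" by simp
      from local_direction[OF this] obtain d where d: "d > 0" "\<And>t. 0 < t \<Longrightarrow> t < d \<Longrightarrow> \<rho> (x - t *\<^sub>R G x) < \<rho> x"
        by blast
      have "(\<lambda>n. x - (d / 2 * inverse (real (Suc n))) *\<^sub>R G x) \<longlonglongrightarrow> x - (d / 2 * 0) *\<^sub>R G x"
        by (intro tendsto_intros LIMSEQ_inverse_real_of_nat)
      moreover have "x - (d / 2 * inverse (real (Suc n))) *\<^sub>R G x \<in> Z \<rho> s" for n
      proof -
        have "d / 2 * inverse (real (Suc n)) \<le> d / 2 * 1" using d(1) by (intro mult_left_mono) (auto simp: inverse_le_1_iff)
        then have "d / 2 * inverse (real (Suc n)) < d" using d(1) by simp
        moreover have "0 < d / 2 * inverse (real (Suc n))" using d(1) by simp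
        ultimately show ?thesis using d(2) True by (simp add: Z_def)
      qed
      ultimately show ?thesis unfolding closure_sequential
        by (intro exI[of _ "\<lambda>n. x - (d / 2 * inverse (real (Suc n))) *\<^sub>R G x"]) auto
    next
      case False
      then have "x \<in> Z \<rho> s" using x by (auto simp: Z_def)
      then show ?thesis using closure_subset by blast
    qed
  qed
qed

lemma open_Z: "open (Z \<rho> s)"
  unfolding Z_def by (intro open_Collect_less \<rho>_cont continuous_on_const)

lemma frontier_Z: "-1 < s \<Longrightarrow> frontier (Z \<rho> s) = {x. \<rho> x = s}"
  using open_Z[of s] by (auto simp: frontier_def closure_Z interior_open) (auto simp: Z_def)

lemma X_eq: "X_dom \<rho> = {x. 0 < \<rho> x \<and> \<rho> x < 1}"
proof -
  have cl: "closure (Z \<rho> 0) = {x. \<rho> x \<le> 0}" by (rule closure_Z) simp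
  show ?thesis unfolding X_dom_def cl by (auto simp: Z_def not_le)
qed

text \<open>For uniqueness: if another function gave a unit normal \<open>n\<close> different from
  \<open>m\<close>, then to first order \<open>h = m - n\<close> would increase
  \<open>\<rho>\<close> and decrease \<open>g\<close>, and points \<open>x + t h\<close> with small
  \<open>t > 0\<close> would lie both outside and inside \<open>Z \<rho> s\<close>.\<close>

lemma outward_normal_Z:
  assumes x: "\<rho> x = s" and s: "-1 < s"
  shows "outward_normal (Z \<rho> s) x = G x /\<^sub>R norm (G x)"
  unfolding outward_normal_def
proof (rule the_equality)
  have Gx: "G x \<noteq> 0" using level_nz[OF x s] G_nz by blast
  have "C1_with_gradient UNIV (\<lambda>y. \<rho> y - s) G"
    unfolding C1_with_gradient_def gderiv_def
    using grad[unfolded gderiv_def] by (auto intro!: G_cont derivative_eq_intros)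
  then show "\<exists>U g G'. open U \<and> x \<in> U \<and> C1_with_gradient U g G' \<and> g x = 0 \<and> G' x \<noteq> 0 \<and>
      Z \<rho> s \<inter> U = {y \<in> U. g y < 0} \<and> G x /\<^sub>R norm (G x) = G' x /\<^sub>R norm (G' x)"
    using Gx x by (intro exI[of _ UNIV] exI[of _ "\<lambda>y. \<rho> y - s"] exI[of _ G]) (auto simp: Z_def)
  fix n
  assume "\<exists>U g G'. open U \<and> x \<in> U \<and> C1_with_gradient U g G' \<and> g x = 0 \<and> G' x \<noteq> 0 \<and>
      Z \<rho> s \<inter> U = {y \<in> U. g y < 0} \<and> n = G' x /\<^sub>R norm (G' x)"
  then obtain U g G' where U: "open U" "x \<in> U" "C1_with_gradient U g G'" "g x = 0" "G' x \<noteq> 0"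
    "Z \<rho> s \<inter> U = {y \<in> U. g y < 0}" "n = G' x /\<^sub>R norm (G' x)" by blast
  define m where "m = G x /\<^sub>R norm (G x)"
  have nm: "norm n = 1" "norm m = 1" using U Gx by (auto simp: m_def)
  show "n = G x /\<^sub>R norm (G x)"
  proof (rule ccontr)
    assume ne: "n \<noteq> G x /\<^sub>R norm (G x)"
    define h where "h = m - n"
    have "0 < (norm (m - n))\<^sup>2" using ne by (simp add: m_def)
    also have "(norm (m - n))\<^sup>2 = 2 - 2 * (n \<bullet> m)"
      using nm by (simp add: power2_norm_eq_inner inner_diff inner_commute norm_eq_1)
    finally have nmless: "n \<bullet> m < 1" by simp
    have "n \<bullet> h < 0" using nmless nm by (simp add: h_def inner_diff norm_eq_1)
    then have G'h: "G' x \<bullet> h < 0" unfolding U(7) using U(5) by (simp add: mult_less_0_iff)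
    have "m \<bullet> h > 0" using nmless nm by (simp add: h_def inner_diff norm_eq_1 inner_commute)
    then have Gh: "G x \<bullet> h > 0" unfolding m_def using Gx by (simp add: zero_less_mult_iff)
    obtain d1 where d1: "d1 > 0" "\<And>t. 0 < t \<Longrightarrow> t < d1 \<Longrightarrow> \<rho> x < \<rho> (x + t *\<^sub>R h)" using local_direction[OF Gh] by blast
    have "GDERIV g x :> G' x" using U by (auto simp: C1_with_gradient_def)
    then have "(g has_derivative (\<lambda>h. h \<bullet> G' x)) (at (x + 0 *\<^sub>R h))" by (simp add: gderiv_def)
    moreover have "((\<lambda>t. x + t *\<^sub>R h) has_derivative (\<lambda>r. r *\<^sub>R h)) (at 0)" by (auto intro!: derivative_eq_intros)
    ultimately have "((\<lambda>t. g (x + t *\<^sub>R h)) has_derivative (\<lambda>r. r *\<^sub>R h \<bullet> G' x)) (at 0)"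
      by (rule has_derivative_compose[rotated])
    then have "((\<lambda>t. g (x + t *\<^sub>R h)) has_derivative (\<lambda>r. (G' x \<bullet> h) * r)) (at 0)"
      by (simp add: inner_commute mult.commute)
    then have "((\<lambda>t. g (x + t *\<^sub>R h)) has_real_derivative (G' x \<bullet> h)) (at 0)"
      by (simp add: has_field_derivative_def)
    from DERIV_neg_dec_right[OF this G'h]
    obtain d2 where d2: "d2 > 0" "\<And>t. 0 < t \<Longrightarrow> t < d2 \<Longrightarrow> g (x + t *\<^sub>R h) < g x" by auto
    have "open ((\<lambda>t. x + t *\<^sub>R h) -` U)" using U(1) by (intro open_vimage continuous_intros)
    moreover have "0 \<in> (\<lambda>t. x + t *\<^sub>R h) -` U" using U(2) by simp
    ultimately obtain d3 where "d3 > 0" "\<forall>t. dist t 0 < d3 \<longrightarrow> t \<in> (\<lambda>t. x + t *\<^sub>R h) -` U"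
      unfolding open_dist by blast
    then have d3: "d3 > 0" "\<And>t. \<bar>t\<bar> < d3 \<Longrightarrow> x + t *\<^sub>R h \<in> U" by (auto simp: dist_real_def)
    define t where "t = min d1 (min d2 d3) / 2"
    have t: "0 < t" "t < d1" "t < d2" "\<bar>t\<bar> < d3" using d1(1) d2(1) d3(1) by (auto simp: t_def)
    have "x + t *\<^sub>R h \<in> Z \<rho> s" using U(4,6) d2(2)[OF t(1,3)] d3(2)[OF t(4)] by auto
    then show False using d1(2)[OF t(1,2)] x by (simp add: Z_def)
  qed
qed

text \<open>Compactness of the closed shell times the unit sphere. The shell avoids the origin,
  where the Hessian may degenerate.\<close>

lemma hessian_lower: "\<exists>c>0. \<forall>x h. 0 \<le> \<rho> x \<longrightarrow> \<rho> x \<le> 1 \<longrightarrow> c * (norm h)\<^sup>2 \<le> h \<bullet> blinfun_apply (H x) h"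
proof -
  define Kc where "Kc = {x. 0 \<le> \<rho> x \<and> \<rho> x \<le> 1} \<times> sphere (0::'a) 1"
  have K: "compact Kc" unfolding Kc_def by (intro compact_Times shell_compact compact_sphere)
  have cont: "continuous_on Kc (\<lambda>q. snd q \<bullet> blinfun_apply (H (fst q)) (snd q))"
    by (intro continuous_intros continuous_on_compose2[OF H_cont]) auto
  have pos: "0 < snd q \<bullet> blinfun_apply (H (fst q)) (snd q)" if "q \<in> Kc" for q
    using that \<rho>_0 by (intro H_pos) (auto simp: Kc_def)
  have "\<exists>c>0. \<forall>q\<in>Kc. c \<le> snd q \<bullet> blinfun_apply (H (fst q)) (snd q)"
  proof (cases "Kc = {}")
    case False
    from continuous_attains_inf[OF K False cont] pos show ?thesis by blast
  qed (auto intro: exI[of _ 1])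
  then obtain c where c: "c > 0" "\<And>q. q \<in> Kc \<Longrightarrow> c \<le> snd q \<bullet> blinfun_apply (H (fst q)) (snd q)" by blast
  have "c * (norm h)\<^sup>2 \<le> h \<bullet> blinfun_apply (H x) h" if "0 \<le> \<rho> x" "\<rho> x \<le> 1" for x h
  proof (cases "h = 0")
    case False
    have "c \<le> (h /\<^sub>R norm h) \<bullet> blinfun_apply (H x) (h /\<^sub>R norm h)"
      using c(2)[of "(x, h /\<^sub>R norm h)"] that False by (simp add: Kc_def)
    also have "\<dots> = (h \<bullet> blinfun_apply (H x) h) / (norm h)\<^sup>2"
      by (simp add: blinfun.scaleR_right power2_eq_square divide_inverse)
    finally show ?thesis using False by (simp add: pos_le_divide_eq)
  qed simp
  then show ?thesis using c(1) by blast
qed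

text \<open>Taylor's lower bound, obtained by integrating the Hessian bound twice in the form of
  monotonicity of a difference. The segment has to stay in the closed shell, where the bound is
  available.\<close>

lemma quadratic_growth:
  assumes c: "\<And>x h. 0 \<le> \<rho> x \<Longrightarrow> \<rho> x \<le> 1 \<Longrightarrow> c * (norm h)\<^sup>2 \<le> h \<bullet> blinfun_apply (H x) h"
    and "t1 \<le> t2" and inX: "\<And>t. t1 \<le> t \<Longrightarrow> t \<le> t2 \<Longrightarrow> 0 \<le> \<rho> (x + t *\<^sub>R v) \<and> \<rho> (x + t *\<^sub>R v) \<le> 1"
  shows "\<rho> (x + t1 *\<^sub>R v) + (G (x + t1 *\<^sub>R v) \<bullet> v) * (t2 - t1) + c / 2 * (norm v)\<^sup>2 * (t2 - t1)\<^sup>2 \<le> \<rho> (x + t2 *\<^sub>R v)"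
proof -
  have g: "G (x + t1 *\<^sub>R v) \<bullet> v + c * (norm v)\<^sup>2 * (t - t1) \<le> G (x + t *\<^sub>R v) \<bullet> v" if t: "t1 \<le> t" "t \<le> t2" for t
  proof -
    have "(\<lambda>t. G (x + t *\<^sub>R v) \<bullet> v - c * (norm v)\<^sup>2 * (t - t1)) t1 \<le> (\<lambda>t. G (x + t *\<^sub>R v) \<bullet> v - c * (norm v)\<^sup>2 * (t - t1)) t"
    proof (rule DERIV_nonneg_imp_nondecreasing[OF t(1)])
      fix r assume r: "t1 \<le> r" "r \<le> t"
      have "((\<lambda>t. G (x + t *\<^sub>R v) \<bullet> v - c * (norm v)\<^sup>2 * (t - t1)) has_real_derivative (v \<bullet> blinfun_apply (H (x + r *\<^sub>R v)) v - c * (norm v)\<^sup>2)) (at r)"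
        by (rule derivative_eq_intros line_deriv2 refl | simp)+
      moreover have "0 \<le> v \<bullet> blinfun_apply (H (x + r *\<^sub>R v)) v - c * (norm v)\<^sup>2" using c[of "x + r *\<^sub>R v" v] inX[of r] r t by simp
      ultimately show "\<exists>y. ((\<lambda>t. G (x + t *\<^sub>R v) \<bullet> v - c * (norm v)\<^sup>2 * (t - t1)) has_real_derivative y) (at r) \<and> 0 \<le> y" by blast
    qed
    then show ?thesis by simp
  qed
  define F where "F t = \<rho> (x + t *\<^sub>R v) - (G (x + t1 *\<^sub>R v) \<bullet> v) * (t - t1) - c / 2 * (norm v)\<^sup>2 * (t - t1)\<^sup>2" for t
  have "F t1 \<le> F t2"
  proof (rule DERIV_nonneg_imp_nondecreasing[OF \<open>t1 \<le> t2\<close>])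
    fix r assume r: "t1 \<le> r" "r \<le> t2"
    have "(F has_real_derivative (G (x + r *\<^sub>R v) \<bullet> v - G (x + t1 *\<^sub>R v) \<bullet> v - c * (norm v)\<^sup>2 * (r - t1))) (at r)"
      unfolding F_def[abs_def] by (rule derivative_eq_intros line_deriv refl | simp)+
    then show "\<exists>y. (F has_real_derivative y) (at r) \<and> 0 \<le> y" using g[OF r] by force
  qed
  then show ?thesis by (simp add: F_def)
qed

text \<open>By Rolle's theorem the slope of \<open>\<rho>\<close> along the segment from
  \<open>y'\<close> to \<open>y\<close> vanishes at an inner point, and a bounded Hessian limits its
  change between there and \<open>y'\<close>. Intermediate points lie in a fixed ball, by convexity
  of the ball. This supplies the flatness hypothesis of
  \<open>emeasure_tube_le_hausdorff\<close>.\<close>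

lemma level_flat:
  assumes s: "-1 < s"
  shows "\<exists>M\<ge>0. \<forall>y y'. \<rho> y = s \<longrightarrow> \<rho> y' = s \<longrightarrow> \<bar>(G y' /\<^sub>R norm (G y')) \<bullet> (y - y')\<bar> \<le> M * (norm (y - y'))\<^sup>2"
proof -
  obtain R where R: "\<And>x. \<rho> x = s \<Longrightarrow> x \<in> cball 0 R"
    using sublevel_bounded[of s] by (auto simp: bounded_iff)
  have "compact (H ` cball 0 R)" by (intro compact_continuous_image continuous_on_subset[OF H_cont]) auto
  from compact_imp_bounded[OF this] obtain C where "\<forall>y\<in>H ` cball 0 R. norm y \<le> C"
    unfolding bounded_iff by blast
  then have C: "\<And>x. x \<in> cball 0 R \<Longrightarrow> norm (H x) \<le> C" by blast
  define S where "S = {x. s \<le> \<rho> x \<and> \<rho> x \<le> s}"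
  have "\<exists>m>0. \<forall>x\<in>S. m \<le> norm (G x)"
  proof (cases "S = {}")
    case False
    have "compact S" unfolding S_def by (rule shell_compact)
    moreover have "continuous_on S (\<lambda>x. norm (G x))" by (intro continuous_intros G_cont)
    ultimately obtain x0 where "x0 \<in> S" "\<forall>x\<in>S. norm (G x0) \<le> norm (G x)" using continuous_attains_inf[OF _ False] by blast
    moreover then have "G x0 \<noteq> 0" using level_nz[OF _ s, of x0] G_nz by (auto simp: S_def)
    ultimately show ?thesis by (intro exI[of _ "norm (G x0)"]) auto
  qed (auto intro: exI[of _ 1])
  then obtain m where m: "m > 0" "\<And>x. \<rho> x = s \<Longrightarrow> m \<le> norm (G x)" by (auto simp: S_def)
  have "\<bar>(G y' /\<^sub>R norm (G y')) \<bullet> (y - y')\<bar> \<le> \<bar>C\<bar> / m * (norm (y - y'))\<^sup>2" if y: "\<rho> y = s" "\<rho> y' = s" for y y'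
  proof -
    define v where "v = y - y'"
    obtain z where z: "0 < z" "z < 1" "\<rho> (y' + 1 *\<^sub>R v) - \<rho> (y' + 0 *\<^sub>R v) = (1 - 0) * (G (y' + z *\<^sub>R v) \<bullet> v)"
      using MVT2[OF zero_less_one, of "\<lambda>t. \<rho> (y' + t *\<^sub>R v)" "\<lambda>t. G (y' + t *\<^sub>R v) \<bullet> v"] line_deriv by blast
    then have Gz: "G (y' + z *\<^sub>R v) \<bullet> v = 0" using y by (simp add: v_def)
    obtain w where w: "0 < w" "w < z" "G (y' + z *\<^sub>R v) \<bullet> v - G (y' + 0 *\<^sub>R v) \<bullet> v = (z - 0) * (v \<bullet> blinfun_apply (H (y' + w *\<^sub>R v)) v)"
      using MVT2[OF z(1), of "\<lambda>t. G (y' + t *\<^sub>R v) \<bullet> v" "\<lambda>t. v \<bullet> blinfun_apply (H (y' + t *\<^sub>R v)) v"] line_deriv2 by blast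
    have "y' + w *\<^sub>R v = (1 - w) *\<^sub>R y' + w *\<^sub>R y" by (simp add: v_def algebra_simps)
    then have inb: "y' + w *\<^sub>R v \<in> cball 0 R"
      using convexD_alt[OF convex_cball R[OF y(2)] R[OF y(1)], of w] w z by simp
    have "\<bar>G y' \<bullet> v\<bar> = z * \<bar>v \<bullet> blinfun_apply (H (y' + w *\<^sub>R v)) v\<bar>"
      using w(3) Gz z(1) by (simp add: abs_mult) (metis abs_minus_cancel abs_mult abs_of_pos)
    also have "\<dots> \<le> 1 * (norm v * (norm (H (y' + w *\<^sub>R v)) * norm v))"
      using z by (intro mult_mono order_trans[OF Cauchy_Schwarz_ineq2] mult_left_mono norm_blinfun) auto
    also have "\<dots> \<le> 1 * (norm v * (\<bar>C\<bar> * norm v))"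
      using C[OF inb] by (intro mult_left_mono mult_right_mono) auto
    finally have a: "\<bar>G y' \<bullet> v\<bar> \<le> \<bar>C\<bar> * (norm v)\<^sup>2" by (simp add: power2_eq_square mult.left_commute)
    have "\<bar>(G y' /\<^sub>R norm (G y')) \<bullet> v\<bar> = \<bar>G y' \<bullet> v\<bar> / norm (G y')" by (simp add: abs_mult divide_inverse mult.commute)
    also have "\<dots> \<le> \<bar>C\<bar> * (norm v)\<^sup>2 / m" using a m(1) m(2)[OF y(2)] by (intro frac_le) auto
    finally show ?thesis by (simp add: v_def)
  qed
  then show ?thesis using m(1) by (intro exI[of _ "\<bar>C\<bar> / m"]) auto
qed

lemma level_closed_hypersurface:
  assumes s: "-1 < s" shows "closed_hypersurface {x. \<rho> x = s}"
  unfolding closed_hypersurface_def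
proof (intro conjI ballI)
  show "compact {x. \<rho> x = s}" using shell_compact[of s s] by (simp add: eq_iff conj_commute)
  fix x assume x: "x \<in> {x. \<rho> x = s}"
  have "C1_with_gradient UNIV (\<lambda>y. \<rho> y - s) G"
    unfolding C1_with_gradient_def gderiv_def
    using grad[unfolded gderiv_def] by (auto intro!: G_cont derivative_eq_intros)
  then show "\<exists>U g G. open U \<and> x \<in> U \<and> C1_with_gradient U g G \<and> G x \<noteq> 0 \<and> {x. \<rho> x = s} \<inter> U = {y \<in> U. g y = 0}"
    using x level_nz[OF _ s] G_nz by (intro exI[of _ UNIV] exI[of _ "\<lambda>y. \<rho> y - s"] exI[of _ G]) auto
qed

section \<open>The minimum of the weight on a line\<close>

definition slope :: "'a \<times> 'a \<Rightarrow> real \<Rightarrow> real" where "slope z t = G (fst z + t *\<^sub>R snd z) \<bullet> snd z"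

definition min_time :: "'a \<times> 'a \<Rightarrow> real" where "min_time z = (if snd z = 0 then 0 else (THE t. slope z t = 0))"

definition line_min :: "'a \<times> 'a \<Rightarrow> real" where "line_min z = \<rho> (fst z + min_time z *\<^sub>R snd z)"

text \<open>The minimum on the line is attained because the times at which \<open>\<rho>\<close>
  does not exceed its value at time 0 form a compact set; strict monotonicity of the slope makes its
  zero unique, as the definite description requires.\<close>

lemma slope_min_time:
  assumes "snd z \<noteq> 0" shows "slope z (min_time z) = 0"
proof -
  let ?f = "\<lambda>t. \<rho> (fst z + t *\<^sub>R snd z)"
  have "bounded {t. ?f t \<le> \<rho> (fst z)}"
  proof -
    obtain R where R: "\<And>x. \<rho> x \<le> \<rho> (fst z) \<Longrightarrow> norm x \<le> R" using sublevel_bounded[of "\<rho> (fst z)"] by (auto simp: bounded_iff)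
    have "\<bar>t\<bar> \<le> (R + norm (fst z)) / norm (snd z)" if "?f t \<le> \<rho> (fst z)" for t
    proof -
      have "\<bar>t\<bar> * norm (snd z) = norm ((fst z + t *\<^sub>R snd z) - fst z)" by simp
      also have "\<dots> \<le> R + norm (fst z)" using R[OF that] norm_triangle_ineq4[of "fst z + t *\<^sub>R snd z" "fst z"] by linarith
      finally show ?thesis using assms by (simp add: pos_le_divide_eq)
    qed
    then show ?thesis by (auto simp: bounded_iff)
  qed
  moreover have "closed {t. ?f t \<le> \<rho> (fst z)}"
    by (intro closed_Collect_le continuous_on_compose2[OF \<rho>_cont] continuous_intros) auto
  ultimately have "compact {t. ?f t \<le> \<rho> (fst z)}" by (simp add: compact_eq_bounded_closed)
  moreover have "0 \<in> {t. ?f t \<le> \<rho> (fst z)}" by simp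
  moreover have "continuous_on {t. ?f t \<le> \<rho> (fst z)} ?f" by (intro continuous_on_compose2[OF \<rho>_cont] continuous_intros) auto
  ultimately obtain t0 where t0: "?f t0 \<le> \<rho> (fst z)" "\<And>t. ?f t \<le> \<rho> (fst z) \<Longrightarrow> ?f t0 \<le> ?f t"
    using continuous_attains_inf[of "{t. ?f t \<le> \<rho> (fst z)}" ?f] by blast
  have min: "?f t0 \<le> ?f t" for t using t0 by (cases "?f t \<le> \<rho> (fst z)") auto
  have "slope z t0 = 0" unfolding slope_def
    by (rule DERIV_local_min[OF line_deriv zero_less_one]) (use min in auto)
  moreover have "t = t0" if "slope z t = 0" for t
    using that \<open>slope z t0 = 0\<close> slope_less[OF assms, of t t0 "fst z"] slope_less[OF assms, of t0 t "fst z"]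
    unfolding slope_def by (cases t t0 rule: linorder_cases) auto
  ultimately have "slope z (THE t. slope z t = 0) = 0" by (rule theI)
  then show ?thesis using assms by (simp add: min_time_def)
qed

lemma slope_iff:
  assumes "snd z \<noteq> 0"
  shows "slope z t < 0 \<longleftrightarrow> t < min_time z" "0 < slope z t \<longleftrightarrow> min_time z < t"
  using slope_min_time[OF assms] slope_less[OF assms, of t "min_time z" "fst z"] slope_less[OF assms, of "min_time z" t "fst z"]
  unfolding slope_def by (cases t "min_time z" rule: linorder_cases; force)+

lemma slope_measurable [measurable]: "(\<lambda>z. slope z t) \<in> borel_measurable borel"
  unfolding slope_def by measurable

text \<open>Whether the minimum comes before time \<open>a\<close> is read off from the sign of the
  slope at \<open>a\<close>, which depends continuously on the line.\<close>

lemma min_time_measurable [measurable]: "min_time \<in> borel_measurable borel"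
proof (rule borel_measurableI_less)
  fix a
  have "{z \<in> space borel. min_time z < a} = {z. (snd z \<noteq> 0 \<and> 0 < slope z a) \<or> (snd z = 0 \<and> 0 < a)}"
    using slope_iff by (auto simp: min_time_def)
  also have "\<dots> \<in> sets borel" by measurable
  finally show "{z \<in> space borel. min_time z < a} \<in> sets borel" .
qed

lemma line_min_measurable [measurable]: "line_min \<in> borel_measurable borel"
  unfolding line_min_def by measurable

lemma slope_flow: "slope (flow t z) s = slope z (s + t)"
  by (simp add: slope_def algebra_simps)

lemma min_time_flow: "snd z \<noteq> 0 \<Longrightarrow> min_time (flow t z) = min_time z - t"
proof -
  assume nz: "snd z \<noteq> 0"
  have "slope (flow t z) (min_time z - t) = 0" using slope_min_time[OF nz] by (simp add: slope_flow)
  then show ?thesis using slope_iff[of "flow t z" "min_time z - t"] nz by force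
qed

lemma line_min_flow: "snd z \<noteq> 0 \<Longrightarrow> line_min (flow t z) = line_min z"
  by (simp add: line_min_def min_time_flow algebra_simps)

lemma line_min_le: "snd z \<noteq> 0 \<Longrightarrow> line_min z \<le> \<rho> (fst z + t *\<^sub>R snd z)"
  using above_tangent_line[of "snd z" t "min_time z" "fst z"] slope_min_time[of z]
  by (cases "t = min_time z") (auto simp: line_min_def slope_def)

lemma increasing_right: "snd z \<noteq> 0 \<Longrightarrow> min_time z \<le> s \<Longrightarrow> s < t \<Longrightarrow> \<rho> (fst z + s *\<^sub>R snd z) < \<rho> (fst z + t *\<^sub>R snd z)"
proof -
  assume a: "snd z \<noteq> 0" "min_time z \<le> s" "s < t"
  have "0 \<le> slope z s" using slope_iff(1)[OF a(1), of s] a(2) by simp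
  then have "0 \<le> slope z s * (t - s)" using a by simp
  then show ?thesis using above_tangent_line[of "snd z" t s "fst z"] a by (simp add: slope_def)
qed

lemma decreasing_left: "snd z \<noteq> 0 \<Longrightarrow> s \<le> min_time z \<Longrightarrow> t < s \<Longrightarrow> \<rho> (fst z + s *\<^sub>R snd z) < \<rho> (fst z + t *\<^sub>R snd z)"
proof -
  assume a: "snd z \<noteq> 0" "s \<le> min_time z" "t < s"
  have "slope z s \<le> 0" using slope_iff(2)[OF a(1), of s] a(2) by simp
  then have "0 \<le> slope z s * (t - s)" using a by (simp add: mult_nonpos_nonpos)
  then show ?thesis using above_tangent_line[of "snd z" t s "fst z"] a by (simp add: slope_def)
qed

end

section \<open>Chords of the shell\<close>

lemma isCont_tendsto_nhds: "isCont f x \<Longrightarrow> (f \<longlongrightarrow> f x) (nhds x)"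
  by (simp only: isCont_def tendsto_at_iff_tendsto_nhds)

locale shell_domain = transport_domain X V D + convex_weight \<rho> G H
  for X V :: "'a::euclidean_space set" and D :: "'a measure" and \<rho> :: "'a \<Rightarrow> real" and G :: "'a \<Rightarrow> 'a" and H :: "'a \<Rightarrow> 'a \<Rightarrow>\<^sub>L 'a" +
  fixes \<epsilon> :: real
  assumes X_shell: "X = {x. 0 < \<rho> x \<and> \<rho> x < 1}" and \<epsilon>: "0 < \<epsilon>" "\<epsilon> < 1"
begin

text \<open>Lines of type \<open>0\<close> meet \<open>Z\<^sub>0\<close>, lines of type \<open>1\<close> avoid the set where \<open>\<rho> < 1 - \<epsilon>\<close>. The base point is the
  end of the chord on \<open>\<partial>Z\<^sub>0\<close> in the first case and the entry point in the second; on all other lines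
  no data are given and the base point is the minimum of \<open>\<rho>\<close>. The sign makes
  \<open>y + inward_sign (y, v) * t * v\<close> enter the shell for small \<open>t > 0\<close>.\<close>

definition exit_time :: "'a \<times> 'a \<Rightarrow> real" where
  "exit_time z = (if fst z \<in> X \<and> snd z \<noteq> 0 then tau_plus X (fst z) (snd z) else 0)"
definition entry_time :: "'a \<times> 'a \<Rightarrow> real" where
  "entry_time z = (if fst z \<in> X \<and> snd z \<noteq> 0 then tau_minus X (fst z) (snd z) else 0)"
definition base_time :: "'a \<times> 'a \<Rightarrow> real" where
  "base_time z = (if 1 - \<epsilon> \<le> line_min z then - entry_time z else max (- entry_time z) (min (min_time z) (exit_time z)))"
definition base :: "'a \<times> 'a \<Rightarrow> 'a" where
  "base z = fst z + base_time z *\<^sub>R snd z"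
definition line_type :: "real \<Rightarrow> 'a \<times> 'a \<Rightarrow> bool" where
  "line_type s z \<longleftrightarrow> fst z \<in> X \<and> snd z \<noteq> 0 \<and> (s = 0 \<and> line_min z < 0 \<or> s = 1 \<and> 1 - \<epsilon> \<le> line_min z)"
definition data_boundary :: "real \<Rightarrow> ('a \<times> 'a) set" where
  "data_boundary s = {z. \<rho> (fst z) = s \<and> (s = 0 \<and> G (fst z) \<bullet> snd z \<noteq> 0 \<or> s = 1 \<and> G (fst z) \<bullet> snd z < 0 \<and> 1 - \<epsilon> \<le> line_min z)}"
definition inward_sign :: "'a \<times> 'a \<Rightarrow> real" where
  "inward_sign z = (if \<rho> (fst z) = 0 \<and> G (fst z) \<bullet> snd z < 0 then -1 else 1)"

lemma seg_exit_time:
  assumes "fst z \<in> X" "snd z \<noteq> 0"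
  shows "0 < exit_time z" "0 < entry_time z" "seg X z t \<longleftrightarrow> - entry_time z < t \<and> t < exit_time z" "T z = entry_time z + exit_time z"
  using seg_iff_tau[OF assms] T_eq(1)[OF assms] assms by (auto simp: exit_time_def entry_time_def tau_def)

text \<open>For \<open>a \<ge> 0\<close> the set where the exit time exceeds \<open>a\<close> is
  given by \<open>seg\<close> at the fixed time \<open>a\<close>, so measurability of an uncountable
  infimum never has to be faced.\<close>

lemma exit_time_measurable [measurable]: "exit_time \<in> borel_measurable borel"
proof (rule borel_measurableI_greater)
  fix a
  show "{z \<in> space borel. a < exit_time z} \<in> sets borel"
  proof (cases "a < 0")
    case True
    then have "a < exit_time z" for z
      using seg_exit_time(1)[of z] by (cases "fst z \<in> X \<and> snd z \<noteq> 0") (force, auto simp: exit_time_def)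
    then show ?thesis by simp
  next
    case False
    have "a < exit_time z \<longleftrightarrow> snd z \<noteq> 0 \<and> seg X z a" for z
    proof (cases "fst z \<in> X \<and> snd z \<noteq> 0")
      case True
      then show ?thesis using seg_exit_time(2)[of z] seg_exit_time(3)[of z a] False by auto
    next
      case no: False
      then show ?thesis using seg_in(1)[of X z a] False by (auto simp: exit_time_def)
    qed
    then have "{z \<in> space borel. a < exit_time z} = {z. snd z \<noteq> 0 \<and> seg X z a}" by auto
    also have "\<dots> \<in> sets borel" by measurable
    finally show ?thesis .
  qed
qed

lemma entry_time_measurable [measurable]: "entry_time \<in> borel_measurable borel"
proof (rule borel_measurableI_greater)
  fix a
  show "{z \<in> space borel. a < entry_time z} \<in> sets borel"
  proof (cases "a < 0")
    case True
    then have "a < entry_time z" for z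
      using seg_exit_time(2)[of z] by (cases "fst z \<in> X \<and> snd z \<noteq> 0") (force, auto simp: entry_time_def)
    then show ?thesis by simp
  next
    case False
    have "a < entry_time z \<longleftrightarrow> snd z \<noteq> 0 \<and> seg X z (- a)" for z
    proof (cases "fst z \<in> X \<and> snd z \<noteq> 0")
      case True
      then show ?thesis using seg_exit_time(1)[of z] seg_exit_time(3)[of z "- a"] False by auto
    next
      case no: False
      then show ?thesis using seg_in(1)[of X z "- a"] False by (auto simp: entry_time_def)
    qed
    then have "{z \<in> space borel. a < entry_time z} = {z. snd z \<noteq> 0 \<and> seg X z (- a)}" by auto
    also have "\<dots> \<in> sets borel" by measurable
    finally show ?thesis .
  qed
qed

lemma base_time_measurable [measurable]: "base_time \<in> borel_measurable borel"
  unfolding base_time_def by measurable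

lemma base_measurable [measurable]: "base \<in> borel_measurable borel"
  unfolding base_def by measurable

lemma line_type_measurable [measurable]: "Measurable.pred borel (line_type s)"
  unfolding line_type_def by measurable

lemma data_boundary_measurable [measurable]: "data_boundary s \<in> sets borel"
  unfolding data_boundary_def by measurable

lemma inward_sign_measurable [measurable]: "inward_sign \<in> borel_measurable borel"
  unfolding inward_sign_def by measurable

lemma exit_time_flow:
  assumes s: "seg X z t" and nz: "snd z \<noteq> 0"
  shows "exit_time (flow t z) = exit_time z - t" "entry_time (flow t z) = entry_time z + t"
proof -
  have z: "fst z \<in> X" "fst (flow t z) \<in> X" using seg_in[OF s] by auto
  note a = seg_exit_time[OF z(1) nz] and b = seg_exit_time[of "flow t z"]
  have eq: "{- entry_time (flow t z)<..<exit_time (flow t z)} = {- entry_time z - t<..<exit_time z - t}"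
  proof (rule set_eqI)
    fix r
    have "seg X (flow t z) r \<longleftrightarrow> - entry_time (flow t z) < r \<and> r < exit_time (flow t z)" using b(3) z(2) nz by simp
    moreover have "seg X (flow t z) r \<longleftrightarrow> - entry_time z < r + t \<and> r + t < exit_time z" unfolding seg_flow_iff[OF s] by (rule a(3))
    ultimately show "r \<in> {- entry_time (flow t z)<..<exit_time (flow t z)} \<longleftrightarrow> r \<in> {- entry_time z - t<..<exit_time z - t}" by auto
  qed
  have ne: "- entry_time (flow t z) < exit_time (flow t z)" "- entry_time z - t < exit_time z - t" using a(1,2) b(1,2) z(2) nz by auto
  show "exit_time (flow t z) = exit_time z - t" using cSup_greaterThanLessThan[OF ne(1)] cSup_greaterThanLessThan[OF ne(2)] eq by simp
  show "entry_time (flow t z) = entry_time z + t" using cInf_greaterThanLessThan[OF ne(1)] cInf_greaterThanLessThan[OF ne(2)] eq by simp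
qed

lemma base_time_flow: "seg X z t \<Longrightarrow> snd z \<noteq> 0 \<Longrightarrow> base_time (flow t z) = base_time z - t"
  unfolding base_time_def by (simp add: exit_time_flow min_time_flow line_min_flow max_def min_def)

lemma base_flow: "seg X z t \<Longrightarrow> snd z \<noteq> 0 \<Longrightarrow> base (flow t z) = base z"
  by (simp add: base_def base_time_flow algebra_simps)

lemma line_type_flow: "seg X z t \<Longrightarrow> line_type s (flow t z) \<longleftrightarrow> line_type s z"
  using seg_in[of X z t] line_min_flow[of z t] by (auto simp: line_type_def)

lemma inside: "fst z \<in> X \<Longrightarrow> snd z \<noteq> 0 \<Longrightarrow> - entry_time z < t \<Longrightarrow> t < exit_time z \<Longrightarrow> 0 < \<rho> (fst z + t *\<^sub>R snd z) \<and> \<rho> (fst z + t *\<^sub>R snd z) < 1"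
  using seg_exit_time(3)[of z t] seg_in(2)[of X z t] by (auto simp: X_shell)

text \<open>By closure the values lie in \<open>{0..1}\<close>; the ends of the chord are not in
  \<open>X\<close>, which excludes values strictly in between.\<close>

lemma endpoints:
  assumes z: "fst z \<in> X" "snd z \<noteq> 0"
  shows "\<rho> (fst z + exit_time z *\<^sub>R snd z) \<in> {0, 1}" "\<rho> (fst z + (- entry_time z) *\<^sub>R snd z) \<in> {0, 1}"
proof -
  note s = seg_exit_time[OF z]
  have "closed {t. 0 \<le> \<rho> (fst z + t *\<^sub>R snd z) \<and> \<rho> (fst z + t *\<^sub>R snd z) \<le> 1}"
    by (intro closed_Collect_conj closed_Collect_le continuous_on_compose2[OF \<rho>_cont] continuous_intros) auto
  moreover have "{- entry_time z<..<exit_time z} \<subseteq> {t. 0 \<le> \<rho> (fst z + t *\<^sub>R snd z) \<and> \<rho> (fst z + t *\<^sub>R snd z) \<le> 1}"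
    using inside[OF z] by (auto simp: less_imp_le)
  ultimately have "closure {- entry_time z<..<exit_time z} \<subseteq> {t. 0 \<le> \<rho> (fst z + t *\<^sub>R snd z) \<and> \<rho> (fst z + t *\<^sub>R snd z) \<le> 1}"
    by (rule closure_minimal[rotated])
  moreover have "closure {- entry_time z<..<exit_time z} = {- entry_time z..exit_time z}" using s(1,2) by (intro closure_greaterThanLessThan) simp
  ultimately have cl: "0 \<le> \<rho> (fst z + t *\<^sub>R snd z) \<and> \<rho> (fst z + t *\<^sub>R snd z) \<le> 1" if "- entry_time z \<le> t" "t \<le> exit_time z" for t
    using that by auto
  have "\<not> seg X z (exit_time z)" "\<not> seg X z (- entry_time z)" using s by auto
  moreover have "r = exit_time z" if "0 \<le> r \<and> r \<le> exit_time z \<or> exit_time z \<le> r \<and> r \<le> 0" "fst z + r *\<^sub>R snd z \<notin> X" for r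
  proof (rule ccontr)
    assume "r \<noteq> exit_time z"
    then have "- entry_time z < r" "r < exit_time z" using that(1) s(1,2) by auto
    then show False using inside[OF z, of r] that(2) by (simp add: X_shell)
  qed
  moreover have "r = - entry_time z" if "0 \<le> r \<and> r \<le> - entry_time z \<or> - entry_time z \<le> r \<and> r \<le> 0" "fst z + r *\<^sub>R snd z \<notin> X" for r
  proof (rule ccontr)
    assume "r \<noteq> - entry_time z"
    then have "- entry_time z < r" "r < exit_time z" using that(1) s(1,2) by auto
    then show False using inside[OF z, of r] that(2) by (simp add: X_shell)
  qed
  ultimately have "fst z + exit_time z *\<^sub>R snd z \<notin> X" "fst z + (- entry_time z) *\<^sub>R snd z \<notin> X"
    unfolding seg_iff by blast+
  then show "\<rho> (fst z + exit_time z *\<^sub>R snd z) \<in> {0, 1}" "\<rho> (fst z + (- entry_time z) *\<^sub>R snd z) \<in> {0, 1}"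
    using cl[of "exit_time z"] cl[of "- entry_time z"] s(1,2) by (auto simp: X_shell)
qed

lemma slope_base: "slope z (base_time z) = G (base z) \<bullet> snd z"
  by (simp add: slope_def base_def)

text \<open>If the line meets \<open>Z\<^sub>0\<close>, its minimum lies outside the chord, and
  clamping \<open>min_time\<close> to the chord selects the end facing the minimum. There
  \<open>\<rho>\<close> is smaller than inside, hence 0. The slope does not vanish because the
  minimum itself is negative and so is not that end. In the other case the entry point precedes the
  minimum, where \<open>\<rho>\<close> is decreasing.\<close>

lemma base_line_type:
  assumes t: "line_type s z"
  shows "\<rho> (base z) = s \<and> G (base z) \<bullet> snd z \<noteq> 0 \<and> (base_time z = - entry_time z \<or> base_time z = exit_time z) \<and> (s = 1 \<longrightarrow> G (base z) \<bullet> snd z < 0)"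
proof -
  have z: "fst z \<in> X" "snd z \<noteq> 0" using t by (auto simp: line_type_def)
  note inward_sign = seg_exit_time[OF z]
  have fz: "0 < \<rho> (fst z + 0 *\<^sub>R snd z)" "\<rho> (fst z + 0 *\<^sub>R snd z) < 1" using z(1) by (auto simp: X_shell)
  show ?thesis
  proof (cases "s = 0")
    case True
    then have neg: "line_min z < 0" using t by (simp add: line_type_def)
    then have base_time: "base_time z = max (- entry_time z) (min (min_time z) (exit_time z))" using \<epsilon> by (simp add: base_time_def)
    have "\<not> (- entry_time z < min_time z \<and> min_time z < exit_time z)" using inside[OF z, of "min_time z"] neg by (auto simp: line_min_def)
    then consider "min_time z \<le> - entry_time z" | "exit_time z \<le> min_time z" by linarith
    then show ?thesis
    proof cases
      case 1
      then have b: "base_time z = - entry_time z" using inward_sign(1,2) base_time by simp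
      have "\<rho> (fst z + (- entry_time z) *\<^sub>R snd z) < \<rho> (fst z + 0 *\<^sub>R snd z)" using increasing_right[OF z(2) 1, of 0] inward_sign(2) by simp
      then have r0: "\<rho> (fst z + (- entry_time z) *\<^sub>R snd z) = 0" using endpoints(2)[OF z] fz by auto
      then have "min_time z \<noteq> - entry_time z" using neg by (auto simp: line_min_def)
      then have "0 < slope z (base_time z)" using slope_iff(2)[OF z(2)] 1 b by simp
      then show ?thesis using b r0 True unfolding slope_base by (simp add: base_def)
    next
      case 2
      then have b: "base_time z = exit_time z" using inward_sign(1,2) base_time by simp
      have "\<rho> (fst z + exit_time z *\<^sub>R snd z) < \<rho> (fst z + 0 *\<^sub>R snd z)" using decreasing_left[OF z(2) 2, of 0] inward_sign(1) by simp
      then have r0: "\<rho> (fst z + exit_time z *\<^sub>R snd z) = 0" using endpoints(1)[OF z] fz by auto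
      then have "min_time z \<noteq> exit_time z" using neg by (auto simp: line_min_def)
      then have "slope z (base_time z) < 0" using slope_iff(1)[OF z(2)] 2 b by simp
      then show ?thesis using b r0 True unfolding slope_base by (simp add: base_def)
    qed
  next
    case False
    then have s: "s = 1" "1 - \<epsilon> \<le> line_min z" using t by (auto simp: line_type_def)
    then have b: "base_time z = - entry_time z" by (simp add: base_time_def)
    have "0 < \<rho> (fst z + (- entry_time z) *\<^sub>R snd z)" using line_min_le[OF z(2), of "- entry_time z"] s(2) \<epsilon> by linarith
    then have r1: "\<rho> (fst z + (- entry_time z) *\<^sub>R snd z) = 1" using endpoints(2)[OF z] by auto
    have "- entry_time z < min_time z"
    proof (rule ccontr)
      assume "\<not> - entry_time z < min_time z"
      then have "\<rho> (fst z + (- entry_time z) *\<^sub>R snd z) < \<rho> (fst z + 0 *\<^sub>R snd z)" using increasing_right[OF z(2), of "- entry_time z" 0] inward_sign(2) by simp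
      then show False using r1 fz by simp
    qed
    then have "slope z (base_time z) < 0" using slope_iff(1)[OF z(2)] b by simp
    then show ?thesis using b r1 s(1) unfolding slope_base by (simp add: base_def)
  qed
qed

text \<open>By continuity the slope keeps the sign it has at \<open>y0\<close>, so
  \<open>\<rho>\<close> is strictly monotone on short segments entering the shell. The equation for
  \<open>base_time\<close> says that \<open>y\<close> itself is the base point of the line through
  the inner point. Uniformity in \<open>y\<close> lets a whole piece of the boundary be swept at
  once.\<close>

lemma near_boundary:
  assumes y0: "(y0, v) \<in> data_boundary s" and v: "v \<noteq> 0"
  shows "\<exists>r>0. \<forall>y t. (y, v) \<in> data_boundary s \<longrightarrow> dist y0 y \<le> r \<longrightarrow> 0 < t \<longrightarrow> t \<le> r \<longrightarrow>
    inward_sign (y, v) = inward_sign (y0, v) \<and> y + (inward_sign (y, v) * t) *\<^sub>R v \<in> X \<and> base_time (y + (inward_sign (y, v) * t) *\<^sub>R v, v) = - (inward_sign (y, v) * t)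
    \<and> line_type s (y + (inward_sign (y, v) * t) *\<^sub>R v, v)"
proof -
  define \<gamma> where "\<gamma> = G y0 \<bullet> v"
  have \<gamma>: "\<gamma> \<noteq> 0" using y0 by (auto simp: data_boundary_def \<gamma>_def)
  have s01: "s = 0 \<or> s = 1" and \<rho>y0: "\<rho> y0 = s" using y0 by (auto simp: data_boundary_def)
  have c1: "isCont (\<lambda>q::'a \<times> real. G (fst q + snd q *\<^sub>R v) \<bullet> v) (y0, 0)"
  proof -
    have "continuous_on UNIV (\<lambda>q::'a \<times> real. G (fst q + snd q *\<^sub>R v) \<bullet> v)"
      by (intro continuous_intros continuous_on_compose2[OF G_cont[of UNIV]]) auto
    then show ?thesis by (simp add: continuous_on_eq_continuous_at)
  qed
  have c2: "isCont (\<lambda>q::'a \<times> real. \<rho> (fst q + snd q *\<^sub>R v)) (y0, 0)"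
  proof -
    have "continuous_on UNIV (\<lambda>q::'a \<times> real. \<rho> (fst q + snd q *\<^sub>R v))"
      by (intro continuous_on_compose2[OF \<rho>_cont[of UNIV]] continuous_intros) auto
    then show ?thesis by (simp add: continuous_on_eq_continuous_at)
  qed
  have "((\<lambda>q. G (fst q + snd q *\<^sub>R v) \<bullet> v) \<longlongrightarrow> \<gamma>) (nhds (y0, 0))"
    using isCont_tendsto_nhds[OF c1] by (simp add: \<gamma>_def)
  then have "\<forall>\<^sub>F q in nhds (y0, 0). dist (G (fst q + snd q *\<^sub>R v) \<bullet> v) \<gamma> < \<bar>\<gamma>\<bar>"
    by (rule tendstoD) (use \<gamma> in simp)
  moreover have "((\<lambda>q. \<rho> (fst q + snd q *\<^sub>R v)) \<longlongrightarrow> s) (nhds (y0, 0))"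
    using isCont_tendsto_nhds[OF c2] by (simp add: \<rho>y0)
  \<comment> \<open>A deviation below 1/2 from one of the levels 0 and 1 keeps \<open>\<rho>\<close>
    away from the other.\<close>
  then have "\<forall>\<^sub>F q in nhds (y0, 0). dist (\<rho> (fst q + snd q *\<^sub>R v)) s < 1 / 2"
    by (rule tendstoD) simp
  ultimately have "\<forall>\<^sub>F q in nhds (y0, 0). dist (G (fst q + snd q *\<^sub>R v) \<bullet> v) \<gamma> < \<bar>\<gamma>\<bar> \<and> dist (\<rho> (fst q + snd q *\<^sub>R v)) s < 1 / 2"
    by (rule eventually_conj)
  then obtain d where d: "d > 0" "\<And>y t. dist (y, t) (y0, 0) < d \<Longrightarrow> \<bar>G (y + t *\<^sub>R v) \<bullet> v - \<gamma>\<bar> < \<bar>\<gamma>\<bar> \<and> \<bar>\<rho> (y + t *\<^sub>R v) - s\<bar> < 1 / 2"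
    unfolding eventually_nhds_metric dist_real_def by (metis fst_conv snd_conv)
  define r where "r = d / 3"
  have r: "r > 0" using d(1) by (simp add: r_def)
  have near: "\<bar>G (y + t *\<^sub>R v) \<bullet> v - \<gamma>\<bar> < \<bar>\<gamma>\<bar>" "\<bar>\<rho> (y + t *\<^sub>R v) - s\<bar> < 1 / 2" if "dist y0 y \<le> r" "\<bar>t\<bar> \<le> r" for y t
  proof -
    have "dist (y, t) (y0, 0) \<le> dist y y0 + dist t 0"
      unfolding dist_Pair_Pair by (rule sqrt_sum_squares_le_sum) auto
    also have "\<dots> < d" using that r by (simp add: r_def dist_commute)
    finally show "\<bar>G (y + t *\<^sub>R v) \<bullet> v - \<gamma>\<bar> < \<bar>\<gamma>\<bar>" "\<bar>\<rho> (y + t *\<^sub>R v) - s\<bar> < 1 / 2" using d(2) by auto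
  qed
  show ?thesis
  proof (intro exI[of _ r] conjI r, intro allI impI)
    fix y t assume y: "(y, v) \<in> data_boundary s" "dist y0 y \<le> r" and t: "0 < t" "t \<le> r"
    have \<rho>y: "\<rho> y = s" using y(1) by (auto simp: data_boundary_def)
    have sgn: "G (y + r' *\<^sub>R v) \<bullet> v > 0 \<longleftrightarrow> \<gamma> > 0" "G (y + r' *\<^sub>R v) \<bullet> v < 0 \<longleftrightarrow> \<gamma> < 0" if "\<bar>r'\<bar> \<le> r" for r'
      using near(1)[OF y(2) that] \<gamma> by linarith+
    have Gy: "G y \<bullet> v > 0 \<longleftrightarrow> \<gamma> > 0" "G y \<bullet> v < 0 \<longleftrightarrow> \<gamma> < 0" using sgn[of 0] r by auto
    have sgeq: "inward_sign (y, v) = inward_sign (y0, v)" using Gy(2) \<rho>y \<rho>y0 by (simp add: inward_sign_def \<gamma>_def)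
    define \<eta> where "\<eta> = inward_sign (y, v)"
    have \<eta>: "\<eta> = (if s = 0 \<and> \<gamma> < 0 then -1 else 1)" using Gy(2) \<rho>y by (simp add: \<eta>_def inward_sign_def)
    have inX: "y + (\<eta> * t) *\<^sub>R v \<in> X" if t: "0 < t" "t \<le> r" for t
    proof -
      have \<eta>t: "\<bar>\<eta> * t\<bar> \<le> r" using t by (simp add: \<eta>)
      consider "s = 0" "\<gamma> > 0" | "s = 0" "\<gamma> < 0" | "s = 1" "\<gamma> < 0"
      proof -
        have "0 < \<gamma> \<or> \<gamma> < 0" using \<gamma> by linarith
        then show ?thesis using y0 that by (auto simp: data_boundary_def \<gamma>_def)
      qed
      then have "0 < \<rho> (y + (\<eta> * t) *\<^sub>R v) \<and> \<rho> (y + (\<eta> * t) *\<^sub>R v) < 1"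
      proof cases
        case 1
        have "\<rho> (y + 0 *\<^sub>R v) < \<rho> (y + t *\<^sub>R v)"
        proof (rule DERIV_pos_imp_increasing[OF t(1)])
          fix x assume "0 \<le> x" "x \<le> t"
          then show "\<exists>D. ((\<lambda>t. \<rho> (y + t *\<^sub>R v)) has_real_derivative D) (at x) \<and> 0 < D"
            using line_deriv[of y v x] sgn(1)[of x] 1 t by auto
        qed
        then show ?thesis using near(2)[OF y(2) \<eta>t] 1 \<rho>y by (simp add: \<eta>)
      next
        case 2
        have "- t < 0" using t by simp
        then have "\<rho> (y + 0 *\<^sub>R v) < \<rho> (y + (- t) *\<^sub>R v)"
        proof (rule DERIV_neg_imp_decreasing)
          fix x assume "- t \<le> x" "x \<le> 0"
          then show "\<exists>D. ((\<lambda>t. \<rho> (y + t *\<^sub>R v)) has_real_derivative D) (at x) \<and> D < 0"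
            using line_deriv[of y v x] sgn(2)[of x] 2 t by auto
        qed
        then show ?thesis using near(2)[OF y(2) \<eta>t] 2 \<rho>y by (simp add: \<eta>)
      next
        case 3
        have "\<rho> (y + t *\<^sub>R v) < \<rho> (y + 0 *\<^sub>R v)"
        proof (rule DERIV_neg_imp_decreasing[OF t(1)])
          fix x assume "0 \<le> x" "x \<le> t"
          then show "\<exists>D. ((\<lambda>t. \<rho> (y + t *\<^sub>R v)) has_real_derivative D) (at x) \<and> D < 0"
            using line_deriv[of y v x] sgn(2)[of x] 3 t by auto
        qed
        then show ?thesis using near(2)[OF y(2) \<eta>t] 3 \<rho>y by (simp add: \<eta> abs_less_iff)
      qed
      then show ?thesis by (simp add: X_shell)
    qed
    define z where "z = (y + (\<eta> * t) *\<^sub>R v, v)"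
    have z: "fst z \<in> X" "snd z \<noteq> 0" using inX[OF t] v by (auto simp: z_def)
    note st = seg_exit_time[OF z]
    have zsh: "z = flow (\<eta> * t) (y, v)" by (simp add: z_def flow_def)
    have ynX: "y \<notin> X" using \<rho>y s01 by (auto simp: X_shell)
    \<comment> \<open>The way back from \<open>z\<close> stays in the shell up to, but not
      including, the boundary point \<open>y\<close>; together with \<open>nseg\<close> this
      determines the end of the chord.\<close>
    have segz: "seg X z (- (\<eta> * r'))" if "0 \<le> r'" "r' < t" for r'
      unfolding seg_iff
    proof (intro allI impI)
      fix w assume w: "0 \<le> w \<and> w \<le> - (\<eta> * r') \<or> - (\<eta> * r') \<le> w \<and> w \<le> 0"
      have "0 < t + \<eta> * w \<and> t + \<eta> * w \<le> t" using w that by (cases "\<eta> = 1") (auto simp: \<eta> split: if_splits)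
      then have "y + (\<eta> * (t + \<eta> * w)) *\<^sub>R v \<in> X" using inX[of "t + \<eta> * w"] t by simp
      moreover have "\<eta> * \<eta> = 1" by (simp add: \<eta>)
      ultimately show "fst z + w *\<^sub>R snd z \<in> X" by (simp add: z_def algebra_simps flip: mult.assoc)
    qed
    have nseg: "\<not> seg X z (- (\<eta> * t))"
    proof
      assume "seg X z (- (\<eta> * t))"
      from seg_in(2)[OF this] show False using ynX by (simp add: z_def)
    qed
    have mnz: "line_min z = line_min (y, v)" using line_min_flow[of "(y, v)" "\<eta> * t"] v by (simp add: zsh)
    have mny: "s = 0 \<Longrightarrow> line_min z < 0"
    proof -
      assume "s = 0"
      have "min_time (y, v) \<noteq> 0" using slope_min_time[of "(y, v)"] v Gy \<gamma> by (auto simp: slope_def)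
      then have "line_min (y, v) < \<rho> (y + 0 *\<^sub>R v)"
        using increasing_right[of "(y, v)" "min_time (y, v)" 0] decreasing_left[of "(y, v)" "min_time (y, v)" 0] v
        by (cases "min_time (y, v) < 0") (auto simp: line_min_def)
      then show ?thesis using mnz \<rho>y \<open>s = 0\<close> by simp
    qed
    have tyz: "line_type s z" using z mny mnz y(1) by (auto simp: line_type_def data_boundary_def)
    have sl: "slope z (- (\<eta> * t)) = G y \<bullet> v" unfolding zsh slope_flow by (simp add: slope_def)
    have "base_time z = - (\<eta> * t)"
    proof (cases "\<eta> = 1")
      case True
      have "t \<le> entry_time z"
      proof (rule ccontr)
        assume "\<not> t \<le> entry_time z"
        then have "seg X z (- entry_time z)" using segz[of "entry_time z"] st(2) True by simp
        then show False using st(3) by simp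
      qed
      moreover have "entry_time z \<le> t" using nseg st(1) st(3)[of "- t"] True t by auto
      ultimately have entry_time: "entry_time z = t" by simp
      show ?thesis
      proof (cases "s = 0")
        case True
        then have "\<gamma> > 0" using \<open>\<eta> = 1\<close> \<gamma> \<eta> by (auto split: if_splits)
        then have "min_time z < - t" using slope_iff(2)[OF z(2), of "- t"] sl Gy \<open>\<eta> = 1\<close> by simp
        then show ?thesis using mny[OF True] entry_time \<open>\<eta> = 1\<close> \<epsilon> by (simp add: base_time_def)
      next
        case False
        then show ?thesis using y(1) mnz entry_time \<open>\<eta> = 1\<close> by (auto simp: base_time_def data_boundary_def)
      qed
    next
      case False
      then have \<eta>': "\<eta> = -1" "s = 0" "\<gamma> < 0" by (auto simp: \<eta> split: if_splits)
      have "t \<le> exit_time z"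
      proof (rule ccontr)
        assume "\<not> t \<le> exit_time z"
        then have "seg X z (exit_time z)" using segz[of "exit_time z"] st(1) \<eta>' by simp
        then show False using st(3) by simp
      qed
      moreover have "exit_time z \<le> t" using nseg st(2) st(3)[of t] \<eta>' t by auto
      ultimately have exit_time: "exit_time z = t" by simp
      have "t < min_time z" using slope_iff(1)[OF z(2), of t] sl Gy \<eta>' by simp
      then show ?thesis using mny[OF \<eta>'(2)] exit_time \<eta>' \<epsilon> st(1,2) t by (simp add: base_time_def)
    qed
    then show "inward_sign (y, v) = inward_sign (y0, v) \<and> y + (inward_sign (y, v) * t) *\<^sub>R v \<in> X \<and> base_time (y + (inward_sign (y, v) * t) *\<^sub>R v, v) = - (inward_sign (y, v) * t)
      \<and> line_type s (y + (inward_sign (y, v) * t) *\<^sub>R v, v)"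
      using sgeq inX[OF t] tyz by (simp add: \<eta>_def z_def)
  qed
qed

section \<open>Pieces of the boundary and the tubes they sweep out\<close>

lemma hausdorff_level_finite: "-1 < s \<Longrightarrow> hausdorff_outer (DIM('a) - 1) {x. \<rho> x = s} < \<infinity>"
  by (rule hausdorff_outer_closed_hypersurface_finite[OF level_closed_hypersurface])

text \<open>A small compact piece of \<open>A\<close> is transversal to \<open>v\<close> and sweeps
  out a tube inside \<open>Nv\<close>, so \<open>hausdorff_outer_le_tube\<close> gives it measure 0,
  whatever the constant. Borel sets are reached through inner regularity, for which the surface
  measure of the level set has to be finite.\<close>

lemma boundary_null:
  assumes s: "s = 0 \<or> s = 1" and v: "v \<noteq> 0" and A: "A \<in> sets borel" "\<And>y. y \<in> A \<Longrightarrow> (y, v) \<in> data_boundary s"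
    and Nv: "Nv \<in> null_sets lborel"
    and inN: "\<And>y r. y \<in> A \<Longrightarrow> 0 < r \<Longrightarrow> (\<And>t. 0 < t \<Longrightarrow> t \<le> r \<Longrightarrow> y + (inward_sign (y, v) * t) *\<^sub>R v \<in> X) \<Longrightarrow> y + (inward_sign (y, v) * r) *\<^sub>R v \<in> Nv"
  shows "hausdorff_outer (DIM('a) - 1) A = 0"
proof -
  let ?m = "DIM('a) - 1"
  define S where "S = {x. \<rho> x = s}"
  have S1: "-1 < s" using s by auto
  have Sb [measurable]: "S \<in> sets borel" unfolding S_def by measurable
  define M where "M = density (hausdorff_measure ?m) (indicator S)"
  have M_eq: "emeasure M B = hausdorff_outer ?m (S \<inter> B)" if "B \<in> sets borel" for B
    using that Sb unfolding M_def
    by (subst emeasure_density) (auto simp: nn_integral_set_ennreal indicator_inter_arith[symmetric] emeasure_hausdorff_measure)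
  have A_S: "A \<subseteq> S" using A(2) by (auto simp: data_boundary_def S_def)
  have comp: "hausdorff_outer ?m K = 0" if K: "compact K" "K \<subseteq> A" for K
  proof -
    have "\<exists>r>0. hausdorff_outer ?m (K \<inter> cball y r) = 0" if y0: "y \<in> K" for y
    proof -
      have ySig: "(y, v) \<in> data_boundary s" using y0 K A by auto
      obtain r1 where r1: "r1 > 0" "\<And>y' t. (y', v) \<in> data_boundary s \<Longrightarrow> dist y y' \<le> r1 \<Longrightarrow> 0 < t \<Longrightarrow> t \<le> r1 \<Longrightarrow>
        inward_sign (y', v) = inward_sign (y, v) \<and> y' + (inward_sign (y', v) * t) *\<^sub>R v \<in> X"
        using near_boundary[OF ySig v] by blast
      have C1: "C1_with_gradient UNIV (\<lambda>y. \<rho> y - s) G"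
        unfolding C1_with_gradient_def gderiv_def
        using grad[unfolded gderiv_def] by (auto intro!: G_cont derivative_eq_intros)
      have nz: "G y \<bullet> v \<noteq> 0" using ySig by (auto simp: data_boundary_def)
      obtain r2 L where r2: "r2 > 0" "1 \<le> L" "\<And>a b t. a \<in> S \<inter> cball y r2 \<Longrightarrow> b \<in> S \<inter> cball y r2 \<Longrightarrow> norm (a - b) \<le> L * norm (a - b - t *\<^sub>R v)"
        using closed_hypersurface_transversal[OF open_UNIV UNIV_I C1 nz, of S] by (auto simp: S_def)
      define r where "r = min r1 r2"
      have r: "r > 0" "r \<le> r1" "r \<le> r2" using r1(1) r2(1) by (auto simp: r_def)
      define K' where "K' = K \<inter> cball y r"
      have K': "compact K'" "K' \<subseteq> S \<inter> cball y r2" "K' \<subseteq> A" using K A_S r by (auto simp: K'_def intro: compact_Int)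
      define \<eta> where "\<eta> = inward_sign (y, v)"
      have \<eta>: "\<eta> = 1 \<or> \<eta> = -1" by (auto simp: \<eta>_def inward_sign_def)
      \<comment> \<open>The tube is taken on the inward side at times between \<open>r / 2\<close>
        and \<open>r\<close>, away from time 0, at which its points lie on the boundary and not in
        \<open>Nv\<close>.\<close>
      define a b where "a = (if \<eta> = 1 then r / 2 else - r)" and "b = (if \<eta> = 1 then r else - r / 2)"
      have ab: "a < b" using r(1) by (auto simp: a_def b_def)
      have "tube K' v a b \<subseteq> Nv"
      proof
        fix w assume "w \<in> tube K' v a b"
        then obtain y' t where w: "w = y' + t *\<^sub>R v" "y' \<in> K'" "a \<le> t" "t \<le> b" by (auto simp: tube_def)
        have y': "y' \<in> A" "dist y y' \<le> r1" "(y', v) \<in> data_boundary s" using w(2) A(2) K r by (auto simp: K'_def)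
        have sgy: "inward_sign (y', v) = \<eta>" using r1(2)[OF y'(3,2), of r1] r1(1) by (simp add: \<eta>_def)
        have t: "0 < \<eta> * t" "\<eta> * t \<le> r" using w(3,4) \<eta> r(1) by (auto simp: a_def b_def split: if_splits)
        have "y' + (inward_sign (y', v) * (\<eta> * t)) *\<^sub>R v \<in> Nv"
        proof (rule inN[OF y'(1) t(1)])
          fix t0 assume "0 < t0" "t0 \<le> \<eta> * t"
          moreover then have "t0 \<le> r1" using t(2) r(2) by simp
          ultimately show "y' + (inward_sign (y', v) * t0) *\<^sub>R v \<in> X" using r1(2)[OF y'(3,2)] by blast
        qed
        moreover have "\<eta> * (\<eta> * t) = t" using \<eta> by auto
        ultimately show "w \<in> Nv" by (simp add: w(1) sgy)
      qed
      then have "emeasure lborel (tube K' v a b) \<le> emeasure lborel Nv" using Nv by (intro emeasure_mono) auto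
      then have "emeasure lborel (tube K' v a b) = 0" using Nv by (simp add: null_setsD1)
      moreover obtain C :: real where "hausdorff_outer ?m K' \<le> ennreal C * emeasure lborel (tube K' v a b)"
        using hausdorff_outer_le_tube[OF K'(1) ab v r2(2)] r2(3) K'(2) by blast
      ultimately have "hausdorff_outer ?m K' = 0" by simp
      then show ?thesis using r(1) by (auto simp: K'_def)
    qed
    then obtain r where r: "\<And>y. y \<in> K \<Longrightarrow> 0 < r y" "\<And>y. y \<in> K \<Longrightarrow> hausdorff_outer ?m (K \<inter> cball y (r y)) = 0" by metis
    have "K \<subseteq> (\<Union>y\<in>K. ball y (r y))" using r(1) by fastforce
    from compactE_image[OF K(1) _ this] obtain F where F: "F \<subseteq> K" "finite F" "K \<subseteq> (\<Union>y\<in>F. ball y (r y))" by auto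
    have "hausdorff_outer ?m (\<Union>y\<in>F. K \<inter> cball y (r y)) = 0"
      using F(2,1)
    proof (induction F rule: finite_induct)
      case (insert x F)
      have "hausdorff_outer ?m (\<Union>x\<in>insert x F. K \<inter> cball x (r x)) \<le>
        hausdorff_outer ?m (K \<inter> cball x (r x)) + hausdorff_outer ?m (\<Union>x\<in>F. K \<inter> cball x (r x))"
        using hausdorff_outer_Un by simp
      also have "\<dots> = 0" using insert r(2) by simp
      finally show ?case by simp
    qed (simp add: hausdorff_outer_empty)
    moreover have "K \<subseteq> (\<Union>y\<in>F. K \<inter> cball y (r y))" using F(3) by force
    ultimately show ?thesis using hausdorff_outer_mono[of K _ ?m] by (metis le_zero_eq)
  qed
  have "emeasure M A = (SUP K\<in>{K. K \<subseteq> A \<and> compact K}. emeasure M K)"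
  proof (rule inner_regular)
    show "sets M = sets borel" by (simp add: M_def)
    show "emeasure M (space M) \<noteq> \<infinity>"
      using M_eq[of UNIV] hausdorff_level_finite[OF S1] by (simp add: M_def S_def)
  qed (use A in auto)
  also have "\<dots> = 0"
  proof -
    have "emeasure M K = 0" if "K \<in> {K. K \<subseteq> A \<and> compact K}" for K
    proof -
      have K: "K \<subseteq> A" "compact K" using that by auto
      then have "S \<inter> K = K" using A_S by blast
      then show ?thesis using comp[OF K(2,1)] M_eq[OF borel_closed[OF compact_imp_closed[OF K(2)]]] by simp
    qed
    then have "(SUP K\<in>{K. K \<subseteq> A \<and> compact K}. emeasure M K) \<le> 0" by (intro SUP_least) simp
    then show ?thesis by simp
  qed
  finally show ?thesis using M_eq[OF A(1)] A_S by (simp add: Int_absorb1)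
qed

definition unit_normal :: "'a \<Rightarrow> 'a" where "unit_normal y = G y /\<^sub>R norm (G y)"

lemma unit_normal_measurable [measurable]: "unit_normal \<in> borel_measurable borel"
  unfolding unit_normal_def by measurable

text \<open>The base point is an end of the chord, so only one half of the window lies in the chord;
  this gives \<open>l\<close> and not \<open>2 * l\<close>.\<close>

lemma base_time_window:
  assumes t: "line_type s z" and l: "0 < l" "l < T z"
  shows "(\<integral>\<^sup>+t. (if seg X z t \<and> \<bar>base_time z - t\<bar> < l then 1 else 0) \<partial>lborel) = ennreal l"
proof -
  have z: "fst z \<in> X" "snd z \<noteq> 0" using t by (auto simp: line_type_def)
  note st = seg_exit_time[OF z]
  consider "base_time z = - entry_time z" | "base_time z = exit_time z" using base_line_type[OF t] by blast
  then show ?thesis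
  proof cases
    case 1
    have "(\<integral>\<^sup>+t. (if seg X z t \<and> \<bar>base_time z - t\<bar> < l then 1 else 0) \<partial>lborel) = (\<integral>\<^sup>+t. indicator {- entry_time z<..<- entry_time z + l} t \<partial>lborel)"
    proof (rule nn_integral_cong)
      fix t
      have "seg X z t \<and> \<bar>base_time z - t\<bar> < l \<longleftrightarrow> t \<in> {- entry_time z<..<- entry_time z + l}"
        unfolding 1 st(3) using l(2) unfolding st(4) by (simp add: abs_less_iff) linarith
      then show "(if seg X z t \<and> \<bar>base_time z - t\<bar> < l then 1 else 0) = indicator {- entry_time z<..<- entry_time z + l} t" by simp
    qed
    then show ?thesis using l by simp
  next
    case 2
    have "(\<integral>\<^sup>+t. (if seg X z t \<and> \<bar>base_time z - t\<bar> < l then 1 else 0) \<partial>lborel) = (\<integral>\<^sup>+t. indicator {exit_time z - l<..<exit_time z} t \<partial>lborel)"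
    proof (rule nn_integral_cong)
      fix t
      have "seg X z t \<and> \<bar>base_time z - t\<bar> < l \<longleftrightarrow> t \<in> {exit_time z - l<..<exit_time z}"
        unfolding 2 st(3) using l(2) unfolding st(4) by (simp add: abs_less_iff) linarith
      then show "(if seg X z t \<and> \<bar>base_time z - t\<bar> < l then 1 else 0) = indicator {exit_time z - l<..<exit_time z} t" by simp
    qed
    then show ?thesis using l by simp
  qed
qed

text \<open>Points in the window lie in the tube over their base points. The base points are sorted
  into dyadic layers by \<open>|n \<bullet> v|\<close>; \<open>emeasure_tube_le_hausdorff\<close>
  applies to each layer with the same constant, and its \<open>\<delta>\<close> is at most
  \<open>|n \<bullet> v|\<close> on the layer, so the disjoint layers add up to the flux
  integral.\<close>

lemma window_measure_le:
  assumes s: "s = 0 \<or> s = 1" and v: "v \<noteq> 0" and l: "0 < l" and A [measurable]: "A \<in> sets borel"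
  shows "emeasure lborel {x. line_type s (x, v) \<and> \<bar>base_time (x, v)\<bar> < l \<and> base (x, v) \<in> A}
    \<le> ennreal l * (\<integral>\<^sup>+y\<in>A. ennreal (tube_const TYPE('a)) * (indicator {x. \<rho> x = s} y * ennreal \<bar>unit_normal y \<bullet> v\<bar>) \<partial>hausdorff_measure (DIM('a) - 1))"
proof -
  let ?m = "DIM('a) - 1"
  let ?c = "tube_const TYPE('a)"
  have c: "0 < ?c" by (rule tube_const_pos)
  have S1: "-1 < s" using s by auto
  define g where "g y = ennreal ?c * (indicator {x. \<rho> x = s} y * ennreal \<bar>unit_normal y \<bullet> v\<bar>)" for y
  have [measurable]: "g \<in> borel_measurable borel" unfolding g_def by measurable
  \<comment> \<open>\<open>int_decode\<close> lets a sequence run through all integer exponents,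
    which covers every positive value of \<open>|n \<bullet> v|\<close> and in particular those
    close to 0.\<close>
  define B where "B n = {y\<in>A. \<rho> y = s \<and> (2::real) powr of_int (int_decode n) \<le> \<bar>unit_normal y \<bullet> v\<bar> \<and> \<bar>unit_normal y \<bullet> v\<bar> < 2 powr of_int (int_decode n + 1)}" for n
  have B_borel [measurable]: "B n \<in> sets borel" for n unfolding B_def by measurable
  have cover: "{x. line_type s (x, v) \<and> \<bar>base_time (x, v)\<bar> < l \<and> base (x, v) \<in> A} \<subseteq> (\<Union>n. {x. line_type s (x, v) \<and> \<bar>base_time (x, v)\<bar> < l \<and> base (x, v) \<in> B n})"
  proof
    fix x assume "x \<in> {x. line_type s (x, v) \<and> \<bar>base_time (x, v)\<bar> < l \<and> base (x, v) \<in> A}"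
    then have x: "line_type s (x, v)" "\<bar>base_time (x, v)\<bar> < l" "base (x, v) \<in> A" by auto
    define y where "y = base (x, v)"
    have y: "\<rho> y = s" "G y \<bullet> v \<noteq> 0" using base_line_type[OF x(1)] by (auto simp: y_def)
    define a where "a = \<bar>unit_normal y \<bullet> v\<bar>"
    have "a > 0" using y(2) by (auto simp: a_def unit_normal_def)
    define j where "j = \<lfloor>log 2 a\<rfloor>"
    have "of_int j \<le> log 2 a" "log 2 a < of_int (j + 1)" unfolding j_def by linarith+
    then have "2 powr of_int j \<le> a" "a < 2 powr of_int (j + 1)"
      using \<open>a > 0\<close> by (auto simp: le_log_iff log_less_iff)
    then have "y \<in> B (int_encode j)" using y x(3) by (auto simp: B_def a_def y_def)
    then show "x \<in> (\<Union>n. {x. line_type s (x, v) \<and> \<bar>base_time (x, v)\<bar> < l \<and> base (x, v) \<in> B n})" using x by (auto simp: y_def)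
  qed
  obtain M where M: "M \<ge> 0" "\<And>y y'. \<rho> y = s \<Longrightarrow> \<rho> y' = s \<Longrightarrow> \<bar>unit_normal y' \<bullet> (y - y')\<bar> \<le> M * (norm (y - y'))\<^sup>2"
    using level_flat[OF S1] unfolding unit_normal_def by blast
  have piece: "emeasure lborel {x. line_type s (x, v) \<and> \<bar>base_time (x, v)\<bar> < l \<and> base (x, v) \<in> B n} \<le> ennreal l * (\<integral>\<^sup>+y\<in>B n. g y \<partial>hausdorff_measure ?m)" for n
  proof -
    define \<delta> where "\<delta> = (2::real) powr of_int (int_decode n)"
    have \<delta>: "\<delta> > 0" "(2::real) powr of_int (int_decode n + 1) = 2 * \<delta>" by (auto simp: \<delta>_def powr_add)
    have "emeasure lborel {x. line_type s (x, v) \<and> \<bar>base_time (x, v)\<bar> < l \<and> base (x, v) \<in> B n} \<le> ennreal (?c * l * \<delta>) * hausdorff_outer ?m (B n)"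
    proof (rule emeasure_tube_le_hausdorff[where n=unit_normal and M=M])
      fix y assume "y \<in> B n"
      then have y: "\<rho> y = s" "\<delta> \<le> \<bar>unit_normal y \<bullet> v\<bar>" "\<bar>unit_normal y \<bullet> v\<bar> < 2 * \<delta>" using \<delta>(2) by (auto simp: B_def \<delta>_def)
      have "G y \<noteq> 0" using level_nz[OF y(1) S1] G_nz by blast
      then show "norm (unit_normal y) = 1" by (simp add: unit_normal_def)
      show "\<bar>unit_normal y \<bullet> v\<bar> \<le> 2 * \<delta>" "\<delta> \<le> \<bar>unit_normal y \<bullet> v\<bar>" using y by auto
    next
      fix y y' assume "y \<in> B n" "y' \<in> B n"
      then show "\<bar>unit_normal y' \<bullet> (y - y')\<bar> \<le> M * (norm (y - y'))\<^sup>2" using M(2) by (auto simp: B_def)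
    next
      show "{x. line_type s (x, v) \<and> \<bar>base_time (x, v)\<bar> < l \<and> base (x, v) \<in> B n} \<subseteq> tube (B n) v (- l) l"
      proof
        fix x assume x: "x \<in> {x. line_type s (x, v) \<and> \<bar>base_time (x, v)\<bar> < l \<and> base (x, v) \<in> B n}"
        have "x = base (x, v) + (- base_time (x, v)) *\<^sub>R v" by (simp add: base_def)
        moreover have "- base_time (x, v) \<in> {- l..l}" using x by auto
        ultimately show "x \<in> tube (B n) v (- l) l" using x unfolding tube_def
          by (intro image_eqI[of _ _ "(base (x, v), - base_time (x, v))"]) auto
      qed
    qed (use \<delta> M v l in auto)
    also have "\<dots> = ennreal l * (ennreal (?c * \<delta>) * emeasure (hausdorff_measure ?m) (B n))"
      using c l \<delta> by (simp add: emeasure_hausdorff_measure ennreal_mult mult_ac)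
    also have "ennreal (?c * \<delta>) * emeasure (hausdorff_measure ?m) (B n) = (\<integral>\<^sup>+y\<in>B n. ennreal (?c * \<delta>) \<partial>hausdorff_measure ?m)"
      by (simp add: nn_integral_cmult_indicator)
    also have "\<dots> \<le> (\<integral>\<^sup>+y\<in>B n. g y \<partial>hausdorff_measure ?m)"
    proof (rule nn_integral_mono)
      fix y
      show "ennreal (?c * \<delta>) * indicator (B n) y \<le> g y * indicator (B n) y"
      proof (cases "y \<in> B n")
        case True
        then have "ennreal (?c * \<delta>) \<le> ennreal (?c * \<bar>unit_normal y \<bullet> v\<bar>)" using c by (intro ennreal_leI mult_left_mono) (auto simp: B_def \<delta>_def)
        then show ?thesis using True c by (simp add: g_def B_def ennreal_mult)
      qed simp
    qed
    finally show ?thesis by (simp add: mult_left_mono)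
  qed
  have "emeasure lborel {x. line_type s (x, v) \<and> \<bar>base_time (x, v)\<bar> < l \<and> base (x, v) \<in> A}
    \<le> emeasure lborel (\<Union>n. {x. line_type s (x, v) \<and> \<bar>base_time (x, v)\<bar> < l \<and> base (x, v) \<in> B n})"
    by (rule emeasure_mono[OF cover]) measurable
  also have "\<dots> \<le> (\<Sum>n. emeasure lborel {x. line_type s (x, v) \<and> \<bar>base_time (x, v)\<bar> < l \<and> base (x, v) \<in> B n})"
    by (rule emeasure_subadditive_countably) auto
  also have "\<dots> \<le> (\<Sum>n. ennreal l * (\<integral>\<^sup>+y\<in>B n. g y \<partial>hausdorff_measure ?m))"
    by (intro suminf_le piece) auto
  also have "\<dots> = ennreal l * (\<Sum>n. \<integral>\<^sup>+y\<in>B n. g y \<partial>hausdorff_measure ?m)" by simp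
  also have "(\<Sum>n. \<integral>\<^sup>+y\<in>B n. g y \<partial>hausdorff_measure ?m) = (\<integral>\<^sup>+y. (\<Sum>n. g y * indicator (B n) y) \<partial>hausdorff_measure ?m)"
    by (rule nn_integral_suminf[symmetric]) measurable
  also have "\<dots> \<le> (\<integral>\<^sup>+y\<in>A. g y \<partial>hausdorff_measure ?m)"
  proof (rule nn_integral_mono)
    fix y
    have disj: "disjoint_family B"
      unfolding disjoint_family_on_def
    proof (intro ballI impI, rule ccontr)
      fix i j :: nat assume "i \<noteq> j" "B i \<inter> B j \<noteq> {}"
      then obtain y where y: "2 powr of_int (int_decode i) \<le> \<bar>unit_normal y \<bullet> v\<bar>" "\<bar>unit_normal y \<bullet> v\<bar> < 2 powr of_int (int_decode i + 1)"
        "2 powr of_int (int_decode j) \<le> \<bar>unit_normal y \<bullet> v\<bar>" "\<bar>unit_normal y \<bullet> v\<bar> < 2 powr of_int (int_decode j + 1)"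
        by (auto simp: B_def)
      have "(2::real) powr of_int (int_decode i) < 2 powr of_int (int_decode j + 1)" using y by linarith
      moreover have "(2::real) powr of_int (int_decode j) < 2 powr of_int (int_decode i + 1)" using y by linarith
      ultimately have "int_decode i = int_decode j" by (simp only: powr_less_cancel_iff of_int_less_iff)
      then show False using \<open>i \<noteq> j\<close> by (metis int_decode_inverse)
    qed
    have "(\<Sum>n. g y * indicator (B n) y) = g y * (\<Sum>n. indicator (B n) y)" by simp
    also have "(\<Sum>n. indicator (B n) y) = (indicator (\<Union>n. B n) y :: ennreal)" by (rule suminf_indicator[OF disj])
    also have "g y * indicator (\<Union>n. B n) y \<le> g y * indicator A y" by (intro mult_left_mono) (auto simp: indicator_def B_def)
    finally show "(\<Sum>n. g y * indicator (B n) y) \<le> g y * indicator A y" .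
  qed
  finally show ?thesis by (simp add: g_def mult_left_mono)
qed

text \<open>Only chords with \<open>T > l\<close> are considered first: each of them spends time \<open>l\<close> in the window of width
  \<open>l\<close> at its base point, so the average over the chord is controlled by the window.\<close>

lemma boundary_integral_le:
  fixes F :: "'a \<Rightarrow> ennreal"
  assumes s: "s = 0 \<or> s = 1" and v: "v \<noteq> 0" and F [measurable]: "F \<in> borel_measurable borel"
  shows "(\<integral>\<^sup>+x. (if line_type s (x, v) then ennreal (1 / T (x, v)) * F (base (x, v)) else 0) \<partial>lborel)
    \<le> ennreal (tube_const TYPE('a)) * (\<integral>\<^sup>+y. indicator {x. \<rho> x = s} y * ennreal \<bar>unit_normal y \<bullet> v\<bar> * F y \<partial>hausdorff_measure (DIM('a) - 1))"
proof -
  let ?m = "DIM('a) - 1"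
  define g where "g y = ennreal (tube_const TYPE('a)) * (indicator {x. \<rho> x = s} y * ennreal \<bar>unit_normal y \<bullet> v\<bar>)" for y
  have [measurable]: "g \<in> borel_measurable borel" unfolding g_def by measurable
  define M2 where "M2 = density (hausdorff_measure ?m) g"
  have bound: "(\<integral>\<^sup>+x. (if line_type s (x, v) \<and> l < T (x, v) then ennreal (1 / T (x, v)) * F (base (x, v)) else 0) \<partial>lborel) \<le> (\<integral>\<^sup>+y. F y \<partial>M2)"
    if l: "0 < l" for l
  proof -
    define f where "f x = (if line_type s (x, v) \<and> l < T (x, v) \<and> \<bar>base_time (x, v)\<bar> < l then ennreal (1 / l) else 0)" for x
    have [measurable]: "f \<in> borel_measurable borel" unfolding f_def by measurable
    \<comment> \<open>The image under \<open>base\<close> of the normalised volume on the window. It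
      is dominated by the flux measure \<open>M2\<close> set by set, and therefore also for
      integrals of \<open>F\<close>.\<close>
    define m1 where "m1 = distr (density lborel f) borel (\<lambda>x. base (x, v))"
    have "emeasure m1 A \<le> emeasure M2 A" if A [measurable]: "A \<in> sets borel" for A
    proof -
      have [measurable]: "(\<lambda>x. base (x, v)) -` A \<in> sets borel"
        using measurable_sets[of "\<lambda>x. base (x, v)" borel borel A] by simp
      have "emeasure m1 A = (\<integral>\<^sup>+x. f x * indicator ((\<lambda>x. base (x, v)) -` A) x \<partial>lborel)"
        unfolding m1_def by (subst emeasure_distr, measurable, subst emeasure_density) auto
      also have "\<dots> \<le> (\<integral>\<^sup>+x. ennreal (1 / l) * indicator {x. line_type s (x, v) \<and> \<bar>base_time (x, v)\<bar> < l \<and> base (x, v) \<in> A} x \<partial>lborel)"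
        by (intro nn_integral_mono) (auto simp: f_def indicator_def)
      also have "\<dots> = ennreal (1 / l) * emeasure lborel {x. line_type s (x, v) \<and> \<bar>base_time (x, v)\<bar> < l \<and> base (x, v) \<in> A}"
        by (rule nn_integral_cmult_indicator) measurable
      also have "\<dots> \<le> ennreal (1 / l) * (ennreal l * (\<integral>\<^sup>+y\<in>A. g y \<partial>hausdorff_measure ?m))"
        unfolding g_def by (intro mult_left_mono window_measure_le s v l A) auto
      also have "\<dots> = (\<integral>\<^sup>+y\<in>A. g y \<partial>hausdorff_measure ?m)"
        using l by (simp add: mult.assoc[symmetric] flip: ennreal_mult)
      also have "\<dots> = emeasure M2 A" unfolding M2_def by (subst emeasure_density) auto
      finally show ?thesis .
    qed
    then have "m1 \<le> M2" by (subst le_measure) (auto simp: m1_def M2_def)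
    then have le: "(\<integral>\<^sup>+y. F y \<partial>m1) \<le> (\<integral>\<^sup>+y. F y \<partial>M2)"
      by (intro nn_integral_mono_measure) (auto simp: m1_def M2_def)
    define H0 where "H0 z = (if line_type s z \<and> l < T z \<and> \<bar>base_time z\<bar> < l then ennreal (1 / l) * (ennreal (1 / T z) * F (base z)) else 0)" for z
    have [measurable]: "H0 \<in> borel_measurable borel" unfolding H0_def by measurable
    have "(\<integral>\<^sup>+x. (if line_type s (x, v) \<and> l < T (x, v) then ennreal (1 / T (x, v)) * F (base (x, v)) else 0) \<partial>lborel)
      = (\<integral>\<^sup>+x. \<integral>\<^sup>+t. (if seg X (x, v) t then H0 (flow t (x, v)) else 0) \<partial>lborel \<partial>lborel)"
    proof (rule nn_integral_cong)
      fix x :: 'a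
      define z where "z = (x, v)"
      have "(\<integral>\<^sup>+t. (if seg X z t then H0 (flow t z) else 0) \<partial>lborel) =
        (\<integral>\<^sup>+t. (if line_type s z \<and> l < T z then ennreal (1 / l) * (ennreal (1 / T z) * F (base z)) else 0) * (if seg X z t \<and> \<bar>base_time z - t\<bar> < l then 1 else 0) \<partial>lborel)"
        using v by (intro nn_integral_cong) (auto simp: H0_def line_type_flow T_flow base_time_flow base_flow z_def)
      also have "\<dots> = (if line_type s z \<and> l < T z then ennreal (1 / l) * (ennreal (1 / T z) * F (base z)) else 0) * (\<integral>\<^sup>+t. (if seg X z t \<and> \<bar>base_time z - t\<bar> < l then 1 else 0) \<partial>lborel)"
        by (rule nn_integral_cmult) measurable
      also have "\<dots> = (if line_type s z \<and> l < T z then ennreal (1 / T z) * F (base z) else 0)"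
      proof (cases "line_type s z \<and> l < T z")
        case True
        have "ennreal (1 / l) * (ennreal (1 / T z) * F (base z)) * ennreal l = (ennreal (1 / l) * ennreal l) * (ennreal (1 / T z) * F (base z))"
          by (simp only: mult_ac)
        also have "ennreal (1 / l) * ennreal l = 1" using l by (simp flip: ennreal_mult)
        finally show ?thesis using True base_time_window[of s z l] l by simp
      qed auto
      finally show "(if line_type s (x, v) \<and> l < T (x, v) then ennreal (1 / T (x, v)) * F (base (x, v)) else 0) = (\<integral>\<^sup>+t. (if seg X (x, v) t then H0 (flow t (x, v)) else 0) \<partial>lborel)"
        unfolding z_def by simp
    qed
    also have "\<dots> = (\<integral>\<^sup>+x. L (x, v) * H0 (x, v) \<partial>lborel)" by (rule seg_swap_slice) measurable
    also have "\<dots> = (\<integral>\<^sup>+x. f x * F (base (x, v)) \<partial>lborel)"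
    proof (rule nn_integral_cong)
      fix x
      show "L (x, v) * H0 (x, v) = f x * F (base (x, v))"
      proof (cases "line_type s (x, v)")
        case True
        then have "L (x, v) = ennreal (T (x, v))" "0 < T (x, v)" using T_eq(2,3)[of "(x, v)"] by (auto simp: line_type_def)
        then have "L (x, v) * ennreal (1 / T (x, v)) = 1" by (simp flip: ennreal_mult)
        then have "L (x, v) * (a * (ennreal (1 / T (x, v)) * b)) = a * b" for a b
          by (metis mult.assoc mult.left_commute mult_1)
        then show ?thesis by (simp add: H0_def f_def)
      qed (simp add: H0_def f_def)
    qed
    also have "\<dots> = (\<integral>\<^sup>+y. F y \<partial>m1)"
      unfolding m1_def by (subst nn_integral_distr, measurable, subst nn_integral_density) auto
    finally show ?thesis using le by simp
  qed
  \<comment> \<open>The bound does not depend on \<open>l\<close>, so the restriction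
    \<open>l < T\<close> disappears along \<open>l = 1 / (n + 1)\<close> by monotone
    convergence.\<close>
  have "(\<integral>\<^sup>+x. (if line_type s (x, v) then ennreal (1 / T (x, v)) * F (base (x, v)) else 0) \<partial>lborel)
    = (\<integral>\<^sup>+x. (SUP n. (if line_type s (x, v) \<and> 1 / real (Suc n) < T (x, v) then ennreal (1 / T (x, v)) * F (base (x, v)) else 0)) \<partial>lborel)"
  proof (rule nn_integral_cong)
    fix x
    show "(if line_type s (x, v) then ennreal (1 / T (x, v)) * F (base (x, v)) else 0) =
      (SUP n. (if line_type s (x, v) \<and> 1 / real (Suc n) < T (x, v) then ennreal (1 / T (x, v)) * F (base (x, v)) else 0))" (is "?l = (SUP n. ?r n)")
    proof (rule antisym)
      show "?l \<le> (SUP n. ?r n)"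
      proof (cases "line_type s (x, v)")
        case True
        then have "0 < T (x, v)" using T_eq(2)[of "(x, v)"] by (auto simp: line_type_def)
        then obtain n where "1 / real (Suc n) < T (x, v)" using nat_approx_posE by metis
        then have "?l \<le> ?r n" using True by simp
        also have "\<dots> \<le> (SUP n. ?r n)" by (rule SUP_upper) simp
        finally show ?thesis .
      qed simp
      show "(SUP n. ?r n) \<le> ?l" by (rule SUP_least) auto
    qed
  qed
  also have "\<dots> = (SUP n. \<integral>\<^sup>+x. (if line_type s (x, v) \<and> 1 / real (Suc n) < T (x, v) then ennreal (1 / T (x, v)) * F (base (x, v)) else 0) \<partial>lborel)"
  proof (rule nn_integral_monotone_convergence_SUP)
    show "incseq (\<lambda>n x. if line_type s (x, v) \<and> 1 / real (Suc n) < T (x, v) then ennreal (1 / T (x, v)) * F (base (x, v)) else 0)"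
    proof (rule incseq_SucI, rule le_funI)
      fix n x
      have "1 / real (Suc (Suc n)) \<le> 1 / real (Suc n)" by (intro divide_left_mono) auto
      then show "(if line_type s (x, v) \<and> 1 / real (Suc n) < T (x, v) then ennreal (1 / T (x, v)) * F (base (x, v)) else 0)
        \<le> (if line_type s (x, v) \<and> 1 / real (Suc (Suc n)) < T (x, v) then ennreal (1 / T (x, v)) * F (base (x, v)) else 0)"
        by (auto simp del: of_nat_Suc)
    qed
  qed measurable
  also have "\<dots> \<le> (\<integral>\<^sup>+y. F y \<partial>M2)" by (rule SUP_least, rule bound) simp
  also have "\<dots> = (\<integral>\<^sup>+y. ennreal (tube_const TYPE('a)) * (indicator {x. \<rho> x = s} y * ennreal \<bar>unit_normal y \<bullet> v\<bar> * F y) \<partial>hausdorff_measure ?m)"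
    unfolding M2_def by (subst nn_integral_density) (auto simp: g_def mult.assoc)
  also have "\<dots> = ennreal (tube_const TYPE('a)) * (\<integral>\<^sup>+y. indicator {x. \<rho> x = s} y * ennreal \<bar>unit_normal y \<bullet> v\<bar> * F y \<partial>hausdorff_measure ?m)"
    by (rule nn_integral_cmult) measurable
  finally show ?thesis .
qed

end

section \<open>The contraction kernel and limits at the boundary\<close>

context shell_domain
begin

text \<open>The three indicators correspond to three cases. For \<open>|s| \<le> \<eta>\<close> on
  an uphill line monotonicity gives the factor 1. For larger \<open>|s|\<close> quadratic growth
  gives the small exponential, and \<open>R\<close> only records that chords are bounded. On a short
  chord \<open>\<rho>\<close> at the other point may exceed \<open>\<rho>\<close> at
  \<open>z\<close>, but by at most 1, whence \<open>exp lam\<close>.\<close>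

lemma kernel_bound:
  fixes c r R lam \<eta> l :: real
  assumes c: "0 < c" "\<And>x h. 0 \<le> \<rho> x \<Longrightarrow> \<rho> x \<le> 1 \<Longrightarrow> c * (norm h)\<^sup>2 \<le> h \<bullet> blinfun_apply (H x) h"
    and r: "0 < r" "\<And>v. v \<in> V \<Longrightarrow> r \<le> norm v" and R: "\<And>z. fst z \<in> X \<Longrightarrow> snd z \<in> V \<Longrightarrow> T z \<le> R"
    and lam: "0 \<le> lam" and \<eta>: "0 < \<eta>" and l: "0 \<le> l" "8 * \<epsilon> \<le> c * r\<^sup>2 * l\<^sup>2"
    and z: "snd z \<in> V" and s: "seg X z s" and w: "oriented_indicator (base_time z) 0 s \<noteq> 0"
  shows "exp (- lam * \<rho> (fst z)) \<le>
    (indicator {-\<eta>..\<eta>} s + exp (- lam * (c / 2 * r\<^sup>2 * \<eta>\<^sup>2)) * indicator {-R..R} s + exp lam * indicator {-l..l} s) * exp (- lam * \<rho> (fst z + s *\<^sub>R snd z))"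
proof -
  let ?f = "\<lambda>t. \<rho> (fst z + t *\<^sub>R snd z)"
  define \<kappa> where "\<kappa> = (indicator {-\<eta>..\<eta>} s + exp (- lam * (c / 2 * r\<^sup>2 * \<eta>\<^sup>2)) * indicator {-R..R} s + exp lam * indicator {-l..l} s :: real)"
  have nz: "snd z \<noteq> 0" using z V_nz by blast
  have zX: "fst z \<in> X" using seg_in(1)[OF s] .
  note st = seg_exit_time[OF zX nz]
  have sI: "- entry_time z < s" "s < exit_time z" using s st(3) by auto
  have ins: "0 < ?f t \<and> ?f t < 1" if "- entry_time z < t" "t < exit_time z" for t using inside[OF zX nz that] .
  have f0: "0 < ?f 0" "?f 0 < 1" and fs: "0 < ?f s" "?f s < 1" using ins[of 0] ins[of s] sI st(1,2) by auto
  have rv: "r\<^sup>2 \<le> (norm (snd z))\<^sup>2" using r(1) r(2)[OF z] by (intro power_mono) auto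
  have main: "exp (- lam * (?f 0 - ?f s)) \<le> \<kappa>"
  proof (cases "1 - \<epsilon> \<le> line_min z")
    case True
    \<comment> \<open>On a line with minimum at least \<open>1 - \<epsilon>\<close> the weight can
      grow by at most \<open>\<epsilon>\<close> inside the shell, so quadratic growth confines the
      chord to times within \<open>l / 2\<close> of the minimum.\<close>
    have far: "(t - min_time z)\<^sup>2 \<le> (l / 2)\<^sup>2" if t: "- entry_time z < t" "t < exit_time z" for t
    proof -
      have ft: "?f t < 1" using ins[OF t] by simp
      have mne: "?f (min_time z) = line_min z" by (simp add: line_min_def)
      have pos: "0 \<le> line_min z" using True \<epsilon> by simp
      have betw: "0 \<le> ?f t' \<and> ?f t' \<le> 1" if "min t (min_time z) \<le> t'" "t' \<le> max t (min_time z)" for t'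
      proof -
        have "?f t' \<le> ?f t"
        proof (cases "t' = t")
          case False
          show ?thesis
          proof (cases "min_time z \<le> t")
            case True then show ?thesis using increasing_right[OF nz, of t' t] that False by simp
          next
            case False' : False then show ?thesis using decreasing_left[OF nz, of t' t] that False by simp
          qed
        qed simp
        then show ?thesis using line_min_le[OF nz, of t'] pos ft by simp
      qed
      have sl0: "G (fst z + min_time z *\<^sub>R snd z) \<bullet> snd z = 0" using slope_min_time[OF nz] by (simp add: slope_def)
      have "line_min z + c / 2 * (norm (snd z))\<^sup>2 * (t - min_time z)\<^sup>2 \<le> ?f t"
      proof (cases "min_time z \<le> t")
        case True
        have "?f (min_time z) + (G (fst z + min_time z *\<^sub>R snd z) \<bullet> snd z) * (t - min_time z) + c / 2 * (norm (snd z))\<^sup>2 * (t - min_time z)\<^sup>2 \<le> ?f t"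
          by (rule quadratic_growth[OF c(2) True]) (use betw True in auto)
        then show ?thesis by (simp add: sl0 mne)
      next
        case False
        \<comment> \<open>\<open>quadratic_growth\<close> runs forward in time; times before the
          minimum are treated by reversing the direction.\<close>
        have "\<rho> (fst z + (- min_time z) *\<^sub>R (- snd z)) + (G (fst z + (- min_time z) *\<^sub>R (- snd z)) \<bullet> (- snd z)) * (- t - (- min_time z)) + c / 2 * (norm (- snd z))\<^sup>2 * (- t - (- min_time z))\<^sup>2 \<le> \<rho> (fst z + (- t) *\<^sub>R (- snd z))"
        proof (rule quadratic_growth[OF c(2)])
          fix t' assume "- min_time z \<le> t'" "t' \<le> - t"
          then show "0 \<le> \<rho> (fst z + t' *\<^sub>R (- snd z)) \<and> \<rho> (fst z + t' *\<^sub>R (- snd z)) \<le> 1"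
            using betw[of "- t'"] False by auto
        qed (use False in auto)
        then show ?thesis by (simp add: sl0 mne power2_commute)
      qed
      then have "c / 2 * (norm (snd z))\<^sup>2 * (t - min_time z)\<^sup>2 \<le> \<epsilon>" using True ft by linarith
      moreover have "c / 2 * r\<^sup>2 * (t - min_time z)\<^sup>2 \<le> c / 2 * (norm (snd z))\<^sup>2 * (t - min_time z)\<^sup>2"
        using c(1) rv by (intro mult_right_mono mult_left_mono) auto
      ultimately have "c / 2 * r\<^sup>2 * (t - min_time z)\<^sup>2 \<le> c * r\<^sup>2 * l\<^sup>2 / 8" using l(2) by linarith
      then have "(c / 2 * r\<^sup>2) * (t - min_time z)\<^sup>2 \<le> (c / 2 * r\<^sup>2) * (l / 2)\<^sup>2" by (simp add: power2_eq_square)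
      moreover have "0 < c / 2 * r\<^sup>2" using c(1) r(1) by simp
      ultimately show ?thesis by (simp only: mult_le_cancel_left_pos)
    qed
    have "\<bar>t - min_time z\<bar> \<le> l / 2" if "- entry_time z < t" "t < exit_time z" for t
      using far[OF that] l(1) by (simp add: abs_le_square_iff[symmetric])
    from this[of 0] this[OF sI] have sl: "\<bar>s\<bar> \<le> l" using st(1,2) by linarith
    have "- (?f 0 - ?f s) \<le> 1" using f0 fs by linarith
    then have "lam * (- (?f 0 - ?f s)) \<le> lam * 1" using lam by (intro mult_left_mono) auto
    then have "exp (- lam * (?f 0 - ?f s)) \<le> exp lam" by (simp add: algebra_simps)
    also have "\<dots> \<le> \<kappa>" using sl by (auto simp: \<kappa>_def indicator_def)
    finally show ?thesis .
  next
    case False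
    then have base_time: "base_time z = max (- entry_time z) (min (min_time z) (exit_time z))" by (simp add: base_time_def)
    \<comment> \<open>Between \<open>z\<close> and its base point the line does not cross the
      minimum, so the first-order term of Taylor's bound is nonnegative and only the quadratic term
      is kept.\<close>
    have growth: "c / 2 * (norm (snd z))\<^sup>2 * s\<^sup>2 \<le> ?f 0 - ?f s"
    proof (cases "s < 0")
      case True
      then have "base_time z \<le> s" using w by (auto simp: oriented_indicator_def split: if_splits)
      then have "min_time z \<le> s" using base_time sI by (auto simp: max_def min_def split: if_splits)
      then have sl: "0 \<le> G (fst z + s *\<^sub>R snd z) \<bullet> snd z" using slope_iff(1)[OF nz, of s] by (simp add: slope_def)
      have "?f s + (G (fst z + s *\<^sub>R snd z) \<bullet> snd z) * (0 - s) + c / 2 * (norm (snd z))\<^sup>2 * (0 - s)\<^sup>2 \<le> ?f 0"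
        by (rule quadratic_growth[OF c(2)]) (use True ins sI st in \<open>auto intro!: less_imp_le\<close>)
      moreover have "0 \<le> (G (fst z + s *\<^sub>R snd z) \<bullet> snd z) * (0 - s)" using sl True by (intro mult_nonneg_nonneg) auto
      ultimately show ?thesis by simp
    next
      case s0: False
      then have "s < base_time z" using w by (auto simp: oriented_indicator_def split: if_splits)
      then have "s \<le> min_time z" using base_time sI by (auto simp: max_def min_def split: if_splits)
      then have sl: "G (fst z + s *\<^sub>R snd z) \<bullet> snd z \<le> 0" using slope_iff(2)[OF nz, of s] by (simp add: slope_def)
      have "\<rho> (fst z + (- s) *\<^sub>R (- snd z)) + (G (fst z + (- s) *\<^sub>R (- snd z)) \<bullet> (- snd z)) * (0 - (- s)) + c / 2 * (norm (- snd z))\<^sup>2 * (0 - (- s))\<^sup>2 \<le> \<rho> (fst z + 0 *\<^sub>R (- snd z))"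
      proof (rule quadratic_growth[OF c(2)])
        fix t' assume "- s \<le> t'" "t' \<le> 0"
        then show "0 \<le> \<rho> (fst z + t' *\<^sub>R (- snd z)) \<and> \<rho> (fst z + t' *\<^sub>R (- snd z)) \<le> 1"
          using ins[of "- t'"] sI st(2) s0 by auto
      qed (use s0 in auto)
      moreover have "0 \<le> (- (G (fst z + s *\<^sub>R snd z) \<bullet> snd z)) * s" using sl s0 by (intro mult_nonneg_nonneg) auto
      ultimately show ?thesis by simp
    qed
    have pos: "0 \<le> c / 2 * (norm (snd z))\<^sup>2 * s\<^sup>2" using c(1) by simp
    show ?thesis
    proof (cases "\<bar>s\<bar> \<le> \<eta>")
      case True
      have "exp (- lam * (?f 0 - ?f s)) \<le> 1" using lam growth pos by simp
      also have "\<dots> \<le> \<kappa>" using True by (auto simp: \<kappa>_def indicator_def)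
      finally show ?thesis .
    next
      case False
      then have "\<eta>\<^sup>2 \<le> s\<^sup>2" using \<eta> by (simp add: abs_le_square_iff[symmetric])
      then have "c / 2 * r\<^sup>2 * \<eta>\<^sup>2 \<le> c / 2 * (norm (snd z))\<^sup>2 * s\<^sup>2"
        using c(1) rv by (intro mult_mono mult_left_mono) auto
      then have "lam * (c / 2 * r\<^sup>2 * \<eta>\<^sup>2) \<le> lam * (?f 0 - ?f s)" using lam growth by (intro mult_left_mono) auto
      then have "exp (- lam * (?f 0 - ?f s)) \<le> exp (- lam * (c / 2 * r\<^sup>2 * \<eta>\<^sup>2))" by simp
      also have "\<dots> \<le> \<kappa>"
      proof -
        have "T z \<le> R" using R zX z by blast
        then have "\<bar>s\<bar> \<le> R" using sI st by auto
        then show ?thesis by (auto simp: \<kappa>_def indicator_def)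
      qed
      finally show ?thesis .
    qed
  qed
  have "exp (- lam * ?f 0) = exp (- lam * (?f 0 - ?f s)) * exp (- lam * ?f s)"
    by (simp add: algebra_simps flip: exp_add)
  also have "\<dots> \<le> \<kappa> * exp (- lam * ?f s)" using main by (intro mult_right_mono) auto
  finally show ?thesis by (simp add: \<kappa>_def)
qed

end

locale boltzmann_solution = shell_domain X V D \<rho> G H \<epsilon> + transport_problem X V D p base_time J \<sigma> k e \<kappa> C c\<kappa>
  for X V :: "'a::euclidean_space set" and D :: "'a measure" and \<rho> :: "'a \<Rightarrow> real" and G :: "'a \<Rightarrow> 'a" and H :: "'a \<Rightarrow> 'a \<Rightarrow>\<^sub>L 'a" and \<epsilon> :: real
    and p :: real and J \<sigma> :: "'a \<times> 'a \<Rightarrow> real" and k :: "'a \<Rightarrow> 'a \<Rightarrow> 'a \<Rightarrow> real"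
    and e :: "'a \<Rightarrow> real" and \<kappa> :: "real \<Rightarrow> real" and C c\<kappa> :: real
begin

section \<open>Divergent lines and traces at the remaining boundary points\<close>

definition line_bound :: "'a \<times> 'a \<Rightarrow> ennreal" where
  "line_bound z = (\<integral>\<^sup>+s. (if seg X z s then Q (flow s z) else 0) \<partial>lborel)"

lemma line_bound_measurable [measurable]: "line_bound \<in> borel_measurable borel"
  unfolding line_bound_def by measurable

lemma line_bound_flow: "seg X z t \<Longrightarrow> line_bound (flow t z) = line_bound z"
  unfolding line_bound_def flow_flow using seg_shift_integral[of z t "\<lambda>s. Q (flow s z)"] by simp

lemma line_integrable:
  assumes "line_bound z < \<infinity>" and [measurable]: "g \<in> borel_measurable borel" and g: "\<And>s. \<bar>g s\<bar> \<le> 1"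
  shows "integrable lborel (\<lambda>s. if seg X z s then g s * q (flow s z) else 0)"
proof (rule integrableI_bounded)
  have "(\<integral>\<^sup>+s. ennreal (norm (if seg X z s then g s * q (flow s z) else 0)) \<partial>lborel) \<le> line_bound z"
    unfolding line_bound_def
  proof (rule nn_integral_mono)
    fix s
    have "ennreal \<bar>g s * q (flow s z)\<bar> \<le> ennreal (1 * \<bar>q (flow s z)\<bar>)"
      unfolding abs_mult by (intro ennreal_leI mult_right_mono g) auto
    also have "\<dots> \<le> Q (flow s z)" using q_le_Q[of "flow s z"] by simp
    finally show "ennreal (norm (if seg X z s then g s * q (flow s z) else 0)) \<le> (if seg X z s then Q (flow s z) else 0)" by simp
  qed
  then show "(\<integral>\<^sup>+s. ennreal (norm (if seg X z s then g s * q (flow s z) else 0)) \<partial>lborel) < \<infinity>"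
    using assms(1) by simp
qed measurable

lemma u_increment:
  assumes "snd z \<in> V" "line_bound z < \<infinity>" "seg X z t"
  shows "u (flow t z) - u z = (\<integral>s. (if seg X z s then oriented_indicator 0 t s * q (flow s z) else 0) \<partial>lborel)"
proof -
  have i: "integrable lborel (\<lambda>s. if seg X z s then oriented_indicator a b' s * q (flow s z) else 0)" for a b'
    by (rule line_integrable[OF assms(2)]) (auto intro: abs_oriented_indicator_le)
  have s0: "seg X z 0" using seg_in(1)[OF assms(3)] by simp
  have "u (flow t z) - u (flow 0 z) = (\<integral>s. (if seg X z s then oriented_indicator (base_time z) t s * q (flow s z) else 0) - (if seg X z s then oriented_indicator (base_time z) 0 s * q (flow s z) else 0) \<partial>lborel)"
    unfolding u_flow[OF assms(1,3)] u_flow[OF assms(1) s0] by (simp add: i)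
  also have "\<dots> = (\<integral>s. (if seg X z s then oriented_indicator 0 t s * q (flow s z) else 0) \<partial>lborel)"
    by (intro Bochner_Integration.integral_cong) (auto simp: oriented_indicator_def)
  finally show ?thesis by simp
qed

lemma AE_increment: "AE z in N. fst z \<in> X \<longrightarrow> (\<forall>t. seg X z t \<longrightarrow>
    u (flow t z) - u z = (\<integral>s. (if seg X z s then oriented_indicator 0 t s * q (flow s z) else 0) \<partial>lborel))"
  using AE_line AE_N_V by eventually_elim (auto simp: u_increment line_bound_def)

definition divergent :: "('a \<times> 'a) set" where "divergent = {z. fst z \<in> X \<and> line_bound z = \<infinity>}"

text \<open>Divergence is constant along a line, so it is detected by the points at times \<open>1 / (n + 1)\<close>; this
  keeps the set measurable.\<close>

definition divergent_boundary :: "real \<Rightarrow> ('a \<times> 'a) set" where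
  "divergent_boundary s = {z \<in> data_boundary s. \<exists>m::nat. \<forall>n::nat. m \<le> n \<longrightarrow> flow (inward_sign z / real (Suc n)) z \<in> divergent}"

lemma divergent_measurable [measurable]: "divergent \<in> sets borel"
  unfolding divergent_def by measurable

lemma divergent_boundary_measurable [measurable]: "divergent_boundary s \<in> sets borel"
proof -
  have "divergent_boundary s = {z. z \<in> data_boundary s \<and> (\<exists>m::nat. \<forall>n::nat. m \<le> n \<longrightarrow> flow (inward_sign z / real (Suc n)) z \<in> divergent)}" by (auto simp: divergent_boundary_def)
  also have "\<dots> \<in> sets borel" by measurable
  finally show ?thesis .
qed

lemma divergent_slice_null: "AE v in D. {x. (x, v) \<in> divergent} \<in> null_sets lborel"
proof -
  have "AE z in N. z \<notin> divergent" using AE_line by eventually_elim (auto simp: divergent_def line_bound_def)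
  then have "(\<integral>\<^sup>+z. indicator divergent z \<partial>N) = 0"
    by (subst nn_integral_0_iff_AE) (auto simp: indicator_def)
  then have "(\<integral>\<^sup>+v. \<integral>\<^sup>+x. indicator divergent (x, v) \<partial>lborel \<partial>D) = 0"
    by (subst (asm) nn_integral_N') auto
  then have "AE v in D. (\<integral>\<^sup>+x. indicator divergent (x, v) \<partial>lborel) = 0"
    by (subst (asm) nn_integral_0_iff_AE) auto
  then show ?thesis
  proof eventually_elim
    case (elim v)
    have [measurable]: "{x. (x, v) \<in> divergent} \<in> sets borel" by measurable
    have "(\<integral>\<^sup>+x. indicator divergent (x, v) \<partial>lborel) = (\<integral>\<^sup>+x. indicator {x. (x, v) \<in> divergent} x \<partial>lborel)"
      by (intro nn_integral_cong) (auto simp: indicator_def)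
    also have "\<dots> = emeasure lborel {x. (x, v) \<in> divergent}" by simp
    finally show ?case using elim by (auto simp: null_sets_def)
  qed
qed

text \<open>\<open>line_bound\<close> is constant along a chord, so from a point of
  \<open>divergent_boundary\<close> every inward point reachable inside \<open>X\<close> is
  divergent. For almost every \<open>v\<close> the divergent points form a null set, and
  \<open>boundary_null\<close> carries this over to the boundary.\<close>

lemma divergent_boundary_slice_null:
  assumes s: "s = 0 \<or> s = 1"
  shows "AE v in D. hausdorff_outer (DIM('a) - 1) {y. (y, v) \<in> divergent_boundary s} = 0"
  using divergent_slice_null D_V
proof eventually_elim
  case (elim v)
  have v: "v \<noteq> 0" using elim V_nz by blast
  show ?case
  proof (rule boundary_null[OF s v _ _ elim(1)])
    show "{y. (y, v) \<in> divergent_boundary s} \<in> sets borel" by measurable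
    show "\<And>y. y \<in> {y. (y, v) \<in> divergent_boundary s} \<Longrightarrow> (y, v) \<in> data_boundary s" by (auto simp: divergent_boundary_def)
    fix y r assume y: "y \<in> {y. (y, v) \<in> divergent_boundary s}" and r: "0 < r" and inX: "\<And>t. 0 < t \<Longrightarrow> t \<le> r \<Longrightarrow> y + (inward_sign (y, v) * t) *\<^sub>R v \<in> X"
    define \<eta> where "\<eta> = inward_sign (y, v)"
    have \<eta>: "\<eta> = 1 \<or> \<eta> = -1" by (auto simp: \<eta>_def inward_sign_def)
    obtain m :: nat where m: "\<And>n. m \<le> n \<Longrightarrow> flow (\<eta> / real (Suc n)) (y, v) \<in> divergent" using y by (auto simp: divergent_boundary_def \<eta>_def)
    obtain n0 where n0: "1 / real (Suc n0) < r" using nat_approx_posE[OF r] by metis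
    define n where "n = max m n0"
    define t1 where "t1 = 1 / real (Suc n)"
    have "t1 \<le> 1 / real (Suc n0)" unfolding t1_def n_def by (intro divide_left_mono) auto
    then have t1: "0 < t1" "t1 < r" using n0 by (auto simp: t1_def)
    have zbad: "flow (\<eta> * t1) (y, v) \<in> divergent" using m[of n] by (simp add: n_def t1_def)
    have seg: "seg X (flow (\<eta> * t1) (y, v)) (\<eta> * r - \<eta> * t1)"
      unfolding seg_iff
    proof (intro allI impI)
      fix t assume t: "0 \<le> t \<and> t \<le> \<eta> * r - \<eta> * t1 \<or> \<eta> * r - \<eta> * t1 \<le> t \<and> t \<le> 0"
      have "0 < t1 + \<eta> * t \<and> t1 + \<eta> * t \<le> r" using t t1 \<eta> by auto
      then have "y + (\<eta> * (t1 + \<eta> * t)) *\<^sub>R v \<in> X" using inX by (simp add: \<eta>_def)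
      moreover have "\<eta> * (t1 + \<eta> * t) = t + \<eta> * t1" using \<eta> by (auto simp: algebra_simps)
      ultimately have "y + (t + \<eta> * t1) *\<^sub>R v \<in> X" by simp
      then show "fst (flow (\<eta> * t1) (y, v)) + t *\<^sub>R snd (flow (\<eta> * t1) (y, v)) \<in> X"
        by (simp add: algebra_simps)
    qed
    have "line_bound (flow (\<eta> * r - \<eta> * t1) (flow (\<eta> * t1) (y, v))) = line_bound (flow (\<eta> * t1) (y, v))" by (rule line_bound_flow[OF seg])
    then have "line_bound (flow (\<eta> * r) (y, v)) = \<infinity>" using zbad by (simp add: divergent_def)
    then have "flow (\<eta> * r) (y, v) \<in> divergent" using inX[of r] r by (simp add: divergent_def \<eta>_def)
    then show "y + (inward_sign (y, v) * r) *\<^sub>R v \<in> {x. (x, v) \<in> divergent}" by (simp add: flow_def \<eta>_def)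
  qed
qed

text \<open>At a boundary point that is not divergent, \<open>u\<close> on the line equals the
  prescribed value plus an integral of \<open>q\<close> over an interval that shrinks to the base
  point. The integrand is dominated by an integrable function on the chord, so the integral tends to
  0.\<close>

lemma trace_at:
  assumes y: "(y, v) \<in> data_boundary s" "(y, v) \<notin> divergent_boundary s" and v: "v \<in> V" and g: "\<And>x. line_type s (x, v) \<Longrightarrow> base (x, v) = y \<Longrightarrow> J (x, v) = g"
  shows "((\<lambda>t. u (y + t *\<^sub>R v, v)) \<longlongrightarrow> g) (at 0 within {t. y + t *\<^sub>R v \<in> X})"
proof -
  have nz: "v \<noteq> 0" using v V_nz by blast
  define \<eta> where "\<eta> = inward_sign (y, v)"
  have \<eta>: "\<eta> = 1 \<or> \<eta> = -1" by (auto simp: \<eta>_def inward_sign_def)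
  have \<eta>\<eta>: "\<eta> * (\<eta> * a) = a" for a using \<eta> by auto
  obtain r where r: "r > 0" "\<And>t. 0 < t \<Longrightarrow> t \<le> r \<Longrightarrow> y + (\<eta> * t) *\<^sub>R v \<in> X \<and> base_time (y + (\<eta> * t) *\<^sub>R v, v) = - (\<eta> * t) \<and> line_type s (y + (\<eta> * t) *\<^sub>R v, v)"
    using near_boundary[OF y(1) nz] y(1) unfolding \<eta>_def by (metis dist_self less_imp_le)
  obtain n0 where n0: "1 / real (Suc n0) < r" using nat_approx_posE[OF r(1)] by metis
  \<comment> \<open>The negation of \<open>divergent_boundary\<close> yields such times beyond every
    index, in particular one below \<open>r\<close>.\<close>
  obtain n where n: "n0 \<le> n" "flow (\<eta> / real (Suc n)) (y, v) \<notin> divergent" using y by (auto simp: divergent_boundary_def \<eta>_def)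
  define t1 where "t1 = 1 / real (Suc n)"
  have "t1 \<le> 1 / real (Suc n0)" unfolding t1_def using n(1) by (intro divide_left_mono) auto
  then have t1: "0 < t1" "t1 < r" using n0 by (auto simp: t1_def)
  define z where "z = flow (\<eta> * t1) (y, v)"
  have z: "fst z \<in> X" "snd z = v" "base_time z = - (\<eta> * t1)" "line_type s z" using r(2)[of t1] t1 by (auto simp: z_def flow_def)
  have zg: "line_bound z < \<infinity>" using n(2) z(1) by (auto simp: divergent_def z_def t1_def less_top)
  have bz: "base z = y" by (simp add: base_def z) (simp add: z_def)
  have Jz: "J z = g" using g[of "fst z"] z(2,4) bz by (metis prod.collapse)
  \<comment> \<open>Close to time 0 the line is in \<open>X\<close> on the inward side only, so the
    filter in the statement is in effect one-sided.\<close>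
  have side: "\<exists>d>0. \<forall>t. \<bar>t\<bar> < d \<longrightarrow> y + t *\<^sub>R v \<in> X \<longrightarrow> 0 \<le> \<eta> * t"
  proof -
    have \<rho>y: "\<rho> y = s" using y(1) by (auto simp: data_boundary_def)
    consider (a) "s = 0" "G y \<bullet> v > 0" | (b) "s = 0" "G y \<bullet> v < 0" | (c) "s = 1" "G y \<bullet> v < 0"
      using y(1) by (fastforce simp: data_boundary_def)
    then show ?thesis
    proof cases
      case a
      then have "\<eta> = 1" using \<rho>y by (simp add: \<eta>_def inward_sign_def)
      from local_direction[OF a(2)] obtain d where d: "d > 0" "\<And>t. 0 < t \<Longrightarrow> t < d \<Longrightarrow> \<rho> (y - t *\<^sub>R v) < \<rho> y" by blast
      have "0 \<le> t" if "\<bar>t\<bar> < d" "y + t *\<^sub>R v \<in> X" for t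
      proof (rule ccontr)
        assume "\<not> 0 \<le> t"
        then have "\<rho> (y + t *\<^sub>R v) < 0" using d(2)[of "- t"] that(1) \<rho>y a(1) by simp
        then show False using that(2) by (simp add: X_shell)
      qed
      then show ?thesis using d(1) \<open>\<eta> = 1\<close> by auto
    next
      case b
      then have "\<eta> = -1" using \<rho>y by (simp add: \<eta>_def inward_sign_def)
      have "G y \<bullet> (- v) > 0" using b by simp
      from local_direction[OF this] obtain d where d: "d > 0" "\<And>t. 0 < t \<Longrightarrow> t < d \<Longrightarrow> \<rho> (y - t *\<^sub>R (- v)) < \<rho> y" by blast
      have "t \<le> 0" if "\<bar>t\<bar> < d" "y + t *\<^sub>R v \<in> X" for t
      proof (rule ccontr)
        assume "\<not> t \<le> 0"
        then have "\<rho> (y + t *\<^sub>R v) < 0" using d(2)[of t] that(1) \<rho>y b(1) by simp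
        then show False using that(2) by (simp add: X_shell)
      qed
      then show ?thesis using d(1) \<open>\<eta> = -1\<close> by auto
    next
      case c
      then have "\<eta> = 1" using \<rho>y by (simp add: \<eta>_def inward_sign_def)
      have "G y \<bullet> (- v) > 0" using c by simp
      from local_direction[OF this] obtain d where d: "d > 0" "\<And>t. 0 < t \<Longrightarrow> t < d \<Longrightarrow> \<rho> y < \<rho> (y + t *\<^sub>R (- v))" by blast
      have "0 \<le> t" if "\<bar>t\<bar> < d" "y + t *\<^sub>R v \<in> X" for t
      proof (rule ccontr)
        assume "\<not> 0 \<le> t"
        then have "1 < \<rho> (y + t *\<^sub>R v)" using d(2)[of "- t"] that(1) \<rho>y c(1) by simp
        then show False using that(2) by (simp add: X_shell)
      qed
      then show ?thesis using d(1) \<open>\<eta> = 1\<close> by auto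
    qed
  qed
  then obtain d where d: "d > 0" "\<And>t. \<bar>t\<bar> < d \<Longrightarrow> y + t *\<^sub>R v \<in> X \<Longrightarrow> 0 \<le> \<eta> * t" by blast
  define Fi where "Fi t s = (if seg X z s then oriented_indicator (- (\<eta> * t1)) (t - \<eta> * t1) s * q (flow s z) else 0)" for t s
  have u_eq: "u (y + t *\<^sub>R v, v) = g + (\<integral>s. Fi t s \<partial>lborel)" if t: "\<bar>t\<bar> < d" "\<bar>t\<bar> < t1" "t \<noteq> 0" "y + t *\<^sub>R v \<in> X" for t
  proof -
    have \<eta>t: "0 < \<eta> * t" "\<eta> * t < t1" using d(2)[OF t(1,4)] t(2,3) \<eta> by auto
    have seg: "seg X z (t - \<eta> * t1)"
      unfolding seg_iff
    proof (intro allI impI)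
      fix w assume w: "0 \<le> w \<and> w \<le> t - \<eta> * t1 \<or> t - \<eta> * t1 \<le> w \<and> w \<le> 0"
      have "0 < t1 + \<eta> * w \<and> t1 + \<eta> * w \<le> t1" using w \<eta>t \<eta> by auto
      then have "y + (\<eta> * (t1 + \<eta> * w)) *\<^sub>R v \<in> X" using r(2)[of "t1 + \<eta> * w"] t1 by simp
      moreover have "\<eta> * (t1 + \<eta> * w) = w + \<eta> * t1" using \<eta> by (auto simp: algebra_simps)
      ultimately have "y + (w + \<eta> * t1) *\<^sub>R v \<in> X" by simp
      then show "fst z + w *\<^sub>R snd z \<in> X" by (simp add: z_def algebra_simps)
    qed
    have "(y + t *\<^sub>R v, v) = flow (t - \<eta> * t1) z" by (simp add: z_def) (simp add: flow_def)
    moreover have "u (flow (t - \<eta> * t1) z) = g + (\<integral>s. Fi t s \<partial>lborel)"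
      unfolding Fi_def z(3)[symmetric] Jz[symmetric] by (rule u_flow[OF _ seg]) (use v z(2) in simp)
    ultimately show ?thesis by simp
  qed
  have [measurable]: "Fi t \<in> borel_measurable borel" for t unfolding Fi_def by measurable
  show ?thesis
    unfolding tendsto_at_iff_sequentially comp_def
  proof (intro allI impI)
    fix Xs :: "nat \<Rightarrow> real" assume Xs: "\<forall>i. Xs i \<in> {t. y + t *\<^sub>R v \<in> X} - {0}" "Xs \<longlonglongrightarrow> 0"
    have "(\<lambda>i. \<integral>s. Fi (Xs i) s \<partial>lborel) \<longlonglongrightarrow> (\<integral>s. 0 \<partial>(lborel :: real measure))"
    proof (rule integral_dominated_convergence[where w="\<lambda>s. \<bar>if seg X z s then 1 * q (flow s z) else 0\<bar>"])
      \<comment> \<open>The integrands vanish eventually except possibly at the base time itself,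
        which is a null set.\<close>
      have "AE s in (lborel :: real measure). s \<noteq> - (\<eta> * t1)" by (rule AE_lborel_singleton)
      then show "AE s in lborel. (\<lambda>i. Fi (Xs i) s) \<longlonglongrightarrow> 0"
      proof eventually_elim
        case (elim s)
        have "eventually (\<lambda>i. \<bar>Xs i\<bar> < \<bar>s + \<eta> * t1\<bar>) sequentially"
          using tendstoD[OF Xs(2), of "\<bar>s + \<eta> * t1\<bar>"] elim by (simp add: dist_real_def)
        then have "eventually (\<lambda>i. Fi (Xs i) s = 0) sequentially"
        proof eventually_elim
          case (elim i)
          then have "oriented_indicator (- (\<eta> * t1)) (Xs i - \<eta> * t1) s = 0" by (auto simp: oriented_indicator_def)
          then show ?case by (simp add: Fi_def)
        qed
        then show ?case by (rule tendsto_eventually)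
      qed
      show "AE s in lborel. norm (Fi (Xs i) s) \<le> \<bar>if seg X z s then 1 * q (flow s z) else 0\<bar>" for i
        by (intro AE_I2) (auto simp: Fi_def abs_mult intro!: mult_left_le_one_le abs_oriented_indicator_le)
      show "integrable lborel (\<lambda>s. \<bar>if seg X z s then 1 * q (flow s z) else 0\<bar>)"
        by (rule integrable_abs, rule line_integrable[OF zg]) auto
    qed auto
    then have "(\<lambda>i. g + (\<integral>s. Fi (Xs i) s \<partial>lborel)) \<longlonglongrightarrow> g + 0"
      by (intro tendsto_add tendsto_const) simp
    moreover have "eventually (\<lambda>i. \<bar>Xs i\<bar> < min d t1) sequentially"
      using tendstoD[OF Xs(2), of "min d t1"] d(1) t1(1) by (simp add: dist_real_def)
    then have "eventually (\<lambda>i. g + (\<integral>s. Fi (Xs i) s \<partial>lborel) = u (y + Xs i *\<^sub>R v, v)) sequentially"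
      by eventually_elim (use u_eq Xs(1) in auto)
    ultimately show "(\<lambda>i. u (y + Xs i *\<^sub>R v, v)) \<longlonglongrightarrow> g"
      using tendsto_cong by fastforce
  qed
qed

end

section \<open>Transfer to phase space\<close>

text \<open>The two kinds of velocity space enter the remaining argument only through these four
  facts.\<close>

lemma velocity_space_facts:
  fixes V :: "'a::euclidean_space set"
  assumes "velocity_space V dv"
  shows "V \<in> sets borel" "sets dv = sets (restrict_space borel V)" "finite_measure dv" "\<exists>r>0. \<forall>v\<in>V. r \<le> norm v"
proof -
  have "V \<in> sets borel \<and> sets dv = sets (restrict_space borel V) \<and> finite_measure dv \<and> (\<exists>r>0. \<forall>v\<in>V. r \<le> norm v)"
    using assms unfolding velocity_space_def
  proof
    assume a: "bounded V \<and> open V \<and> (\<exists>r>0. V \<inter> ball 0 r = {}) \<and> dv = restrict_space lborel V"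
    then obtain r where r: "r > 0" "V \<inter> ball 0 r = {}" by blast
    have "r \<le> norm v" if "v \<in> V" for v
    proof (rule ccontr)
      assume "\<not> r \<le> norm v"
      then have "v \<in> V \<inter> ball 0 r" using that by simp
      then show False using r(2) by simp
    qed
    moreover have "finite_measure dv"
    proof
      have "emeasure dv (space dv) = emeasure lborel V" using a by (simp add: space_restrict_space emeasure_restrict_space)
      then show "emeasure dv (space dv) \<noteq> \<infinity>" using emeasure_bounded_finite[of V] a by simp
    qed
    moreover have "sets dv = sets (restrict_space borel V)" using a by (auto simp: sets_restrict_space)
    ultimately show ?thesis using a r(1) by auto
  next
    assume a: "closed_hypersurface V \<and> 0 \<notin> V \<and> dv = surface_measure V"
    then have cV: "compact V" by (simp add: closed_hypersurface_def)
    then have bV: "V \<in> sets borel" by (simp add: compact_imp_closed)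
    have "\<exists>r>0. \<forall>v\<in>V. r \<le> norm v"
    proof (cases "V = {}")
      case False
      obtain v0 where v0: "v0 \<in> V" "\<And>v. v \<in> V \<Longrightarrow> norm v0 \<le> norm v"
        using continuous_attains_inf[OF cV False, of norm] by (auto intro: continuous_intros)
      then have "norm v0 > 0" using a by auto
      then show ?thesis using v0(2) by blast
    qed (auto intro: exI[of _ 1])
    moreover have "finite_measure dv"
    proof
      have "emeasure dv (space dv) = hausdorff_outer (DIM('a) - 1) V" using a bV
        by (simp add: surface_measure_def space_restrict_space emeasure_restrict_space emeasure_hausdorff_measure)
      then show "emeasure dv (space dv) \<noteq> \<infinity>" using hausdorff_outer_closed_hypersurface_finite[of V] a by simp
    qed
    moreover have "sets dv = sets (restrict_space borel V)" using a by (auto simp: surface_measure_def sets_restrict_space)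
    ultimately show ?thesis using bV by blast
  qed
  then show "V \<in> sets borel" "sets dv = sets (restrict_space borel V)" "finite_measure dv" "\<exists>r>0. \<forall>v\<in>V. r \<le> norm v" by auto
qed

text \<open>The measure \<open>dv\<close> lives on \<open>V\<close>; its image on the whole space allows working with Borel functions on
  \<open>'a \<times> 'a\<close> throughout.\<close>

locale phase_space =
  fixes X V :: "'a::euclidean_space set" and dv :: "'a measure"
  assumes open_X': "open X" and bounded_X': "bounded X" and V_borel [measurable]: "V \<in> sets borel"
    and sets_dv: "sets dv = sets (restrict_space borel V)" and finite_dv: "finite_measure dv"
    and V_low': "\<exists>r>0. \<forall>v\<in>V. r \<le> norm v"
begin

sublocale dv: finite_measure dv by (rule finite_dv)

lemma space_dv: "space dv = V"
  using sets_eq_imp_space_eq[OF sets_dv] by (simp add: space_restrict_space)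

lemma id_dv: "(\<lambda>v. v) \<in> dv \<rightarrow>\<^sub>M borel"
proof -
  have "(\<lambda>v. v) \<in> restrict_space borel V \<rightarrow>\<^sub>M borel" by (rule measurable_restrict_space1) simp
  then show ?thesis by (simp add: measurable_cong_sets[OF sets_dv refl])
qed

sublocale transport_domain X V "distr dv borel (\<lambda>v. v)"
proof (rule transport_domain.intro)
  show "AE v in distr dv borel (\<lambda>v. v). v \<in> V"
    by (subst AE_distr_iff[OF id_dv]) (auto simp: space_dv intro!: AE_I2)
  show "finite_measure (distr dv borel (\<lambda>v. v))"
    by (rule dv.finite_measure_distr[OF id_dv])
qed (use open_X' bounded_X' V_low' in auto)

abbreviation D where "D \<equiv> distr dv borel (\<lambda>v. v)"
abbreviation M where "M \<equiv> dx X \<Otimes>\<^sub>M dv"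

lemma nn_integral_D: "f \<in> borel_measurable borel \<Longrightarrow> (\<integral>\<^sup>+v. f v \<partial>D) = (\<integral>\<^sup>+v. f v \<partial>dv)"
  by (subst nn_integral_distr[OF id_dv]) simp_all

lemma space_M: "space M = X \<times> V"
  by (simp add: space_pair_measure space_dv space_restrict_space)

lemma id_M: "(\<lambda>z. z) \<in> M \<rightarrow>\<^sub>M borel"
proof -
  have "(\<lambda>x. x) \<in> dx X \<rightarrow>\<^sub>M borel" by (rule measurable_restrict_space1) simp
  then have "(\<lambda>z. (fst z, snd z)) \<in> M \<rightarrow>\<^sub>M borel"
    by (intro borel_measurable_Pair measurable_compose[OF measurable_fst] measurable_compose[OF measurable_snd id_dv])
  then show ?thesis by simp
qed

lemma M_from_borel: "f \<in> borel_measurable borel \<Longrightarrow> f \<in> borel_measurable M"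
  using measurable_compose[OF id_M] by blast

lemma nn_integral_M:
  assumes [measurable]: "f \<in> borel_measurable borel"
  shows "(\<integral>\<^sup>+z. f z \<partial>M) = (\<integral>\<^sup>+z. (if fst z \<in> X then f z else 0) \<partial>N)"
proof -
  have "(\<integral>\<^sup>+z. f z \<partial>M) = (\<integral>\<^sup>+x. \<integral>\<^sup>+v. f (x, v) \<partial>dv \<partial>dx X)"
    by (rule dv.nn_integral_fst[symmetric]) (rule M_from_borel, measurable)
  also have "\<dots> = (\<integral>\<^sup>+x. \<integral>\<^sup>+v. f (x, v) \<partial>D \<partial>dx X)"
    by (subst nn_integral_D) auto
  also have "\<dots> = (\<integral>\<^sup>+x\<in>X. (\<integral>\<^sup>+v. f (x, v) \<partial>D) \<partial>lborel)"
    by (rule nn_integral_restrict_space) simp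
  also have "\<dots> = (\<integral>\<^sup>+x. \<integral>\<^sup>+v. (if fst (x, v) \<in> X then f (x, v) else 0) \<partial>D \<partial>lborel)"
    by (intro nn_integral_cong) (auto simp: indicator_def)
  also have "\<dots> = (\<integral>\<^sup>+z. (if fst z \<in> X then f z else 0) \<partial>N)"
    by (rule nn_integral_N[symmetric]) measurable
  finally show ?thesis .
qed

text \<open>Identifies integration over \<open>M\<close> with integration over \<open>X\<close>
  inside the whole phase space, so that Bochner integrals can be transferred and translations become
  available.\<close>

lemma distr_M: "distr M borel (\<lambda>z. z) = density N (\<lambda>z. if fst z \<in> X then 1 else 0)"
proof (rule measure_eqI)
  fix A assume "A \<in> sets (distr M borel (\<lambda>z. z))"
  then have A [measurable]: "A \<in> sets borel" by simp
  have "emeasure (distr M borel (\<lambda>z. z)) A = (\<integral>\<^sup>+z. indicator A z \<partial>distr M borel (\<lambda>z. z))" by simp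
  also have "\<dots> = (\<integral>\<^sup>+z. indicator A z \<partial>M)" by (rule nn_integral_distr[OF id_M]) measurable
  also have "\<dots> = (\<integral>\<^sup>+z. (if fst z \<in> X then indicator A z else 0) \<partial>N)" by (rule nn_integral_M) measurable
  also have "\<dots> = (\<integral>\<^sup>+z. (if fst z \<in> X then 1 else 0) * indicator A z \<partial>N)" by (intro nn_integral_cong) auto
  also have "\<dots> = emeasure (density N (\<lambda>z. if fst z \<in> X then 1 else 0)) A"
  proof (rule emeasure_density[symmetric])
    show "A \<in> sets N" unfolding sets_N by (rule A)
  qed measurable
  finally show "emeasure (distr M borel (\<lambda>z. z)) A = emeasure (density N (\<lambda>z. if fst z \<in> X then 1 else 0)) A" .
qed (simp only: sets_distr sets_density sets_N)

lemma integral_M: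
  fixes f :: "'a \<times> 'a \<Rightarrow> real"
  assumes [measurable]: "f \<in> borel_measurable borel"
  shows "integrable M f \<longleftrightarrow> integrable N (\<lambda>z. if fst z \<in> X then f z else 0)"
    "(\<integral>z. f z \<partial>M) = (\<integral>z. (if fst z \<in> X then f z else 0) \<partial>N)"
proof -
  have d: "density N (\<lambda>z. if fst z \<in> X then 1 else 0) = density N (\<lambda>z. ennreal (if fst z \<in> X then 1 else 0))"
    by (intro density_cong) auto
  have eq: "(\<lambda>z. (if fst z \<in> X then 1 else 0) * f z) = (\<lambda>z. if fst z \<in> X then f z else 0)" by auto
  have "integrable M f \<longleftrightarrow> integrable (distr M borel (\<lambda>z. z)) f"
    by (rule integrable_distr_eq[OF id_M, symmetric]) measurable
  also have "\<dots> \<longleftrightarrow> integrable N (\<lambda>z. if fst z \<in> X then f z else 0)"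
    unfolding distr_M d by (subst integrable_density) (auto simp: eq)
  finally show "integrable M f \<longleftrightarrow> integrable N (\<lambda>z. if fst z \<in> X then f z else 0)" .
  have "(\<integral>z. f z \<partial>M) = (\<integral>z. f z \<partial>distr M borel (\<lambda>z. z))"
    by (rule integral_distr[OF id_M, symmetric]) measurable
  also have "\<dots> = (\<integral>z. (if fst z \<in> X then f z else 0) \<partial>N)"
    unfolding distr_M d by (subst integral_density) (auto simp: eq)
  finally show "(\<integral>z. f z \<partial>M) = (\<integral>z. (if fst z \<in> X then f z else 0) \<partial>N)" .
qed

lemma AE_M:
  assumes "AE z in N. fst z \<in> X \<longrightarrow> P z"
  shows "AE z in M. P z"
proof -
  obtain B where B: "{z \<in> space N. \<not> (fst z \<in> X \<longrightarrow> P z)} \<subseteq> B" "emeasure N B = 0" "B \<in> sets N"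
    using assms by (auto elim: AE_E)
  have [measurable]: "B \<in> sets borel" using B(3) by (simp only: sets_N)
  have "(\<integral>\<^sup>+z. indicator B z \<partial>M) = (\<integral>\<^sup>+z. (if fst z \<in> X then indicator B z else 0) \<partial>N)"
    by (rule nn_integral_M) measurable
  also have "\<dots> \<le> (\<integral>\<^sup>+z. indicator B z \<partial>N)" by (intro nn_integral_mono) auto
  also have "\<dots> = 0" using B(2,3) by (subst nn_integral_indicator)
  finally have "AE z in M. indicator B z = (0::ennreal)"
    by (subst (asm) le_zero_eq, subst (asm) nn_integral_0_iff_AE) (auto intro!: M_from_borel)
  then show ?thesis
  proof (rule AE_mp)
    show "AE z in M. indicator B z = (0::ennreal) \<longrightarrow> P z"
    proof (rule AE_I2, rule impI)
      fix z assume "z \<in> space M" "indicator B z = (0::ennreal)"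
      then have "fst z \<in> X" "z \<notin> B" by (auto simp: space_M indicator_def split: if_splits)
      then show "P z" using B(1) by (auto simp: space_pair_measure)
    qed
  qed
qed

end

locale boltzmann_phase = phase_space X V dv + boltzmann_solution X V "distr dv borel (\<lambda>v. v)" \<rho> G H \<epsilon> p J \<sigma> k e \<kappa> C c\<kappa>
  for X V :: "'a::euclidean_space set" and dv :: "'a measure" and \<rho> :: "'a \<Rightarrow> real" and G :: "'a \<Rightarrow> 'a" and H :: "'a \<Rightarrow> 'a \<Rightarrow>\<^sub>L 'a" and \<epsilon> :: real
    and p :: real and J \<sigma> :: "'a \<times> 'a \<Rightarrow> real" and k :: "'a \<Rightarrow> 'a \<Rightarrow> 'a \<Rightarrow> real"
    and e :: "'a \<Rightarrow> real" and \<kappa> :: "real \<Rightarrow> real" and C c\<kappa> :: real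
begin

text \<open>Since \<open>X\<close> has finite volume and chords are bounded,
  \<open>|u| \<le> 1 + |u| powr p\<close> and the weighted bound \<open>u_W\<close> give plain
  integrability, as the weak formulation requires.\<close>

lemma u_integrable: "integrable N (\<lambda>z. if fst z \<in> X then u z else 0)"
proof (rule integrableI_bounded)
  obtain R where R: "R > 0" "\<And>z. fst z \<in> X \<Longrightarrow> snd z \<in> V \<Longrightarrow> T z \<le> R" using T_bounded by blast
  have "(\<integral>\<^sup>+z. ennreal (norm (if fst z \<in> X then u z else 0)) \<partial>N)
    \<le> (\<integral>\<^sup>+z. indicator (X \<times> UNIV) z + ennreal R * (if fst z \<in> X then ennreal (\<bar>u z\<bar> powr p / T z) else 0) \<partial>N)"
  proof (rule nn_integral_mono_AE)
    show "AE z in N. ennreal (norm (if fst z \<in> X then u z else 0)) \<le> indicator (X \<times> UNIV) z + ennreal R * (if fst z \<in> X then ennreal (\<bar>u z\<bar> powr p / T z) else 0)"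
      using AE_N_V
    proof eventually_elim
      case (elim z)
      show ?case
      proof (cases "fst z \<in> X")
        case True
        have T: "0 < T z" "T z \<le> R" using T_eq(2)[OF True V_nz[OF elim]] R(2)[OF True elim] by auto
        have "ennreal \<bar>u z\<bar> \<le> 1 + ennreal (\<bar>u z\<bar> powr p)" using le_one_plus_ennpowr[OF p, of "ennreal \<bar>u z\<bar>"] by (simp add: ennpowr_ennreal)
        also have "ennreal (\<bar>u z\<bar> powr p) \<le> ennreal (R * (\<bar>u z\<bar> powr p / T z))"
          using T by (intro ennreal_leI) (auto simp: field_simps mult_right_mono)
        also have "\<dots> = ennreal R * ennreal (\<bar>u z\<bar> powr p / T z)" using T R by (intro ennreal_mult) auto
        finally show ?thesis using True by (auto simp: indicator_def mem_Times_iff add_left_mono)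
      qed simp
    qed
  qed
  also have "\<dots> = (\<integral>\<^sup>+z. indicator (X \<times> UNIV) z \<partial>N) + (\<integral>\<^sup>+z. ennreal R * (if fst z \<in> X then ennreal (\<bar>u z\<bar> powr p / T z) else 0) \<partial>N)"
  proof (rule nn_integral_add)
    have "X \<times> (UNIV :: 'a set) \<in> sets borel" using open_X by (intro borel_open open_Times) auto
    then show "indicator (X \<times> UNIV) \<in> borel_measurable N"
      unfolding measurable_cong_sets[OF sets_N refl] by (rule borel_measurable_indicator)
  qed measurable
  also have "(\<integral>\<^sup>+z. indicator (X \<times> UNIV) z \<partial>N) = emeasure N (X \<times> UNIV)"
  proof (rule nn_integral_indicator)
    have "X \<times> (UNIV :: 'a set) \<in> sets borel" using open_X by (intro borel_open open_Times) auto
    then show "X \<times> UNIV \<in> sets N" by (simp only: sets_N)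
  qed
  also have "emeasure N (X \<times> UNIV) = emeasure lborel X * emeasure D UNIV"
    using open_X by (intro D.emeasure_pair_measure_Times) auto
  also have "(\<integral>\<^sup>+z. ennreal R * (if fst z \<in> X then ennreal (\<bar>u z\<bar> powr p / T z) else 0) \<partial>N) = ennreal R * (\<integral>\<^sup>+z. (if fst z \<in> X then ennreal (\<bar>u z\<bar> powr p / T z) else 0) \<partial>N)"
    by (rule nn_integral_cmult) measurable
  also have "emeasure lborel X * emeasure D UNIV + \<dots> < \<infinity>"
  proof -
    have "emeasure D UNIV < \<infinity>"
      using D.emeasure_finite[of UNIV] by (simp only: less_top[symmetric] infinity_ennreal_def) simp
    then show ?thesis
      using u_W emeasure_bounded_finite[OF bounded_X] by (simp add: ennreal_mult_less_top)
  qed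
  finally show "(\<integral>\<^sup>+z. ennreal (norm (if fst z \<in> X then u z else 0)) \<partial>N) < \<infinity>" .
qed measurable

lemma q_integrable: "integrable N (\<lambda>z. if fst z \<in> X then q z else 0)"
proof (rule integrableI_bounded)
  have "(\<integral>\<^sup>+z. ennreal (norm (if fst z \<in> X then q z else 0)) \<partial>N) \<le> (\<integral>\<^sup>+z. (if fst z \<in> X then Q z else 0) \<partial>N)"
    using q_le_Q by (intro nn_integral_mono) auto
  then show "(\<integral>\<^sup>+z. ennreal (norm (if fst z \<in> X then q z else 0)) \<partial>N) < \<infinity>" using Q_L1 by (rule le_less_trans)
qed measurable

lemma locally_integrable_M:
  assumes [measurable]: "f \<in> borel_measurable borel" and "integrable N (\<lambda>z. if fst z \<in> X then f z else 0)"
  shows "locally_integrable X V dv f"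
  unfolding locally_integrable_def
proof (intro conjI allI impI)
  show "f \<in> borel_measurable M" by (rule M_from_borel) measurable
  fix K assume "compact K \<and> K \<subseteq> X \<times> V"
  then have K: "K \<in> sets borel" "K \<subseteq> X \<times> V" by (auto intro: borel_closed compact_imp_closed)
  have "(\<lambda>z. z) -` K \<inter> space M \<in> sets M" by (rule measurable_sets[OF id_M K(1)])
  then have "K \<in> sets M" using K(2) by (simp add: space_M Int_absorb2)
  then show "set_integrable M K f"
    unfolding set_integrable_def using integral_M(1)[of f] assms by (intro integrable_mult_indicator) auto
qed

text \<open>A test function is controlled only on \<open>X \<times> V\<close>. Extended by zero off
  its compact carrier \<open>K\<close> it is differentiable along every line with velocity in
  \<open>V\<close>, because near a time at which the line is outside \<open>X\<close> it avoids the
  closed set \<open>K\<close>; this is the input of \<open>transport_identity\<close>.\<close>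

lemma transport_derivative_u: "transport_derivative X V dv u q"
  unfolding transport_derivative_def
proof (intro conjI allI impI)
  show "locally_integrable X V dv u" by (rule locally_integrable_M[OF _ u_integrable]) measurable
  show "locally_integrable X V dv q" by (rule locally_integrable_M[OF _ q_integrable]) measurable
  fix \<phi> :: "'a \<times> 'a \<Rightarrow> real" and \<Phi> :: "'a \<times> 'a \<Rightarrow> 'a"
  assume t: "test_function X V \<phi> \<Phi>"
  obtain K where K: "compact K" "K \<subseteq> X \<times> V" "\<And>z. z \<in> X \<times> V - K \<Longrightarrow> \<phi> z = 0"
    using t by (auto simp: test_function_def)
  have der: "GDERIV (\<lambda>y. \<phi> (y, v)) x :> \<Phi> (x, v)" if "x \<in> X" "v \<in> V" for x v
    using t that by (auto simp: test_function_def)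
  have cK: "continuous_on K \<phi>" "continuous_on K \<Phi>"
    using t K(2) by (auto simp: test_function_def intro: continuous_on_subset)
  \<comment> \<open>\<open>K\<close> is assumed to carry \<open>\<phi>\<close> only. The slice of
    its complement at \<open>v\<close> is open, so the gradient vanishes off \<open>K\<close> as
    well.\<close>
  have \<Phi>0: "\<Phi> (x, v) = 0" if xv: "x \<in> X" "v \<in> V" "(x, v) \<notin> K" for x v
  proof -
    define O' where "O' = X \<inter> (\<lambda>y. (y, v)) -` (- K)"
    have "open ((\<lambda>y. (y, v)) -` (- K))"
      using compact_imp_closed[OF K(1)] by (intro open_vimage continuous_intros) auto
    then have "open O'" "x \<in> O'" using open_X xv by (auto simp: O'_def)
    have d: "((\<lambda>y. \<phi> (y, v)) has_derivative (\<lambda>h. h \<bullet> \<Phi> (x, v))) (at x)" using der[OF xv(1,2)] by (simp add: gderiv_def)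
    have "\<phi> (y, v) = 0" if "y \<in> O'" for y using that K(3) xv(2) by (auto simp: O'_def)
    with d \<open>open O'\<close> \<open>x \<in> O'\<close> have "((\<lambda>y. 0::real) has_derivative (\<lambda>h. h \<bullet> \<Phi> (x, v))) (at x)"
      by (rule has_derivative_transform_within_open)
    then have "(\<lambda>h. h \<bullet> \<Phi> (x, v)) = (\<lambda>h. 0)" by (rule has_derivative_unique) (rule has_derivative_const)
    then have "\<Phi> (x, v) \<bullet> \<Phi> (x, v) = 0" by metis
    then show ?thesis by simp
  qed
  define \<phi>0 where "\<phi>0 z = (if z \<in> K then \<phi> z else 0)" for z
  define \<psi>0 where "\<psi>0 z = (if z \<in> K then snd z \<bullet> \<Phi> z else 0)" for z
  have Kb: "K \<in> sets borel" using K(1) by (intro borel_closed compact_imp_closed)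
  have c2: "continuous_on K (\<lambda>z. snd z \<bullet> \<Phi> z)" by (intro continuous_intros cK)
  have [measurable]: "\<phi>0 \<in> borel_measurable borel" "\<psi>0 \<in> borel_measurable borel"
    unfolding \<phi>0_def[abs_def] \<psi>0_def[abs_def] by (intro borel_measurable_continuous_on_if Kb cK c2 continuous_on_const)+
  obtain B1 where B1: "\<And>z. z \<in> K \<Longrightarrow> \<bar>\<phi> z\<bar> \<le> B1"
    using compact_imp_bounded[OF compact_continuous_image[OF cK(1) K(1)]] by (auto simp: bounded_iff)
  obtain B2 where B2: "\<And>z. z \<in> K \<Longrightarrow> \<bar>snd z \<bullet> \<Phi> z\<bar> \<le> B2"
    using compact_imp_bounded[OF compact_continuous_image[OF c2 K(1)]] by (auto simp: bounded_iff)
  define B where "B = max 0 (max B1 B2)"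
  have bounds: "\<bar>\<phi>0 z\<bar> \<le> B" "\<bar>\<psi>0 z\<bar> \<le> B" for z
    using B1[of z] B2[of z] by (auto simp: \<phi>0_def \<psi>0_def B_def le_max_iff_disj)
  have \<phi>eq: "\<phi>0 z = \<phi> z" "\<psi>0 z = snd z \<bullet> \<Phi> z" if "z \<in> X \<times> V" for z
    using that K(3) \<Phi>0[of "fst z" "snd z"] by (auto simp: \<phi>0_def \<psi>0_def)
  have line_der: "((\<lambda>t. \<phi>0 (flow t z)) has_real_derivative \<psi>0 (flow t z)) (at t)" if v: "snd z \<in> V" for z t
  proof (cases "fst z + t *\<^sub>R snd z \<in> X")
    case True
    define S where "S = (\<lambda>t. fst z + t *\<^sub>R snd z) -` X"
    have S: "open S" "t \<in> S" using True unfolding S_def by (auto intro!: open_vimage open_X continuous_intros)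
    have "((\<lambda>t. fst z + t *\<^sub>R snd z) has_derivative (\<lambda>h. h *\<^sub>R snd z)) (at t)"
      by (auto intro!: derivative_eq_intros)
    from has_derivative_compose[OF this der[OF True v, unfolded gderiv_def]]
    have "((\<lambda>t. \<phi> (fst z + t *\<^sub>R snd z, snd z)) has_derivative (\<lambda>h. (snd z \<bullet> \<Phi> (flow t z)) * h)) (at t)"
      by (simp add: flow_def mult.commute)
    then have "((\<lambda>t. \<phi>0 (flow t z)) has_derivative (\<lambda>h. (snd z \<bullet> \<Phi> (flow t z)) * h)) (at t)"
      by (rule has_derivative_transform_within_open[OF _ S]) (use v in \<open>auto simp: S_def flow_def intro!: \<phi>eq(1)[symmetric]\<close>)
    moreover have "\<psi>0 (flow t z) = snd z \<bullet> \<Phi> (flow t z)" using \<phi>eq(2)[of "flow t z"] True v by (simp add: mem_Times_iff)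
    ultimately show ?thesis by (simp add: has_field_derivative_def)
  next
    case False
    define S where "S = (\<lambda>t. flow t z) -` (- K)"
    have notK: "flow t z \<notin> K" using False K(2) by (auto simp: flow_def)
    have "continuous_on UNIV (\<lambda>t. flow t z)" unfolding flow_def by (intro continuous_intros)
    then have S: "open S" "t \<in> S" using notK compact_imp_closed[OF K(1)] unfolding S_def by (auto intro!: open_vimage)
    have "((\<lambda>t. 0::real) has_derivative (\<lambda>h. \<psi>0 (flow t z) * h)) (at t)" using notK by (simp add: \<psi>0_def)
    then have "((\<lambda>t. \<phi>0 (flow t z)) has_derivative (\<lambda>h. \<psi>0 (flow t z) * h)) (at t)"
      by (rule has_derivative_transform_within_open[OF _ S]) (auto simp: S_def \<phi>0_def)
    then show ?thesis by (simp add: has_field_derivative_def)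
  qed
  have id: "(\<integral>z. (if fst z \<in> X then u z else 0) * \<psi>0 z \<partial>N) = - (\<integral>z. (if fst z \<in> X then q z else 0) * \<phi>0 z \<partial>N)"
  proof (rule transport_identity[OF _ _ _ _ u_integrable q_integrable K(1) _ _ bounds line_der AE_increment])
    show "K \<subseteq> X \<times> UNIV" using K(2) by auto
    show "z \<notin> K \<Longrightarrow> \<phi>0 z = 0" for z by (simp add: \<phi>0_def)
  qed measurable
  have "(\<integral>z. u z * (snd z \<bullet> \<Phi> z) \<partial>M) = (\<integral>z. u z * \<psi>0 z \<partial>M)"
    by (intro Bochner_Integration.integral_cong refl) (simp add: space_M \<phi>eq)
  also have "\<dots> = (\<integral>z. (if fst z \<in> X then u z * \<psi>0 z else 0) \<partial>N)" by (rule integral_M) measurable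
  also have "\<dots> = (\<integral>z. (if fst z \<in> X then u z else 0) * \<psi>0 z \<partial>N)" by (intro Bochner_Integration.integral_cong) auto
  also note id
  also have "(\<integral>z. (if fst z \<in> X then q z else 0) * \<phi>0 z \<partial>N) = (\<integral>z. (if fst z \<in> X then q z * \<phi>0 z else 0) \<partial>N)" by (intro Bochner_Integration.integral_cong) auto
  also have "\<dots> = (\<integral>z. q z * \<phi>0 z \<partial>M)" by (rule integral_M[symmetric]) measurable
  also have "\<dots> = (\<integral>z. q z * \<phi> z \<partial>M)"
    by (intro Bochner_Integration.integral_cong refl) (simp add: space_M \<phi>eq)
  finally show "(\<integral>z. u z * (snd z \<bullet> \<Phi> z) \<partial>M) = - (\<integral>z. q z * \<phi> z \<partial>M)" .
qed

lemma in_Lp_weighted: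
  assumes [measurable]: "f \<in> borel_measurable borel"
    and fin: "(\<integral>\<^sup>+z. (if fst z \<in> X then ennreal (T z powr (a * p) * \<bar>f z\<bar> powr p) else 0) \<partial>N) < \<infinity>"
  shows "in_Lp p M (\<lambda>(x, v). tau X x v powr a * f (x, v))"
proof -
  have eq: "(case z of (x, v) \<Rightarrow> tau X x v powr a * f (x, v)) = T z powr a * f z" if "z \<in> space M" for z
    using T_eq(1)[of z] that V_nz by (cases z) (auto simp: space_M)
  have m: "(\<lambda>z. T z powr a * f z) \<in> borel_measurable M" by (rule M_from_borel) measurable
  have "integrable M (\<lambda>z. \<bar>T z powr a * f z\<bar> powr p)"
  proof (rule integrableI_bounded)
    have "(\<integral>\<^sup>+z. ennreal (norm (\<bar>T z powr a * f z\<bar> powr p)) \<partial>M) = (\<integral>\<^sup>+z. (if fst z \<in> X then ennreal (norm (\<bar>T z powr a * f z\<bar> powr p)) else 0) \<partial>N)"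
      by (rule nn_integral_M) measurable
    also have "\<dots> = (\<integral>\<^sup>+z. (if fst z \<in> X then ennreal (T z powr (a * p) * \<bar>f z\<bar> powr p) else 0) \<partial>N)"
      by (intro nn_integral_cong) (auto simp: abs_mult powr_mult powr_powr)
    finally show "(\<integral>\<^sup>+z. ennreal (norm (\<bar>T z powr a * f z\<bar> powr p)) \<partial>M) < \<infinity>" using fin by simp
  qed (use m in measurable)
  then have "integrable M (\<lambda>z. \<bar>case z of (x, v) \<Rightarrow> tau X x v powr a * f (x, v)\<bar> powr p)"
    by (subst Bochner_Integration.integrable_cong[OF refl, of M _ "\<lambda>z. \<bar>T z powr a * f z\<bar> powr p"]) (simp_all add: eq)
  moreover have "(\<lambda>(x, v). tau X x v powr a * f (x, v)) \<in> borel_measurable M"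
    by (subst measurable_cong[of M _ "\<lambda>z. T z powr a * f z"]) (simp_all add: eq m)
  ultimately show ?thesis by (simp add: in_Lp_def)
qed

text \<open>For \<open>u\<close> the exponent of \<open>T\<close> is -1 and \<open>u_W\<close> is
  the required bound. For the derivative it is \<open>p - 1 \<ge> 0\<close>, so bounded chords
  reduce the claim to integrability of \<open>|q| powr p\<close>.\<close>

lemma u_in_W: "u \<in> W_space p X V dv"
  unfolding W_space_def
proof (intro CollectI conjI exI[of _ q] transport_derivative_u)
  obtain R where R: "R > 0" "\<And>z. fst z \<in> X \<Longrightarrow> snd z \<in> V \<Longrightarrow> T z \<le> R" using T_bounded by blast
  show "in_Lp p M (\<lambda>(x, v). tau X x v powr (- 1 / p) * u (x, v))"
  proof (rule in_Lp_weighted)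
    have "(\<integral>\<^sup>+z. (if fst z \<in> X then ennreal (T z powr (- 1 / p * p) * \<bar>u z\<bar> powr p) else 0) \<partial>N) = (\<integral>\<^sup>+z. (if fst z \<in> X then ennreal (\<bar>u z\<bar> powr p / T z) else 0) \<partial>N)"
    proof (rule nn_integral_cong_AE)
      show "AE z in N. (if fst z \<in> X then ennreal (T z powr (- 1 / p * p) * \<bar>u z\<bar> powr p) else 0) = (if fst z \<in> X then ennreal (\<bar>u z\<bar> powr p / T z) else 0)"
        using AE_N_V
      proof eventually_elim
        case (elim z)
        have "- 1 / p * p = -1" using p by simp
        then show ?case using T_eq(2)[of z] V_nz[OF elim] by (cases "fst z \<in> X") (simp_all add: powr_minus_divide)
      qed
    qed
    then show "(\<integral>\<^sup>+z. (if fst z \<in> X then ennreal (T z powr (- 1 / p * p) * \<bar>u z\<bar> powr p) else 0) \<partial>N) < \<infinity>" using u_W by simp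
  qed measurable
  show "in_Lp p M (\<lambda>(x, v). tau X x v powr (1 - 1 / p) * q (x, v))"
  proof (rule in_Lp_weighted)
    have "(\<integral>\<^sup>+z. (if fst z \<in> X then ennreal (T z powr ((1 - 1 / p) * p) * \<bar>q z\<bar> powr p) else 0) \<partial>N) \<le> (\<integral>\<^sup>+z. ennreal (R powr ((1 - 1 / p) * p)) * (if fst z \<in> X then ennreal (\<bar>q z\<bar> powr p) else 0) \<partial>N)"
    proof (rule nn_integral_mono_AE)
      show "AE z in N. (if fst z \<in> X then ennreal (T z powr ((1 - 1 / p) * p) * \<bar>q z\<bar> powr p) else 0) \<le> ennreal (R powr ((1 - 1 / p) * p)) * (if fst z \<in> X then ennreal (\<bar>q z\<bar> powr p) else 0)"
        using AE_N_V
      proof eventually_elim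
        case (elim z)
        show ?case
        proof (cases "fst z \<in> X")
          case True
          have "0 < T z" "T z \<le> R" using T_eq(2)[OF True V_nz[OF elim]] R(2)[OF True elim] by auto
          moreover have "0 \<le> (1 - 1 / p) * p" using p by (intro mult_nonneg_nonneg) auto
          ultimately have "T z powr ((1 - 1 / p) * p) \<le> R powr ((1 - 1 / p) * p)" by (intro powr_mono2) auto
          then have "ennreal (T z powr ((1 - 1 / p) * p) * \<bar>q z\<bar> powr p) \<le> ennreal (R powr ((1 - 1 / p) * p) * \<bar>q z\<bar> powr p)"
            by (intro ennreal_leI mult_right_mono) auto
          then show ?thesis using True by (simp add: ennreal_mult)
        qed simp
      qed
    qed
    also have "\<dots> = ennreal (R powr ((1 - 1 / p) * p)) * (\<integral>\<^sup>+z. (if fst z \<in> X then ennreal (\<bar>q z\<bar> powr p) else 0) \<partial>N)"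
      by (rule nn_integral_cmult) measurable
    also have "\<dots> < \<infinity>" using q_Lp by (simp add: ennreal_mult_less_top)
    finally show "(\<integral>\<^sup>+z. (if fst z \<in> X then ennreal (T z powr ((1 - 1 / p) * p) * \<bar>q z\<bar> powr p) else 0) \<partial>N) < \<infinity>" .
  qed measurable
qed

lemma u_solves:
  assumes \<sigma>0: "\<And>x v. x \<in> X \<Longrightarrow> v \<in> V \<Longrightarrow> \<sigma>0 (x, v) = \<sigma> (x, v)"
    and k0: "\<And>x v' v. x \<in> X \<Longrightarrow> v' \<in> V \<Longrightarrow> v \<in> V \<Longrightarrow> k0 x v' v = k x v' v"
  shows "solves_boltzmann X V dv \<sigma>0 k0 u"
  unfolding solves_boltzmann_def
proof (intro exI[of _ q] conjI transport_derivative_u)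
  have "AE z in M. z \<in> space M" by (rule AE_space)
  moreover have "AE z in M. integrable D (\<lambda>v'. k (fst z) v' (snd z) * u (fst z, v')) \<and>
     q z + \<sigma> z * u z = (\<integral>v'. k (fst z) v' (snd z) * u (fst z, v') \<partial>D)"
    using AE_boltzmann by (rule AE_M)
  ultimately show "AE (x, v) in M. integrable dv (\<lambda>v'. k0 x v' v * u (x, v')) \<and>
     q (x, v) + \<sigma>0 (x, v) * u (x, v) = (\<integral>v'. k0 x v' v * u (x, v') \<partial>dv)"
  proof eventually_elim
    case (elim z)
    obtain x v where z: "z = (x, v)" by (cases z)
    then have xv: "x \<in> X" "v \<in> V" using elim(1) by (auto simp: space_M)
    have [measurable]: "(\<lambda>v'. k x v' v * u (x, v')) \<in> borel_measurable borel" by measurable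
    have "integrable dv (\<lambda>v'. k x v' v * u (x, v'))"
      using elim(2) integrable_distr_eq[OF id_dv, of "\<lambda>v'. k x v' v * u (x, v')"] by (simp add: z)
    then have i: "integrable dv (\<lambda>v'. k0 x v' v * u (x, v'))"
      by (subst Bochner_Integration.integrable_cong[OF refl]) (simp_all add: space_dv k0 xv)
    have "(\<integral>v'. k x v' v * u (x, v') \<partial>D) = (\<integral>v'. k x v' v * u (x, v') \<partial>dv)"
      by (rule integral_distr[OF id_dv]) measurable
    also have "\<dots> = (\<integral>v'. k0 x v' v * u (x, v') \<partial>dv)"
      by (rule Bochner_Integration.integral_cong) (simp_all add: space_dv k0 xv)
    finally show ?case using i elim(2) \<sigma>0[OF xv] by (simp add: z)
  qed
qed

end

section \<open>Surface integrals and boundary data\<close>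

lemma measurable_into_restricted:
  assumes B: "sets B = sets (restrict_space borel V)" and f: "f \<in> R \<rightarrow>\<^sub>M borel" "\<And>z. z \<in> space R \<Longrightarrow> f z \<in> V"
  shows "f \<in> R \<rightarrow>\<^sub>M B"
proof -
  have "f \<in> R \<rightarrow>\<^sub>M restrict_space borel V"
    by (rule measurable_restrict_space2) (use f in auto)
  then show ?thesis by (simp add: measurable_cong_sets[OF refl B])
qed

text \<open>The identity from the restricted Borel space on \<open>S \<times> V\<close> to the
  product of the restricted spaces is measurable, which turns the given function into a Borel
  function on \<open>S \<times> V\<close>; zero extends it.\<close>

lemma product_extend:
  fixes g :: "'b::second_countable_topology \<times> 'c::second_countable_topology \<Rightarrow> real"
  assumes A: "sets A = sets (restrict_space borel S)" and B: "sets B = sets (restrict_space borel V)"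
    and [measurable]: "S \<in> sets borel" "V \<in> sets borel" and g: "g \<in> borel_measurable (A \<Otimes>\<^sub>M B)"
  shows "(\<lambda>z. if z \<in> S \<times> V then g z else 0) \<in> borel_measurable borel"
proof -
  let ?R = "restrict_space (borel :: ('b \<times> 'c) measure) (S \<times> V)"
  have SV: "S \<times> V \<in> sets borel" unfolding borel_prod[symmetric] by (intro pair_measureI) auto
  have "(\<lambda>z. (fst z, snd z)) \<in> ?R \<rightarrow>\<^sub>M A \<Otimes>\<^sub>M B"
    by (intro measurable_Pair measurable_into_restricted[OF A] measurable_into_restricted[OF B] measurable_restrict_space1)
       (auto simp: space_restrict_space)
  then have "(\<lambda>z. z) \<in> ?R \<rightarrow>\<^sub>M A \<Otimes>\<^sub>M B" by simp
  from measurable_compose[OF this g] have "g \<in> borel_measurable ?R" .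
  then show ?thesis using SV by (subst (asm) measurable_restrict_space_iff[where c=0]) auto
qed

lemma product_to_borel:
  assumes A: "sets A = sets (restrict_space borel S)" and B: "sets B = sets (restrict_space borel V)"
  shows "(\<lambda>z :: 'b::second_countable_topology \<times> 'c::second_countable_topology. z) \<in> A \<Otimes>\<^sub>M B \<rightarrow>\<^sub>M borel"
proof -
  have "(\<lambda>x. x) \<in> restrict_space borel S \<rightarrow>\<^sub>M borel" "(\<lambda>x. x) \<in> restrict_space borel V \<rightarrow>\<^sub>M borel"
    by (rule measurable_restrict_space1, simp)+
  then have "(\<lambda>x. x) \<in> A \<rightarrow>\<^sub>M borel" "(\<lambda>x. x) \<in> B \<rightarrow>\<^sub>M borel"
    by (simp_all add: measurable_cong_sets[OF A refl] measurable_cong_sets[OF B refl])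
  then have "(\<lambda>z. (fst z, snd z)) \<in> A \<Otimes>\<^sub>M B \<rightarrow>\<^sub>M borel"
    by (intro borel_measurable_Pair measurable_compose[OF measurable_fst] measurable_compose[OF measurable_snd])
  then show ?thesis by simp
qed

lemma triple_extend:
  fixes g :: "'a::second_countable_topology \<times> 'b::second_countable_topology \<times> 'c::second_countable_topology \<Rightarrow> real"
  assumes A: "sets A = sets (restrict_space borel S)" and B: "sets B = sets (restrict_space borel V)" and C: "sets C = sets (restrict_space borel W)"
    and [measurable]: "S \<in> sets borel" "V \<in> sets borel" "W \<in> sets borel" and g: "g \<in> borel_measurable (A \<Otimes>\<^sub>M (B \<Otimes>\<^sub>M C))"
  shows "(\<lambda>z. if z \<in> S \<times> V \<times> W then g z else 0) \<in> borel_measurable borel"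
proof -
  let ?R = "restrict_space (borel :: ('a \<times> 'b \<times> 'c) measure) (S \<times> V \<times> W)"
  have VW: "V \<times> W \<in> sets borel" unfolding borel_prod[symmetric] by (intro pair_measureI) auto
  have SV: "S \<times> V \<times> W \<in> sets borel" unfolding borel_prod[symmetric, where 'a='a]
    by (intro pair_measureI VW) auto
  have "(\<lambda>z. (fst z, fst (snd z), snd (snd z))) \<in> ?R \<rightarrow>\<^sub>M A \<Otimes>\<^sub>M (B \<Otimes>\<^sub>M C)"
    by (intro measurable_Pair measurable_into_restricted[OF A] measurable_into_restricted[OF B] measurable_into_restricted[OF C] measurable_restrict_space1)
       (auto simp: space_restrict_space)
  then have "(\<lambda>z. z) \<in> ?R \<rightarrow>\<^sub>M A \<Otimes>\<^sub>M (B \<Otimes>\<^sub>M C)" by simp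
  from measurable_compose[OF this g] have "g \<in> borel_measurable ?R" .
  then show ?thesis using SV by (subst (asm) measurable_restrict_space_iff[where c=0]) auto
qed

locale shell_phase = phase_space X V dv + shell_domain X V "distr dv borel (\<lambda>v. v)" \<rho> G H \<epsilon>
  for X V :: "'a::euclidean_space set" and dv :: "'a measure" and \<rho> :: "'a \<Rightarrow> real" and G :: "'a \<Rightarrow> 'a" and H :: "'a \<Rightarrow> 'a \<Rightarrow>\<^sub>L 'a" and \<epsilon> :: real
begin

text \<open>The surface measure of the level set carried by the whole space, playing for positions
  on the boundary the part that \<open>D\<close> plays for velocities.\<close>

definition level_measure :: "real \<Rightarrow> 'a measure" where
  "level_measure s = density (hausdorff_measure (DIM('a) - 1)) (indicator {x. \<rho> x = s})"

lemma level_borel [measurable]: "{x. \<rho> x = s} \<in> sets borel"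
  by measurable

lemma sets_level_measure [measurable_cong, simp]: "sets (level_measure s) = sets borel"
  by (simp add: level_measure_def)

lemma emeasure_level_measure: "A \<in> sets borel \<Longrightarrow> emeasure (level_measure s) A = hausdorff_outer (DIM('a) - 1) ({x. \<rho> x = s} \<inter> A)"
  using level_borel[of s] unfolding level_measure_def
  by (subst emeasure_density) (auto simp: nn_integral_set_ennreal indicator_inter_arith[symmetric] emeasure_hausdorff_measure)

lemma finite_level_measure: "-1 < s \<Longrightarrow> finite_measure (level_measure s)"
proof
  assume "-1 < s"
  have "space (level_measure s) = UNIV" using sets_eq_imp_space_eq[OF sets_level_measure] by simp
  then show "emeasure (level_measure s) (space (level_measure s)) \<noteq> \<infinity>"
    using hausdorff_level_finite[OF \<open>-1 < s\<close>] by (simp add: emeasure_level_measure)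
qed

abbreviation xi :: "real \<Rightarrow> ('a \<times> 'a) measure" where "xi s \<equiv> xi_measure dv (Z \<rho> s)"

lemma sets_surface: "-1 < s \<Longrightarrow> sets (surface_measure (frontier (Z \<rho> s))) = sets (restrict_space borel {x. \<rho> x = s})"
  by (simp add: surface_measure_def frontier_Z sets_restrict_space)

lemma xi_id: "-1 < s \<Longrightarrow> (\<lambda>z. z) \<in> xi s \<rightarrow>\<^sub>M borel"
  unfolding xi_measure_def using product_to_borel[OF sets_surface sets_dv] by simp

lemma space_xi: "-1 < s \<Longrightarrow> space (xi s) = {x. \<rho> x = s} \<times> V"
  by (simp add: xi_measure_def space_pair_measure space_dv surface_measure_def space_restrict_space frontier_Z)

lemma xi_extend:
  assumes "-1 < s" "g \<in> borel_measurable (xi s)"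
  shows "(\<lambda>z. if z \<in> {x. \<rho> x = s} \<times> V then g z else (0::real)) \<in> borel_measurable borel"
  by (rule product_extend[OF sets_surface[OF assms(1)] sets_dv level_borel V_borel])
     (use assms(2) in \<open>simp add: xi_measure_def\<close>)

lemma nn_integral_surface:
  assumes s: "-1 < s" and [measurable]: "f \<in> borel_measurable borel"
  shows "(\<integral>\<^sup>+y. f y \<partial>surface_measure (frontier (Z \<rho> s))) = (\<integral>\<^sup>+y. f y \<partial>level_measure s)"
proof -
  have "(\<integral>\<^sup>+y. f y \<partial>surface_measure (frontier (Z \<rho> s))) = (\<integral>\<^sup>+y\<in>{x. \<rho> x = s}. f y \<partial>hausdorff_measure (DIM('a) - 1))"
    unfolding surface_measure_def frontier_Z[OF s] by (rule nn_integral_restrict_space) simp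
  also have "\<dots> = (\<integral>\<^sup>+y. f y \<partial>level_measure s)"
    unfolding level_measure_def by (subst nn_integral_density) (auto simp: mult.commute)
  finally show ?thesis .
qed

text \<open>The velocity integral is placed outside because all boundary estimates are made for a
  fixed direction. Finiteness of the surface measure is what justifies the exchange.\<close>

lemma nn_integral_xi:
  assumes s: "-1 < s" and f [measurable]: "f \<in> borel_measurable borel"
  shows "(\<integral>\<^sup>+z. f z \<partial>xi s) = (\<integral>\<^sup>+v. \<integral>\<^sup>+y. ennreal \<bar>unit_normal y \<bullet> v\<bar> * f (y, v) \<partial>level_measure s \<partial>D)"
proof -
  let ?S = "surface_measure (frontier (Z \<rho> s))"
  interpret level_measure: finite_measure "level_measure s" by (rule finite_level_measure[OF s])
  have "finite_measure ?S"
  proof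
    have "emeasure ?S (space ?S) = (\<integral>\<^sup>+y. 1 \<partial>?S)" by simp
    also have "\<dots> = (\<integral>\<^sup>+y. 1 \<partial>level_measure s)" by (rule nn_integral_surface[OF s]) simp
    also have "\<dots> < \<infinity>" using level_measure.emeasure_finite[of "space (level_measure s)"] by (simp add: less_top[symmetric] del: level_measure.emeasure_finite)
    finally show "emeasure ?S (space ?S) \<noteq> \<infinity>" by simp
  qed
  then interpret S: finite_measure ?S .
  interpret SP: pair_sigma_finite ?S dv ..
  define w where "w z = ennreal \<bar>unit_normal (fst z) \<bullet> snd z\<bar>" for z
  have [measurable]: "w \<in> borel_measurable borel" unfolding w_def by measurable
  have id: "(\<lambda>z. z) \<in> ?S \<Otimes>\<^sub>M dv \<rightarrow>\<^sub>M borel" by (rule product_to_borel[OF sets_surface[OF s] sets_dv])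
  have sp: "space (?S \<Otimes>\<^sub>M dv) = {x. \<rho> x = s} \<times> V"
    by (simp add: space_pair_measure space_dv surface_measure_def space_restrict_space frontier_Z[OF s])
  have weq: "(case z of (x, v) \<Rightarrow> ennreal \<bar>outward_normal (Z \<rho> s) x \<bullet> v\<bar>) = w z" if "z \<in> space (?S \<Otimes>\<^sub>M dv)" for z
    using that outward_normal_Z[OF _ s] by (auto simp: sp w_def unit_normal_def)
  have wm: "w \<in> borel_measurable (?S \<Otimes>\<^sub>M dv)" "f \<in> borel_measurable (?S \<Otimes>\<^sub>M dv)"
    "(\<lambda>z. w z * f z) \<in> borel_measurable (?S \<Otimes>\<^sub>M dv)"
    by (rule measurable_compose[OF id], measurable)+
  have wm': "(\<lambda>(x, v). ennreal \<bar>outward_normal (Z \<rho> s) x \<bullet> v\<bar>) \<in> borel_measurable (?S \<Otimes>\<^sub>M dv)"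
    by (subst measurable_cong[of "?S \<Otimes>\<^sub>M dv" _ w]) (use weq wm in auto)
  have "(\<integral>\<^sup>+z. f z \<partial>xi s) = (\<integral>\<^sup>+z. (case z of (x, v) \<Rightarrow> ennreal \<bar>outward_normal (Z \<rho> s) x \<bullet> v\<bar>) * f z \<partial>(?S \<Otimes>\<^sub>M dv))"
    unfolding xi_measure_def by (rule nn_integral_density[OF wm' wm(2)])
  also have "\<dots> = (\<integral>\<^sup>+z. w z * f z \<partial>(?S \<Otimes>\<^sub>M dv))"
    by (intro nn_integral_cong) (simp add: weq)
  also have "\<dots> = (\<integral>\<^sup>+v. \<integral>\<^sup>+y. w (y, v) * f (y, v) \<partial>?S \<partial>dv)"
    by (rule SP.nn_integral_snd[OF wm(3), symmetric])
  also have "\<dots> = (\<integral>\<^sup>+v. \<integral>\<^sup>+y. w (y, v) * f (y, v) \<partial>level_measure s \<partial>dv)"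
    by (subst nn_integral_surface[OF s]) auto
  also have "\<dots> = (\<integral>\<^sup>+v. \<integral>\<^sup>+y. w (y, v) * f (y, v) \<partial>level_measure s \<partial>D)"
    by (rule nn_integral_D[symmetric]) measurable
  finally show ?thesis by (simp add: w_def)
qed

lemma AE_xi_borel:
  assumes s: "-1 < s" and A: "A \<in> sets borel" and "(\<integral>\<^sup>+z. indicator A z \<partial>xi s) = 0"
  shows "AE z in xi s. z \<notin> A"
proof -
  have "(indicator A :: _ \<Rightarrow> ennreal) \<in> borel_measurable (xi s)"
    by (rule measurable_compose[OF xi_id[OF s]]) (use A in simp)
  then have "AE z in xi s. indicator A z = (0::ennreal)" using assms(3) by (simp add: nn_integral_0_iff_AE)
  then show ?thesis by eventually_elim (auto simp: indicator_def split: if_splits)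
qed

text \<open>The density \<open>|\<nu> \<bullet> v|\<close> vanishes at grazing points, so they are
  null for \<open>d\<xi>\<close> even if they are not null for the product measure.\<close>

lemma AE_xi_transversal:
  assumes s: "-1 < s"
  shows "AE z in xi s. \<rho> (fst z) = s \<and> snd z \<in> V \<and> G (fst z) \<bullet> snd z \<noteq> 0"
proof -
  define A where "A = {z :: 'a \<times> 'a. G (fst z) \<bullet> snd z = 0}"
  have A [measurable]: "A \<in> sets borel" unfolding A_def by measurable
  have "(\<integral>\<^sup>+z. indicator A z \<partial>xi s) = (\<integral>\<^sup>+v. \<integral>\<^sup>+y. ennreal \<bar>unit_normal y \<bullet> v\<bar> * indicator A (y, v) \<partial>level_measure s \<partial>D)"
    by (rule nn_integral_xi[OF s]) measurable
  also have "\<dots> = (\<integral>\<^sup>+v. \<integral>\<^sup>+y. 0 \<partial>level_measure s \<partial>D)"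
    by (intro nn_integral_cong) (auto simp: A_def unit_normal_def indicator_def)
  finally have "AE z in xi s. z \<notin> A" by (intro AE_xi_borel[OF s A]) simp
  moreover have "AE z in xi s. z \<in> space (xi s)" by (rule AE_space)
  ultimately show ?thesis by eventually_elim (auto simp: A_def space_xi[OF s])
qed

text \<open>A line avoids \<open>Z \<rho> (1 - \<epsilon>)\<close> exactly if the minimum of
  \<open>\<rho>\<close> on it is at least \<open>1 - \<epsilon>\<close>, and the normal is a
  positive multiple of \<open>G\<close>. The right-hand side is visibly Borel.\<close>

lemma G_minus_eq: "G_minus \<rho> V 1 (1 - \<epsilon>) = {z \<in> data_boundary 1. snd z \<in> V}"
proof -
  have "(x, v) \<in> G_minus \<rho> V 1 (1 - \<epsilon>) \<longleftrightarrow> (x, v) \<in> {z \<in> data_boundary 1. snd z \<in> V}" for x v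
  proof (cases "\<rho> x = 1 \<and> v \<in> V")
    case True
    then have nz: "v \<noteq> 0" using V_nz by blast
    have Gx: "G x \<noteq> 0" using level_nz[of x 1] G_nz True by auto
    have "- (v \<bullet> outward_normal (Z \<rho> 1) x) > 0 \<longleftrightarrow> G x \<bullet> v < 0"
    proof -
      have "v \<bullet> outward_normal (Z \<rho> 1) x = (G x \<bullet> v) / norm (G x)"
        using True by (subst outward_normal_Z) (auto simp: inner_commute divide_inverse mult.commute)
      then show ?thesis using Gx by (simp add: divide_less_0_iff)
    qed
    moreover have "{x + t *\<^sub>R v |t. True} \<inter> Z \<rho> (1 - \<epsilon>) = {} \<longleftrightarrow> 1 - \<epsilon> \<le> line_min (x, v)"
    proof
      assume "{x + t *\<^sub>R v |t. True} \<inter> Z \<rho> (1 - \<epsilon>) = {}"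
      then have "x + min_time (x, v) *\<^sub>R v \<notin> Z \<rho> (1 - \<epsilon>)" by blast
      then show "1 - \<epsilon> \<le> line_min (x, v)" by (simp add: Z_def line_min_def)
    next
      assume m: "1 - \<epsilon> \<le> line_min (x, v)"
      have "1 - \<epsilon> \<le> \<rho> (x + t *\<^sub>R v)" for t using m line_min_le[of "(x, v)" t] nz by simp
      then show "{x + t *\<^sub>R v |t. True} \<inter> Z \<rho> (1 - \<epsilon>) = {}" by (auto simp: Z_def not_less[symmetric])
    qed
    ultimately show ?thesis using True by (simp add: G_minus_def Gamma_minus_def data_boundary_def frontier_Z)
  qed (auto simp: G_minus_def Gamma_minus_def data_boundary_def frontier_Z)
  then show ?thesis by auto
qed

lemma data_boundary_V_borel: "{z \<in> data_boundary 1. snd z \<in> V} \<in> sets borel"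
  by measurable

text \<open>Takes the place of \<open>J\<close> in the transport problem. Reading the data at
  \<open>base z\<close> makes the function constant along each chord.\<close>

definition line_data :: "('a \<times> 'a \<Rightarrow> real) \<Rightarrow> ('a \<times> 'a \<Rightarrow> real) \<Rightarrow> 'a \<times> 'a \<Rightarrow> real" where
  "line_data \<beta> \<gamma> z = (if fst z \<in> X \<and> snd z \<in> V then
     (if line_min z < 0 then \<beta> (base z, snd z) else if 1 - \<epsilon> \<le> line_min z then \<gamma> (base z, snd z) else 0) else 0)"

lemma line_data_measurable [measurable]:
  assumes [measurable]: "\<beta> \<in> borel_measurable borel" "\<gamma> \<in> borel_measurable borel"
  shows "line_data \<beta> \<gamma> \<in> borel_measurable borel"
  unfolding line_data_def[abs_def] by measurable

lemma line_data_flow: "snd z \<in> V \<Longrightarrow> seg X z t \<Longrightarrow> line_data \<beta> \<gamma> (flow t z) = line_data \<beta> \<gamma> z"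
  using seg_in[of X z t] V_nz[of "snd z"] by (simp add: line_data_def line_min_flow base_flow)

text \<open>For almost every \<open>v\<close> the lines with inner and with outer data are handled
  by \<open>boundary_integral_le\<close> on the levels 0 and 1. Integration over \<open>v\<close>
  turns the two bounds into the norms of the data with respect to \<open>d\<xi>\<close>.\<close>

lemma line_data_integrable:
  assumes [measurable]: "\<beta> \<in> borel_measurable borel" "\<gamma> \<in> borel_measurable borel"
    and fin: "(\<integral>\<^sup>+z. ennreal (\<bar>\<beta> z\<bar> powr p) \<partial>xi 0) < \<infinity>" "(\<integral>\<^sup>+z. ennreal (\<bar>\<gamma> z\<bar> powr p) \<partial>xi 1) < \<infinity>"
  shows "(\<integral>\<^sup>+z. (if fst z \<in> X then ennreal (\<bar>line_data \<beta> \<gamma> z\<bar> powr p / T z) else 0) \<partial>N) < \<infinity>"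
proof -
  let ?c = "ennreal (tube_const TYPE('a))"
  have bd: "(\<integral>\<^sup>+x. (if line_type s (x, v) then ennreal (1 / T (x, v)) * ennreal (\<bar>f (base (x, v), v)\<bar> powr p) else 0) \<partial>lborel)
    \<le> ?c * (\<integral>\<^sup>+y. ennreal \<bar>unit_normal y \<bullet> v\<bar> * ennreal (\<bar>f (y, v)\<bar> powr p) \<partial>level_measure s)"
    if "s = 0 \<or> s = 1" "v \<noteq> 0" and [measurable]: "f \<in> borel_measurable borel" for s v and f :: "'a \<times> 'a \<Rightarrow> real"
  proof -
    have "(\<integral>\<^sup>+y. ennreal \<bar>unit_normal y \<bullet> v\<bar> * ennreal (\<bar>f (y, v)\<bar> powr p) \<partial>level_measure s)
      = (\<integral>\<^sup>+y. indicator {x. \<rho> x = s} y * ennreal \<bar>unit_normal y \<bullet> v\<bar> * ennreal (\<bar>f (y, v)\<bar> powr p) \<partial>hausdorff_measure (DIM('a) - 1))"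
      unfolding level_measure_def by (subst nn_integral_density) (auto simp: mult.assoc)
    then show ?thesis using boundary_integral_le[OF that(1,2), of "\<lambda>y. ennreal (\<bar>f (y, v)\<bar> powr p)"] by simp
  qed
  interpret H0: finite_measure "level_measure 0" by (rule finite_level_measure) simp
  interpret H1: finite_measure "level_measure 1" by (rule finite_level_measure) simp
  have "(\<integral>\<^sup>+z. (if fst z \<in> X then ennreal (\<bar>line_data \<beta> \<gamma> z\<bar> powr p / T z) else 0) \<partial>N)
    = (\<integral>\<^sup>+v. \<integral>\<^sup>+x. (if fst (x, v) \<in> X then ennreal (\<bar>line_data \<beta> \<gamma> (x, v)\<bar> powr p / T (x, v)) else 0) \<partial>lborel \<partial>D)"
    by (rule nn_integral_N') measurable
  also have "\<dots> \<le> (\<integral>\<^sup>+v. ?c * (\<integral>\<^sup>+y. ennreal \<bar>unit_normal y \<bullet> v\<bar> * ennreal (\<bar>\<beta> (y, v)\<bar> powr p) \<partial>level_measure 0) + ?c * (\<integral>\<^sup>+y. ennreal \<bar>unit_normal y \<bullet> v\<bar> * ennreal (\<bar>\<gamma> (y, v)\<bar> powr p) \<partial>level_measure 1) \<partial>D)"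
  proof (rule nn_integral_mono_AE)
    show "AE v in D. (\<integral>\<^sup>+x. (if fst (x, v) \<in> X then ennreal (\<bar>line_data \<beta> \<gamma> (x, v)\<bar> powr p / T (x, v)) else 0) \<partial>lborel)
      \<le> ?c * (\<integral>\<^sup>+y. ennreal \<bar>unit_normal y \<bullet> v\<bar> * ennreal (\<bar>\<beta> (y, v)\<bar> powr p) \<partial>level_measure 0) + ?c * (\<integral>\<^sup>+y. ennreal \<bar>unit_normal y \<bullet> v\<bar> * ennreal (\<bar>\<gamma> (y, v)\<bar> powr p) \<partial>level_measure 1)"
      using D_V
    proof eventually_elim
      case (elim v)
      have nz: "v \<noteq> 0" using V_nz[OF elim] .
      have "(\<integral>\<^sup>+x. (if fst (x, v) \<in> X then ennreal (\<bar>line_data \<beta> \<gamma> (x, v)\<bar> powr p / T (x, v)) else 0) \<partial>lborel)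
        \<le> (\<integral>\<^sup>+x. (if line_type 0 (x, v) then ennreal (1 / T (x, v)) * ennreal (\<bar>\<beta> (base (x, v), v)\<bar> powr p) else 0)
            + (if line_type 1 (x, v) then ennreal (1 / T (x, v)) * ennreal (\<bar>\<gamma> (base (x, v), v)\<bar> powr p) else 0) \<partial>lborel)"
      proof (rule nn_integral_mono)
        fix x
        have e: "ennreal (a / T (x, v)) = ennreal (1 / T (x, v)) * ennreal a" if "x \<in> X" "0 \<le> a" for a
          using T_eq(2)[of "(x, v)"] that nz by (simp flip: ennreal_mult)
        show "(if fst (x, v) \<in> X then ennreal (\<bar>line_data \<beta> \<gamma> (x, v)\<bar> powr p / T (x, v)) else 0)
          \<le> (if line_type 0 (x, v) then ennreal (1 / T (x, v)) * ennreal (\<bar>\<beta> (base (x, v), v)\<bar> powr p) else 0)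
            + (if line_type 1 (x, v) then ennreal (1 / T (x, v)) * ennreal (\<bar>\<gamma> (base (x, v), v)\<bar> powr p) else 0)"
        proof (cases "x \<in> X")
          case True
          show ?thesis
          proof (cases "line_min (x, v) < 0")
            case m: True
            then have "line_type 0 (x, v)" using True nz by (simp add: line_type_def)
            moreover have "line_data \<beta> \<gamma> (x, v) = \<beta> (base (x, v), v)" using True m elim by (simp add: line_data_def)
            ultimately show ?thesis using e[OF True, of "\<bar>\<beta> (base (x, v), v)\<bar> powr p"] True by simp
          next
            case m: False
            show ?thesis
            proof (cases "1 - \<epsilon> \<le> line_min (x, v)")
              case m': True
              then have "line_type 1 (x, v)" using True nz by (simp add: line_type_def)
              moreover have "line_data \<beta> \<gamma> (x, v) = \<gamma> (base (x, v), v)" using True m m' elim by (simp add: line_data_def)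
              ultimately show ?thesis using e[OF True, of "\<bar>\<gamma> (base (x, v), v)\<bar> powr p"] True by simp
            qed (use m in \<open>simp add: line_data_def\<close>)
          qed
        qed simp
      qed
      also have "\<dots> = (\<integral>\<^sup>+x. (if line_type 0 (x, v) then ennreal (1 / T (x, v)) * ennreal (\<bar>\<beta> (base (x, v), v)\<bar> powr p) else 0) \<partial>lborel)
         + (\<integral>\<^sup>+x. (if line_type 1 (x, v) then ennreal (1 / T (x, v)) * ennreal (\<bar>\<gamma> (base (x, v), v)\<bar> powr p) else 0) \<partial>lborel)"
        by (rule nn_integral_add) measurable
      also have "\<dots> \<le> ?c * (\<integral>\<^sup>+y. ennreal \<bar>unit_normal y \<bullet> v\<bar> * ennreal (\<bar>\<beta> (y, v)\<bar> powr p) \<partial>level_measure 0) + ?c * (\<integral>\<^sup>+y. ennreal \<bar>unit_normal y \<bullet> v\<bar> * ennreal (\<bar>\<gamma> (y, v)\<bar> powr p) \<partial>level_measure 1)"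
        by (intro add_mono bd nz) auto
      finally show ?case .
    qed
  qed
  also have "\<dots> = (\<integral>\<^sup>+v. ?c * (\<integral>\<^sup>+y. ennreal \<bar>unit_normal y \<bullet> v\<bar> * ennreal (\<bar>\<beta> (y, v)\<bar> powr p) \<partial>level_measure 0) \<partial>D) + (\<integral>\<^sup>+v. ?c * (\<integral>\<^sup>+y. ennreal \<bar>unit_normal y \<bullet> v\<bar> * ennreal (\<bar>\<gamma> (y, v)\<bar> powr p) \<partial>level_measure 1) \<partial>D)"
    by (rule nn_integral_add) measurable
  also have "(\<integral>\<^sup>+v. ?c * (\<integral>\<^sup>+y. ennreal \<bar>unit_normal y \<bullet> v\<bar> * ennreal (\<bar>\<beta> (y, v)\<bar> powr p) \<partial>level_measure 0) \<partial>D) = ?c * (\<integral>\<^sup>+z. ennreal (\<bar>\<beta> z\<bar> powr p) \<partial>xi 0)"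
    by (subst nn_integral_cmult, measurable) (subst nn_integral_xi, auto)
  also have "(\<integral>\<^sup>+v. ?c * (\<integral>\<^sup>+y. ennreal \<bar>unit_normal y \<bullet> v\<bar> * ennreal (\<bar>\<gamma> (y, v)\<bar> powr p) \<partial>level_measure 1) \<partial>D) = ?c * (\<integral>\<^sup>+z. ennreal (\<bar>\<gamma> z\<bar> powr p) \<partial>xi 1)"
    by (subst nn_integral_cmult, measurable) (subst nn_integral_xi, auto)
  also have "?c * (\<integral>\<^sup>+z. ennreal (\<bar>\<beta> z\<bar> powr p) \<partial>xi 0) + ?c * (\<integral>\<^sup>+z. ennreal (\<bar>\<gamma> z\<bar> powr p) \<partial>xi 1) < \<infinity>"
    using fin by (simp add: ennreal_mult_less_top)
  finally show ?thesis .
qed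

end

sublocale boltzmann_phase \<subseteq> SP: shell_phase X V dv \<rho> G H \<epsilon> ..

context boltzmann_phase
begin

lemma AE_xi_not_divergent_boundary:
  assumes s: "s = 0 \<or> s = 1"
  shows "AE z in SP.xi s. z \<notin> divergent_boundary s"
proof -
  have s1: "-1 < s" using s by auto
  interpret level_measure: finite_measure "SP.level_measure s" by (rule SP.finite_level_measure[OF s1])
  have "(\<integral>\<^sup>+z. indicator (divergent_boundary s) z \<partial>SP.xi s) = (\<integral>\<^sup>+v. \<integral>\<^sup>+y. ennreal \<bar>unit_normal y \<bullet> v\<bar> * indicator (divergent_boundary s) (y, v) \<partial>SP.level_measure s \<partial>D)"
    by (rule SP.nn_integral_xi[OF s1]) measurable
  also have "\<dots> = 0"
  proof (subst nn_integral_0_iff_AE)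
    show "AE v in D. (\<integral>\<^sup>+y. ennreal \<bar>unit_normal y \<bullet> v\<bar> * indicator (divergent_boundary s) (y, v) \<partial>SP.level_measure s) = 0"
      using divergent_boundary_slice_null[OF s]
    proof eventually_elim
      case (elim v)
      have [measurable]: "{y. (y, v) \<in> divergent_boundary s} \<in> sets borel" by measurable
      have "emeasure (SP.level_measure s) {y. (y, v) \<in> divergent_boundary s} \<le> hausdorff_outer (DIM('a) - 1) {y. (y, v) \<in> divergent_boundary s}"
        by (subst SP.emeasure_level_measure) (auto intro!: hausdorff_outer_mono)
      then have "{y. (y, v) \<in> divergent_boundary s} \<in> null_sets (SP.level_measure s)" using elim by (auto simp: null_sets_def)
      then have "AE y in SP.level_measure s. y \<notin> {y. (y, v) \<in> divergent_boundary s}" by (rule AE_not_in)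
      then have "AE y in SP.level_measure s. ennreal \<bar>unit_normal y \<bullet> v\<bar> * indicator (divergent_boundary s) (y, v) = 0"
        by eventually_elim (auto simp: indicator_def)
      then show ?case by (subst nn_integral_0_iff_AE) auto
    qed
  qed measurable
  finally show ?thesis by (intro SP.AE_xi_borel[OF s1]) measurable
qed

lemma trace_inner:
  assumes "\<And>x v. v \<in> V \<Longrightarrow> line_type 0 (x, v) \<Longrightarrow> J (x, v) = \<beta> (base (x, v), v)"
  shows "has_trace X dv (xi_measure dv (Z \<rho> 0)) u \<beta>"
  unfolding has_trace_def
proof (intro exI[of _ u] conjI)
  have s: "-1 < (0::real)" by simp
  show "AE (x, v) in xi_measure dv (Z \<rho> 0). ((\<lambda>t. u (x + t *\<^sub>R v, v)) \<longlongrightarrow> \<beta> (x, v)) (at 0 within {t. x + t *\<^sub>R v \<in> X})"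
    using SP.AE_xi_transversal[OF s] AE_xi_not_divergent_boundary[of 0, simplified]
  proof eventually_elim
    case (elim z)
    obtain y v where z: "z = (y, v)" by (cases z)
    have "(y, v) \<in> data_boundary 0" using elim by (auto simp: z data_boundary_def)
    moreover have "J (x, v) = \<beta> (y, v)" if "line_type 0 (x, v)" "base (x, v) = y" for x
      using assms[OF _ that(1)] elim that(2) by (simp add: z)
    ultimately show ?case using trace_at[of y v 0 "\<beta> (y, v)"] elim by (simp add: z)
  qed
qed simp

lemma trace_outer:
  assumes "\<And>x v. v \<in> V \<Longrightarrow> line_type 1 (x, v) \<Longrightarrow> J (x, v) = \<gamma> (base (x, v), v)"
  shows "has_trace X dv (restrict_space (xi_measure dv (Z \<rho> 1)) (G_minus \<rho> V 1 (1 - \<epsilon>))) u \<gamma>"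
  unfolding has_trace_def
proof (intro exI[of _ u] conjI)
  have s: "-1 < (1::real)" by simp
  let ?A = "{z \<in> data_boundary 1. snd z \<in> V}"
  have "(\<lambda>z. z) -` ?A \<inter> space (SP.xi 1) \<in> sets (SP.xi 1)" by (rule measurable_sets[OF SP.xi_id[OF s] SP.data_boundary_V_borel])
  then have A: "?A \<inter> space (SP.xi 1) \<in> sets (SP.xi 1)" by simp
  show "AE (x, v) in restrict_space (xi_measure dv (Z \<rho> 1)) (G_minus \<rho> V 1 (1 - \<epsilon>)).
      ((\<lambda>t. u (x + t *\<^sub>R v, v)) \<longlongrightarrow> \<gamma> (x, v)) (at 0 within {t. x + t *\<^sub>R v \<in> X})"
    unfolding SP.G_minus_eq AE_restrict_space_iff[OF A]
    using AE_xi_not_divergent_boundary[of 1, simplified]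
  proof eventually_elim
    case (elim z)
    obtain y v where z: "z = (y, v)" by (cases z)
    show ?case
    proof
      assume zA: "z \<in> ?A"
      have "J (x, v) = \<gamma> (y, v)" if "line_type 1 (x, v)" "base (x, v) = y" for x
        using assms[OF _ that(1)] zA that(2) by (simp add: z)
      then show "case z of (x, v) \<Rightarrow> ((\<lambda>t. u (x + t *\<^sub>R v, v)) \<longlongrightarrow> \<gamma> (x, v)) (at 0 within {t. x + t *\<^sub>R v \<in> X})"
        using trace_at[of y v 1 "\<gamma> (y, v)"] elim zA by (simp add: z)
    qed
  qed
qed simp

end

section \<open>The collision operator\<close>

context phase_space
begin

lemma AE_D: "{v. P v} \<in> sets borel \<Longrightarrow> (AE v in D. P v) \<longleftrightarrow> (AE v in dv. P v)"
  by (subst AE_distr_iff[OF id_dv]) auto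

lemma sigma_finite_dx: "sigma_finite_measure (dx X)"
  by (rule sigma_finite_measure_restrict_space) (auto intro: lborel.sigma_finite_measure_axioms)

lemma absorption_bound:
  assumes \<sigma>0: "in_Linf M \<sigma>0" and [measurable]: "\<sigma> \<in> borel_measurable borel"
    and eq: "\<And>x v. x \<in> X \<Longrightarrow> v \<in> V \<Longrightarrow> \<sigma> (x, v) = \<sigma>0 (x, v)"
  shows "\<exists>S\<ge>0. AE x in lborel. x \<in> X \<longrightarrow> (AE v in D. \<bar>\<sigma> (x, v)\<bar> \<le> S)"
proof -
  interpret dxX: sigma_finite_measure "dx X" by (rule sigma_finite_dx)
  interpret DX: pair_sigma_finite "dx X" dv ..
  obtain S where S: "0 \<le> S" "esssup M (\<lambda>z. ennreal \<bar>\<sigma>0 z\<bar>) = ennreal S"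
    using \<sigma>0 by (cases "esssup M (\<lambda>z. ennreal \<bar>\<sigma>0 z\<bar>)") (auto simp: in_Linf_def)
  have "AE z in M. \<bar>\<sigma>0 z\<bar> \<le> S"
    using esssup_AE[of "\<lambda>z. ennreal \<bar>\<sigma>0 z\<bar>" M] unfolding S(2) by eventually_elim (use S in simp)
  then have "AE x in dx X. AE v in dv. \<bar>\<sigma>0 (x, v)\<bar> \<le> S" by (rule DX.AE_pair)
  then have "AE x in lborel. x \<in> X \<longrightarrow> (AE v in dv. \<bar>\<sigma>0 (x, v)\<bar> \<le> S)"
    by (subst (asm) AE_restrict_space_iff) auto
  then have "AE x in lborel. x \<in> X \<longrightarrow> (AE v in D. \<bar>\<sigma> (x, v)\<bar> \<le> S)"
  proof eventually_elim
    case (elim x)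
    have "(AE v in D. \<bar>\<sigma> (x, v)\<bar> \<le> S) \<longleftrightarrow> (AE v in dv. \<bar>\<sigma> (x, v)\<bar> \<le> S)" by (rule AE_D) measurable
    moreover have "AE v in dv. v \<in> V" using AE_space[of dv] by (simp add: space_dv)
    ultimately show ?case using elim by (auto simp: eq elim: AE_mp)
  qed
  with S(1) show ?thesis by blast
qed

text \<open>Hoelder's inequality in \<open>v'\<close> separates the kernel from \<open>F\<close>;
  the remaining integral over \<open>v\<close> of the kernel factor is the quantity whose essential
  supremum over \<open>x\<close> is assumed finite.\<close>

lemma gain_bound_Lp:
  assumes p: "1 < p" and k0: "in_Linf_Lp_Lq p X dv k0" and k: "(\<lambda>(x, v', v). k x v' v) \<in> borel_measurable borel"
    and eq: "\<And>x v' v. x \<in> X \<Longrightarrow> v' \<in> V \<Longrightarrow> v \<in> V \<Longrightarrow> k x v' v = k0 x v' v"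
  shows "\<exists>K\<ge>0. \<forall>F\<in>borel_measurable borel. AE x in lborel. x \<in> X \<longrightarrow>
    (\<integral>\<^sup>+v. ennpowr (\<integral>\<^sup>+v'. ennreal \<bar>k x v' v\<bar> * F (x, v') \<partial>D) p \<partial>D) \<le> ennreal K * (\<integral>\<^sup>+v. ennpowr (F (x, v)) p \<partial>D)"
proof -
  note [measurable (raw)] = measurable_triple_comp[OF k]
  define \<Psi> where "\<Psi> k x = (\<integral>\<^sup>+ v. ennpowr (\<integral>\<^sup>+ v'. ennreal (\<bar>k x v' v\<bar> powr (p / (p - 1))) \<partial>dv) (p - 1) \<partial>dv)"
    for k :: "'a \<Rightarrow> 'a \<Rightarrow> 'a \<Rightarrow> real" and x
  obtain K where K: "0 \<le> K" "esssup (dx X) (\<Psi> k0) = ennreal K"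
    using k0 by (cases "esssup (dx X) (\<Psi> k0)") (auto simp: in_Linf_Lp_Lq_def \<Psi>_def[abs_def])
  have "AE x in dx X. \<Psi> k0 x \<le> ennreal K" using esssup_AE[of "\<Psi> k0" "dx X"] unfolding K(2) .
  then have AEK: "AE x in lborel. x \<in> X \<longrightarrow> \<Psi> k0 x \<le> ennreal K"
    by (subst (asm) AE_restrict_space_iff) auto
  have "AE x in lborel. x \<in> X \<longrightarrow>
    (\<integral>\<^sup>+v. ennpowr (\<integral>\<^sup>+v'. ennreal \<bar>k x v' v\<bar> * F (x, v') \<partial>D) p \<partial>D) \<le> ennreal K * (\<integral>\<^sup>+v. ennpowr (F (x, v)) p \<partial>D)"
    if [measurable]: "F \<in> borel_measurable borel" for F
    using AEK
  proof eventually_elim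
    case (elim x)
    show ?case
    proof
      assume x: "x \<in> X"
      have inner: "(\<integral>\<^sup>+v'. ennpowr (ennreal \<bar>k x v' v\<bar>) (p / (p - 1)) \<partial>D) = (\<integral>\<^sup>+v'. ennreal (\<bar>k0 x v' v\<bar> powr (p / (p - 1))) \<partial>dv)"
        if "v \<in> V" for v
        by (subst nn_integral_D, measurable) (auto intro!: nn_integral_cong simp: ennpowr_ennreal space_dv eq x that)
      have outer: "(\<integral>\<^sup>+v. ennpowr (\<integral>\<^sup>+v'. ennpowr (ennreal \<bar>k x v' v\<bar>) (p / (p - 1)) \<partial>D) (p - 1) \<partial>D) = \<Psi> k0 x"
        unfolding \<Psi>_def by (subst nn_integral_D, measurable) (auto intro!: nn_integral_cong simp: space_dv inner)
      have "(\<integral>\<^sup>+v. ennpowr (\<integral>\<^sup>+v'. ennreal \<bar>k x v' v\<bar> * F (x, v') \<partial>D) p \<partial>D)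
        \<le> (\<integral>\<^sup>+v. ennpowr (\<integral>\<^sup>+v'. ennpowr (ennreal \<bar>k x v' v\<bar>) (p / (p - 1)) \<partial>D) (p - 1) * (\<integral>\<^sup>+v'. ennpowr (F (x, v')) p \<partial>D) \<partial>D)"
        by (intro nn_integral_mono Hoelder_ennpowr p) measurable
      also have "\<dots> = \<Psi> k0 x * (\<integral>\<^sup>+v'. ennpowr (F (x, v')) p \<partial>D)"
        by (subst nn_integral_multc, measurable) (simp add: outer)
      also have "\<dots> \<le> ennreal K * (\<integral>\<^sup>+v'. ennpowr (F (x, v')) p \<partial>D)"
        using elim x by (intro mult_right_mono) auto
      finally show "(\<integral>\<^sup>+v. ennpowr (\<integral>\<^sup>+v'. ennreal \<bar>k x v' v\<bar> * F (x, v') \<partial>D) p \<partial>D) \<le> ennreal K * (\<integral>\<^sup>+v. ennpowr (F (x, v)) p \<partial>D)" .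
    qed
  qed
  with K(1) show ?thesis by blast
qed

text \<open>For \<open>p = 1\<close> the order of integration is exchanged, so that the bounded
  kernel is integrated over the outgoing velocity and contributes at most \<open>K\<close> times the
  total mass of \<open>D\<close>.\<close>

lemma gain_bound_L1:
  assumes k0: "in_Linf (dx X \<Otimes>\<^sub>M (dv \<Otimes>\<^sub>M dv)) (\<lambda>(x, v', v). k0 x v' v)" and k: "(\<lambda>(x, v', v). k x v' v) \<in> borel_measurable borel"
    and eq: "\<And>x v' v. x \<in> X \<Longrightarrow> v' \<in> V \<Longrightarrow> v \<in> V \<Longrightarrow> k x v' v = k0 x v' v"
  shows "\<exists>K\<ge>0. \<forall>F\<in>borel_measurable borel. AE x in lborel. x \<in> X \<longrightarrow>
    (\<integral>\<^sup>+v. (\<integral>\<^sup>+v'. ennreal \<bar>k x v' v\<bar> * F (x, v') \<partial>D) \<partial>D) \<le> ennreal K * (\<integral>\<^sup>+v. F (x, v) \<partial>D)"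
proof -
  note [measurable (raw)] = measurable_triple_comp[OF k]
  let ?k = "\<lambda>(x, v', v). k0 x v' v"
  interpret DV: pair_sigma_finite dv dv ..
  interpret dxX: sigma_finite_measure "dx X" by (rule sigma_finite_dx)
  interpret DVV: sigma_finite_measure "dv \<Otimes>\<^sub>M dv" by (rule DV.sigma_finite_measure_axioms)
  interpret DX: pair_sigma_finite "dx X" "dv \<Otimes>\<^sub>M dv" ..
  interpret DD: pair_sigma_finite D D ..
  obtain K where K: "0 \<le> K" "esssup (dx X \<Otimes>\<^sub>M (dv \<Otimes>\<^sub>M dv)) (\<lambda>z. ennreal \<bar>?k z\<bar>) = ennreal K"
    using k0 by (cases "esssup (dx X \<Otimes>\<^sub>M (dv \<Otimes>\<^sub>M dv)) (\<lambda>z. ennreal \<bar>?k z\<bar>)") (auto simp: in_Linf_def)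
  have "AE z in dx X \<Otimes>\<^sub>M (dv \<Otimes>\<^sub>M dv). \<bar>?k z\<bar> \<le> K"
    using esssup_AE[of "\<lambda>z. ennreal \<bar>?k z\<bar>" "dx X \<Otimes>\<^sub>M (dv \<Otimes>\<^sub>M dv)"] unfolding K(2) by eventually_elim (use K in simp)
  then have "AE x in dx X. AE w in dv \<Otimes>\<^sub>M dv. \<bar>?k (x, w)\<bar> \<le> K" by (rule DX.AE_pair)
  then have AEK: "AE x in lborel. x \<in> X \<longrightarrow> (AE w in dv \<Otimes>\<^sub>M dv. \<bar>?k (x, w)\<bar> \<le> K)"
    by (subst (asm) AE_restrict_space_iff) auto
  have "AE x in lborel. x \<in> X \<longrightarrow>
    (\<integral>\<^sup>+v. (\<integral>\<^sup>+v'. ennreal \<bar>k x v' v\<bar> * F (x, v') \<partial>D) \<partial>D) \<le> ennreal (K * measure D UNIV) * (\<integral>\<^sup>+v. F (x, v) \<partial>D)"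
    if [measurable]: "F \<in> borel_measurable borel" for F
    using AEK
  proof eventually_elim
    case (elim x)
    show ?case
    proof
      assume x: "x \<in> X"
      have V: "AE v in dv. v \<in> V" using AE_space[of dv] by (simp add: space_dv)
      have "AE v' in dv. AE v in dv. \<bar>?k (x, v', v)\<bar> \<le> K" using elim x by (intro DV.AE_pair) auto
      with V have "AE v' in dv. AE v in dv. \<bar>k x v' v\<bar> \<le> K"
      proof eventually_elim
        case (elim v')
        from elim(2) V show ?case by eventually_elim (use elim(1) x in \<open>simp add: eq\<close>)
      qed
      moreover have "(AE v in dv. \<bar>k x v' v\<bar> \<le> K) \<longleftrightarrow> (AE v in D. \<bar>k x v' v\<bar> \<le> K)" for v'
        by (rule AE_D[symmetric]) measurable
      ultimately have "AE v' in dv. AE v in D. \<bar>k x v' v\<bar> \<le> K" by simp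
      \<comment> \<open>Expressing the inner almost-everywhere statement by a vanishing integral
        shows that the set of such \<open>v'\<close> is Borel, as needed to pass from
        \<open>dv\<close> to \<open>D\<close>. \<open>ennreal\<close> truncates negative values to
        0, so the integrand is the positive part.\<close>
      moreover have "(AE v in D. \<bar>k x v' v\<bar> \<le> K) \<longleftrightarrow> (\<integral>\<^sup>+v. ennreal (\<bar>k x v' v\<bar> - K) \<partial>D) = 0" for v'
        by (subst nn_integral_0_iff_AE) (auto simp: ennreal_eq_0_iff)
      then have "{v'. AE v in D. \<bar>k x v' v\<bar> \<le> K} \<in> sets borel" by simp
      ultimately have AEk: "AE v' in D. AE v in D. \<bar>k x v' v\<bar> \<le> K" by (simp add: AE_D)
      have "(\<integral>\<^sup>+v. (\<integral>\<^sup>+v'. ennreal \<bar>k x v' v\<bar> * F (x, v') \<partial>D) \<partial>D) = (\<integral>\<^sup>+v'. (\<integral>\<^sup>+v. ennreal \<bar>k x v' v\<bar> * F (x, v') \<partial>D) \<partial>D)"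
        by (rule DD.Fubini') measurable
      also have "\<dots> = (\<integral>\<^sup>+v'. (\<integral>\<^sup>+v. ennreal \<bar>k x v' v\<bar> \<partial>D) * F (x, v') \<partial>D)"
        by (intro nn_integral_cong nn_integral_multc) measurable
      also have "\<dots> \<le> (\<integral>\<^sup>+v'. ennreal (K * measure D UNIV) * F (x, v') \<partial>D)"
      proof (rule nn_integral_mono_AE, use AEk in eventually_elim)
        case (elim v')
        have "(\<integral>\<^sup>+v. ennreal \<bar>k x v' v\<bar> \<partial>D) \<le> (\<integral>\<^sup>+v. ennreal K \<partial>D)"
          by (rule nn_integral_mono_AE, use elim in eventually_elim) (simp add: ennreal_leI)
        also have "\<dots> = ennreal (K * measure D UNIV)"
          using K(1) by (simp add: D.emeasure_eq_measure ennreal_mult)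
        finally show ?case by (rule mult_right_mono) simp
      qed
      also have "\<dots> = ennreal (K * measure D UNIV) * (\<integral>\<^sup>+v'. F (x, v') \<partial>D)"
        by (rule nn_integral_cmult) measurable
      finally show "(\<integral>\<^sup>+v. (\<integral>\<^sup>+v'. ennreal \<bar>k x v' v\<bar> * F (x, v') \<partial>D) \<partial>D) \<le> ennreal (K * measure D UNIV) * (\<integral>\<^sup>+v. F (x, v) \<partial>D)" .
    qed
  qed
  moreover have "0 \<le> K * measure D UNIV" using K(1) by simp
  ultimately show ?thesis by blast
qed

lemma collision_bound:
  assumes p: "1 \<le> p" and \<sigma>0: "in_Linf M \<sigma>0"
    and k0: "p > 1 \<Longrightarrow> in_Linf_Lp_Lq p X dv k0" "p = 1 \<Longrightarrow> in_Linf (dx X \<Otimes>\<^sub>M (dv \<Otimes>\<^sub>M dv)) (\<lambda>(x, v', v). k0 x v' v)"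
    and \<sigma> [measurable]: "\<sigma> \<in> borel_measurable borel" and k: "(\<lambda>(x, v', v). k x v' v) \<in> borel_measurable borel"
    and \<sigma>_eq: "\<And>x v. x \<in> X \<Longrightarrow> v \<in> V \<Longrightarrow> \<sigma> (x, v) = \<sigma>0 (x, v)"
    and k_eq: "\<And>x v' v. x \<in> X \<Longrightarrow> v' \<in> V \<Longrightarrow> v \<in> V \<Longrightarrow> k x v' v = k0 x v' v"
  shows "\<exists>C\<ge>0. \<forall>F\<in>borel_measurable borel. AE x in lborel. x \<in> X \<longrightarrow>
       (\<integral>\<^sup>+v. ennpowr (ennreal \<bar>\<sigma> (x, v)\<bar> * F (x, v) + (\<integral>\<^sup>+v'. ennreal \<bar>k x v' v\<bar> * F (x, v') \<partial>D)) p \<partial>D)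
         \<le> ennreal C * (\<integral>\<^sup>+v. ennpowr (F (x, v)) p \<partial>D)"
proof -
  note [measurable (raw)] = measurable_triple_comp[OF k]
  obtain S where S: "0 \<le> S" "AE x in lborel. x \<in> X \<longrightarrow> (AE v in D. \<bar>\<sigma> (x, v)\<bar> \<le> S)"
    using absorption_bound[OF \<sigma>0 \<sigma> \<sigma>_eq] by blast
  have "\<exists>K\<ge>0. \<forall>F\<in>borel_measurable borel. AE x in lborel. x \<in> X \<longrightarrow>
    (\<integral>\<^sup>+v. ennpowr (\<integral>\<^sup>+v'. ennreal \<bar>k x v' v\<bar> * F (x, v') \<partial>D) p \<partial>D) \<le> ennreal K * (\<integral>\<^sup>+v. ennpowr (F (x, v)) p \<partial>D)"
  proof (cases "p = 1")
    case True
    show ?thesis using gain_bound_L1[OF k0(2)[OF True] k k_eq] by (simp add: True)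
  next
    case False
    then have "1 < p" using p by simp
    then show ?thesis using gain_bound_Lp[OF _ k0(1) k k_eq] by blast
  qed
  then obtain K where K: "0 \<le> K" "\<And>F. F \<in> borel_measurable borel \<Longrightarrow> AE x in lborel. x \<in> X \<longrightarrow>
    (\<integral>\<^sup>+v. ennpowr (\<integral>\<^sup>+v'. ennreal \<bar>k x v' v\<bar> * F (x, v') \<partial>D) p \<partial>D) \<le> ennreal K * (\<integral>\<^sup>+v. ennpowr (F (x, v)) p \<partial>D)"
    by blast
  have "AE x in lborel. x \<in> X \<longrightarrow>
       (\<integral>\<^sup>+v. ennpowr (ennreal \<bar>\<sigma> (x, v)\<bar> * F (x, v) + (\<integral>\<^sup>+v'. ennreal \<bar>k x v' v\<bar> * F (x, v') \<partial>D)) p \<partial>D)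
         \<le> ennreal (2 powr p * (S powr p + K)) * (\<integral>\<^sup>+v. ennpowr (F (x, v)) p \<partial>D)"
    if [measurable]: "F \<in> borel_measurable borel" for F
    using S(2) K(2)[OF that]
  proof eventually_elim
    case (elim x)
    show ?case
    proof
      assume x: "x \<in> X"
      let ?g = "\<lambda>v. \<integral>\<^sup>+v'. ennreal \<bar>k x v' v\<bar> * F (x, v') \<partial>D" and ?I = "\<integral>\<^sup>+v. ennpowr (F (x, v)) p \<partial>D"
      have Sx: "AE v in D. \<bar>\<sigma> (x, v)\<bar> \<le> S" and Kx: "(\<integral>\<^sup>+v. ennpowr (?g v) p \<partial>D) \<le> ennreal K * ?I" using elim x by auto
      have "(\<integral>\<^sup>+v. ennpowr (ennreal \<bar>\<sigma> (x, v)\<bar> * F (x, v) + ?g v) p \<partial>D)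
        \<le> (\<integral>\<^sup>+v. ennreal (2 powr p) * (ennreal (S powr p) * ennpowr (F (x, v)) p + ennpowr (?g v) p) \<partial>D)"
      proof (rule nn_integral_mono_AE, use Sx in eventually_elim)
        case (elim v)
        have "ennpowr (ennreal \<bar>\<sigma> (x, v)\<bar> * F (x, v)) p \<le> ennreal (S powr p) * ennpowr (F (x, v)) p"
          unfolding ennpowr_mult using elim p by (auto simp: ennpowr_ennreal intro!: mult_right_mono ennreal_leI powr_mono2)
        then show ?case by (intro order_trans[OF ennpowr_add_le[OF p]] mult_left_mono add_right_mono) auto
      qed
      also have "\<dots> = ennreal (2 powr p) * (ennreal (S powr p) * ?I + (\<integral>\<^sup>+v. ennpowr (?g v) p \<partial>D))"
        by (subst nn_integral_cmult, measurable) (subst nn_integral_add, measurable, subst nn_integral_cmult, measurable)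
      also have "\<dots> \<le> ennreal (2 powr p) * (ennreal (S powr p) * ?I + ennreal K * ?I)"
        by (intro mult_left_mono add_left_mono Kx) simp
      also have "\<dots> = ennreal (2 powr p * (S powr p + K)) * ?I"
        using S(1) K(1) by (simp add: ennreal_mult distrib_right[symmetric] mult.assoc)
      finally show "(\<integral>\<^sup>+v. ennpowr (ennreal \<bar>\<sigma> (x, v)\<bar> * F (x, v) + ?g v) p \<partial>D) \<le> ennreal (2 powr p * (S powr p + K)) * ?I" .
    qed
  qed
  moreover have "0 \<le> 2 powr p * (S powr p + K)" using K(1) by simp
  ultimately show ?thesis by blast
qed

end

section \<open>Choice of the constants\<close>

context shell_phase
begin

lemma inner_data_extend:
  assumes "in_Lp p (xi 0) \<beta>"
  obtains \<beta>' where "\<beta>' \<in> borel_measurable borel" "\<And>x v. \<rho> x = 0 \<Longrightarrow> v \<in> V \<Longrightarrow> \<beta>' (x, v) = \<beta> (x, v)"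
    "(\<integral>\<^sup>+z. ennreal (\<bar>\<beta>' z\<bar> powr p) \<partial>xi 0) < \<infinity>"
proof
  let ?\<beta> = "\<lambda>z. if z \<in> {x. \<rho> x = 0} \<times> V then \<beta> z else 0"
  show "?\<beta> \<in> borel_measurable borel"
    by (rule xi_extend) (use assms in \<open>auto simp: in_Lp_def\<close>)
  show "?\<beta> (x, v) = \<beta> (x, v)" if "\<rho> x = 0" "v \<in> V" for x v using that by simp
  have "(\<integral>\<^sup>+z. ennreal (\<bar>?\<beta> z\<bar> powr p) \<partial>xi 0) = (\<integral>\<^sup>+z. ennreal (norm (\<bar>\<beta> z\<bar> powr p)) \<partial>xi 0)"
    by (intro nn_integral_cong) (simp add: space_xi)
  also have "\<dots> < \<infinity>" using assms by (simp add: in_Lp_def integrable_iff_bounded)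
  finally show "(\<integral>\<^sup>+z. ennreal (\<bar>?\<beta> z\<bar> powr p) \<partial>xi 0) < \<infinity>" .
qed

lemma outer_data_extend:
  assumes \<gamma>: "in_Lp p (restrict_space (xi 1) (G_minus \<rho> V 1 (1 - \<epsilon>))) \<gamma>"
  obtains \<gamma>' where "\<gamma>' \<in> borel_measurable borel" "\<And>z. z \<in> data_boundary 1 \<Longrightarrow> snd z \<in> V \<Longrightarrow> \<gamma>' z = \<gamma> z"
    "(\<integral>\<^sup>+z. ennreal (\<bar>\<gamma>' z\<bar> powr p) \<partial>xi 1) < \<infinity>"
proof
  let ?A = "{z \<in> data_boundary 1. snd z \<in> V}"
  let ?f = "\<lambda>z. if z \<in> ?A then \<gamma> z else 0"
  let ?\<gamma> = "\<lambda>z. if z \<in> {x. \<rho> x = 1} \<times> V then ?f z else 0"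
  have s: "-1 < (1::real)" by simp
  have "(\<lambda>z. z) -` ?A \<inter> space (xi 1) \<in> sets (xi 1)" by (rule measurable_sets[OF xi_id[OF s] data_boundary_V_borel])
  then have A: "?A \<inter> space (xi 1) \<in> sets (xi 1)" by simp
  have m: "\<gamma> \<in> borel_measurable (restrict_space (xi 1) ?A)" using \<gamma> by (simp add: in_Lp_def G_minus_eq)
  have "?f \<in> borel_measurable (xi 1)"
    using m by (subst (asm) measurable_restrict_space_iff[OF A, where c=0]) auto
  then show "?\<gamma> \<in> borel_measurable borel" by (rule xi_extend[OF s])
  show "?\<gamma> z = \<gamma> z" if "z \<in> data_boundary 1" "snd z \<in> V" for z using that by (cases z) (auto simp: data_boundary_def)
  have "(\<integral>\<^sup>+z. ennreal (\<bar>?\<gamma> z\<bar> powr p) \<partial>xi 1) = (\<integral>\<^sup>+z\<in>?A. ennreal (norm (\<bar>\<gamma> z\<bar> powr p)) \<partial>xi 1)"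
    by (intro nn_integral_cong) (simp add: space_xi[OF s])
  also have "\<dots> = (\<integral>\<^sup>+z. ennreal (norm (\<bar>\<gamma> z\<bar> powr p)) \<partial>restrict_space (xi 1) ?A)"
    by (rule nn_integral_restrict_space[OF A, symmetric])
  also have "\<dots> < \<infinity>" using \<gamma> by (simp add: in_Lp_def integrable_iff_bounded G_minus_eq)
  finally show "(\<integral>\<^sup>+z. ennreal (\<bar>?\<gamma> z\<bar> powr p) \<partial>xi 1) < \<infinity>" .
qed

lemma line_type_outer_data_boundary: "line_type 1 z \<Longrightarrow> (base z, snd z) \<in> data_boundary 1"
proof -
  assume t: "line_type 1 z"
  then have "snd z \<noteq> 0" "1 - \<epsilon> \<le> line_min z" by (auto simp: line_type_def)
  moreover from this have "line_min (base z, snd z) = line_min z" using line_min_flow[of z "base_time z"] by (simp add: base_def flow_def)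
  ultimately show ?thesis using base_line_type[OF t] by (simp add: data_boundary_def)
qed

end

lemma nn_integral_three_indicators:
  fixes \<eta> R l a b :: real
  assumes "0 \<le> \<eta>" "0 \<le> R" "0 \<le> l" "0 \<le> a" "0 \<le> b"
  shows "(\<integral>\<^sup>+s. ennreal (indicator {-\<eta>..\<eta>} s + a * indicator {-R..R} s + b * indicator {-l..l} s) \<partial>lborel)
    = ennreal (2 * \<eta> + 2 * R * a + 2 * l * b)"
proof -
  have "(\<integral>\<^sup>+s. ennreal (indicator {-\<eta>..\<eta>} s + a * indicator {-R..R} s + b * indicator {-l..l} s) \<partial>lborel)
    = (\<integral>\<^sup>+s. indicator {-\<eta>..\<eta>} s + ennreal a * indicator {-R..R} s + ennreal b * indicator {-l..l} s \<partial>lborel)"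
    using assms by (intro nn_integral_cong) (auto simp: indicator_def)
  also have "\<dots> = emeasure lborel {-\<eta>..\<eta>} + ennreal a * emeasure lborel {-R..R} + ennreal b * emeasure lborel {-l..l}"
    by (simp add: nn_integral_add nn_integral_cmult_indicator)
  also have "\<dots> = ennreal (2 * \<eta> + 2 * R * a + 2 * l * b)"
    using assms by (simp add: mult.commute flip: ennreal_mult ennreal_plus)
  finally show ?thesis .
qed

text \<open>The order of the choices matters: first \<open>\<eta>\<close>, then the weight exponent \<open>lam\<close>, then \<open>l\<close>, and
  the admissible \<open>\<epsilon>\<close> last.\<close>

lemma contraction_constants:
  fixes C c r R p :: real
  assumes C: "0 \<le> C" and c: "0 < c" and r: "0 < r" and R: "0 < R" and p: "1 \<le> p"
  obtains \<eta> lam l \<epsilon> :: real where "0 < \<eta>" "0 \<le> lam" "0 \<le> l" "0 < \<epsilon>" "\<epsilon> < 1" "8 * \<epsilon> \<le> c * r\<^sup>2 * l\<^sup>2"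
    "C * (2 * \<eta> + 2 * R * exp (- lam * (c / 2 * r\<^sup>2 * \<eta>\<^sup>2)) + 2 * l * exp lam) powr p \<le> 2 powr (- p)"
proof -
  \<comment> \<open>Since \<open>C \<le> (C + 1) powr p\<close> and
    \<open>(C + 1) * c0 = 1 / 2\<close>, it is enough to bound the kernel integral by
    \<open>c0\<close>. The choices below make each of its three terms at most
    \<open>c0 / 4\<close>.\<close>
  define c0 where "c0 = 1 / (2 * (C + 1))"
  define \<eta> where "\<eta> = c0 / 8"
  define K where "K = c / 2 * r\<^sup>2 * \<eta>\<^sup>2"
  define lam where "lam = 8 * R / (c0 * K)"
  define l where "l = c0 / (8 * exp lam)"
  define \<epsilon> where "\<epsilon> = min (1 / 2) (c * r\<^sup>2 * l\<^sup>2 / 8)"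
  have c0: "0 < c0" using C by (simp add: c0_def)
  then have pos: "0 < \<eta>" "0 < K" using c r by (simp_all add: \<eta>_def K_def)
  then have lam: "0 < lam" "0 < l" using c0 R by (simp_all add: lam_def l_def)
  have "lam * K = 8 * R / c0" using pos c0 by (simp add: lam_def)
  \<comment> \<open>The linear lower bound for the exponential suffices, and it explains the value
    of \<open>lam\<close>.\<close>
  moreover have "lam * K \<le> exp (lam * K)" using exp_ge_add_one_self[of "lam * K"] by linarith
  ultimately have "8 * R / c0 \<le> exp (lam * K)" by simp
  then have "8 * R \<le> c0 * exp (lam * K)" using c0 by (simp add: field_simps)
  then have "2 * R * exp (- lam * K) \<le> c0 / 4" by (simp add: exp_minus field_simps)
  moreover have "2 * l * exp lam = c0 / 4" by (simp add: l_def)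
  ultimately have le: "2 * \<eta> + 2 * R * exp (- lam * K) + 2 * l * exp lam \<le> c0" using c0 by (simp add: \<eta>_def)
  have "0 \<le> 2 * \<eta> + 2 * R * exp (- lam * K) + 2 * l * exp lam" using pos R lam by simp
  then have "C * (2 * \<eta> + 2 * R * exp (- lam * K) + 2 * l * exp lam) powr p \<le> (C + 1) powr p * c0 powr p"
    using C p le powr_mono[of 1 p "C + 1"] by (intro mult_mono powr_mono2) auto
  also have "\<dots> = ((C + 1) * c0) powr p" by (simp only: powr_mult)
  also have "(C + 1) * c0 = 1 / 2" using C by (simp add: c0_def field_simps)
  also have "(1 / 2) powr p = 2 powr (- p)" by (simp add: powr_minus_divide powr_divide)
  finally have *: "C * (2 * \<eta> + 2 * R * exp (- lam * K) + 2 * l * exp lam) powr p \<le> 2 powr (- p)" .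
  show ?thesis
    by (rule that[of \<eta> lam l \<epsilon>])
       (use pos lam c r * in \<open>auto simp: \<epsilon>_def K_def min_def\<close>)
qed

theorem theorem4p3:
  fixes \<rho> :: "'a::euclidean_space \<Rightarrow> real"
    and V :: "'a set" and dv :: "'a measure"
    and p :: real
    and \<sigma> :: "'a \<times> 'a \<Rightarrow> real"
    and k :: "'a \<Rightarrow> 'a \<Rightarrow> 'a \<Rightarrow> real"
  defines "X \<equiv> X_dom \<rho>"
  assumes "velocity_space V dv"
    and "admissible_weight \<rho>"
    and "1 \<le> p"
    and "in_Linf (dx X \<Otimes>\<^sub>M dv) \<sigma>"
    and "p > 1 \<Longrightarrow> in_Linf_Lp_Lq p X dv k"
    and "p = 1 \<Longrightarrow> in_Linf (dx X \<Otimes>\<^sub>M (dv \<Otimes>\<^sub>M dv)) (\<lambda>(x, v', v). k x v' v)"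
  shows "\<exists>\<epsilon>. 0 < \<epsilon> \<and> \<epsilon> < 2 \<and>
    (\<forall>\<beta> \<gamma>. in_Lp p (xi_measure dv (Z \<rho> 0)) \<beta> \<and>
        in_Lp p (restrict_space (xi_measure dv (Z \<rho> 1)) (G_minus \<rho> V 1 (1 - \<epsilon>))) \<gamma> \<longrightarrow>
      (\<exists>u \<in> W_space p X V dv.
        solves_boltzmann X V dv \<sigma> k u \<and>
        has_trace X dv (xi_measure dv (Z \<rho> 0)) u \<beta> \<and>
        has_trace X dv (restrict_space (xi_measure dv (Z \<rho> 1)) (G_minus \<rho> V 1 (1 - \<epsilon>))) u \<gamma>))"
proof -
  obtain G H where GH: "convex_weight \<rho> G H"
    using \<open>admissible_weight \<rho>\<close> unfolding admissible_weight_def convex_weight_def by blast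
  interpret W: convex_weight \<rho> G H by (rule GH)
  have X: "X = {x. 0 < \<rho> x \<and> \<rho> x < 1}" unfolding X_def by (rule W.X_eq)
  interpret P: phase_space X V dv
  proof (rule phase_space.intro)
    show "open X" unfolding X by (intro open_Collect_conj open_Collect_less continuous_on_const W.\<rho>_cont)
    show "bounded X" by (rule bounded_subset[OF W.sublevel_bounded[of 1]]) (auto simp: X)
  qed (fact velocity_space_facts[OF \<open>velocity_space V dv\<close>])+
  have X_borel [measurable]: "X \<in> sets borel" using P.open_X' by simp
  have sets_dx: "sets (dx X) = sets (restrict_space borel X)" by (rule sets_restrict_space_cong) simp
  \<comment> \<open>Zero extension turns the coefficients into Borel functions on the whole space;
    the equation refers to their values on \<open>X\<close> and \<open>V\<close> only, where nothing
    changes.\<close>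
  define \<sigma>' where "\<sigma>' z = (if z \<in> X \<times> V then \<sigma> z else 0)" for z
  define k' where "k' x v' v = (if (x, v', v) \<in> X \<times> V \<times> V then k x v' v else 0)" for x v' v
  have \<sigma>'_m: "\<sigma>' \<in> borel_measurable borel"
    unfolding \<sigma>'_def[abs_def]
    by (rule product_extend[OF sets_dx P.sets_dv X_borel P.V_borel]) (use assms(5) in \<open>simp add: in_Linf_def\<close>)
  have "(\<lambda>(x, v', v). k x v' v) \<in> borel_measurable (dx X \<Otimes>\<^sub>M (dv \<Otimes>\<^sub>M dv))"
    using assms(4,6,7) by (cases "p = 1") (auto simp: in_Linf_def in_Linf_Lp_Lq_def)
  from triple_extend[OF sets_dx P.sets_dv P.sets_dv X_borel P.V_borel P.V_borel this]
  have "(\<lambda>z. if z \<in> X \<times> V \<times> V then case z of (x, v', v) \<Rightarrow> k x v' v else 0) \<in> borel_measurable borel" .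
  also have "(\<lambda>z. if z \<in> X \<times> V \<times> V then case z of (x, v', v) \<Rightarrow> k x v' v else 0) = (\<lambda>(x, v', v). k' x v' v)"
    by (auto simp: k'_def fun_eq_iff)
  finally have k'_m: "(\<lambda>(x, v', v). k' x v' v) \<in> borel_measurable borel" .
  have \<sigma>'_eq: "\<sigma>' (x, v) = \<sigma> (x, v)" if "x \<in> X" "v \<in> V" for x v using that by (simp add: \<sigma>'_def)
  have k'_eq: "k' x v' v = k x v' v" if "x \<in> X" "v' \<in> V" "v \<in> V" for x v' v using that by (simp add: k'_def)
  obtain C where C: "0 \<le> C" and coll: "\<And>F. F \<in> borel_measurable borel \<Longrightarrow> AE x in lborel. x \<in> X \<longrightarrow>
       (\<integral>\<^sup>+v. ennpowr (ennreal \<bar>\<sigma>' (x, v)\<bar> * F (x, v) + (\<integral>\<^sup>+v'. ennreal \<bar>k' x v' v\<bar> * F (x, v') \<partial>P.D)) p \<partial>P.D)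
         \<le> ennreal C * (\<integral>\<^sup>+v. ennpowr (F (x, v)) p \<partial>P.D)"
    using P.collision_bound[OF assms(4-7) \<sigma>'_m k'_m \<sigma>'_eq k'_eq] by blast
  obtain c where c: "0 < c" "\<And>x h. 0 \<le> \<rho> x \<Longrightarrow> \<rho> x \<le> 1 \<Longrightarrow> c * (norm h)\<^sup>2 \<le> h \<bullet> blinfun_apply (H x) h"
    using W.hessian_lower by blast
  obtain r where r: "0 < r" "\<And>v. v \<in> V \<Longrightarrow> r \<le> norm v" using P.V_low by blast
  obtain R where R: "0 < R" "\<And>z. fst z \<in> X \<Longrightarrow> snd z \<in> V \<Longrightarrow> P.T z \<le> R" using P.T_bounded by blast
  \<comment> \<open>The constants that enter here depend on the domain, the velocities and the
    coefficients only. Base points and the transport operator depend on \<open>\<epsilon>\<close>,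
    which is fixed now and serves for all boundary data.\<close>
  obtain \<eta> lam l \<epsilon> where pos: "0 < \<eta>" "0 \<le> lam" "0 \<le> l" "0 < \<epsilon>" "\<epsilon> < 1" and l: "8 * \<epsilon> \<le> c * r\<^sup>2 * l\<^sup>2"
    and small: "C * (2 * \<eta> + 2 * R * exp (- lam * (c / 2 * r\<^sup>2 * \<eta>\<^sup>2)) + 2 * l * exp lam) powr p \<le> 2 powr (- p)"
    by (rule contraction_constants[OF C c(1) r(1) R(1) assms(4)])
  define e where "e x = (if x \<in> X then exp (- lam * \<rho> x) else 0)" for x
  define \<kappa> where "\<kappa> s = (indicator {-\<eta>..\<eta>} s + exp (- lam * (c / 2 * r\<^sup>2 * \<eta>\<^sup>2)) * indicator {-R..R} s
    + exp lam * indicator {-l..l} s :: real)" for s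
  interpret S: shell_phase X V dv \<rho> G H \<epsilon> by unfold_locales (use X pos in auto)
  have "\<exists>u \<in> W_space p X V dv. solves_boltzmann X V dv \<sigma> k u \<and> has_trace X dv (S.xi 0) u \<beta> \<and>
      has_trace X dv (restrict_space (S.xi 1) (G_minus \<rho> V 1 (1 - \<epsilon>))) u \<gamma>"
    if \<beta>: "in_Lp p (S.xi 0) \<beta>" and \<gamma>: "in_Lp p (restrict_space (S.xi 1) (G_minus \<rho> V 1 (1 - \<epsilon>))) \<gamma>" for \<beta> \<gamma>
  proof -
    obtain \<beta>' where \<beta>': "\<beta>' \<in> borel_measurable borel" "\<And>x v. \<rho> x = 0 \<Longrightarrow> v \<in> V \<Longrightarrow> \<beta>' (x, v) = \<beta> (x, v)"
      "(\<integral>\<^sup>+z. ennreal (\<bar>\<beta>' z\<bar> powr p) \<partial>S.xi 0) < \<infinity>" using S.inner_data_extend[OF \<beta>] by blast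
    obtain \<gamma>' where \<gamma>': "\<gamma>' \<in> borel_measurable borel" "\<And>z. z \<in> S.data_boundary 1 \<Longrightarrow> snd z \<in> V \<Longrightarrow> \<gamma>' z = \<gamma> z"
      "(\<integral>\<^sup>+z. ennreal (\<bar>\<gamma>' z\<bar> powr p) \<partial>S.xi 1) < \<infinity>" using S.outer_data_extend[OF \<gamma>] by blast
    interpret B: boltzmann_phase X V dv \<rho> G H \<epsilon> p "S.line_data \<beta>' \<gamma>'" \<sigma>' k' e \<kappa> C
      "2 * \<eta> + 2 * R * exp (- lam * (c / 2 * r\<^sup>2 * \<eta>\<^sup>2)) + 2 * l * exp lam"
    proof unfold_locales
      show "S.line_data \<beta>' \<gamma>' \<in> borel_measurable borel" by (rule S.line_data_measurable[OF \<beta>'(1) \<gamma>'(1)])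
      show "e \<in> borel_measurable borel" unfolding e_def[abs_def] by measurable
      show "\<kappa> \<in> borel_measurable borel" unfolding \<kappa>_def[abs_def] by measurable
      show "\<exists>c1>0. \<exists>c2. \<forall>x\<in>X. c1 \<le> e x \<and> e x \<le> c2"
      proof -
        have "exp (- lam) \<le> e x \<and> e x \<le> 1" if "x \<in> X" for x
          using that pos(2) by (auto simp: e_def X mult_left_le)
        then show ?thesis using exp_gt_zero by blast
      qed
      show "(\<integral>\<^sup>+s. ennreal (\<kappa> s) \<partial>lborel) = ennreal (2 * \<eta> + 2 * R * exp (- lam * (c / 2 * r\<^sup>2 * \<eta>\<^sup>2)) + 2 * l * exp lam)"
        unfolding \<kappa>_def by (rule nn_integral_three_indicators) (use pos R in auto)
      show "e (fst z) \<le> \<kappa> s * e (fst z + s *\<^sub>R snd z)" if "snd z \<in> V" "seg X z s" "oriented_indicator (S.base_time z) 0 s \<noteq> 0" for z s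
        using S.kernel_bound[OF c r R(2) pos(2,1,3) l that] seg_in[OF that(2)] by (simp add: e_def \<kappa>_def)
      show "S.base_time (flow t z) = S.base_time z - t" if "snd z \<in> V" "seg X z t" for z t
        using that P.V_nz by (intro S.base_time_flow) auto
      show "(\<integral>\<^sup>+z. (if fst z \<in> X then ennreal (\<bar>S.line_data \<beta>' \<gamma>' z\<bar> powr p / P.T z) else 0) \<partial>P.N) < \<infinity>"
        by (rule S.line_data_integrable[OF \<beta>'(1) \<gamma>'(1) \<beta>'(3) \<gamma>'(3)])
      show "S.line_data \<beta>' \<gamma>' (flow t z) = S.line_data \<beta>' \<gamma>' z" if "snd z \<in> V" "seg X z t" for z t
        by (rule S.line_data_flow[OF that])
      show "e x = 0" if "x \<notin> X" for x using that by (simp add: e_def)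
      show "0 \<le> \<kappa> s" for s by (simp add: \<kappa>_def)
      show "0 \<le> 2 * \<eta> + 2 * R * exp (- lam * (c / 2 * r\<^sup>2 * \<eta>\<^sup>2)) + 2 * l * exp lam" using pos R by simp
    qed (fact assms(4) S.base_time_measurable \<sigma>'_m k'_m C small coll)+
    show ?thesis
    proof (intro bexI conjI)
      show "B.u \<in> W_space p X V dv" by (rule B.u_in_W)
      show "solves_boltzmann X V dv \<sigma> k B.u" by (rule B.u_solves) (auto simp: \<sigma>'_eq k'_eq)
      show "has_trace X dv (S.xi 0) B.u \<beta>"
      proof (rule B.trace_inner)
        fix x v assume v: "v \<in> V" and t: "S.line_type 0 (x, v)"
        have "\<rho> (S.base (x, v)) = 0" using S.base_line_type[OF t] by simp
        then show "S.line_data \<beta>' \<gamma>' (x, v) = \<beta> (S.base (x, v), v)"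
          using t v by (simp add: S.line_data_def S.line_type_def \<beta>'(2))
      qed
      show "has_trace X dv (restrict_space (S.xi 1) (G_minus \<rho> V 1 (1 - \<epsilon>))) B.u \<gamma>"
      proof (rule B.trace_outer)
        fix x v assume v: "v \<in> V" and t: "S.line_type 1 (x, v)"
        have "(S.base (x, v), v) \<in> S.data_boundary 1" using S.line_type_outer_data_boundary[OF t] by simp
        then show "S.line_data \<beta>' \<gamma>' (x, v) = \<gamma> (S.base (x, v), v)"
          using t v pos by (simp add: S.line_data_def S.line_type_def \<gamma>'(2))
      qed
    qed
  qed
  then show ?thesis using pos by (intro exI[of _ \<epsilon>]) auto
qed

end
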